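(* Let $k$ be an infinite field of characteristic $p>0$, and let $\lambda,h\in\wedge^{+}(n,r)$ with $\lambda=(\lambda_1,\dots,\lambda_m)$, $\lambda_m\neq 0$, $h=(a,1^b)$ (where $b\ge 0$, and $h=(r)$ if $b=0$) and $m\ge b+2$. Let $S=S_k(n,r)$ be the Schur algebra. Put $q=\max\{i:\lambda_i\ge 2\}$ if $\lambda\neq(1,\dots,1)$, and $q=0$, $\lambda_q=0$ if $\lambda=(1,\dots,1)$. Then the following hold. (i) $\dim_k\operatorname{Hom}_S(\Delta(\lambda),\Delta(h))\le 1$. (ii) Suppose $q\ge b+1$. Then $\operatorname{Hom}_S(\Delta(\lambda),\Delta(h))\neq 0$ if and only if $p$ divides all of the following integers: $$R(\lambda_i,\lambda_{i+1}-1),\ i=1,\dots,b-1;\qquad R(\lambda_b,\lambda_{b+1});\qquad R(\lambda_i+1,\lambda_{i+1}),\ i=b+1,\dots,m-1,$$ where for $b=0$ the condition on $R(\lambda_b,\lambda_{b+1})$ is omitted. (iii) Suppose $q\le b$. Then $\operatorname{Hom}_S(\Delta(\lambda),\Delta(h))\neq 0$ if and only if $p$ divides all of the following integers: $$R(\lambda_i,\lambda_{i+1}-1),\ i=1,\dots,q-1;\qquad \lambda_q+b+2-q;\qquad 2,\ \text{if } m-b\ge 3.$$ (iv) In cases (ii) and (iii), when $\operatorname{Hom}_S(\Delta(\lambda),\Delta(h))\neq0$, a nonzero element of $\operatorname{Hom}_S(\Delta(\lambda),\Delta(h))$ is induced by the map $\psi=\sum_{I\in B(\lambda,h)}d_I\phi_I: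 D(\lambda)\to\Delta(h)$, where $$d_I=\prod_{u=1}^{b}\ \prod_{v=u}^{i_u-2}(-\lambda_{v+1}),\qquad I=(i_1,\dots,i_b),$$ and empty products are equal to $1$.
   Context: $V=k^n$ is the natural $GL_n(k)$-module; $S=S_k(n,r)$ is the Schur algebra, whose modules are the homogeneous polynomial representations of $GL_n(k)$ of degree $r$. $D_i=D_iV$ is the $i$-th divided power of $V$, and $D(a_1,\dots,a_s)=D_{a_1}\otimes\cdots\otimes D_{a_s}$ (tensor products over $k$). $\wedge^+(n,r)$ is the set of partitions $\lambda=(\lambda_1\ge\dots\ge\lambda_n\ge 0)$ of $r$ with at most $n$ parts; trailing zeros may be omitted. A hook is a partition of the form $(a,1^b)=(a,1,\dots,1)$ ($b$ ones). For positive integers $x,y$: $R(x,y)=\gcd\{\binom{x}{1},\binom{x+1}{2},\dots,\binom{x+y-1}{y}\}$. Weyl modules: for $\lambda=(\lambda_1,\dots,\lambda_m)\in\wedge^+(n,r)$ with $\lambda_m>0$, $\Delta(\lambda)$ is the Weyl module of highest weight $\lambda$. It is the cokernel, with canonical surjection $d'_\lambda:D(\lambda)\to\Delta(\lambda)$, of the $S$-map $$\square:\bigoplus_{i=1}^{m-1}\bigoplus_{t=1}^{\lambda_{i+1}}D(\lambda_1,\dots,\lambda_i+t,\lambda_{i+1}-t,\dots,\lambda_m)\to D(\lambda)$$ which on each summand is the comultiplication component $D_{\lambda_i+t}\to D_{\lambda_i}\otimes D_t$ followed by the multiplication $D_t\otimes D_{\lambda_{i+1}-t}\to D_{\lambda_{i+1}}$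 (identity on the other factors). A map $D(\lambda)\to\Delta(h)$ "induces" a map $\Delta(\lambda)\to\Delta(h)$ if it factors through $d'_\lambda$. The maps $\phi_J$: let $h=(a,1^b)$. $B(\lambda,h)=\{J=(j_1,\dots,j_b)\in\mathbb{N}^b: 2\le j_1<\dots<j_b\le m\}$ (for $b=0$ it contains only the empty sequence $\emptyset$). For $J\in B(\lambda,h)$, $\phi_J:D(\lambda)\to\Delta(h)$ is the composition of: the map applying the comultiplication $D_{\lambda_{j_s}}\to D_{\lambda_{j_s}-1}\otimes D_1$ to the factor $D_{\lambda_{j_s}}$ for $s=1,\dots,b$ and the identity to all other factors; the rearrangement of tensor factors moving the $b$ factors $D_1$ (in the order $j_1,\dots,j_b$) to the right end; the multiplication of all the remaining factors into $D_a$, giving an element of $D_a\otimes D_1^{\otimes b}=D(h)$; and $d'_h:D(h)\to\Delta(h)$. For $b=0$, $\phi_\emptyset:D(\lambda)\to D_r=\Delta(h)$ is multiplication. *)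

theory Defs
  imports "Jordan_Normal_Form.VS_Connect" "HOL-Algebra.AbelCoset"
begin

section \<open>Tensor space and the Schur algebra\<close>

text \<open>A tensor is a coefficient function on words: with \<open>e\<^sub>1, \<dots>, e\<^sub>n\<close> the standard basis of
  \<open>V = k\<^sup>n\<close>, the function \<open>f\<close> stands for the sum of \<open>f [i\<^sub>1, \<dots>, i\<^sub>r] \<cdot> e\<^bsub>i\<^sub>1\<^esub> \<otimes> \<dots> \<otimes> e\<^bsub>i\<^sub>r\<^esub>\<close>.\<close>

type_synonym 'k tensor = "nat list \<Rightarrow> 'k"

definition tensor_space :: "nat \<Rightarrow> nat \<Rightarrow> 'k::field tensor set" where
  "tensor_space n r = {f. \<forall>w. f w \<noteq> 0 \<longrightarrow> length w = r \<and> set w \<subseteq> {1..n}}"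

text \<open>A vector space with operators indexed by \<open>'s\<close>; here \<open>'s\<close> is the type that contains the
  elements of the Schur algebra. The ring fields \<open>mult\<close> and \<open>one\<close> play no role.\<close>

record ('a, 'b, 's) smodule = "('a, 'b) module" +
  action :: "'s \<Rightarrow> 'b \<Rightarrow> 'b"

definition tensor_module ::
  "'k::field tensor set \<Rightarrow> ('k, 'k tensor, 'k tensor \<Rightarrow> 'k tensor) smodule" where
  "tensor_module U =
    \<lparr>carrier = U, mult = undefined, one = undefined, zero = (\<lambda>w. 0), add = (\<lambda>f g w. f w + g w),
     smult = (\<lambda>c f w. c * f w), action = (\<lambda>s f. s f)\<rparr>"

definition place_perm :: "(nat \<Rightarrow> nat) \<Rightarrow> 'k::field tensor \<Rightarrow> 'k tensor" where
  "place_perm \<sigma> f = (\<lambda>w. f (permute_list \<sigma> w))"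

text \<open>The Schur algebra \<open>S\<^sub>k(n,r)\<close>, as the algebra of endomorphisms of \<open>V\<^bsup>\<otimes>r\<^esup>\<close> commuting with the
  place permutations. It contains the operators \<open>g\<^bsup>\<otimes>r\<^esup>\<close>, \<open>g \<in> GL\<^sub>n(k)\<close>, which give the action of
  \<open>GL\<^sub>n(k)\<close> on an \<open>S\<close>-module, and is spanned by them when \<open>k\<close> is infinite.\<close>

definition schur_algebra :: "nat \<Rightarrow> nat \<Rightarrow> ('k::field tensor \<Rightarrow> 'k tensor) set" where
  "schur_algebra n r =
    {s \<in> LinearCombinations.module_hom class_ring (tensor_module (tensor_space n r)) (tensor_module (tensor_space n r))
         \<inter> extensional (tensor_space n r).
      \<forall>\<sigma> f. \<sigma> permutes {..<r} \<longrightarrow> f \<in> tensor_space n r \<longrightarrow> s (place_perm \<sigma> f) = place_perm \<sigma> (s f)}"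

section \<open>Quotients and homomorphisms\<close>

definition quotient_smodule ::
  "('a, 'b, 's) smodule \<Rightarrow> 'b set \<Rightarrow> ('a, 'b set, 's) smodule" where
  "quotient_smodule M W =
    \<lparr>carrier = a_rcosets\<^bsub>M\<^esub> W, mult = undefined, one = undefined, zero = W,
     add = (\<lambda>X Y. X <+>\<^bsub>M\<^esub> Y),
     smult = (\<lambda>c X. \<Union>x\<in>X. W +>\<^bsub>M\<^esub> (c \<odot>\<^bsub>M\<^esub> x)),
     action = (\<lambda>s X. \<Union>x\<in>X. W +>\<^bsub>M\<^esub> action M s x)\<rparr>"

definition shom_set ::
  "'s set \<Rightarrow> ('k::field, 'b, 's) smodule \<Rightarrow> ('k, 'c, 's) smodule \<Rightarrow> ('b \<Rightarrow> 'c) set" where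
  "shom_set S M N =
    {f \<in> LinearCombinations.module_hom class_ring M N \<inter> extensional (carrier M).
      \<forall>s\<in>S. \<forall>x\<in>carrier M. f (action M s x) = action N s (f x)}"

definition shom ::
  "'s set \<Rightarrow> ('k::field, 'b, 's) smodule \<Rightarrow> ('k, 'c, 's) smodule \<Rightarrow> ('k, 'b \<Rightarrow> 'c) module" where
  "shom S M N =
    \<lparr>carrier = shom_set S M N, mult = undefined, one = undefined,
     zero = (\<lambda>x\<in>carrier M. \<zero>\<^bsub>N\<^esub>),
     add = (\<lambda>f g. \<lambda>x\<in>carrier M. f x \<oplus>\<^bsub>N\<^esub> g x),
     smult = (\<lambda>c f. \<lambda>x\<in>carrier M. c \<odot>\<^bsub>N\<^esub> f x)\<rparr>"

section \<open>Divided powers\<close>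

text \<open>\<open>D\<^sub>i V\<close> is realised as the space of symmetric tensors in \<open>V\<^bsup>\<otimes>i\<^esup>\<close>, the divided power
  \<open>x\<^bsup>(i)\<^esup>\<close> being \<open>x \<otimes> \<dots> \<otimes> x\<close>. In this realisation the comultiplication
  \<open>D\<^bsub>i+j\<^esub> \<rightarrow> D\<^sub>i \<otimes> D\<^sub>j\<close>, \<open>x\<^bsup>(i+j)\<^esup> \<mapsto> x\<^bsup>(i)\<^esup> \<otimes> x\<^bsup>(j)\<^esup>\<close>, is the inclusion inside
  \<open>V\<^bsup>\<otimes>(i+j)\<^esup>\<close>, and therefore leaves no trace in the formulas below.\<close>

definition divided_power :: "nat \<Rightarrow> nat \<Rightarrow> 'k::field tensor set" where
  "divided_power n i =
    {f \<in> tensor_space n i. \<forall>\<sigma>. \<sigma> permutes {..<i} \<longrightarrow> place_perm \<sigma> f = f}"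

definition tensor_mult :: "'k::field tensor \<Rightarrow> 'k tensor \<Rightarrow> 'k tensor" where
  "tensor_mult f g = (\<lambda>w. \<Sum>(u, v) | u @ v = w. f u * g v)"

fun tensor_prod :: "'k::field tensor list \<Rightarrow> 'k tensor" where
  "tensor_prod [] = (\<lambda>w. if w = [] then 1 else 0)"
| "tensor_prod (f # fs) = tensor_mult f (tensor_prod fs)"

text \<open>\<open>D(a\<^sub>1, \<dots>, a\<^sub>s) = D\<^bsub>a\<^sub>1\<^esub> \<otimes> \<dots> \<otimes> D\<^bsub>a\<^sub>s\<^esub>\<close> inside \<open>V\<^bsup>\<otimes>r\<^esup>\<close>, \<open>r = a\<^sub>1 + \<dots> + a\<^sub>s\<close>.\<close>

definition D_set :: "nat \<Rightarrow> nat list \<Rightarrow> 'k::field tensor set" where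
  "D_set n \<alpha> = LinearCombinations.module.span class_ring
     (tensor_module (tensor_space n (sum_list \<alpha>)))
     {tensor_prod fs |fs. list_all2 (\<lambda>f a. f \<in> divided_power n a) fs \<alpha>}"

definition D_module ::
  "nat \<Rightarrow> nat list \<Rightarrow> ('k::field, 'k tensor, 'k tensor \<Rightarrow> 'k tensor) smodule" where
  "D_module n \<alpha> = tensor_module (D_set n \<alpha>)"

text \<open>The multiplication \<open>D\<^sub>i \<otimes> D\<^sub>j \<rightarrow> D\<^bsub>i+j\<^esub>\<close> is the shuffle product of symmetric tensors,
  e.g. \<open>x\<^bsup>(i)\<^esup> x\<^bsup>(j)\<^esup> = (i+j choose i) x\<^bsup>(i+j)\<^esup>\<close>. The set \<open>A\<close> consists of the positions
  in \<open>V\<^bsup>\<otimes>(i+j)\<^esup>\<close> that receive the letters of the first factor.\<close>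

definition D_mult :: "nat \<Rightarrow> 'k::field tensor \<Rightarrow> 'k tensor" where
  "D_mult i f = (\<lambda>w. \<Sum>A | A \<subseteq> {..<length w} \<and> card A = i. f (nths w A @ nths w (- A)))"

text \<open>For a linear map \<open>\<phi>\<close> on \<open>V\<^bsup>\<otimes>l\<^esup>\<close>, the map \<open>id \<otimes> \<phi> \<otimes> id\<close> with \<open>\<phi>\<close> placed on the
  positions \<open>p+1, \<dots>, p+l\<close>.\<close>

definition on_places ::
  "nat \<Rightarrow> nat \<Rightarrow> ('k tensor \<Rightarrow> 'k tensor) \<Rightarrow> 'k::field tensor \<Rightarrow> 'k tensor" where
  "on_places p l \<phi> f =
    (\<lambda>w. \<phi> (\<lambda>u. f (take p w @ u @ drop (p + l) w)) (take l (drop p w)))"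

fun D_mult_list :: "nat list \<Rightarrow> 'k::field tensor \<Rightarrow> 'k tensor" where
  "D_mult_list [] f = f"
| "D_mult_list (a # as) f = D_mult a (on_places a (sum_list as) (D_mult_list as) f)"

section \<open>Weyl modules\<close>

definition partitions :: "nat \<Rightarrow> nat \<Rightarrow> nat list set" where
  "partitions n r = {lam. length lam \<le> n \<and> sorted_wrt (\<ge>) lam \<and> sum_list lam = r}"

text \<open>The \<open>i\<close>-th part, counted from 1; it is 0 for \<open>i = 0\<close>.\<close>

definition part :: "nat list \<Rightarrow> nat \<Rightarrow> nat" where
  "part lam i = (if 1 \<le> i \<and> i \<le> length lam then lam ! (i - 1) else 0)"

definition raise :: "nat list \<Rightarrow> nat \<Rightarrow> nat \<Rightarrow> nat list" where
  "raise lam i t = lam[i - 1 := part lam i + t, i := part lam (i + 1) - t]"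

text \<open>The component of \<open>\<box>\<close> on \<open>D(\<lambda>\<^sub>1, \<dots>, \<lambda>\<^sub>i + t, \<lambda>\<^bsub>i+1\<^esub> - t, \<dots>, \<lambda>\<^sub>m)\<close>: after the
  comultiplication (an inclusion), \<open>D\<^sub>t \<otimes> D\<^bsub>\<lambda>\<^sub>i\<^sub>+\<^sub>1 - t\<^esub>\<close> occupies the \<open>\<lambda>\<^bsub>i+1\<^esub>\<close> positions following the
  first \<open>\<lambda>\<^sub>1 + \<dots> + \<lambda>\<^sub>i\<close>.\<close>

definition box_component :: "nat list \<Rightarrow> nat \<Rightarrow> nat \<Rightarrow> 'k::field tensor \<Rightarrow> 'k tensor" where
  "box_component lam i t = on_places (sum_list (take i lam)) (part lam (i + 1)) (D_mult t)"

definition box_index :: "nat list \<Rightarrow> (nat \<times> nat) set" where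
  "box_index lam = {(i, t). 1 \<le> i \<and> i < length lam \<and> 1 \<le> t \<and> t \<le> part lam (i + 1)}"

definition box_image :: "nat \<Rightarrow> nat list \<Rightarrow> 'k::field tensor set" where
  "box_image n lam =
    {(\<lambda>w. \<Sum>(i, t)\<in>box_index lam. box_component lam i t (x i t) w) |x.
      \<forall>(i, t)\<in>box_index lam. x i t \<in> D_set n (raise lam i t)}"

definition weyl_module ::
  "nat \<Rightarrow> nat list \<Rightarrow> ('k::field, 'k tensor set, 'k tensor \<Rightarrow> 'k tensor) smodule" where
  "weyl_module n lam = quotient_smodule (D_module n lam) (box_image n lam)"

definition weyl_proj :: "nat \<Rightarrow> nat list \<Rightarrow> 'k::field tensor \<Rightarrow> 'k tensor set" where
  "weyl_proj n lam x = box_image n lam +>\<^bsub>D_module n lam\<^esub> x"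

section \<open>The maps \<open>\<phi>\<^sub>J\<close>\<close>

definition B_set :: "nat list \<Rightarrow> nat \<Rightarrow> nat list set" where
  "B_set lam b = {J. length J = b \<and> sorted_wrt (<) J \<and> set J \<subseteq> {2..length lam}}"

text \<open>The linear map of \<open>V\<^bsup>\<otimes>r\<^esup>\<close> that moves the tensor factors at the (0-based) positions in
  \<open>E\<close> to the right end, keeping the order among them and among the others: the basis tensor
  of a word \<open>x\<close> goes to that of \<open>nths x (- E) @ nths x E\<close>.\<close>

definition move_right :: "nat set \<Rightarrow> 'k::field tensor \<Rightarrow> 'k tensor" where
  "move_right E f = (\<lambda>w. \<Sum>x | nths x (- E) @ nths x E = w. f x)"

text \<open>After \<open>D\<^bsub>\<lambda>\<^sub>j\<^esub> \<rightarrow> D\<^bsub>\<lambda>\<^sub>j - 1\<^esub> \<otimes> D\<^sub>1\<close> (an inclusion) the factor \<open>D\<^sub>1\<close> sits at the last position of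
  the \<open>j\<close>-th block, whose 0-based index is \<open>\<lambda>\<^sub>1 + \<dots> + \<lambda>\<^sub>j - 1\<close>.\<close>

definition phi_lift :: "nat list \<Rightarrow> nat list \<Rightarrow> 'k::field tensor \<Rightarrow> 'k tensor" where
  "phi_lift lam J f =
    (let \<alpha> = map (\<lambda>j. if j \<in> set J then part lam j - 1 else part lam j) [1..<length lam + 1];
         E = {sum_list (take j lam) - 1 |j. j \<in> set J}
     in on_places 0 (sum_list \<alpha>) (D_mult_list \<alpha>) (move_right E f))"

definition phi :: "nat \<Rightarrow> nat list \<Rightarrow> nat list \<Rightarrow> nat list \<Rightarrow> 'k::field tensor \<Rightarrow> 'k tensor set" where
  "phi n lam h J f = weyl_proj n h (phi_lift lam J f)"

definition d_coeff :: "nat list \<Rightarrow> nat list \<Rightarrow> int" where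
  "d_coeff lam I = (\<Prod>u=1..length I. \<Prod>v=u..part I u - 2. - int (part lam (v + 1)))"

definition psi :: "nat \<Rightarrow> nat list \<Rightarrow> nat list \<Rightarrow> nat \<Rightarrow> 'k::field tensor \<Rightarrow> 'k tensor set" where
  "psi n lam h b f =
    (\<Oplus>\<^bsub>weyl_module n h\<^esub>I\<in>B_set lam b. of_int (d_coeff lam I) \<odot>\<^bsub>weyl_module n h\<^esub> phi n lam h I f)"

definition R_gcd :: "nat \<Rightarrow> nat \<Rightarrow> nat" where
  "R_gcd x y = Gcd {(x + j - 1) choose j |j. 1 \<le> j \<and> j \<le> y}"

end

theory Submission
  imports Defs
begin

text \<open>The divided power \<open>D(\<lambda>)\<close> is generated over the Schur algebra by one vector of weight \<open>\<lambda>\<close>, so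
  homomorphisms from \<open>\<Delta>(\<lambda>)\<close> to a module correspond to its vectors of weight \<open>\<lambda>\<close> that are killed by the
  divided powers of the simple root vectors occurring in \<open>\<box>\<close>. In \<open>\<Delta>(h)\<close> the vectors of weight \<open>\<lambda>\<close> have
  the basis \<open>\<phi>\<^sub>J\<close>, \<open>J \<in> B(\<lambda>, h)\<close>, applied to the generator; coordinates are read off by the Koszul map
  \<open>D\<^sub>a \<otimes> \<Lambda>\<^sup>b \<rightarrow> D\<^bsub>a-1\<^esub> \<otimes> \<Lambda>\<^bsup>b+1\<^esup>\<close>. For \<open>i \<ge> 2\<close> the relation of the first divided power expresses the
  coefficient of \<open>J\<close> with an entry \<open>i\<close> raised to \<open>i + 1\<close> as \<open>-\<lambda>\<^sub>i\<close> times that of \<open>J\<close>, which determines the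
  coefficients up to a scalar. The other relations then become congruences between binomial
  coefficients, which are simplified with Pascal's rule and absorption.\<close>

section \<open>Spaces of tensors\<close>

text \<open>With tensors as coefficient functions on words, comultiplication is an inclusion,
  multiplication is a sum of place permutations, and membership in D(\<alpha>) is a pointwise
  condition. The Schur algebra is the commutant of the place permutations, so every structural map
  commutes with it and only values at the generator have to be computed. The obstacle is the
  relation for i = 1: it brings a letter 1 into the column, where no standard tableau has one, and
  rewriting by standard tableaux gives an alternating sum. The Koszul functionals compute this sum
  without straightening. The sums for all columns without 2 follow from the one for the column (3,
  ..., b+2). Its value yields \<lambda>_q + b + 2 - q if q \<le> b, and \<lambda>_{b+1} = -1 in k if
  q \<ge> b + 1. The two cases differ because a condition on R(\<lambda>_i, \<lambda>_{i+1} - 1)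
  forces \<lambda>_i = 0 in k only when \<lambda>_{i+1} \<ge> 2; for i \<ge> q \<ge> 1 only t = 1
  occurs. A column that skips some w with 2 \<le> w \<le> b + 1 and \<lambda>_w = 0 in k has
  coefficient 0, which disposes of many of the remaining relations.\<close>

definition lin_sub :: "'k::field tensor set \<Rightarrow> bool" where
  "lin_sub U \<longleftrightarrow> (\<lambda>w. 0) \<in> U \<and> (\<forall>f\<in>U. \<forall>g\<in>U. (\<lambda>w. f w + g w) \<in> U)
    \<and> (\<forall>c. \<forall>f\<in>U. (\<lambda>w. c * f w) \<in> U)"

lemma lin_sub_zero: "lin_sub U \<Longrightarrow> (\<lambda>w. 0) \<in> U"
  and lin_sub_add: "lin_sub U \<Longrightarrow> f \<in> U \<Longrightarrow> g \<in> U \<Longrightarrow> (\<lambda>w. f w + g w) \<in> U"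
  and lin_sub_smult: "lin_sub U \<Longrightarrow> f \<in> U \<Longrightarrow> (\<lambda>w. c * f w) \<in> U"
  by (auto simp: lin_sub_def)

lemma lin_sub_neg: "lin_sub U \<Longrightarrow> f \<in> U \<Longrightarrow> (\<lambda>w. - f w) \<in> U"
  using lin_sub_smult[of U f "-1"] by simp

lemma lin_sub_diff: "lin_sub U \<Longrightarrow> f \<in> U \<Longrightarrow> g \<in> U \<Longrightarrow> (\<lambda>w. f w - g w) \<in> U"
  using lin_sub_add[of U f "\<lambda>w. - g w"] lin_sub_neg[of U g] by simp

lemma lin_sub_sum:
  assumes "lin_sub U" "\<And>i. i \<in> I \<Longrightarrow> f i \<in> U"
  shows "(\<lambda>w. \<Sum>i\<in>I. f i w) \<in> U"
  using assms(2)
  by (induction I rule: infinite_finite_induct)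
    (auto simp: lin_sub_zero[OF assms(1)] intro: lin_sub_add[OF assms(1)])

lemma tensor_module_simps [simp]:
  "carrier (tensor_module U) = U"
  "\<zero>\<^bsub>tensor_module U\<^esub> = (\<lambda>w. 0)"
  "f \<oplus>\<^bsub>tensor_module U\<^esub> g = (\<lambda>w. f w + g w)"
  "c \<odot>\<^bsub>tensor_module U\<^esub> f = (\<lambda>w. c * f w)"
  "action (tensor_module U) s f = s f"
  by (auto simp: tensor_module_def)

lemma cring_class_ring: "cring (class_ring :: 'k::field ring)"
proof -
  interpret field "class_ring :: 'k ring" by (rule class_field)
  show ?thesis ..
qed

lemma module_tensor_module:
  assumes "lin_sub U"
  shows "Module.module class_ring (tensor_module U)"
proof (rule module_criteria[OF cring_class_ring], goal_cases)
  case 3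
  show ?case
  proof
    fix v assume "v \<in> carrier (tensor_module U)"
    then show "\<exists>neg_v\<in>carrier (tensor_module U). v \<oplus>\<^bsub>tensor_module U\<^esub> neg_v = \<zero>\<^bsub>tensor_module U\<^esub>"
      using lin_sub_neg[OF assms, of v] by (auto intro!: bexI[of _ "\<lambda>w. - v w"])
  qed
qed (use assms in \<open>auto simp: lin_sub_def algebra_simps\<close>)

lemma tensor_spaceI:
  "(\<And>w. f w \<noteq> 0 \<Longrightarrow> length w = r \<and> set w \<subseteq> {1..n}) \<Longrightarrow> f \<in> tensor_space n r"
  by (simp add: tensor_space_def)

lemma tensor_spaceD:
  "f \<in> tensor_space n r \<Longrightarrow> f w \<noteq> 0 \<Longrightarrow> length w = r \<and> set w \<subseteq> {1..n}"
  "f \<in> tensor_space n r \<Longrightarrow> length w \<noteq> r \<Longrightarrow> f w = 0"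
  unfolding tensor_space_def by blast+

lemma tensor_space_lin_sub [simp]: "lin_sub (tensor_space n r)"
  unfolding lin_sub_def
proof (intro conjI ballI allI)
  fix f g :: "'a tensor" and c
  assume f: "f \<in> tensor_space n r"
  show "(\<lambda>w. c * f w) \<in> tensor_space n r"
  proof (rule tensor_spaceI)
    fix w assume "c * f w \<noteq> 0"
    then have "f w \<noteq> 0" by auto
    then show "length w = r \<and> set w \<subseteq> {1..n}" by (rule tensor_spaceD(1)[OF f])
  qed
  assume g: "g \<in> tensor_space n r"
  show "(\<lambda>w. f w + g w) \<in> tensor_space n r"
  proof (rule tensor_spaceI)
    fix w assume "f w + g w \<noteq> 0"
    then have "f w \<noteq> 0 \<or> g w \<noteq> 0" by auto
    then show "length w = r \<and> set w \<subseteq> {1..n}"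
      using tensor_spaceD(1)[OF f] tensor_spaceD(1)[OF g] by blast
  qed
qed (rule tensor_spaceI, simp)

lemma finite_words: "finite {w :: nat list. length w = r \<and> set w \<subseteq> {1..n}}"
  using finite_lists_length_eq[of "{1..n}" r] by (simp add: conj_commute)

lemma span_subset:
  assumes "lin_sub T" "S \<subseteq> U" "lin_sub U" "U \<subseteq> T"
  shows "LinearCombinations.module.span class_ring (tensor_module T) S \<subseteq> U"
proof -
  interpret Module.module class_ring "tensor_module T" by (rule module_tensor_module[OF assms(1)])
  have "submodule class_ring U (tensor_module T)"
    by unfold_locales (use assms in \<open>auto simp: lin_sub_def\<close>)
  then show ?thesis by (intro span_is_subset assms)
qed

lemma span_lin_sub:
  assumes "lin_sub T" "S \<subseteq> T"
  shows "lin_sub (LinearCombinations.module.span class_ring (tensor_module T) S)"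
    and "S \<subseteq> LinearCombinations.module.span class_ring (tensor_module T) S"
proof -
  interpret Module.module class_ring "tensor_module T" by (rule module_tensor_module[OF assms(1)])
  have "submodule class_ring (span S) (tensor_module T)"
    using assms by (intro span_is_submodule) auto
  then interpret submodule class_ring "span S" "tensor_module T" .
  show "lin_sub (span S)"
    using zero_closed m_closed smult_closed by (auto simp: lin_sub_def)
  show "S \<subseteq> span S" using assms by (intro in_own_span) auto
qed

section \<open>Permutations of words\<close>

definition shift :: "nat \<Rightarrow> (nat \<Rightarrow> nat) \<Rightarrow> nat \<Rightarrow> nat" where
  "shift p \<tau> k = (if k < p then k else p + \<tau> (k - p))"

lemma shift_permutes:
  assumes "\<tau> permutes {..<l}"
  shows "shift p \<tau> permutes {..<p + l}"
proof (rule bij_imp_permutes)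
  have "inj_on (shift p \<tau>) {..<p + l}"
  proof (rule inj_onI)
    fix x y assume e: "shift p \<tau> x = shift p \<tau> y"
    consider "x < p" "y < p" | "x \<ge> p" "y \<ge> p" | "x < p" "y \<ge> p" | "x \<ge> p" "y < p" by linarith
    then show "x = y"
    proof cases
      case 2
      then have "\<tau> (x - p) = \<tau> (y - p)" using e by (simp add: shift_def)
      then have "x - p = y - p" using permutes_inj[OF assms] by (simp add: inj_eq)
      then show ?thesis using 2 by simp
    qed (use e in \<open>auto simp: shift_def\<close>)
  qed
  moreover have "shift p \<tau> ` {..<p + l} \<subseteq> {..<p + l}"
  proof
    fix y assume "y \<in> shift p \<tau> ` {..<p + l}"
    then obtain x where x: "x < p + l" "y = shift p \<tau> x" by auto
    show "y \<in> {..<p + l}"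
      using x permutes_in_image[OF assms, of "x - p"] by (cases "x < p") (auto simp: shift_def)
  qed
  ultimately show "bij_betw (shift p \<tau>) {..<p + l} {..<p + l}"
    by (simp add: bij_betw_def endo_inj_surj)
next
  fix x assume "x \<notin> {..<p + l}"
  then show "shift p \<tau> x = x"
    using permutes_not_in[OF assms, of "x - p"] by (auto simp: shift_def)
qed

lemma permute_list_shift:
  assumes "\<tau> permutes {..<length v}"
  shows "permute_list (shift (length u) \<tau>) (u @ v) = u @ permute_list \<tau> v"
  by (rule nth_equalityI)
    (auto simp: permute_list_def nth_append shift_def nth_Cons split: if_splits)

lemma permute_list_append_left:
  assumes "\<tau> permutes {..<length u}"
  shows "permute_list \<tau> (u @ v) = permute_list \<tau> u @ v"
proof (rule nth_equalityI)
  fix i assume "i < length (permute_list \<tau> (u @ v))"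
  then show "permute_list \<tau> (u @ v) ! i = (permute_list \<tau> u @ v) ! i"
    using permutes_in_image[OF assms, of i] permutes_not_in[OF assms, of i]
    by (auto simp: permute_list_def nth_append)
qed simp

lemma permutes_mono_lessThan:
  "\<tau> permutes {..<l :: nat} \<Longrightarrow> l \<le> N \<Longrightarrow> \<tau> permutes {..<N}"
  by (rule permutes_subset) auto

section \<open>Divided powers and functions constant on block contents\<close>

fun blocks :: "nat list \<Rightarrow> 'a list \<Rightarrow> 'a list list" where
  "blocks [] w = []"
| "blocks (a # \<alpha>) w = take a w # blocks \<alpha> (drop a w)"

abbreviation content :: "nat list \<Rightarrow> 'a list \<Rightarrow> 'a multiset list" where
  "content \<alpha> w \<equiv> map mset (blocks \<alpha> w)"

lemma blocks_append:
  "blocks (\<alpha> @ \<beta>) w = blocks \<alpha> (take (sum_list \<alpha>) w) @ blocks \<beta> (drop (sum_list \<alpha>) w)"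
  by (induction \<alpha> arbitrary: w) (auto simp: add.commute drop_take)


text \<open>Two words of length \<open>sum_list \<alpha>\<close> have equal contents exactly when a
  permutation inside the blocks carries one to the other, so these are the invariants of the Young
  subgroup. Stating invariance through contents makes membership a pointwise check.\<close>

definition class_fun :: "nat \<Rightarrow> nat list \<Rightarrow> 'k::field tensor set" where
  "class_fun n \<alpha> = {f \<in> tensor_space n (sum_list \<alpha>).
    \<forall>w w'. length w = sum_list \<alpha> \<longrightarrow> length w' = sum_list \<alpha> \<longrightarrow> content \<alpha> w = content \<alpha> w' \<longrightarrow> f w = f w'}"

lemma class_funI:
  assumes "f \<in> tensor_space n (sum_list \<alpha>)"
    and "\<And>w w'. length w = sum_list \<alpha> \<Longrightarrow> length w' = sum_list \<alpha> \<Longrightarrow> content \<alpha> w = content \<alpha> w' \<Longrightarrow> f w = f w'"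
  shows "f \<in> class_fun n \<alpha>"
  unfolding class_fun_def using assms by (intro CollectI conjI allI impI)

lemma class_fun_tensor_space: "f \<in> class_fun n \<alpha> \<Longrightarrow> f \<in> tensor_space n (sum_list \<alpha>)"
  by (simp add: class_fun_def)

lemma class_funD:
  assumes f: "f \<in> class_fun n \<alpha>" and l: "length w = length w'" and c: "content \<alpha> w = content \<alpha> w'"
  shows "f w = f w'"
proof (cases "length w = sum_list \<alpha>")
  case True
  then show ?thesis using f l c unfolding class_fun_def mem_Collect_eq by metis
next
  case False
  then have "f w = 0" "f w' = 0"
    using tensor_spaceD(2)[OF class_fun_tensor_space[OF f]] l by simp_all
  then show ?thesis by simp
qed

lemma class_fun_lin_sub: "lin_sub (class_fun n \<alpha>)"
  unfolding lin_sub_def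
proof (intro conjI ballI allI)
  show "(\<lambda>w. 0) \<in> class_fun n \<alpha>"
    by (rule class_funI) (simp_all add: lin_sub_zero)
  fix f g :: "'a tensor" and c
  assume f: "f \<in> class_fun n \<alpha>"
  show "(\<lambda>w. c * f w) \<in> class_fun n \<alpha>"
  proof (rule class_funI)
    show "(\<lambda>w. c * f w) \<in> tensor_space n (sum_list \<alpha>)"
      by (intro lin_sub_smult tensor_space_lin_sub class_fun_tensor_space f)
    show "c * f w = c * f w'"
      if "length w = sum_list \<alpha>" "length w' = sum_list \<alpha>" "content \<alpha> w = content \<alpha> w'" for w w'
      using class_funD[OF f, of w w'] that by simp
  qed
  assume g: "g \<in> class_fun n \<alpha>"
  show "(\<lambda>w. f w + g w) \<in> class_fun n \<alpha>"
  proof (rule class_funI)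
    show "(\<lambda>w. f w + g w) \<in> tensor_space n (sum_list \<alpha>)"
      by (intro lin_sub_add tensor_space_lin_sub class_fun_tensor_space f g)
    show "f w + g w = f w' + g w'"
      if "length w = sum_list \<alpha>" "length w' = sum_list \<alpha>" "content \<alpha> w = content \<alpha> w'" for w w'
      using class_funD[OF f, of w w'] class_funD[OF g, of w w'] that by simp
  qed
qed

lemma divided_power_mset:
  assumes "f \<in> divided_power n a" "mset u = mset u'"
  shows "f u = f u'"
proof (cases "length u = a")
  case True
  obtain \<sigma> where s: "\<sigma> permutes {..<length u'}" "permute_list \<sigma> u' = u"
    using mset_eq_permutation[OF assms(2)] by blast
  have "length u' = a" using True assms(2) by (metis size_mset)
  then have "place_perm \<sigma> f = f" using assms(1) s(1) by (auto simp: divided_power_def)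
  then have "place_perm \<sigma> f u' = f u'" by simp
  then show ?thesis using s(2) by (simp add: place_perm_def)
next
  case False
  then have "length u' \<noteq> a" using assms(2) by (metis size_mset)
  moreover have "f \<in> tensor_space n a" using assms(1) by (simp add: divided_power_def)
  ultimately show ?thesis using False by (simp add: tensor_spaceD(2))
qed

text \<open>The orbit sum of a multiset of letters: a product of divided powers of distinct basis
  vectors, that is, a standard basis element of a divided power.\<close>

definition mset_ind :: "nat multiset \<Rightarrow> 'k::field tensor" where
  "mset_ind M w = (if mset w = M then 1 else 0)"

lemma mset_ind_divided_power:
  assumes "size M = a" "set_mset M \<subseteq> {1..n}"
  shows "mset_ind M \<in> divided_power n a"
proof -
  have "place_perm \<sigma> (mset_ind M) = (mset_ind M :: 'k::field tensor)" if "\<sigma> permutes {..<a}" for \<sigma>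
  proof
    fix w :: "nat list"
    show "place_perm \<sigma> (mset_ind M) w = (mset_ind M w :: 'k)"
    proof (cases "length w = a")
      case True
      then show ?thesis using that by (simp add: place_perm_def mset_ind_def)
    next
      case False
      then have "mset w \<noteq> M" "mset (permute_list \<sigma> w) \<noteq> M"
        using assms(1) by auto
      then show ?thesis by (simp add: place_perm_def mset_ind_def)
    qed
  qed
  then show ?thesis
    using assms by (auto simp: divided_power_def tensor_space_def mset_ind_def split: if_splits)
qed

text \<open>The sum over all splittings of \<open>w\<close> has at most one nonzero term, because
  the left factor is supported on words of length \<open>a\<close>.\<close>

lemma tensor_mult_eval:
  assumes "\<And>u. f u \<noteq> 0 \<Longrightarrow> length u = a"
  shows "tensor_mult f g w = f (take a w) * (g (drop a w) :: 'k::field)"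
proof -
  have S: "{(u, v). u @ v = w} = (\<lambda>k. (take k w, drop k w)) ` {..length w}"
    (is "?L = ?R")
  proof
    show "?L \<subseteq> ?R"
    proof
      fix x assume "x \<in> ?L"
      then have "x = (take (length (fst x)) w, drop (length (fst x)) w)" "length (fst x) \<le> length w" by auto
      then show "x \<in> ?R" by blast
    qed
  qed auto
  then have fin: "finite {(u, v). u @ v = w}" by simp
  have "tensor_mult f g w = (\<Sum>(u, v)\<in>{(take a w, drop a w)}. f u * g v)"
    unfolding tensor_mult_def
    by (rule sum.mono_neutral_right[OF fin]) (use assms in auto)
  then show ?thesis by simp
qed

lemma tensor_prod_class_fun:
  assumes "list_all2 (\<lambda>f a. f \<in> divided_power n a) fs \<alpha>"
  shows "tensor_prod fs \<in> class_fun n \<alpha>"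
  using assms
proof (induction rule: list_all2_induct)
  case Nil
  then show ?case by (auto simp: class_fun_def tensor_space_def)
next
  case (Cons f fs a \<alpha>)
  have ts: "f \<in> tensor_space n a" using Cons(1) by (simp add: divided_power_def)
  have ev: "tensor_prod (f # fs) w = f (take a w) * tensor_prod fs (drop a w)" for w
    using tensor_mult_eval[of f a] tensor_spaceD[OF ts] by auto
  have tp: "tensor_prod fs \<in> tensor_space n (sum_list \<alpha>)" using Cons(3) by (simp add: class_fun_def)
  have "length w = a + sum_list \<alpha> \<and> set w \<subseteq> {1..n}"
    if "f (take a w) * tensor_prod fs (drop a w) \<noteq> 0" for w
  proof -
    have a: "length (take a w) = a \<and> set (take a w) \<subseteq> {1..n}"
      using that tensor_spaceD(1)[OF ts, of "take a w"] by auto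
    have b: "length (drop a w) = sum_list \<alpha> \<and> set (drop a w) \<subseteq> {1..n}"
      using that tensor_spaceD(1)[OF tp, of "drop a w"] by auto
    have "set w = set (take a w) \<union> set (drop a w)" by (metis append_take_drop_id set_append)
    then show ?thesis using a b by (auto simp: min_def split: if_splits)
  qed
  moreover have "f (take a w) * tensor_prod fs (drop a w) = f (take a w') * tensor_prod fs (drop a w')"
    if "length w = a + sum_list \<alpha>" "length w' = a + sum_list \<alpha>" "content (a # \<alpha>) w = content (a # \<alpha>) w'" for w w'
    using that divided_power_mset[OF Cons(1), of "take a w" "take a w'"]
      class_funD[OF Cons(3), of "drop a w" "drop a w'"] by simp
  ultimately show ?case
    by (intro class_funI tensor_spaceI) (unfold ev sum_list.Cons)
qed

lemma tensor_prod_mset_ind: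
  assumes "list_all2 (\<lambda>M a. size M = a) C \<alpha>"
  shows "tensor_prod (map mset_ind C) w
    = (if length w = sum_list \<alpha> \<and> content \<alpha> w = C then 1 else 0 :: 'k::field)"
  using assms
proof (induction arbitrary: w rule: list_all2_induct)
  case (Cons M C a \<alpha>)
  have "tensor_prod (map mset_ind (M # C)) w
      = mset_ind M (take a w) * (tensor_prod (map mset_ind C) (drop a w) :: 'k)"
    using Cons(1) by (simp, intro tensor_mult_eval) (auto simp: mset_ind_def split: if_splits)
  moreover have "length w = a + sum_list \<alpha>" if "length (drop a w) = sum_list \<alpha>" "mset (take a w) = M"
    using arg_cong[OF that(2), of size] that(1) Cons(1) by (auto simp: min_def split: if_splits)
  moreover have "length (drop a w) = sum_list \<alpha>" if "length w = a + sum_list \<alpha>" using that by simp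
  moreover have "content (a # \<alpha>) w = M # C \<longleftrightarrow> mset (take a w) = M \<and> content \<alpha> (drop a w) = C" by simp
  ultimately show ?case
    unfolding Cons(3) mset_ind_def sum_list.Cons by (smt (verit) mult_zero_left mult_zero_right mult_1)
qed simp

lemma content_sizes:
  "length w = sum_list \<alpha> \<Longrightarrow> list_all2 (\<lambda>M a. size M = a) (content \<alpha> w) \<alpha>"
  by (induction \<alpha> arbitrary: w) auto

lemma content_set:
  "M \<in> set (content \<alpha> w) \<Longrightarrow> set_mset M \<subseteq> set w"
proof (induction \<alpha> arbitrary: w)
  case (Cons a \<alpha>)
  then consider "M = mset (take a w)" | "M \<in> set (content \<alpha> (drop a w))" by auto
  then show ?case
  proof cases
    case 1
    then show ?thesis using set_take_subset[of a w] by simp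
  next
    case 2
    then show ?thesis using Cons.IH[of "drop a w"] set_drop_subset[of a w] by blast
  qed
qed simp

text \<open>A function constant on contents is a finite combination of indicators of contents, and
  such an indicator is the tensor product of the orbit sums of its blocks. After this identification
  the span in \<open>D_set\<close> is not opened again.\<close>

theorem D_set_eq: "D_set n \<alpha> = (class_fun n \<alpha> :: 'k::field tensor set)"
proof -
  let ?T = "tensor_space n (sum_list \<alpha>) :: 'k tensor set"
  let ?G = "{tensor_prod fs |fs. list_all2 (\<lambda>f a. f \<in> divided_power n a) fs \<alpha>} :: 'k tensor set"
  have G: "?G \<subseteq> class_fun n \<alpha>" using tensor_prod_class_fun by auto
  have CT: "class_fun n \<alpha> \<subseteq> ?T" by (auto simp: class_fun_def)
  have "D_set n \<alpha> \<subseteq> (class_fun n \<alpha> :: 'k tensor set)"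
    unfolding D_set_def using G CT by (intro span_subset class_fun_lin_sub) auto
  moreover have "f \<in> D_set n \<alpha>" if f: "f \<in> class_fun n \<alpha>" for f :: "'k tensor"
  proof -
    have "?G \<subseteq> ?T" using G CT by (rule subset_trans)
    then have ls: "lin_sub (D_set n \<alpha> :: 'k tensor set)" and GD: "?G \<subseteq> D_set n \<alpha>"
      unfolding D_set_def by (intro span_lin_sub tensor_space_lin_sub; assumption)+
    define W where "W = {w :: nat list. length w = sum_list \<alpha> \<and> set w \<subseteq> {1..n}}"
    \<comment> \<open>Any word with the given content will do, since \<open>f\<close> takes a single
      value on the class.\<close>
    define rep where "rep C = (SOME w. w \<in> W \<and> content \<alpha> w = C)" for C
    have rep: "rep C \<in> W \<and> content \<alpha> (rep C) = C" if "C \<in> content \<alpha> ` W" for C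
      unfolding rep_def by (rule someI_ex) (use that in auto)
    let ?g = "\<lambda>w. \<Sum>C\<in>content \<alpha> ` W. f (rep C) * tensor_prod (map mset_ind C) w"
    have fin: "finite (content \<alpha> ` W)" using finite_words by (auto simp: W_def)
    have sizes: "list_all2 (\<lambda>M a. size M = a) C \<alpha>" if "C \<in> content \<alpha> ` W" for C
      using that content_sizes by (auto simp: W_def)
    have "?g w = f w" for w
    proof -
      have "?g w = (\<Sum>C\<in>content \<alpha> ` W. if length w = sum_list \<alpha> \<and> content \<alpha> w = C then f (rep C) else 0)"
        by (intro sum.cong refl) (auto simp: tensor_prod_mset_ind[OF sizes])
      also have "\<dots> = (if length w = sum_list \<alpha> \<and> content \<alpha> w \<in> content \<alpha> ` W then f (rep (content \<alpha> w)) else 0)"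
        using fin by (cases "length w = sum_list \<alpha>") (simp_all add: sum.delta')
      also have "\<dots> = f w"
      proof (cases "length w = sum_list \<alpha> \<and> content \<alpha> w \<in> content \<alpha> ` W")
        case True
        then have "f (rep (content \<alpha> w)) = f w"
          using rep[of "content \<alpha> w"] by (intro class_funD[OF f]) (auto simp: W_def)
        then show ?thesis using True by simp
      next
        case False
        then have "w \<notin> W" by (auto simp: W_def)
        then have "f w = 0"
          using tensor_spaceD(1)[OF class_fun_tensor_space[OF f], of w] by (auto simp: W_def)
        then show ?thesis using False by auto
      qed
      finally show ?thesis .
    qed
    then have "f = ?g" by auto
    moreover have "tensor_prod (map mset_ind C) \<in> (D_set n \<alpha> :: 'k tensor set)" if "C \<in> content \<alpha> ` W" for C
    proof -
      have "list_all2 (\<lambda>f a. f \<in> divided_power n a) (map mset_ind C) \<alpha>"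
      proof -
        obtain w where w: "w \<in> W" "C = content \<alpha> w" using \<open>C \<in> _\<close> by auto
        have "set_mset M \<subseteq> {1..n}" if "M \<in> set C" for M
          using content_set[of M \<alpha> w] that w by (auto simp: W_def)
        then show ?thesis
          using sizes[OF \<open>C \<in> _\<close>] mset_ind_divided_power[of _ _ n]
          unfolding list_all2_conv_all_nth by (metis length_map nth_map nth_mem)
      qed
      then have "tensor_prod (map mset_ind C) \<in> ?G" by blast
      then show ?thesis using GD by (rule rev_subsetD)
    qed
    ultimately have "?g \<in> D_set n \<alpha>"
      by (intro lin_sub_sum[OF ls] lin_sub_smult[OF ls])
    then show ?thesis using \<open>f = ?g\<close> by simp
  qed
  ultimately show ?thesis by blast
qed

text \<open>The permutation is built block by block, so it lies in the Young subgroup. The last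
  conjunct records this for all words; it is what makes the place permutation fix every element of
  \<open>class_fun\<close>.\<close>

lemma content_permutation:
  assumes "length w = sum_list \<alpha>" "length w' = sum_list \<alpha>" "content \<alpha> w = content \<alpha> w'"
  shows "\<exists>\<sigma>. \<sigma> permutes {..<sum_list \<alpha>} \<and> permute_list \<sigma> w' = w
    \<and> (\<forall>x :: 'b list. length x = sum_list \<alpha> \<longrightarrow> content \<alpha> (permute_list \<sigma> x) = content \<alpha> x)"
  using assms
proof (induction \<alpha> arbitrary: w w')
  case Nil
  then show ?case by (intro exI[of _ id]) (auto simp: permutes_id)
next
  case (Cons a \<alpha>)
  have "mset (take a w) = mset (take a w')" using Cons.prems by simp
  then obtain \<sigma> where s: "\<sigma> permutes {..<length (take a w')}" "permute_list \<sigma> (take a w') = take a w"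
    using mset_eq_permutation by blast
  obtain \<tau> where t: "\<tau> permutes {..<sum_list \<alpha>}" "permute_list \<tau> (drop a w') = drop a w"
    "\<And>x :: 'b list. length x = sum_list \<alpha> \<Longrightarrow> content \<alpha> (permute_list \<tau> x) = content \<alpha> x"
    using Cons.IH[of "drop a w" "drop a w'"] Cons.prems by auto
  have s': "\<sigma> permutes {..<a}" using s(1) Cons.prems by simp
  define N where "N = sum_list (a # \<alpha>)"
  have sN: "\<sigma> permutes {..<N}" using permutes_mono_lessThan[OF s'] by (simp add: N_def)
  have tN: "shift a \<tau> permutes {..<N}" using shift_permutes[OF t(1), of a] by (simp add: N_def)
  have ev: "permute_list (\<sigma> \<circ> shift a \<tau>) x = permute_list \<sigma> (take a x) @ permute_list \<tau> (drop a x)"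
    if "length x = N" for x :: "'c list"
  proof -
    have "permute_list (\<sigma> \<circ> shift a \<tau>) x = permute_list (shift a \<tau>) (permute_list \<sigma> (take a x @ drop a x))"
      using tN that by (simp add: permute_list_compose)
    also have "permute_list \<sigma> (take a x @ drop a x) = permute_list \<sigma> (take a x) @ drop a x"
      using s' that by (intro permute_list_append_left) (simp add: N_def)
    also have "permute_list (shift a \<tau>) \<dots> = permute_list \<sigma> (take a x) @ permute_list \<tau> (drop a x)"
      using permute_list_shift[of \<tau> "drop a x" "permute_list \<sigma> (take a x)"] t(1) that by (simp add: N_def)
    finally show ?thesis .
  qed
  show ?case
  proof (intro exI conjI allI impI)
    show "\<sigma> \<circ> shift a \<tau> permutes {..<sum_list (a # \<alpha>)}"
      using permutes_compose[OF tN sN] by (simp add: N_def)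
    show "permute_list (\<sigma> \<circ> shift a \<tau>) w' = w"
      using ev[of w'] s(2) t(2) Cons.prems by (simp add: N_def)
    fix x :: "'b list" assume x: "length x = sum_list (a # \<alpha>)"
    have "length (permute_list \<sigma> (take a x)) = a" using x by simp
    then show "content (a # \<alpha>) (permute_list (\<sigma> \<circ> shift a \<tau>) x) = content (a # \<alpha>) x"
      using ev[of x] x s' t(3)[of "drop a x"] by (simp add: N_def)
  qed
qed

section \<open>The Schur algebra and place operators\<close>

text \<open>Multiplications, rearrangements and the components of the map box all act as a sum of
  place permutations that does not depend on the tensor. A list is used because a composite can
  contain one permutation several times. The last conjunct controls words whose length is not
  \<open>N\<close>, about which the first says nothing.\<close>

definition place_op :: "nat \<Rightarrow> ('k::field tensor \<Rightarrow> 'k tensor) \<Rightarrow> bool" where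
  "place_op N T \<longleftrightarrow>
    (\<exists>\<sigma>s. (\<forall>\<sigma>\<in>set \<sigma>s. \<sigma> permutes {..<N}) \<and>
      (\<forall>f w. length w = N \<longrightarrow> T f w = (\<Sum>\<sigma>\<leftarrow>\<sigma>s. f (permute_list \<sigma> w))))
    \<and> (\<forall>f w. T f w \<noteq> 0 \<longrightarrow> (\<exists>u. mset u = mset w \<and> f u \<noteq> 0))"

lemma place_op_tensor_space:
  assumes "place_op N T" "f \<in> tensor_space n r"
  shows "T f \<in> tensor_space n r"
proof -
  have "length w = r \<and> set w \<subseteq> {1..n}" if "T f w \<noteq> 0" for w
  proof -
    obtain u where u: "mset u = mset w" "f u \<noteq> 0" using assms(1) \<open>T f w \<noteq> 0\<close> unfolding place_op_def by blast
    then show ?thesis using tensor_spaceD(1)[OF assms(2) u(2)] mset_eq_setD[OF u(1)] mset_eq_length[OF u(1)] by auto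
  qed
  then show ?thesis by (auto simp: tensor_space_def)
qed

lemma place_perm_tensor_space:
  assumes "\<sigma> permutes {..<r}" "f \<in> tensor_space n r"
  shows "place_perm \<sigma> f \<in> tensor_space n r"
proof -
  have "length w = r \<and> set w \<subseteq> {1..n}" if "f (permute_list \<sigma> w) \<noteq> 0" for w
    using tensor_spaceD(1)[OF assms(2) that] set_permute_list[of \<sigma> w] assms(1) by auto
  then show ?thesis by (auto simp: tensor_space_def place_perm_def)
qed

lemma schurD:
  assumes "s \<in> schur_algebra n r"
  shows "f \<in> tensor_space n r \<Longrightarrow> s f \<in> tensor_space n r"
    and "f \<in> tensor_space n r \<Longrightarrow> g \<in> tensor_space n r \<Longrightarrow> s (\<lambda>w. f w + g w) = (\<lambda>w. s f w + s g w)"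
    and "f \<in> tensor_space n r \<Longrightarrow> s (\<lambda>w. c * f w) = (\<lambda>w. c * s f w)"
    and "\<sigma> permutes {..<r} \<Longrightarrow> f \<in> tensor_space n r \<Longrightarrow> s (place_perm \<sigma> f) = place_perm \<sigma> (s f)"
proof -
  have hom: "s \<in> LinearCombinations.module_hom class_ring (tensor_module (tensor_space n r)) (tensor_module (tensor_space n r))"
    using assms by (simp add: schur_algebra_def)
  show "f \<in> tensor_space n r \<Longrightarrow> s f \<in> tensor_space n r"
    using module_hom_closed[OF hom] by (simp add: Pi_iff)
  show "f \<in> tensor_space n r \<Longrightarrow> g \<in> tensor_space n r \<Longrightarrow> s (\<lambda>w. f w + g w) = (\<lambda>w. s f w + s g w)"
    using LinearCombinations.module_hom_add[OF hom, of f g] by simp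
  show "f \<in> tensor_space n r \<Longrightarrow> s (\<lambda>w. c * f w) = (\<lambda>w. c * s f w)"
    using module_hom_smult[OF hom, of c f] by simp
  show "\<sigma> permutes {..<r} \<Longrightarrow> f \<in> tensor_space n r \<Longrightarrow> s (place_perm \<sigma> f) = place_perm \<sigma> (s f)"
    using assms by (simp add: schur_algebra_def)
qed

lemma schur_zero:
  assumes "s \<in> schur_algebra n r"
  shows "s (\<lambda>w. 0) = (\<lambda>w. 0)"
  using schurD(3)[OF assms lin_sub_zero[OF tensor_space_lin_sub], of 0] by simp

lemma schur_sum:
  assumes "s \<in> schur_algebra n r" "\<And>i. i \<in> I \<Longrightarrow> f i \<in> tensor_space n r"
  shows "s (\<lambda>w. \<Sum>i\<in>I. f i w) = (\<lambda>w. \<Sum>i\<in>I. s (f i) w)"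
  using assms(2)
proof (induction I rule: infinite_finite_induct)
  case (insert x F)
  then show ?case
    using schurD(2)[OF assms(1), of "f x" "\<lambda>w. \<Sum>i\<in>F. f i w"]
      lin_sub_sum[OF tensor_space_lin_sub, of F f n r] by simp
qed (auto simp: schur_zero[OF assms(1)])


text \<open>The Schur algebra is by definition the commutant of the place permutations, so its
  elements commute with sums of them.\<close>

lemma schur_place_op:
  assumes s: "s \<in> schur_algebra n r" and T: "place_op r T" and f: "f \<in> tensor_space n r"
  shows "s (T f) = T (s f)"
proof -
  obtain \<sigma>s where perm: "\<And>\<sigma>. \<sigma> \<in> set \<sigma>s \<Longrightarrow> \<sigma> permutes {..<r}"
    and ev: "\<And>f w. length w = r \<Longrightarrow> T f w = (\<Sum>\<sigma>\<leftarrow>\<sigma>s. f (permute_list \<sigma> w))"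
    using T unfolding place_op_def by blast
  have TT: "T g = (\<lambda>w. \<Sum>\<sigma>\<leftarrow>\<sigma>s. place_perm \<sigma> g w)" if g: "g \<in> tensor_space n r" for g
  proof
    fix w
    show "T g w = (\<Sum>\<sigma>\<leftarrow>\<sigma>s. place_perm \<sigma> g w)"
    proof (cases "length w = r")
      case True
      then show ?thesis by (simp add: ev place_perm_def)
    next
      case False
      then have "place_perm \<sigma> g w = 0" for \<sigma>
        using tensor_spaceD(2)[OF g] by (simp add: place_perm_def)
      then have "(\<Sum>\<sigma>\<leftarrow>\<sigma>s. place_perm \<sigma> g w) = 0" by (induction \<sigma>s) auto
      then show ?thesis using tensor_spaceD(2)[OF place_op_tensor_space[OF T g] False] by simp
    qed
  qed
  have "s (\<lambda>w. \<Sum>\<sigma>\<leftarrow>\<sigma>s. place_perm \<sigma> f w) = (\<lambda>w. \<Sum>\<sigma>\<leftarrow>\<sigma>s. place_perm \<sigma> (s f) w)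
     \<and> (\<lambda>w. \<Sum>\<sigma>\<leftarrow>\<sigma>s. place_perm \<sigma> f w) \<in> tensor_space n r"
    using perm
  proof (induction \<sigma>s)
    case Nil
    then show ?case using schur_zero[OF s] lin_sub_zero[OF tensor_space_lin_sub] by simp
  next
    case (Cons \<sigma> \<sigma>s)
    have p: "place_perm \<sigma> f \<in> tensor_space n r" using Cons f by (intro place_perm_tensor_space) auto
    then show ?case
      using Cons schurD(2)[OF s p] schurD(4)[OF s _ f, of \<sigma>]
      by (auto intro!: lin_sub_add[OF tensor_space_lin_sub])
  qed
  then show ?thesis using TT[OF f] TT[OF schurD(1)[OF s f]] by simp
qed

text \<open>An operator commuting with all place permutations preserves the invariants of the Young
  subgroup.\<close>

lemma schur_class_fun:
  assumes s: "s \<in> schur_algebra n (sum_list \<alpha>)" and f: "f \<in> class_fun n \<alpha>"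
  shows "s f \<in> class_fun n \<alpha>"
proof -
  have ft: "f \<in> tensor_space n (sum_list \<alpha>)" using f by (simp add: class_fun_def)
  note sf = schurD(1)[OF s ft]
  have "s f w = s f w'" if w: "length w = sum_list \<alpha>" "length w' = sum_list \<alpha>" "content \<alpha> w = content \<alpha> w'" for w w'
  proof -
    obtain \<sigma> where \<sigma>: "\<sigma> permutes {..<sum_list \<alpha>}" "permute_list \<sigma> w' = w"
      "\<And>x :: nat list. length x = sum_list \<alpha> \<Longrightarrow> content \<alpha> (permute_list \<sigma> x) = content \<alpha> x"
      using content_permutation[OF w] by blast
    have "place_perm \<sigma> f = f"
    proof
      fix x
      show "place_perm \<sigma> f x = f x"
      proof (cases "length x = sum_list \<alpha>")
        case True
        then show ?thesis using class_funD[OF f, of "permute_list \<sigma> x" x] \<sigma>(3) by (simp add: place_perm_def)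
      next
        case False
        then show ?thesis using tensor_spaceD(2)[OF ft] by (simp add: place_perm_def)
      qed
    qed
    then have "place_perm \<sigma> (s f) = s f" using schurD(4)[OF s \<sigma>(1) ft] by simp
    then have "place_perm \<sigma> (s f) w' = s f w'" by simp
    then show ?thesis using \<sigma>(2) by (simp add: place_perm_def)
  qed
  then show ?thesis using sf by (intro class_funI)
qed

lemma place_op_compose:
  assumes S: "place_op N S" and T: "place_op N T"
  shows "place_op N (\<lambda>f. S (T f))"
proof -
  obtain \<sigma>s where s: "\<And>\<sigma>. \<sigma> \<in> set \<sigma>s \<Longrightarrow> \<sigma> permutes {..<N}"
    and sev: "\<And>f w. length w = N \<Longrightarrow> S f w = (\<Sum>\<sigma>\<leftarrow>\<sigma>s. f (permute_list \<sigma> w))"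
    using S unfolding place_op_def by blast
  obtain \<tau>s where t: "\<And>\<sigma>. \<sigma> \<in> set \<tau>s \<Longrightarrow> \<sigma> permutes {..<N}"
    and tev: "\<And>f w. length w = N \<Longrightarrow> T f w = (\<Sum>\<sigma>\<leftarrow>\<tau>s. f (permute_list \<sigma> w))"
    using T unfolding place_op_def by blast
  have "S (T f) w = (\<Sum>\<rho>\<leftarrow>concat (map (\<lambda>\<sigma>. map (\<lambda>\<tau>. \<sigma> \<circ> \<tau>) \<tau>s) \<sigma>s). f (permute_list \<rho> w))"
    if "length w = N" for f w
  proof -
    have "S (T f) w = (\<Sum>\<sigma>\<leftarrow>\<sigma>s. \<Sum>\<tau>\<leftarrow>\<tau>s. f (permute_list \<tau> (permute_list \<sigma> w)))"
      using that by (simp add: sev tev)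
    also have "\<dots> = (\<Sum>\<sigma>\<leftarrow>\<sigma>s. \<Sum>\<tau>\<leftarrow>\<tau>s. f (permute_list (\<sigma> \<circ> \<tau>) w))"
      using t that by (intro arg_cong[of _ _ sum_list] map_cong refl)
        (auto simp: permute_list_compose)
    also have "\<dots> = (\<Sum>\<rho>\<leftarrow>concat (map (\<lambda>\<sigma>. map (\<lambda>\<tau>. \<sigma> \<circ> \<tau>) \<tau>s) \<sigma>s). f (permute_list \<rho> w))"
      by (induction \<sigma>s) (auto simp: o_def)
    finally show ?thesis .
  qed
  moreover have "\<rho> permutes {..<N}" if "\<rho> \<in> set (concat (map (\<lambda>\<sigma>. map (\<lambda>\<tau>. \<sigma> \<circ> \<tau>) \<tau>s) \<sigma>s))" for \<rho>
    using that s t by (auto intro: permutes_compose)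
  moreover have "\<exists>u. mset u = mset w \<and> f u \<noteq> 0" if "S (T f) w \<noteq> 0" for f w
    using that S T unfolding place_op_def by metis
  ultimately show ?thesis unfolding place_op_def by blast
qed

lemma list_permutation:
  assumes "distinct xs" "set xs = {..<N}"
  defines "\<sigma> \<equiv> (\<lambda>k. if k < N then xs ! k else k)"
  shows "\<sigma> permutes {..<N}"
    and "length w = N \<Longrightarrow> permute_list \<sigma> w = map (\<lambda>k. w ! k) xs"
proof -
  have len: "length xs = N" using distinct_card[OF assms(1)] assms(2) by simp
  have "bij_betw ((!) xs) {..<N} {..<N}"
    by (rule bij_betw_nth[OF assms(1)]) (simp_all add: len assms(2))
  then have "bij_betw \<sigma> {..<N} {..<N}"
    by (rule bij_betw_cong[THEN iffD1, rotated]) (simp add: \<sigma>_def)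
  then show "\<sigma> permutes {..<N}" by (rule bij_imp_permutes) (simp add: \<sigma>_def)
  show "permute_list \<sigma> w = map (\<lambda>k. w ! k) xs" if "length w = N"
    using that len by (intro nth_equalityI) (auto simp: permute_list_def \<sigma>_def)
qed

text \<open>The permutation is read off from the same splitting applied to the list of positions
  \<open>[0..<N]\<close>.\<close>

lemma nths_permutation:
  "\<exists>\<sigma>. \<sigma> permutes {..<N} \<and> (\<forall>w :: 'a list. length w = N \<longrightarrow> nths w A @ nths w (- A) = permute_list \<sigma> w)"
proof -
  let ?xs = "nths [0..<N] A @ nths [0..<N] (- A)"
  have sn: "set (nths [0..<N] B) = {i. i < N \<and> i \<in> B}" for B
    by (auto simp: set_nths) (metis add_0 nth_upt)
  have "distinct ?xs" by (auto simp: sn distinct_nthsI)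
  moreover have "set ?xs = {..<N}" by (auto simp: sn)
  moreover have "nths w A @ nths w (- A) = map (\<lambda>k. w ! k) ?xs" if "length w = N" for w :: "'a list"
  proof -
    have "w = map (\<lambda>k. w ! k) [0..<N]" using that map_nth by metis
    then show ?thesis by (metis map_append nths_map)
  qed
  ultimately show ?thesis
    by (intro exI[of _ "\<lambda>k. if k < N then ?xs ! k else k"] conjI allI impI)
      (simp_all only: list_permutation)
qed

lemma mset_nths_append: "mset (nths w A @ nths w (- A)) = mset w"
  using nths_permutation[of "length w" A] by (metis mset_permute_list)

lemma place_op_D_mult: "place_op N (D_mult i)"
proof -
  define S where "S = {A. A \<subseteq> {..<N} \<and> card A = i}"
  have fin: "finite S" by (rule finite_subset[of _ "Pow {..<N}"]) (auto simp: S_def)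
  obtain xs where xs: "set xs = S" "distinct xs" using finite_distinct_list[OF fin] by blast
  have "\<exists>\<sigma>. \<forall>A. \<sigma> A permutes {..<N} \<and>
      (\<forall>w :: nat list. length w = N \<longrightarrow> nths w A @ nths w (- A) = permute_list (\<sigma> A) w)"
    using nths_permutation by (intro choice) blast
  then obtain \<sigma> where p: "\<And>A. \<sigma> A permutes {..<N}"
    and ev: "\<And>A w. length (w :: nat list) = N \<Longrightarrow> nths w A @ nths w (- A) = permute_list (\<sigma> A) w"
    by blast
  have "D_mult i f w = (\<Sum>\<rho>\<leftarrow>map \<sigma> xs. f (permute_list \<rho> w))" if "length w = N" for f :: "'a tensor" and w
  proof -
    have "D_mult i f w = (\<Sum>A\<in>set xs. f (permute_list (\<sigma> A) w))"
      using that by (simp add: D_mult_def ev xs(1) S_def)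
    then show ?thesis by (simp add: sum.distinct_set_conv_list[OF xs(2)] o_def)
  qed
  moreover have "\<rho> permutes {..<N}" if "\<rho> \<in> set (map \<sigma> xs)" for \<rho> using that p by auto
  moreover have "\<exists>u. mset u = mset w \<and> f u \<noteq> 0" if "D_mult i f w \<noteq> 0" for f :: "'a tensor" and w
  proof -
    have "\<exists>A. f (nths w A @ nths w (- A)) \<noteq> 0"
    proof (rule ccontr)
      assume "\<not> ?thesis"
      then have "D_mult i f w = 0" by (simp add: D_mult_def)
      then show False using that by simp
    qed
    then show ?thesis using mset_nths_append by blast
  qed
  ultimately show ?thesis unfolding place_op_def by blast
qed

lemma place_op_on_places:
  assumes "place_op l \<phi>" "p + l \<le> N"
  shows "place_op N (on_places p l \<phi>)"
proof -
  obtain \<sigma>s where s: "\<And>\<sigma>. \<sigma> \<in> set \<sigma>s \<Longrightarrow> \<sigma> permutes {..<l}"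
    and sev: "\<And>f w. length w = l \<Longrightarrow> \<phi> f w = (\<Sum>\<sigma>\<leftarrow>\<sigma>s. f (permute_list \<sigma> w))"
    using assms(1) unfolding place_op_def by blast
  have split: "w = take p w @ take l (drop p w) @ drop (p + l) w" for w :: "nat list"
    by (metis append_take_drop_id drop_drop add.commute)
  have "on_places p l \<phi> f w = (\<Sum>\<rho>\<leftarrow>map (shift p) \<sigma>s. f (permute_list \<rho> w))" if "length w = N" for f w
  proof -
    have "permute_list (shift p \<tau>) w = take p w @ permute_list \<tau> (take l (drop p w)) @ drop (p + l) w"
      if "\<tau> permutes {..<l}" for \<tau>
    proof -
      have lp: "length (take p w) = p" and ll: "length (take l (drop p w)) = l"
        using assms(2) \<open>length w = N\<close> by auto
      have "permute_list (shift p \<tau>) (take p w @ (take l (drop p w) @ drop (p + l) w))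
          = take p w @ permute_list \<tau> (take l (drop p w) @ drop (p + l) w)"
        using permute_list_shift[of \<tau> "take l (drop p w) @ drop (p + l) w" "take p w"] lp
          permutes_mono_lessThan[OF that] ll by simp
      also have "permute_list \<tau> (take l (drop p w) @ drop (p + l) w)
          = permute_list \<tau> (take l (drop p w)) @ drop (p + l) w"
        using that ll by (intro permute_list_append_left) simp
      finally show ?thesis using split[of w] by simp
    qed
    then have "map (\<lambda>\<tau>. f (permute_list (shift p \<tau>) w)) \<sigma>s
        = map (\<lambda>\<tau>. f (take p w @ permute_list \<tau> (take l (drop p w)) @ drop (p + l) w)) \<sigma>s"
      using s by auto
    then have "(\<Sum>\<rho>\<leftarrow>map (shift p) \<sigma>s. f (permute_list \<rho> w))
        = (\<Sum>\<tau>\<leftarrow>\<sigma>s. f (take p w @ permute_list \<tau> (take l (drop p w)) @ drop (p + l) w))"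
      unfolding map_map o_def by (rule arg_cong)
    then show ?thesis using that assms(2) by (simp add: on_places_def sev)
  qed
  moreover have "\<rho> permutes {..<N}" if "\<rho> \<in> set (map (shift p) \<sigma>s)" for \<rho>
    using that s assms(2) by (auto intro!: permutes_mono_lessThan[OF shift_permutes])
  moreover have "\<exists>u. mset u = mset w \<and> f u \<noteq> 0" if "on_places p l \<phi> f w \<noteq> 0" for f w
  proof -
    let ?g = "\<lambda>u. f (take p w @ u @ drop (p + l) w)"
    have "\<phi> ?g (take l (drop p w)) \<noteq> 0" using that by (simp add: on_places_def)
    then have "\<exists>u. mset u = mset (take l (drop p w)) \<and> ?g u \<noteq> 0"
      using assms(1) unfolding place_op_def by blast
    then obtain u where u: "mset u = mset (take l (drop p w))" "f (take p w @ u @ drop (p + l) w) \<noteq> 0"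
      by blast
    then have "mset (take p w @ u @ drop (p + l) w) = mset w" by (subst (3) split) simp
    then show ?thesis using u(2) by blast
  qed
  ultimately show ?thesis unfolding place_op_def by blast
qed

lemma place_op_D_mult_list: "place_op (sum_list \<alpha>) (D_mult_list \<alpha>)"
proof (induction \<alpha>)
  case Nil
  have "D_mult_list [] f w = (\<Sum>\<sigma>\<leftarrow>[id]. f (permute_list \<sigma> w))" for f :: "'a tensor" and w by simp
  then show ?case unfolding place_op_def
    by (intro conjI exI[of _ "[id]"]) (auto simp: permutes_id)
next
  case (Cons a \<alpha>)
  then show ?case
    using place_op_compose[OF place_op_D_mult place_op_on_places[OF Cons, of a "a + sum_list \<alpha>"], of a] by simp
qed

text \<open>The rearrangement is a bijection on words of length \<open>N\<close>, so the sum in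
  \<open>move_right\<close> has exactly one term, given by the inverse permutation.\<close>

lemma move_right_eval:
  "\<exists>\<sigma>. \<sigma> permutes {..<N} \<and> (\<forall>w. length w = N \<longrightarrow>
    {x. nths x (- E) @ nths x E = w} = {permute_list \<sigma> w})"
proof -
  obtain \<sigma> where p: "\<sigma> permutes {..<N}"
    and ev: "\<And>w :: 'a list. length w = N \<Longrightarrow> nths w (- E) @ nths w E = permute_list \<sigma> w"
    using nths_permutation[of N "- E"] by auto
  have "{x. nths x (- E) @ nths x E = w} = {permute_list (inv_into UNIV \<sigma>) w}" if w: "length w = N" for w :: "'a list"
  proof -
    have pi: "inv_into UNIV \<sigma> permutes {..<N}" by (rule permutes_inv[OF p])
    have l: "length x = N" if "nths x (- E) @ nths x E = w" for x
      using mset_nths_append[of x "- E"] that w by (metis double_complement size_mset)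
    have "permute_list \<sigma> (permute_list (inv_into UNIV \<sigma>) w) = w"
      using permute_list_compose[of \<sigma> w "inv_into UNIV \<sigma>"] p w permutes_inv_o[OF p] by simp
    moreover have "x = permute_list (inv_into UNIV \<sigma>) w" if "permute_list \<sigma> x = w" "length x = N" for x
      using permute_list_compose[of "inv_into UNIV \<sigma>" x \<sigma>] pi that permutes_inv_o[OF p] by simp
    ultimately have "nths x (- E) @ nths x E = w \<longleftrightarrow> x = permute_list (inv_into UNIV \<sigma>) w" for x
      using l[of x] ev[of x] ev[of "permute_list (inv_into UNIV \<sigma>) w"] w length_permute_list by metis
    then show ?thesis by blast
  qed
  then show ?thesis using permutes_inv[OF p] by blast
qed

lemma place_op_move_right: "place_op N (move_right E)"
proof -
  obtain \<sigma> where p: "\<sigma> permutes {..<N}"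
    and ev: "\<And>w :: nat list. length w = N \<Longrightarrow> {x. nths x (- E) @ nths x E = w} = {permute_list \<sigma> w}"
    using move_right_eval[of N E] by blast
  have "move_right E f w = (\<Sum>\<sigma>\<leftarrow>[\<sigma>]. f (permute_list \<sigma> w))" if "length w = N" for f :: "'a tensor" and w
    using ev[OF that] by (simp add: move_right_def)
  moreover have "\<exists>u. mset u = mset w \<and> f u \<noteq> 0" if "move_right E f w \<noteq> 0" for f :: "'a tensor" and w
  proof -
    have "\<exists>x. nths x (- E) @ nths x E = w \<and> f x \<noteq> 0"
    proof (rule ccontr)
      assume "\<not> ?thesis"
      then have "move_right E f w = 0" by (auto simp: move_right_def intro!: sum.neutral)
      then show False using that by simp
    qed
    then obtain x where "nths x (- E) @ nths x E = w" "f x \<noteq> 0" by blast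
    then show ?thesis using mset_nths_append[of x "- E"] by auto
  qed
  ultimately show ?thesis using p unfolding place_op_def by (intro conjI exI[of _ "[\<sigma>]"]) auto
qed

section \<open>Quotients\<close>

text \<open>Agrees with the coset in any \<open>tensor_module\<close> but does not mention the
  ambient space; equality of cosets becomes membership of a difference.\<close>

definition coset :: "'k::field tensor set \<Rightarrow> 'k tensor \<Rightarrow> 'k tensor set" where
  "coset W x = {y. (\<lambda>w. y w - x w) \<in> W}"

lemma a_r_coset_tensor_module [simp]: "W +>\<^bsub>tensor_module U\<^esub> x = coset W x"
proof -
  have "W +>\<^bsub>tensor_module U\<^esub> x = (\<lambda>h w. h w + x w) ` W"
    by (auto simp: a_r_coset_def r_coset_def tensor_module_def)
  also have "\<dots> = coset W x"
  proof
    show "coset W x \<subseteq> (\<lambda>h w. h w + x w) ` W"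
    proof
      fix y assume "y \<in> coset W x"
      then show "y \<in> (\<lambda>h w. h w + x w) ` W"
        by (intro image_eqI[of _ _ "\<lambda>w. y w - x w"]) (simp_all add: coset_def)
    qed
  qed (auto simp: coset_def)
  finally show ?thesis .
qed

lemma coset_eq_iff:
  assumes W: "lin_sub W"
  shows "coset W x = coset W y \<longleftrightarrow> (\<lambda>w. x w - y w) \<in> W"
proof
  assume "coset W x = coset W y"
  moreover have "x \<in> coset W x" using lin_sub_zero[OF W] by (simp add: coset_def)
  ultimately show "(\<lambda>w. x w - y w) \<in> W" by (simp add: coset_def)
next
  assume xy: "(\<lambda>w. x w - y w) \<in> W"
  have "(\<lambda>w. z w - x w) \<in> W \<longleftrightarrow> (\<lambda>w. z w - y w) \<in> W" for z
    using lin_sub_add[OF W _ xy, of "\<lambda>w. z w - x w"] lin_sub_diff[OF W _ xy, of "\<lambda>w. z w - y w"] by auto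
  then show "coset W x = coset W y" by (simp add: coset_def)
qed

locale tensor_quotient =
  fixes U W :: "'k::field tensor set"
  assumes U: "lin_sub U" and W: "lin_sub W" and WU: "W \<subseteq> U"
begin

abbreviation Q :: "('k, 'k tensor set, 'k tensor \<Rightarrow> 'k tensor) smodule" where
  "Q \<equiv> quotient_smodule (tensor_module U) W"

lemma carrier_Q: "carrier Q = coset W ` U"
  by (auto simp: quotient_smodule_def A_RCOSETS_def')

lemma zero_Q: "\<zero>\<^bsub>Q\<^esub> = coset W (\<lambda>w. 0)"
  by (simp add: quotient_smodule_def coset_def)

lemma add_Q: "coset W x \<oplus>\<^bsub>Q\<^esub> coset W y = coset W (\<lambda>w. x w + y w)"
proof -
  have "coset W x \<oplus>\<^bsub>Q\<^esub> coset W y = (\<Union>g\<in>coset W x. \<Union>h\<in>coset W y. {\<lambda>w. g w + h w})"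
    by (simp add: quotient_smodule_def set_add_def set_mult_def tensor_module_def)
  also have "\<dots> = coset W (\<lambda>w. x w + y w)"
  proof
    show "\<dots> \<subseteq> coset W (\<lambda>w. x w + y w)"
    proof
      fix z assume "z \<in> (\<Union>g\<in>coset W x. \<Union>h\<in>coset W y. {\<lambda>w. g w + h w})"
      then obtain g h where gh: "(\<lambda>w. g w - x w) \<in> W" "(\<lambda>w. h w - y w) \<in> W" "z = (\<lambda>w. g w + h w)"
        by (auto simp: coset_def)
      show "z \<in> coset W (\<lambda>w. x w + y w)"
        using lin_sub_add[OF W gh(1,2)] by (simp add: coset_def gh(3) algebra_simps)
    qed
    show "coset W (\<lambda>w. x w + y w) \<subseteq> (\<Union>g\<in>coset W x. \<Union>h\<in>coset W y. {\<lambda>w. g w + h w})"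
    proof
      fix z assume z: "z \<in> coset W (\<lambda>w. x w + y w)"
      have "(\<lambda>w. z w - y w) \<in> coset W x" using z by (simp add: coset_def algebra_simps)
      moreover have "y \<in> coset W y" using lin_sub_zero[OF W] by (simp add: coset_def)
      moreover have "z = (\<lambda>w. (z w - y w) + y w)" by simp
      ultimately show "z \<in> (\<Union>g\<in>coset W x. \<Union>h\<in>coset W y. {\<lambda>w. g w + h w})" by blast
    qed
  qed
  finally show ?thesis .
qed

text \<open>The quotient operations are unions over all representatives. Such a union collapses to
  one coset as soon as the map respects \<open>W\<close>, which is the usual independence of
  representatives.\<close>

lemma coset_UN:
  assumes "\<And>z. z \<in> coset W x \<Longrightarrow> (\<lambda>w. g z w - g x w) \<in> W"
  shows "(\<Union>z\<in>coset W x. coset W (g z)) = coset W (g x)"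
proof -
  have "coset W (g z) = coset W (g x)" if "z \<in> coset W x" for z
    using assms[OF that] coset_eq_iff[OF W] by blast
  moreover have "x \<in> coset W x" using lin_sub_zero[OF W] by (simp add: coset_def)
  ultimately show ?thesis by blast
qed

lemma smult_Q: "c \<odot>\<^bsub>Q\<^esub> coset W x = coset W (\<lambda>w. c * x w)"
proof -
  have "c \<odot>\<^bsub>Q\<^esub> coset W x = (\<Union>z\<in>coset W x. coset W (\<lambda>w. c * z w))"
    by (simp add: quotient_smodule_def)
  also have "\<dots> = coset W (\<lambda>w. c * x w)"
  proof (rule coset_UN)
    fix z assume "z \<in> coset W x"
    then show "(\<lambda>w. c * z w - c * x w) \<in> W"
      using lin_sub_smult[OF W, of "\<lambda>w. z w - x w" c] by (simp add: coset_def algebra_simps)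
  qed
  finally show ?thesis .
qed

lemma action_Q:
  assumes "\<And>z. z \<in> coset W x \<Longrightarrow> (\<lambda>w. s z w - s x w) \<in> W"
  shows "action Q s (coset W x) = coset W (s x)"
  using coset_UN[of x s, OF assms] by (simp add: quotient_smodule_def)

lemma module_Q: "Module.module class_ring Q"
proof (rule module_criteria[OF cring_class_ring], goal_cases)
  case 1
  then show ?case using lin_sub_zero[OF U] by (auto simp: carrier_Q zero_Q)
next
  case 2
  then show ?case using lin_sub_add[OF U] by (auto simp: carrier_Q add_Q)
next
  case 3
  show ?case
  proof
    fix v assume "v \<in> carrier Q"
    then obtain x where x: "x \<in> U" "v = coset W x" by (auto simp: carrier_Q)
    then have "v \<oplus>\<^bsub>Q\<^esub> coset W (\<lambda>w. - x w) = \<zero>\<^bsub>Q\<^esub>" by (simp add: add_Q zero_Q)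
    then show "\<exists>neg_v\<in>carrier Q. v \<oplus>\<^bsub>Q\<^esub> neg_v = \<zero>\<^bsub>Q\<^esub>"
      using lin_sub_neg[OF U x(1)] by (auto simp: carrier_Q)
  qed
next
  case 4
  then show ?case using lin_sub_smult[OF U] by (auto simp: carrier_Q smult_Q)
qed (auto simp: carrier_Q zero_Q add_Q smult_Q algebra_simps)

end

section \<open>Spaces of homomorphisms\<close>

definition is_smodule :: "'s set \<Rightarrow> ('k::field, 'b, 's) smodule \<Rightarrow> bool" where
  "is_smodule S M \<longleftrightarrow> Module.module class_ring M \<and>
    (\<forall>s\<in>S. \<forall>x\<in>carrier M. action M s x \<in> carrier M
      \<and> (\<forall>y\<in>carrier M. action M s (x \<oplus>\<^bsub>M\<^esub> y) = action M s x \<oplus>\<^bsub>M\<^esub> action M s y)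
      \<and> (\<forall>c. action M s (c \<odot>\<^bsub>M\<^esub> x) = c \<odot>\<^bsub>M\<^esub> action M s x))"

text \<open>The action on the target is additive and homogeneous, so pointwise sums and multiples of
  maps that commute with \<open>S\<close> again commute with it.\<close>

lemma vectorspace_shom:
  fixes M :: "('k::field, 'b, 's) smodule" and N :: "('k, 'c, 's) smodule"
  assumes M: "is_smodule S M" and N: "is_smodule S N"
  shows "vectorspace class_ring (shom S M N)"
proof -
  interpret M: Module.module class_ring M using M by (simp add: is_smodule_def)
  interpret N: Module.module class_ring N using N by (simp add: is_smodule_def)
  let ?H = "shom S M N"
  have carr: "carrier ?H = shom_set S M N" by (simp add: shom_def)
  have closed: "f x \<in> carrier N" if "f \<in> shom_set S M N" "x \<in> carrier M" for f x
    using that by (auto simp: shom_set_def LinearCombinations.module_hom_def)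
  have I: "(\<lambda>x\<in>carrier M. f x) \<in> shom_set S M N"
    if "\<And>x. x \<in> carrier M \<Longrightarrow> f x \<in> carrier N"
      "\<And>x y. x \<in> carrier M \<Longrightarrow> y \<in> carrier M \<Longrightarrow> f (x \<oplus>\<^bsub>M\<^esub> y) = f x \<oplus>\<^bsub>N\<^esub> f y"
      "\<And>c x. x \<in> carrier M \<Longrightarrow> f (c \<odot>\<^bsub>M\<^esub> x) = c \<odot>\<^bsub>N\<^esub> f x"
      "\<And>s x. s \<in> S \<Longrightarrow> x \<in> carrier M \<Longrightarrow> f (action M s x) = action N s (f x)" for f
    using that M unfolding shom_set_def LinearCombinations.module_hom_def is_smodule_def
    by (simp add: Pi_iff)
  have hom: "f (x \<oplus>\<^bsub>M\<^esub> y) = f x \<oplus>\<^bsub>N\<^esub> f y" "f (c \<odot>\<^bsub>M\<^esub> x) = c \<odot>\<^bsub>N\<^esub> f x"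
    "s \<in> S \<Longrightarrow> f (action M s x) = action N s (f x)"
    if "f \<in> shom_set S M N" "x \<in> carrier M" "y \<in> carrier M" for f x y c s
    using that by (auto simp: shom_set_def LinearCombinations.module_hom_def)
  have act: "action N s (x \<oplus>\<^bsub>N\<^esub> y) = action N s x \<oplus>\<^bsub>N\<^esub> action N s y"
    "action N s (c \<odot>\<^bsub>N\<^esub> x) = c \<odot>\<^bsub>N\<^esub> action N s x" "action N s x \<in> carrier N"
    if "s \<in> S" "x \<in> carrier N" "y \<in> carrier N" for s x y c
    using that N by (auto simp: is_smodule_def)
  have act0: "action N s \<zero>\<^bsub>N\<^esub> = \<zero>\<^bsub>N\<^esub>" if "s \<in> S" for s
    using act(2)[OF that, of "\<zero>\<^bsub>N\<^esub>" "\<zero>\<^bsub>N\<^esub>" 0] act(3)[OF that, of "\<zero>\<^bsub>N\<^esub>" "\<zero>\<^bsub>N\<^esub>"]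
      N.smult_l_null by simp
  have ext: "f = (\<lambda>x\<in>carrier M. f x)" if "f \<in> shom_set S M N" for f
    using that by (simp add: shom_set_def extensional_restrict)
  have eqI: "f = g" if "f \<in> shom_set S M N" "g \<in> shom_set S M N" "\<And>x. x \<in> carrier M \<Longrightarrow> f x = g x" for f g
    using that unfolding shom_set_def by (auto intro: extensionalityI)
  have Hadd: "(f \<oplus>\<^bsub>?H\<^esub> g) = (\<lambda>x\<in>carrier M. f x \<oplus>\<^bsub>N\<^esub> g x)" for f g by (simp add: shom_def)
  have Hsm: "(c \<odot>\<^bsub>?H\<^esub> g) = (\<lambda>x\<in>carrier M. c \<odot>\<^bsub>N\<^esub> g x)" for c g by (simp add: shom_def)
  have Hz: "\<zero>\<^bsub>?H\<^esub> = (\<lambda>x\<in>carrier M. \<zero>\<^bsub>N\<^esub>)" by (simp add: shom_def)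
  have addc: "f \<oplus>\<^bsub>?H\<^esub> g \<in> shom_set S M N" if f: "f \<in> shom_set S M N" and g: "g \<in> shom_set S M N" for f g
    unfolding Hadd
  proof (rule I)
    fix x y c s assume x: "x \<in> carrier M"
    show "f x \<oplus>\<^bsub>N\<^esub> g x \<in> carrier N" by (intro N.a_closed closed f g x)
    show "f (c \<odot>\<^bsub>M\<^esub> x) \<oplus>\<^bsub>N\<^esub> g (c \<odot>\<^bsub>M\<^esub> x) = c \<odot>\<^bsub>N\<^esub> (f x \<oplus>\<^bsub>N\<^esub> g x)"
      using closed[OF f x] closed[OF g x] by (simp add: hom(2)[OF f x x] hom(2)[OF g x x] N.smult_r_distr)
    { assume y: "y \<in> carrier M"
      show "f (x \<oplus>\<^bsub>M\<^esub> y) \<oplus>\<^bsub>N\<^esub> g (x \<oplus>\<^bsub>M\<^esub> y) = (f x \<oplus>\<^bsub>N\<^esub> g x) \<oplus>\<^bsub>N\<^esub> (f y \<oplus>\<^bsub>N\<^esub> g y)"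
        using closed[OF f x] closed[OF g x] closed[OF f y] closed[OF g y]
        by (simp add: hom(1)[OF f x y] hom(1)[OF g x y] N.a_ac) }
    { assume s: "s \<in> S"
      show "f (action M s x) \<oplus>\<^bsub>N\<^esub> g (action M s x) = action N s (f x \<oplus>\<^bsub>N\<^esub> g x)"
        using hom(3)[OF f x x s] hom(3)[OF g x x s] act(1)[OF s closed[OF f x] closed[OF g x]] by simp }
  qed
  have smc: "c \<odot>\<^bsub>?H\<^esub> f \<in> shom_set S M N" if f: "f \<in> shom_set S M N" for f and c :: 'k
    unfolding Hsm
  proof (rule I)
    fix x y s d assume x: "x \<in> carrier M"
    show "c \<odot>\<^bsub>N\<^esub> f x \<in> carrier N" using closed[OF f x] by simp
    show "c \<odot>\<^bsub>N\<^esub> f (d \<odot>\<^bsub>M\<^esub> x) = d \<odot>\<^bsub>N\<^esub> (c \<odot>\<^bsub>N\<^esub> f x)"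
      using closed[OF f x] N.smult_assoc1[of c d "f x"] N.smult_assoc1[of d c "f x"]
      by (simp add: hom(2)[OF f x x] mult.commute)
    { assume y: "y \<in> carrier M"
      show "c \<odot>\<^bsub>N\<^esub> f (x \<oplus>\<^bsub>M\<^esub> y) = c \<odot>\<^bsub>N\<^esub> f x \<oplus>\<^bsub>N\<^esub> c \<odot>\<^bsub>N\<^esub> f y"
        using closed[OF f x] closed[OF f y] by (simp add: hom(1)[OF f x y] N.smult_r_distr) }
    { assume s: "s \<in> S"
      show "c \<odot>\<^bsub>N\<^esub> f (action M s x) = action N s (c \<odot>\<^bsub>N\<^esub> f x)"
        using hom(3)[OF f x x s] act(2)[OF s closed[OF f x] closed[OF f x]] by simp }
  qed
  have zc: "\<zero>\<^bsub>?H\<^esub> \<in> shom_set S M N"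
    unfolding Hz by (rule I) (simp_all add: act0)
  have "Module.module class_ring ?H"
  proof (rule module_criteria[OF cring_class_ring], unfold carr, goal_cases)
    case 1 then show ?case by (rule zc)
  next
    case 2 then show ?case using addc by blast
  next
    case 3
    show ?case
    proof
      fix f assume f: "f \<in> shom_set S M N"
      have "f \<oplus>\<^bsub>?H\<^esub> ((-1) \<odot>\<^bsub>?H\<^esub> f) = \<zero>\<^bsub>?H\<^esub>"
      proof (rule eqI[OF addc[OF f smc[OF f]] zc])
        fix x assume x: "x \<in> carrier M"
        have "f x \<oplus>\<^bsub>N\<^esub> (-1) \<odot>\<^bsub>N\<^esub> f x = 0 \<odot>\<^bsub>N\<^esub> f x"
          using closed[OF f x] N.smult_l_distr[of 1 "-1" "f x"] N.smult_one[of "f x"] by simp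
        then show "(f \<oplus>\<^bsub>?H\<^esub> ((-1) \<odot>\<^bsub>?H\<^esub> f)) x = \<zero>\<^bsub>?H\<^esub> x"
          using closed[OF f x] x N.smult_l_null[of "f x"] by (simp add: Hadd Hsm Hz)
      qed
      then show "\<exists>g\<in>shom_set S M N. f \<oplus>\<^bsub>?H\<^esub> g = \<zero>\<^bsub>?H\<^esub>" using smc[OF f] by blast
    qed
  next
    case 4 then show ?case using smc by blast
  next
    case 5
    show ?case using closed by (auto simp: Hadd N.a_comm intro!: restrict_ext)
  next
    case 6
    show ?case using closed by (auto simp: Hadd N.a_assoc intro!: restrict_ext)
  next
    case 7
    show ?case
    proof
      fix f assume f: "f \<in> shom_set S M N"
      show "f \<oplus>\<^bsub>?H\<^esub> \<zero>\<^bsub>?H\<^esub> = f"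
        by (rule eqI[OF addc[OF f zc] f]) (simp add: Hadd Hz closed[OF f])
    qed
  next
    case 8
    show ?case using closed N.smult_assoc1 by (auto simp: Hsm intro!: restrict_ext)
  next
    case 9
    show ?case
    proof
      fix f assume f: "f \<in> shom_set S M N"
      show "\<one>\<^bsub>class_ring\<^esub> \<odot>\<^bsub>?H\<^esub> f = f"
        using smc[OF f, of 1] N.smult_one closed[OF f] by (intro eqI[OF _ f]) (auto simp: Hsm)
    qed
  next
    case 10
    show ?case using closed N.smult_l_distr by (auto simp: Hsm Hadd intro!: restrict_ext)
  next
    case 11
    show ?case using closed N.smult_r_distr by (auto simp: Hsm Hadd intro!: restrict_ext)
  qed
  then show ?thesis using class_field by (simp add: vectorspace_def)
qed

text \<open>A bound on \<open>dim\<close> is meaningful only for a finitely generated space, so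
  finite dimension is part of the conclusion.\<close>

lemma dim_le_1:
  assumes V: "vectorspace class_ring V" and F: "F \<in> carrier V"
    and gen: "\<And>G. G \<in> carrier V \<Longrightarrow> \<exists>c. G = c \<odot>\<^bsub>V\<^esub> F"
  shows "vectorspace.fin_dim (class_ring :: 'k::field ring) V \<and> vectorspace.dim class_ring V \<le> 1"
proof -
  interpret vectorspace "class_ring :: 'k ring" V by (rule V)
  have "carrier V \<subseteq> span {F}"
  proof
    fix G assume "G \<in> carrier V"
    then obtain c where "G = c \<odot>\<^bsub>V\<^esub> F" using gen by blast
    then have "G = lincomb (\<lambda>_. c) {F}"
      unfolding lincomb_def using F smult_closed[of c F] by simp
    then show "G \<in> span {F}" unfolding span_def by auto
  qed
  then have gs: "gen_set {F}" using span_is_subset2[of "{F}"] F by auto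
  then show ?thesis
    using gen_ge_dim[of "{F}"] F unfolding fin_dim_def by (intro conjI exI[of _ "{F}"]) auto
qed

declare One_nat_def [simp del]

section \<open>Block words\<close>

text \<open>For \<open>k = 1\<close> the basis tensor of this word is the tensor product of the
  divided powers of the successive basis vectors, the canonical cyclic generator of
  D(\<alpha>).\<close>

fun block_word :: "nat \<Rightarrow> nat list \<Rightarrow> nat list" where
  "block_word k [] = []"
| "block_word k (a # \<alpha>) = replicate a k @ block_word (Suc k) \<alpha>"

definition basis_tensor :: "nat list \<Rightarrow> 'k::field tensor" where
  "basis_tensor v w = (if w = v then 1 else 0)"

abbreviation gen_tensor :: "nat list \<Rightarrow> 'k::field tensor" where
  "gen_tensor \<alpha> \<equiv> basis_tensor (block_word 1 \<alpha>)"

definition pick :: "'b \<Rightarrow> 'b list \<Rightarrow> 'a list \<Rightarrow> 'a list" where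
  "pick k w u = map snd (filter (\<lambda>p. fst p = k) (zip w u))"

text \<open>If \<open>w\<close> is a rearrangement of \<open>block_word k \<alpha>\<close>, then \<open>collect k \<alpha> w u\<close> is \<open>u\<close> permuted by one of
  the permutations which carry \<open>w\<close> to \<open>block_word k \<alpha>\<close>.\<close>

fun collect :: "nat \<Rightarrow> nat list \<Rightarrow> nat list \<Rightarrow> 'a list \<Rightarrow> 'a list" where
  "collect k [] w u = []"
| "collect k (a # \<alpha>) w u = pick k w u @ collect (Suc k) \<alpha> w u"

lemma length_block_word [simp]: "length (block_word k \<alpha>) = sum_list \<alpha>"
  by (induction \<alpha> arbitrary: k) auto

lemma set_block_word: "set (block_word k \<alpha>) \<subseteq> {k..<k + length \<alpha>}"
proof (induction \<alpha> arbitrary: k)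
  case (Cons a \<alpha>)
  have "set (block_word (Suc k) \<alpha>) \<subseteq> {k..<k + length (a # \<alpha>)}"
    using Cons[of "Suc k"] by auto
  then show ?case by auto
qed simp

lemma block_word_append: "block_word k (\<alpha> @ \<beta>) = block_word k \<alpha> @ block_word (k + length \<alpha>) \<beta>"
  by (induction \<alpha> arbitrary: k) auto

lemma count_block_word:
  "count (mset (block_word k \<alpha>)) j = (if k \<le> j \<and> j < k + length \<alpha> then \<alpha> ! (j - k) else 0)"
proof (induction \<alpha> arbitrary: k)
  case (Cons a \<alpha>)
  have "(a # \<alpha>) ! (j - k) = \<alpha> ! (j - Suc k)" if "Suc k \<le> j"
    using that by (simp add: nth_Cons' One_nat_def)
  then show ?case using Cons by (auto simp: not_le less_Suc_eq_le)
qed simp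

lemma length_pick:
  assumes "length w = length u"
  shows "length (pick k w u) = count (mset w) k"
  using assms by (induction w u rule: list_induct2) (auto simp: pick_def)

lemma pick_append:
  "length v = length p \<Longrightarrow> pick k (p @ w) (v @ u) = pick k p v @ pick k w u"
  by (simp add: pick_def)

lemma pick_Nil: "k \<notin> set w \<Longrightarrow> pick k w u = []"
  by (auto simp: pick_def filter_empty_conv dest: set_zip_leftD)

lemma pick_replicate: "length u = a \<Longrightarrow> pick k (replicate a k) u = u"
  by (induction u arbitrary: a) (auto simp: pick_def)

lemma set_pick: "set (pick k w u) \<subseteq> set u"
  by (auto simp: pick_def dest: set_zip_rightD)

text \<open>\<open>p\<close> and \<open>v\<close> hold the blocks already passed. Their letters lie
  below \<open>k\<close>, so they contribute nothing to the later picks.\<close>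

lemma collect_block_word_aux:
  assumes "length p = length v" "set p \<subseteq> {..<k}" "length u = sum_list \<alpha>"
  shows "collect k \<alpha> (p @ block_word k \<alpha>) (v @ u) = u"
  using assms
proof (induction \<alpha> arbitrary: k p v u)
  case (Cons a \<alpha>)
  define u1 u2 where "u1 = take a u" and "u2 = drop a u"
  have u: "u = u1 @ u2" "length u1 = a" "length u2 = sum_list \<alpha>"
    using Cons.prems by (auto simp: u1_def u2_def)
  have "pick k (p @ block_word k (a # \<alpha>)) (v @ u)
      = pick k p v @ pick k (replicate a k) u1 @ pick k (block_word (Suc k) \<alpha>) u2"
    using Cons.prems u by (simp add: pick_append)
  also have "\<dots> = u1"
    using Cons.prems(2) set_block_word[of "Suc k" \<alpha>] u(2) by (subst (1 3) pick_Nil) (auto simp: pick_replicate)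
  finally have 1: "pick k (p @ block_word k (a # \<alpha>)) (v @ u) = u1" .
  have "collect (Suc k) \<alpha> ((p @ replicate a k) @ block_word (Suc k) \<alpha>) ((v @ u1) @ u2) = u2"
    using Cons.prems u by (intro Cons.IH) auto
  then show ?case using 1 u by simp
qed simp

lemma collect_block_word:
  "length u = sum_list \<alpha> \<Longrightarrow> collect k \<alpha> (block_word k \<alpha>) u = u"
  using collect_block_word_aux[of "[]" "[]" k u \<alpha>] by simp

text \<open>The block for j consists of the letters of \<open>u\<close> over the letter j of
  \<open>w\<close>. The contents therefore depend only on the multiset of pairs of letters, which a
  simultaneous permutation of \<open>w\<close> and \<open>u\<close> does not change.\<close>

lemma content_collect:
  assumes "length w = length u" "\<And>i. i < length \<alpha> \<Longrightarrow> count (mset w) (k + i) = \<alpha> ! i"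
  shows "content \<alpha> (collect k \<alpha> w u) = map (\<lambda>j. mset (pick j w u)) [k..<k + length \<alpha>]"
    and "length (collect k \<alpha> w u) = sum_list \<alpha>"
proof -
  have "content \<alpha> (collect k \<alpha> w u) = map (\<lambda>j. mset (pick j w u)) [k..<k + length \<alpha>]
    \<and> length (collect k \<alpha> w u) = sum_list \<alpha>"
    using assms(2)
  proof (induction \<alpha> arbitrary: k)
    case (Cons a \<alpha>)
    have l: "length (pick k w u) = a" using Cons.prems[of 0] length_pick[OF assms(1)] by simp
    have "count (mset w) (Suc k + i) = \<alpha> ! i" if "i < length \<alpha>" for i
      using Cons.prems[of "Suc i"] that by simp
    note IH = Cons.IH[OF this]
    have "[k..<k + length (a # \<alpha>)] = k # [Suc k..<Suc k + length \<alpha>]" by (simp add: upt_conv_Cons del: upt_Suc)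
    then show ?case using l IH by simp
  qed simp
  then show "content \<alpha> (collect k \<alpha> w u) = map (\<lambda>j. mset (pick j w u)) [k..<k + length \<alpha>]"
    and "length (collect k \<alpha> w u) = sum_list \<alpha>" by auto
qed

lemma set_collect:
  assumes "length w = length u" "set w \<subseteq> {k..<k + length \<alpha>}"
  shows "set (collect k \<alpha> w u) = set u"
proof -
  have *: "set (collect k \<alpha> w u) = (\<Union>j\<in>{k..<k + length \<alpha>}. set (pick j w u))"
  proof (induction \<alpha> arbitrary: k)
    case (Cons a \<alpha>)
    have "{k..<k + length (a # \<alpha>)} = insert k {Suc k..<Suc k + length \<alpha>}" by auto
    then show ?case using Cons[of "Suc k"] by simp
  qed simp
  have "set u \<subseteq> (\<Union>j\<in>{k..<k + length \<alpha>}. set (pick j w u))"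
  proof
    fix x assume "x \<in> set u"
    then obtain i where i: "i < length u" "u ! i = x" by (auto simp: in_set_conv_nth)
    then have "(w ! i, x) \<in> set (zip w u)" using assms(1) by (auto simp: set_zip)
    then have "x \<in> set (pick (w ! i) w u)" by (force simp: pick_def)
    moreover have "w ! i \<in> {k..<k + length \<alpha>}" using assms(1) i by (intro subsetD[OF assms(2)]) simp
    ultimately show "x \<in> (\<Union>j\<in>{k..<k + length \<alpha>}. set (pick j w u))" by blast
  qed
  moreover have "(\<Union>j\<in>{k..<k + length \<alpha>}. set (pick j w u)) \<subseteq> set u" using set_pick[of _ w u] by blast
  ultimately show ?thesis unfolding * by blast
qed

lemma mset_pick_permute:
  assumes "\<tau> permutes {..<length w}" "length w = length u"
  shows "mset (pick k (permute_list \<tau> w) (permute_list \<tau> u)) = mset (pick k w u)"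
proof -
  have "zip (permute_list \<tau> w) (permute_list \<tau> u) = permute_list \<tau> (zip w u)"
    using permute_list_zip[of \<tau> "{..<length w}" w u] assms by simp
  moreover have "mset (permute_list \<tau> (zip w u)) = mset (zip w u)"
    using assms by (intro mset_permute_list) simp
  ultimately show ?thesis unfolding pick_def by (metis mset_filter mset_map)
qed

lemma finite_mset_words: "finite {w. mset w = M}"
proof (rule finite_subset)
  show "{w. mset w = M} \<subseteq> {w. set w \<subseteq> set_mset M \<and> length w = size M}" by auto
  show "finite {w. set w \<subseteq> set_mset M \<and> length w = size M}" by (rule finite_lists_length_eq) simp
qed

lemma eq_replicateI: "mset w = mset (replicate a k) \<Longrightarrow> w = replicate a k"
  by (metis in_set_replicate length_replicate mset_eq_length mset_eq_setD replicate_eqI)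

lemma content_block_word:
  "length w = sum_list \<alpha> \<Longrightarrow> content \<alpha> w = content \<alpha> (block_word k \<alpha>) \<Longrightarrow> w = block_word k \<alpha>"
proof (induction \<alpha> arbitrary: w k)
  case (Cons a \<alpha>)
  have "take a w = replicate a k" using Cons.prems by (intro eq_replicateI) simp
  moreover have "drop a w = block_word (Suc k) \<alpha>" using Cons.prems by (intro Cons.IH) auto
  ultimately show ?case by (metis append_take_drop_id block_word.simps(2))
qed simp

lemma basis_tensor_tensor_space:
  "length v = r \<Longrightarrow> set v \<subseteq> {1..n} \<Longrightarrow> basis_tensor v \<in> tensor_space n r"
  by (rule tensor_spaceI) (auto simp: basis_tensor_def split: if_splits)

lemma gen_tensor_class_fun:
  assumes "length \<alpha> \<le> n"
  shows "gen_tensor \<alpha> \<in> class_fun n \<alpha>"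
proof (rule class_funI)
  have "set (block_word 1 \<alpha>) \<subseteq> {1..n}" using set_block_word[of 1 \<alpha>] assms by auto
  then show "gen_tensor \<alpha> \<in> tensor_space n (sum_list \<alpha>)" by (intro basis_tensor_tensor_space) auto
  fix w w' :: "nat list" assume "length w = sum_list \<alpha>" "length w' = sum_list \<alpha>" "content \<alpha> w = content \<alpha> w'"
  then show "gen_tensor \<alpha> w = gen_tensor \<alpha> w'"
    using content_block_word[of w \<alpha> 1] content_block_word[of w' \<alpha> 1] unfolding basis_tensor_def by metis
qed

section \<open>Divided powers are cyclic modules\<close>

text \<open>The element of the Schur algebra that sends the generator of weight \<alpha> to
  \<open>x\<close> and kills all other weights. Its matrix entry at (u, w) is the value of
  \<open>x\<close> at \<open>u\<close> rearranged along \<open>w\<close>; the length condition makes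
  it vanish at words of the wrong length.\<close>

definition schur_op :: "nat list \<Rightarrow> 'k::field tensor \<Rightarrow> 'k tensor \<Rightarrow> 'k tensor" where
  "schur_op \<alpha> x f u =
    (\<Sum>w | mset w = mset (block_word 1 \<alpha>) \<and> length w = length u. f w * x (collect 1 \<alpha> w u))"

lemma schur_op_length: "length u \<noteq> sum_list \<alpha> \<Longrightarrow> schur_op \<alpha> x f u = 0"
proof -
  assume "length u \<noteq> sum_list \<alpha>"
  then have "{w. mset w = mset (block_word 1 \<alpha>) \<and> length w = length u} = {}"
    by (auto dest!: mset_eq_length)
  then show ?thesis unfolding schur_op_def by (simp only: sum.empty)
qed

lemma schur_op_eq:
  assumes "length u = sum_list \<alpha>"
  shows "schur_op \<alpha> x f u = (\<Sum>w | mset w = mset (block_word 1 \<alpha>). f w * x (collect 1 \<alpha> w u))"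
proof -
  have "{w. mset w = mset (block_word 1 \<alpha>) \<and> length w = length u} = {w. mset w = mset (block_word 1 \<alpha>)}"
    using assms by (auto dest: mset_eq_length)
  then show ?thesis unfolding schur_op_def by (rule arg_cong)
qed

text \<open>Only \<open>w = block_word 1 \<alpha>\<close> contributes, and rearranging along this
  word changes nothing.\<close>

lemma schur_op_gen:
  assumes "x \<in> class_fun n \<alpha>"
  shows "schur_op \<alpha> x (gen_tensor \<alpha>) = x"
proof
  fix u
  show "schur_op \<alpha> x (gen_tensor \<alpha>) u = x u"
  proof (cases "length u = sum_list \<alpha>")
    case True
    have "schur_op \<alpha> x (gen_tensor \<alpha>) u
        = (\<Sum>w | mset w = mset (block_word 1 \<alpha>). if w = block_word 1 \<alpha> then x (collect 1 \<alpha> w u) else 0)"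
      unfolding schur_op_eq[OF True] basis_tensor_def by (intro sum.cong) auto
    also have "\<dots> = x u" by (simp add: sum.delta[OF finite_mset_words] collect_block_word[OF True])
    finally show ?thesis .
  next
    case False
    then show ?thesis
      using schur_op_length tensor_spaceD(2)[OF class_fun_tensor_space[OF assms]] by simp
  qed
qed

lemma schur_op_tensor_space:
  assumes "x \<in> class_fun n \<alpha>"
  shows "schur_op \<alpha> x f \<in> tensor_space n (sum_list \<alpha>)"
proof (rule tensor_spaceI)
  fix u assume nz: "schur_op \<alpha> x f u \<noteq> 0"
  then have l: "length u = sum_list \<alpha>" using schur_op_length by blast
  have "\<exists>w. mset w = mset (block_word 1 \<alpha>) \<and> x (collect 1 \<alpha> w u) \<noteq> 0"
  proof (rule ccontr)
    assume "\<not> ?thesis"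
    then have "schur_op \<alpha> x f u = 0" unfolding schur_op_eq[OF l] by (auto intro!: sum.neutral)
    then show False using nz by simp
  qed
  then obtain w where w: "mset w = mset (block_word 1 \<alpha>)" "x (collect 1 \<alpha> w u) \<noteq> 0" by blast
  have "set w \<subseteq> {1..<1 + length \<alpha>}" using mset_eq_setD[OF w(1)] set_block_word[of 1 \<alpha>] by simp
  moreover have "length w = length u" using mset_eq_length[OF w(1)] l by simp
  ultimately have "set (collect 1 \<alpha> w u) = set u" by (intro set_collect)
  then show "length u = sum_list \<alpha> \<and> set u \<subseteq> {1..n}"
    using l tensor_spaceD(1)[OF class_fun_tensor_space[OF assms] w(2)] by simp
qed

text \<open>Permuting \<open>w\<close> and \<open>u\<close> together leaves the contents of the
  rearranged word unchanged, and \<open>x\<close> depends only on these. Reindexing the sum by the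
  permutation then moves it from the argument to the value.\<close>

lemma schur_op_place_perm:
  assumes x: "x \<in> class_fun n \<alpha>" and \<tau>: "\<tau> permutes {..<sum_list \<alpha>}"
  shows "schur_op \<alpha> x (place_perm \<tau> f) = place_perm \<tau> (schur_op \<alpha> x f)"
proof
  fix u
  let ?M = "mset (block_word 1 \<alpha>)"
  show "schur_op \<alpha> x (place_perm \<tau> f) u = place_perm \<tau> (schur_op \<alpha> x f) u"
  proof (cases "length u = sum_list \<alpha>")
    case True
    have ti: "inv_into UNIV \<tau> permutes {..<sum_list \<alpha>}" by (rule permutes_inv[OF \<tau>])
    have len: "length w = sum_list \<alpha>" if "mset w = ?M" for w using mset_eq_length[OF that] by simp
    have inv1: "permute_list (inv_into UNIV \<tau>) (permute_list \<tau> w) = w" if "length w = sum_list \<alpha>" for w :: "nat list"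
      using permute_list_compose[of "inv_into UNIV \<tau>" w \<tau>] ti that permutes_inv_o[OF \<tau>] by simp
    have inv2: "permute_list \<tau> (permute_list (inv_into UNIV \<tau>) w) = w" if "length w = sum_list \<alpha>" for w :: "nat list"
      using permute_list_compose[of \<tau> w "inv_into UNIV \<tau>"] \<tau> that permutes_inv_o[OF \<tau>] by simp
    have xc: "x (collect 1 \<alpha> (permute_list \<tau> w) (permute_list \<tau> u)) = x (collect 1 \<alpha> w u)" if w: "mset w = ?M" for w
    proof -
      have c: "count (mset w) (1 + i) = \<alpha> ! i" if "i < length \<alpha>" for i
        using w that by (simp add: count_block_word)
      have m: "mset (permute_list \<tau> w) = mset w" using \<tau> len[OF w] by (intro mset_permute_list) simp
      have l: "length w = length u" "\<tau> permutes {..<length w}" using len[OF w] True \<tau> by auto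
      have "content \<alpha> (collect 1 \<alpha> (permute_list \<tau> w) (permute_list \<tau> u))
          = map (\<lambda>j. mset (pick j (permute_list \<tau> w) (permute_list \<tau> u))) [1..<1 + length \<alpha>]"
        by (rule content_collect(1)) (simp add: l, simp add: m c[simplified])
      also have "\<dots> = map (\<lambda>j. mset (pick j w u)) [1..<1 + length \<alpha>]"
        by (simp add: mset_pick_permute[OF l(2,1)])
      also have "\<dots> = content \<alpha> (collect 1 \<alpha> w u)"
        by (rule content_collect(1)[OF l(1), symmetric]) (simp add: c[simplified])
      finally have "content \<alpha> (collect 1 \<alpha> (permute_list \<tau> w) (permute_list \<tau> u)) = content \<alpha> (collect 1 \<alpha> w u)" .
      moreover have "length (collect 1 \<alpha> (permute_list \<tau> w) (permute_list \<tau> u)) = length (collect 1 \<alpha> w u)"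
        using content_collect(2)[of w u \<alpha> 1] content_collect(2)[of "permute_list \<tau> w" "permute_list \<tau> u" \<alpha> 1]
          l(1) m c by simp
      ultimately show ?thesis by (intro class_funD[OF x])
    qed
    have "schur_op \<alpha> x (place_perm \<tau> f) u
        = (\<Sum>w | mset w = ?M. f (permute_list \<tau> w) * x (collect 1 \<alpha> w u))"
      by (simp add: schur_op_eq[OF True] place_perm_def)
    also have "\<dots> = (\<Sum>w | mset w = ?M. f w * x (collect 1 \<alpha> w (permute_list \<tau> u)))"
    proof (rule sum.reindex_bij_witness[of _ "permute_list (inv_into UNIV \<tau>)" "permute_list \<tau>"])
      fix w assume "w \<in> {w. mset w = ?M}"
      then have w: "mset w = ?M" by simp
      show "permute_list (inv_into UNIV \<tau>) (permute_list \<tau> w) = w" by (rule inv1[OF len[OF w]])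
      show "permute_list \<tau> (permute_list (inv_into UNIV \<tau>) w) = w" by (rule inv2[OF len[OF w]])
      show "permute_list \<tau> w \<in> {w. mset w = ?M}" using w \<tau> len[OF w] by simp
      show "permute_list (inv_into UNIV \<tau>) w \<in> {w. mset w = ?M}" using w ti len[OF w] by simp
      show "f (permute_list \<tau> w) * x (collect 1 \<alpha> (permute_list \<tau> w) (permute_list \<tau> u))
          = f (permute_list \<tau> w) * x (collect 1 \<alpha> w u)" using xc[OF w] by simp
    qed
    also have "\<dots> = place_perm \<tau> (schur_op \<alpha> x f) u"
      using True by (simp add: schur_op_eq place_perm_def)
    finally show ?thesis .
  next
    case False
    then show ?thesis by (simp add: place_perm_def schur_op_length)
  qed
qed

lemma schur_algebraI:
  assumes "\<And>f. f \<in> tensor_space n r \<Longrightarrow> T f \<in> tensor_space n r"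
    and "\<And>f g. f \<in> tensor_space n r \<Longrightarrow> g \<in> tensor_space n r \<Longrightarrow> T (\<lambda>w. f w + g w) = (\<lambda>w. T f w + T g w)"
    and "\<And>c f. f \<in> tensor_space n r \<Longrightarrow> T (\<lambda>w. c * f w) = (\<lambda>w. c * T f w)"
    and "\<And>\<sigma> f. \<sigma> permutes {..<r} \<Longrightarrow> f \<in> tensor_space n r \<Longrightarrow> T (place_perm \<sigma> f) = place_perm \<sigma> (T f)"
  shows "restrict T (tensor_space n r) \<in> schur_algebra n r"
proof -
  let ?U = "tensor_space n r :: 'a tensor set"
  have "restrict T ?U \<in> LinearCombinations.module_hom class_ring (tensor_module ?U) (tensor_module ?U)"
    unfolding LinearCombinations.module_hom_def
    using assms(1-3) by (auto simp: lin_sub_add lin_sub_smult)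
  moreover have "restrict T ?U (place_perm \<sigma> f) = place_perm \<sigma> (restrict T ?U f)"
    if "\<sigma> permutes {..<r}" "f \<in> ?U" for \<sigma> f
    using that place_perm_tensor_space[OF that] assms(4)[OF that] by simp
  ultimately show ?thesis unfolding schur_algebra_def by simp
qed
lemma schur_op_schur:
  assumes "x \<in> class_fun n \<alpha>"
  shows "restrict (schur_op \<alpha> x) (tensor_space n (sum_list \<alpha>)) \<in> schur_algebra n (sum_list \<alpha>)"
  by (rule schur_algebraI)
    (auto simp: schur_op_tensor_space[OF assms] schur_op_place_perm[OF assms] schur_op_def
      sum.distrib sum_distrib_left algebra_simps)

lemma schur_op_add_left: "schur_op \<alpha> (\<lambda>w. x w + y w) f = (\<lambda>w. schur_op \<alpha> x f w + schur_op \<alpha> y f w)"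
  by (rule ext) (simp add: schur_op_def sum.distrib algebra_simps)

lemma schur_op_smult_left: "schur_op \<alpha> (\<lambda>w. c * x w) f = (\<lambda>w. c * schur_op \<alpha> x f w)"
  by (rule ext) (simp add: schur_op_def sum_distrib_left mult.left_commute)

lemma schur_op_diff_left: "schur_op \<alpha> (\<lambda>w. x w - y w) f = (\<lambda>w. schur_op \<alpha> x f w - schur_op \<alpha> y f w)"
  by (rule ext) (simp add: schur_op_def sum_subtractf algebra_simps)

lemma schur_op_sum_left: "schur_op \<alpha> (\<lambda>w. \<Sum>i\<in>I. x i w) f = (\<lambda>w. \<Sum>i\<in>I. schur_op \<alpha> (x i) f w)"
  by (rule ext) (simp add: schur_op_def sum_distrib_left sum.swap[of _ I])

definition has_weight :: "nat list \<Rightarrow> 'k::field tensor \<Rightarrow> bool" where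
  "has_weight \<alpha> f \<longleftrightarrow> (\<forall>w. f w \<noteq> 0 \<longrightarrow> mset w = mset (block_word 1 \<alpha>))"

lemma basis_tensor_place_perm:
  assumes "mset w = mset v"
  obtains \<sigma> where "\<sigma> permutes {..<length v}"
    "basis_tensor w = place_perm \<sigma> (basis_tensor v :: 'k::field tensor)"
proof -
  obtain \<sigma> where s: "\<sigma> permutes {..<length w}" "permute_list \<sigma> w = v"
    using mset_eq_permutation[of v w] assms by metis
  have l: "length w = length v" by (rule mset_eq_length[OF assms])
  have "x = w" if "permute_list \<sigma> x = v" for x
  proof -
    have lx: "length x = length w" using that l by (metis length_permute_list)
    have "permute_list (inv_into UNIV \<sigma>) (permute_list \<sigma> y) = y" if "length y = length w" for y :: "nat list"
      using permute_list_compose[of "inv_into UNIV \<sigma>" y \<sigma>] permutes_inv[OF s(1)] that permutes_inv_o[OF s(1)] by simp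
    then show ?thesis using that s(2) lx by metis
  qed
  then have "x = w \<longleftrightarrow> permute_list \<sigma> x = v" for x using s(2) by blast
  then have "basis_tensor w = (place_perm \<sigma> (basis_tensor v) :: 'k tensor)"
    by (intro ext) (simp add: basis_tensor_def place_perm_def)
  then show ?thesis using that s(1) l by simp
qed

text \<open>Each basis tensor of weight \<alpha> is a place permutation of the generator, and both
  operators commute with place permutations.\<close>

lemma schur_eq_on_weight:
  fixes s s' :: "'k::field tensor \<Rightarrow> 'k tensor"
  assumes s: "s \<in> schur_algebra n (sum_list \<alpha>)" and s': "s' \<in> schur_algebra n (sum_list \<alpha>)"
    and n: "length \<alpha> \<le> n"
    and eq: "s (gen_tensor \<alpha>) = s' (gen_tensor \<alpha>)"
    and f: "has_weight \<alpha> f"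
  shows "s f = s' f"
proof -
  let ?M = "mset (block_word 1 \<alpha>)"
  have g: "(gen_tensor \<alpha> :: 'k tensor) \<in> tensor_space n (sum_list \<alpha>)"
    by (rule class_fun_tensor_space[OF gen_tensor_class_fun[OF n]])
  have f': "f = (\<lambda>w. \<Sum>v | mset v = ?M. f v * basis_tensor v w)"
  proof
    fix w
    have "(\<Sum>v | mset v = ?M. f v * basis_tensor v w) = (\<Sum>v | mset v = ?M. if w = v then f v else 0)"
      by (intro sum.cong) (auto simp: basis_tensor_def)
    also have "\<dots> = f w" using finite_mset_words[of ?M] f by (auto simp: sum.delta has_weight_def)
    finally show "f w = (\<Sum>v | mset v = ?M. f v * basis_tensor v w)" by simp
  qed
  have b: "s (basis_tensor v) = s' (basis_tensor v) \<and> (basis_tensor v :: 'k tensor) \<in> tensor_space n (sum_list \<alpha>)"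
    if v: "mset v = ?M" for v
  proof -
    obtain \<sigma> where \<sigma>: "\<sigma> permutes {..<sum_list \<alpha>}"
      "basis_tensor v = place_perm \<sigma> (gen_tensor \<alpha> :: 'k tensor)"
      using basis_tensor_place_perm[OF v] by auto
    show ?thesis
      unfolding \<sigma>(2) schurD(4)[OF s \<sigma>(1) g] schurD(4)[OF s' \<sigma>(1) g] eq
      using place_perm_tensor_space[OF \<sigma>(1) g] by simp
  qed
  have "t f = (\<lambda>w. \<Sum>v | mset v = ?M. f v * t (basis_tensor v) w)" if t: "t \<in> schur_algebra n (sum_list \<alpha>)" for t
  proof -
    have "t f = (\<lambda>w. \<Sum>v | mset v = ?M. t (\<lambda>w. f v * basis_tensor v w) w)"
      using b by (subst f', intro schur_sum[OF t] lin_sub_smult tensor_space_lin_sub) auto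
    also have "\<dots> = (\<lambda>w. \<Sum>v | mset v = ?M. f v * t (basis_tensor v) w)"
      by (intro ext sum.cong refl) (simp add: schurD(3)[OF t conjunct2[OF b]])
    finally show ?thesis .
  qed
  note * = this
  show ?thesis unfolding *[OF s] *[OF s'] by (intro ext sum.cong refl) (simp add: conjunct1[OF b])
qed

section \<open>Raising operators\<close>

text \<open>The order of arguments follows the coefficient convention: the coefficient of the result
  at \<open>w\<close> collects the coefficients at source words \<open>v\<close>, so letters go up
  from \<open>w\<close> to \<open>v\<close> although the operator lowers them from
  \<open>i + 1\<close> to \<open>i\<close>.\<close>

abbreviation raised :: "nat \<Rightarrow> nat list \<Rightarrow> nat list \<Rightarrow> bool" where
  "raised i \<equiv> list_all2 (\<lambda>c d. d = c \<or> c = i \<and> d = Suc i)"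

text \<open>The divided power of the root vector which replaces \<open>e\<^bsub>i+1\<^esub>\<close> by \<open>e\<^sub>i\<close>.\<close>

definition raise_op :: "nat \<Rightarrow> nat \<Rightarrow> 'k::field tensor \<Rightarrow> 'k tensor" where
  "raise_op i t f w = (\<Sum>v | raised i w v \<and> count (mset v) i + t = count (mset w) i. f v)"

lemma raised_set: "raised i w v \<Longrightarrow> set v \<subseteq> insert (Suc i) (set w) \<and> set w \<subseteq> insert i (set v)
    \<and> (i \<in> set w \<longrightarrow> i \<in> set v \<or> Suc i \<in> set v)"
  by (induction rule: list_all2_induct) auto

lemma finite_raised: "finite {v. raised i w v \<and> P v}"
proof (rule finite_subset)
  show "{v. raised i w v \<and> P v} \<subseteq> {v. set v \<subseteq> insert (Suc i) (set w) \<and> length v = length w}"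
    using raised_set[of i w] by (auto simp: list_all2_lengthD)
  show "finite {v. set v \<subseteq> insert (Suc i) (set w) \<and> length v = length w}"
    by (rule finite_lists_length_eq) simp
qed

lemma raise_op_nz:
  assumes "raise_op i t f w \<noteq> 0"
  shows "\<exists>v. raised i w v \<and> count (mset v) i + t = count (mset w) i \<and> f v \<noteq> 0"
proof (rule ccontr)
  assume "\<not> ?thesis"
  then have "raise_op i t f w = 0" unfolding raise_op_def by (intro sum.neutral) auto
  then show False using assms by simp
qed

lemma raise_op_tensor_space:
  assumes "1 \<le> i" "f \<in> tensor_space n r"
  shows "raise_op i t f \<in> tensor_space n r"
proof (rule tensor_spaceI)
  fix w assume "raise_op i t f w \<noteq> 0"
  then obtain v where v: "raised i w v" "f v \<noteq> 0" using raise_op_nz by blast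
  have "length v = r" "set v \<subseteq> {1..n}" using tensor_spaceD(1)[OF assms(2) v(2)] by auto
  moreover have "length w = length v" using v(1) by (rule list_all2_lengthD)
  moreover have "c \<in> {1..n}" if "c \<in> set w" for c
  proof (cases "c = i")
    case True
    then have "i \<in> set v \<or> Suc i \<in> set v" using raised_set[OF v(1)] that by blast
    then show ?thesis using True assms(1) \<open>set v \<subseteq> _\<close> by auto
  next
    case False
    then have "c \<in> set v" using raised_set[OF v(1)] that by blast
    then show ?thesis using \<open>set v \<subseteq> _\<close> by auto
  qed
  ultimately show "length w = r \<and> set w \<subseteq> {1..n}" by auto
qed

lemma raise_op_place_perm:
  assumes \<tau>: "\<tau> permutes {..<r}" and f: "f \<in> tensor_space n r"
  shows "raise_op i t (place_perm \<tau> f) = place_perm \<tau> (raise_op i t f)"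
proof
  fix w
  show "raise_op i t (place_perm \<tau> f) w = place_perm \<tau> (raise_op i t f) w"
  proof (cases "length w = r")
    case True
    let ?\<tau>' = "inv_into UNIV \<tau>"
    have ti: "?\<tau>' permutes {..<r}" by (rule permutes_inv[OF \<tau>])
    have inv1: "permute_list ?\<tau>' (permute_list \<tau> w) = w" if "length w = r" for w :: "nat list"
      using permute_list_compose[of ?\<tau>' w \<tau>] ti that permutes_inv_o[OF \<tau>] by simp
    have inv2: "permute_list \<tau> (permute_list ?\<tau>' w) = w" if "length w = r" for w :: "nat list"
      using permute_list_compose[of \<tau> w ?\<tau>'] \<tau> that permutes_inv_o[OF \<tau>] by simp
    have A: "raised i (permute_list \<tau> w) (permute_list \<tau> v) \<longleftrightarrow> raised i w v" for v
      using \<tau> True by (intro list_all2_permute_list_iff) simp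
    have "raise_op i t (place_perm \<tau> f) w
        = (\<Sum>v | raised i w v \<and> count (mset v) i + t = count (mset w) i. f (permute_list \<tau> v))"
      by (simp add: raise_op_def place_perm_def)
    also have "\<dots> = (\<Sum>v | raised i (permute_list \<tau> w) v
        \<and> count (mset v) i + t = count (mset (permute_list \<tau> w)) i. f v)"
    proof (rule sum.reindex_bij_witness[of _ "permute_list ?\<tau>'" "permute_list \<tau>"])
      fix v assume "v \<in> {v. raised i w v \<and> count (mset v) i + t = count (mset w) i}"
      then have v: "raised i w v" "count (mset v) i + t = count (mset w) i" by auto
      have l: "length v = r" using list_all2_lengthD[OF v(1)] True by simp
      show "permute_list ?\<tau>' (permute_list \<tau> v) = v" by (rule inv1[OF l])
      show "permute_list \<tau> v \<in> {v. raised i (permute_list \<tau> w) v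
          \<and> count (mset v) i + t = count (mset (permute_list \<tau> w)) i}"
        using v A \<tau> l True by simp
    next
      fix v assume "v \<in> {v. raised i (permute_list \<tau> w) v
          \<and> count (mset v) i + t = count (mset (permute_list \<tau> w)) i}"
      then have v: "raised i (permute_list \<tau> w) v"
        "count (mset v) i + t = count (mset (permute_list \<tau> w)) i" by auto
      have l: "length v = r" using list_all2_lengthD[OF v(1)] True by simp
      show "permute_list \<tau> (permute_list ?\<tau>' v) = v" by (rule inv2[OF l])
      show "permute_list ?\<tau>' v \<in> {v. raised i w v \<and> count (mset v) i + t = count (mset w) i}"
        using v A[of "permute_list ?\<tau>' v"] inv2[OF l] \<tau> ti l True by simp
    qed simp
    also have "\<dots> = place_perm \<tau> (raise_op i t f) w" by (simp add: raise_op_def place_perm_def)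
    finally show ?thesis .
  next
    case False
    have "raise_op i t g u = 0" if "length u \<noteq> r" "g \<in> tensor_space n r" for g and u :: "nat list"
      unfolding raise_op_def using that tensor_spaceD(2)[OF that(2)]
      by (intro sum.neutral) (auto dest: list_all2_lengthD)
    from this[of w "place_perm \<tau> f"] this[of "permute_list \<tau> w" f] show ?thesis
      using False f place_perm_tensor_space[OF \<tau> f] by (simp add: place_perm_def[of \<tau> "raise_op i t f"])
  qed
qed

lemma raise_op_schur:
  assumes "1 \<le> i"
  shows "restrict (raise_op i t) (tensor_space n r) \<in> schur_algebra n r"
  by (rule schur_algebraI)
    (auto simp: raise_op_tensor_space[OF assms] raise_op_place_perm raise_op_def
      sum.distrib sum_distrib_left)

section \<open>The maps on generators\<close>

lemma nths_restrict: "nths xs A = nths xs {i. i < length xs \<and> i \<in> A}"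
  unfolding nths_def by (intro arg_cong[of _ _ "map fst"] filter_cong) (auto dest: set_zip_rightD)

lemma count_mset_filter: "count (mset w) c = length (filter (\<lambda>x. x = c) w)"
  by (induction w) auto

text \<open>A subset of positions contributes only if it carries letters \<open>c\<close> alone and
  its complement carries none, so the set \<open>A0\<close> of all positions of \<open>c\<close> is
  the only candidate.\<close>

lemma D_mult_split:
  assumes f: "\<And>u v. length u = a \<Longrightarrow> length v + a = length w \<Longrightarrow> f (u @ v) = (if u = replicate a c then g v else 0)"
    and g: "\<And>v. length v + a = length w \<Longrightarrow> g v \<noteq> 0 \<Longrightarrow> c \<notin> set v"
  shows "D_mult a f w = (if count (mset w) c = a then g (filter (\<lambda>x. x \<noteq> c) w) else (0 :: 'k::field))"
proof -
  define A0 where "A0 = {k. k < length w \<and> w ! k = c}"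
  let ?S = "{A. A \<subseteq> {..<length w} \<and> card A = a}"
  let ?F = "\<lambda>A. f (nths w A @ nths w (- A))"
  have fin: "finite ?S" by (rule finite_subset[of _ "Pow {..<length w}"]) auto
  have n1: "nths w A0 = filter (\<lambda>x. x = c) w" by (simp add: A0_def filter_eq_nths)
  have "{i. i < length w \<and> i \<in> - A0} = {i. i < length w \<and> w ! i \<noteq> c}" by (auto simp: A0_def)
  then have n2: "nths w (- A0) = filter (\<lambda>x. x \<noteq> c) w"
    using nths_restrict[of w "- A0"] by (simp add: filter_eq_nths)
  have cA0: "card A0 = count (mset w) c"
    unfolding A0_def count_mset_filter length_filter_conv_card ..
  have lenA: "length (nths w A) = card A \<and> length (nths w (- A)) + card A = length w" if "A \<subseteq> {..<length w}" for A
  proof -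
    have "{i. i < length w \<and> i \<in> A} = A" using that by auto
    then have "length (nths w A) = card A" by (simp add: length_nths)
    moreover have "length (nths w A @ nths w (- A)) = length w" using mset_nths_append[of w A] by (metis size_mset)
    ultimately show ?thesis by simp
  qed
  have z: "?F A = 0" if A: "A \<in> ?S" "A \<noteq> A0" for A
  proof (rule ccontr)
    assume nz: "?F A \<noteq> 0"
    have l: "length (nths w A) = a" "length (nths w (- A)) + a = length w" using lenA[of A] A by auto
    from nz f[OF l] have e: "nths w A = replicate a c" "g (nths w (- A)) \<noteq> 0" by (auto split: if_splits)
    have 1: "w ! k = c" if "k \<in> A" for k
    proof -
      have "w ! k \<in> set (nths w A)" using that A(1) by (auto simp: set_nths)
      then show ?thesis unfolding e(1) by (simp split: if_splits)
    qed
    have 2: "w ! k \<noteq> c" if "k \<notin> A" "k < length w" for k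
    proof -
      have "w ! k \<in> set (nths w (- A))" using that by (auto simp: set_nths)
      then show ?thesis using g[OF l(2) e(2)] by blast
    qed
    have "A = A0" using 1 2 A(1) by (auto simp: A0_def)
    then show False using A(2) by simp
  qed
  have "D_mult a f w = (\<Sum>A\<in>?S. if A = A0 then ?F A0 else 0)"
    unfolding D_mult_def using z by (intro sum.cong refl) auto
  also have "\<dots> = (if A0 \<in> ?S then ?F A0 else 0)" by (rule sum.delta[OF fin])
  also have "A0 \<in> ?S \<longleftrightarrow> count (mset w) c = a" using cA0 by (auto simp: A0_def)
  also have "?F A0 = g (filter (\<lambda>x. x \<noteq> c) w)" if c: "count (mset w) c = a"
  proof -
    have A: "A0 \<subseteq> {..<length w}" by (auto simp: A0_def)
    have l: "length (nths w A0) = a" "length (nths w (- A0)) + a = length w" using lenA[OF A] cA0 c by auto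
    have "nths w A0 = replicate a c" using l(1) unfolding n1 by (intro replicate_eqI) auto
    then show ?thesis using f[OF l] n2 by simp
  qed
  ultimately show ?thesis by auto
qed

lemma place_op_nz: "place_op N T \<Longrightarrow> T f w \<noteq> 0 \<Longrightarrow> \<exists>u. mset u = mset w \<and> f u \<noteq> 0"
  unfolding place_op_def by blast

lemma place_op_zero: "place_op N T \<Longrightarrow> T (\<lambda>w. 0) w = 0"
  using place_op_nz by blast

lemma mset_filter_split:
  assumes "c \<notin> set v"
  shows "count (mset w) c = a \<and> mset (filter (\<lambda>x. x \<noteq> c) w) = mset v
    \<longleftrightarrow> mset w = mset (replicate a c @ v)"
proof
  assume *: "count (mset w) c = a \<and> mset (filter (\<lambda>x. x \<noteq> c) w) = mset v"
  have "mset w = filter_mset (\<lambda>x. x = c) (mset w) + filter_mset (\<lambda>x. x \<noteq> c) (mset w)"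
    by (rule multiset_partition)
  also have "filter_mset (\<lambda>x. x = c) (mset w) = replicate_mset a c"
    using * by (simp add: filter_eq_replicate_mset)
  finally show "mset w = mset (replicate a c @ v)" using * by simp
next
  assume *: "mset w = mset (replicate a c @ v)"
  have "count (mset v) c = 0" using assms by simp
  moreover have "filter_mset (\<lambda>x. x \<noteq> c) (mset v) = mset v"
    using assms by (auto simp: filter_mset_eq_conv)
  moreover have "filter_mset (\<lambda>x. x \<noteq> c) (replicate_mset a c) = {#}" by simp
  ultimately show "count (mset w) c = a \<and> mset (filter (\<lambda>x. x \<noteq> c) w) = mset v" by (simp add: *)
qed

text \<open>The product of divided powers of distinct basis vectors is the sum over all words with
  the given content, each with coefficient 1.\<close>

lemma D_mult_list_block_word:
  "D_mult_list \<alpha> (basis_tensor (block_word k \<alpha>)) w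
    = (if mset w = mset (block_word k \<alpha>) then 1 else (0 :: 'k::field))"
proof (induction \<alpha> arbitrary: k w)
  case Nil
  then show ?case by (simp add: basis_tensor_def)
next
  case (Cons a \<alpha>)
  let ?b = "basis_tensor (block_word k (a # \<alpha>)) :: 'k tensor" and ?s = "sum_list \<alpha>"
  let ?bw = "block_word (Suc k) \<alpha>"
  have k: "k \<notin> set ?bw" using set_block_word[of "Suc k" \<alpha>] by auto
  show ?case
  proof (cases "length w = a + ?s")
    case True
    let ?g = "\<lambda>v. if mset v = mset ?bw then 1 else (0 :: 'k)"
    have f: "on_places a ?s (D_mult_list \<alpha>) ?b (u @ v) = (if u = replicate a k then ?g v else 0)"
      if "length u = a" "length v + a = length w" for u v
    proof -
      have "(\<lambda>z. ?b (u @ z)) = (if u = replicate a k then basis_tensor ?bw else (\<lambda>z. 0))"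
        using that(1) by (auto simp: basis_tensor_def)
      moreover have "D_mult_list \<alpha> (\<lambda>u. 0) v = (0 :: 'k)"
        by (rule place_op_zero[OF place_op_D_mult_list])
      ultimately show ?thesis
        using that True Cons[of "Suc k" v] by (simp add: on_places_def)
    qed
    have "D_mult a (on_places a ?s (D_mult_list \<alpha>) ?b) w
        = (if count (mset w) k = a then ?g (filter (\<lambda>x. x \<noteq> k) w) else 0)"
    proof (rule D_mult_split[OF f])
      fix v assume "length v + a = length w" "?g v \<noteq> 0"
      then have "set v = set ?bw" by (auto dest: mset_eq_setD split: if_splits)
      then show "k \<notin> set v" using k by simp
    qed
    also have "\<dots> = (if count (mset w) k = a \<and> mset (filter (\<lambda>x. x \<noteq> k) w) = mset ?bw then 1 else 0)"
      by simp
    also have "\<dots> = (if mset w = mset (block_word k (a # \<alpha>)) then 1 else 0)"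
      unfolding mset_filter_split[OF k, of w a] block_word.simps ..
    finally show ?thesis by simp
  next
    case False
    have "D_mult_list (a # \<alpha>) ?b w = 0"
    proof (rule ccontr)
      assume "D_mult_list (a # \<alpha>) ?b w \<noteq> 0"
      then obtain u where "mset u = mset w" "?b u \<noteq> 0"
        using place_op_nz[OF place_op_D_mult_list] by blast
      then have "mset w = mset (block_word k (a # \<alpha>))" by (auto simp: basis_tensor_def split: if_splits)
      from mset_eq_length[OF this] False show False by simp
    qed
    moreover have "mset w \<noteq> mset (block_word k (a # \<alpha>))"
    proof
      assume "mset w = mset (block_word k (a # \<alpha>))"
      from mset_eq_length[OF this] False show False by simp
    qed
    ultimately show ?thesis by simp
  qed
qed

lemma part_nth: "1 \<le> i \<Longrightarrow> i \<le> length lam \<Longrightarrow> part lam i = lam ! (i - 1)"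
  by (simp add: part_def)

lemma raise_split:
  assumes "1 \<le> i" "i < length lam"
  obtains A x y B where "lam = A @ x # y # B" "length A = i - 1" "part lam i = x" "part lam (i + 1) = y"
    "\<And>t. raise lam i t = A @ (x + t) # (y - t) # B"
proof -
  define A x y B where "A = take (i - 1) lam" "x = lam ! (i - 1)" "y = lam ! i" "B = drop (Suc i) lam"
  have "drop (i - 1) lam = x # drop i lam"
    using assms Cons_nth_drop_Suc[of "i - 1" lam] by (simp add: A_x_y_B_def)
  moreover have "drop i lam = y # B"
    using assms Cons_nth_drop_Suc[of i lam] by (simp add: A_x_y_B_def)
  ultimately have l: "lam = A @ x # y # B" by (metis A_x_y_B_def(1) append_take_drop_id)
  have lA: "length A = i - 1" using assms by (simp add: A_x_y_B_def)
  have p: "part lam i = x" "part lam (i + 1) = y"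
    using assms by (simp_all add: part_nth A_x_y_B_def)
  have "raise lam i t = A @ (x + t) # (y - t) # B" for t
  proof -
    have "lam[i - 1 := x + t] = A @ (x + t) # y # B"
      unfolding l using lA by (simp add: list_update_append)
    moreover have "i = length A + Suc 0" using lA assms by simp
    then have "(A @ (x + t) # y # B)[i := y - t] = A @ (x + t) # (y - t) # B"
      by (simp only: list_update_append) simp
    ultimately show ?thesis unfolding raise_def p by simp
  qed
  then show ?thesis using that l lA p by blast
qed

lemma sum_list_raise:
  "1 \<le> i \<Longrightarrow> i < length lam \<Longrightarrow> t \<le> part lam (i + 1) \<Longrightarrow> sum_list (raise lam i t) = sum_list lam"
  by (rule raise_split[of i lam]) auto

lemma length_raise [simp]: "length (raise lam i t) = length lam"
  by (simp add: raise_def)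

lemma list_all2_eqI: "list_all2 P xs ys \<Longrightarrow> (\<And>x y. x \<in> set xs \<Longrightarrow> y \<in> set ys \<Longrightarrow> P x y \<Longrightarrow> x = y) \<Longrightarrow> xs = ys"
  by (induction rule: list_all2_induct) auto

lemma raised_refl: "raised i w w"
  by (rule list_all2_refl) simp

lemma raised_replicate:
  "raised i w (replicate (length w) (Suc i)) \<longleftrightarrow> set w \<subseteq> {i, Suc i}"
  by (induction w) auto

lemma raise_op_basis_tensor:
  "raise_op i t (basis_tensor v) w = (if raised i w v \<and> count (mset v) i + t = count (mset w) i then 1 else 0)"
proof -
  have "raise_op i t (basis_tensor v) w
      = (\<Sum>u | raised i w u \<and> count (mset u) i + t = count (mset w) i. if u = v then 1 else 0)"
    by (simp add: raise_op_def basis_tensor_def)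
  then show ?thesis by (simp add: sum.delta[OF finite_raised])
qed

lemma place_op_box_component:
  assumes "1 \<le> i" "i < length lam"
  shows "place_op (sum_list lam) (box_component lam i t)"
proof -
  obtain A x y B where "lam = A @ x # y # B" "length A = i - 1" "part lam i = x" "part lam (i + 1) = y"
    using raise_split[OF assms] by metis
  then have "sum_list (take i lam) + part lam (i + 1) \<le> sum_list lam"
    using assms by (cases i) auto
  then show ?thesis unfolding box_component_def[abs_def]
    using place_op_on_places[OF place_op_D_mult] by blast
qed

text \<open>The link between box and the root vectors: both sides are the sum of the words obtained
  from the generator of weight \<lambda> by turning \<open>t\<close> letters of block
  \<open>i + 1\<close> into \<open>i\<close>. The generator of the raised weight carries these
  letters at the start of that block, and the multiplication shuffles them.\<close>

lemma box_component_gen: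
  assumes i: "1 \<le> i" "i < length lam" and t: "t \<le> part lam (i + 1)"
  shows "box_component lam i t (gen_tensor (raise lam i t)) = (raise_op i t (gen_tensor lam) :: 'k::field tensor)"
proof
  fix w
  obtain A x y B where lam: "lam = A @ x # y # B" "length A = i - 1" "part lam (i + 1) = y"
    "raise lam i t = A @ (x + t) # (y - t) # B"
    using raise_split[OF i] by metis
  have ty: "t \<le> y" using t lam(3) by simp
  \<comment> \<open>\<open>P\<close> is the part of the word up to the end of block
    \<open>i\<close>, \<open>S\<close> the part from block \<open>i + 2\<close> on; only the segment
    between them is affected.\<close>
  define P S where "P = block_word 1 A @ replicate x i" "S = block_word (Suc (Suc i)) B"
  have i': "1 + length A = i" "Suc (length A) = i" using i lam(2) by auto
  have bl: "block_word 1 lam = P @ replicate y (Suc i) @ S"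
    unfolding lam(1) block_word_append i'(1) by (simp add: P_S_def)
  have br: "block_word 1 (raise lam i t) = P @ (replicate t i @ replicate (y - t) (Suc i)) @ S"
    unfolding lam(4) block_word_append i'(1) by (simp add: P_S_def replicate_add)
  have lP: "length P = sum_list (take i lam)"
  proof -
    have "take i lam = A @ [x]" unfolding lam(1) using lam(2) i(1) by (cases i) auto
    then show ?thesis by (simp add: P_S_def)
  qed
  have Pi: "d \<le> i" if "d \<in> set P" for d
    using that set_block_word[of 1 A] i'(1) by (auto simp: P_S_def)
  have Si: "d \<ge> Suc (Suc i)" if "d \<in> set S" for d
    using that set_block_word[of "Suc (Suc i)" B] by (auto simp: P_S_def)
  have sl: "sum_list lam = length P + y + length S"
    using arg_cong[OF bl, of length] by simp
  let ?R = "block_word 1 (raise lam i t)"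
  show "box_component lam i t (gen_tensor (raise lam i t)) w = (raise_op i t (gen_tensor lam) w :: 'k)"
  proof (cases "length w = sum_list lam")
    case True
    define w1 w2 w3 where "w1 = take (length P) w" "w2 = take y (drop (length P) w)" "w3 = drop (length P + y) w"
    have w: "w = w1 @ w2 @ w3"
      unfolding w1_w2_w3_def by (metis append_take_drop_id drop_drop add.commute)
    have l: "length w1 = length P" "length w2 = y" "length w3 = length S"
      using True sl by (auto simp: w1_w2_w3_def)
    let ?c = "w1 = P \<and> w3 = S"
    let ?g = "\<lambda>v. if ?c \<and> v = replicate (y - t) (Suc i) then 1 else (0 :: 'k)"
    have "box_component lam i t (gen_tensor (raise lam i t)) w
        = D_mult t (\<lambda>z. basis_tensor ?R (w1 @ z @ w3)) w2"
      by (simp add: box_component_def on_places_def lam(3) lP w1_w2_w3_def)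
    also have "\<dots> = (if count (mset w2) i = t then ?g (filter (\<lambda>z. z \<noteq> i) w2) else 0)"
    proof (rule D_mult_split)
      fix u v :: "nat list" assume "length u = t" "length v + t = length w2"
      then show "basis_tensor ?R (w1 @ (u @ v) @ w3) = (if u = replicate t i then ?g v else 0)"
        using l ty by (auto simp: basis_tensor_def br)
    qed (auto split: if_splits)
    also have "\<dots> = (if ?c \<and> count (mset w2) i = t \<and> filter (\<lambda>z. z \<noteq> i) w2 = replicate (y - t) (Suc i) then 1 else 0)"
      by simp
    also have "count (mset w2) i = t \<and> filter (\<lambda>z. z \<noteq> i) w2 = replicate (y - t) (Suc i)
        \<longleftrightarrow> raised i w2 (replicate y (Suc i)) \<and> count (mset w2) i = t"
    proof -
      have lf: "length (filter (\<lambda>z. z \<noteq> i) w2) = y - count (mset w2) i"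
        using sum_length_filter_compl[of "\<lambda>z. z = i" w2] l(2) unfolding count_mset_filter by linarith
      have "set w2 \<subseteq> {i, Suc i}" if "filter (\<lambda>z. z \<noteq> i) w2 = replicate (y - t) (Suc i)"
      proof
        fix z assume "z \<in> set w2"
        then have "z = i \<or> z \<in> set (filter (\<lambda>z. z \<noteq> i) w2)" by auto
        then show "z \<in> {i, Suc i}" unfolding that by auto
      qed
      moreover have "filter (\<lambda>z. z \<noteq> i) w2 = replicate (y - t) (Suc i)"
        if "set w2 \<subseteq> {i, Suc i}" "count (mset w2) i = t"
        using that lf by (intro replicate_eqI) auto
      ultimately show ?thesis using raised_replicate[of i w2] l(2) by auto
    qed
    also have "(?c \<and> raised i w2 (replicate y (Suc i)) \<and> count (mset w2) i = t)
        \<longleftrightarrow> raised i w (block_word 1 lam) \<and> count (mset (block_word 1 lam)) i + t = count (mset w) i"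
    proof -
      \<comment> \<open>Neither \<open>P\<close> nor \<open>S\<close> contains the letter
        \<open>i + 1\<close>, so no letter can change there.\<close>
      have "raised i w1 P \<longleftrightarrow> w1 = P"
        using list_all2_eqI[of _ w1 P] raised_refl Pi by fastforce
      moreover have "raised i w3 S \<longleftrightarrow> w3 = S"
        using list_all2_eqI[of _ w3 S] raised_refl Si by fastforce
      moreover have "raised i w (block_word 1 lam) \<longleftrightarrow> raised i w1 P \<and> raised i w2 (replicate y (Suc i)) \<and> raised i w3 S"
        unfolding w bl using l by (simp add: list_all2_append)
      ultimately show ?thesis unfolding w bl by auto
    qed
    finally show ?thesis unfolding raise_op_basis_tensor by simp
  next
    case False
    have "box_component lam i t (gen_tensor (raise lam i t)) w = (0 :: 'k)"
    proof (rule ccontr)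
      assume "\<not> ?thesis"
      then obtain u where "mset u = mset w" "basis_tensor ?R u \<noteq> (0 :: 'k)"
        using place_op_nz[OF place_op_box_component[OF i]] by blast
      then have "mset w = mset ?R" by (auto simp: basis_tensor_def split: if_splits)
      then show False using mset_eq_length[of w ?R] False sum_list_raise[OF i t] by simp
    qed
    moreover have "\<not> raised i w (block_word 1 lam)"
      using False by (auto dest: list_all2_lengthD)
    ultimately show ?thesis unfolding raise_op_basis_tensor by simp
  qed
qed

lemma nths_replicate: "nths (replicate a c) A = replicate (card {i. i < a \<and> i \<in> A}) c"
  by (intro replicate_eqI) (auto simp: length_nths dest: in_set_nthsD)

lemma sum_list_take_pos:
  assumes "\<And>x. x \<in> set lam \<Longrightarrow> (0::nat) < x" "0 < j" "lam \<noteq> []"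
  shows "0 < sum_list (take j lam)"
  using assms by (cases j; cases lam) auto

text \<open>The positions are the ends of the blocks with number in \<open>J\<close>, which exist
  because all parts are positive. With numbering from \<open>k\<close>, there are
  \<open>Suc j - k\<close> blocks up to block j. In the induction the positions behind the head
  block are those of the tail, shifted by \<open>a\<close>.\<close>

lemma nths_block_word:
  assumes "\<And>x. x \<in> set lam \<Longrightarrow> 0 < x" "J \<subseteq> {k..<k + length lam}"
  shows "nths (block_word k lam) {sum_list (take (Suc j - k) lam) - 1 |j. j \<in> J} = filter (\<lambda>j. j \<in> J) [k..<k + length lam]
    \<and> nths (block_word k lam) (- {sum_list (take (Suc j - k) lam) - 1 |j. j \<in> J})
      = block_word k (map (\<lambda>j. if j \<in> J then lam ! (j - k) - 1 else lam ! (j - k)) [k..<k + length lam])"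
  using assms
proof (induction lam arbitrary: k J)
  case (Cons a lam)
  define E where "E = {sum_list (take (Suc j - k) (a # lam)) - 1 |j. j \<in> J}"
  define E' where "E' = {sum_list (take (Suc j - Suc k) lam) - 1 |j. j \<in> J - {k}}"
  have a: "0 < a" using Cons.prems by simp
  have pos: "0 < sum_list (take (Suc j - Suc k) lam)
      \<and> sum_list (take (Suc j - k) (a # lam)) = a + sum_list (take (Suc j - Suc k) lam)"
    if "j \<in> J" "j \<noteq> k" for j
  proof -
    have j: "k < j" "j < k + Suc (length lam)" using that Cons.prems(2) by (auto simp: subset_iff le_less)
    then have "lam \<noteq> []" by auto
    moreover have "Suc j - k = Suc (Suc j - Suc k)" using j by simp
    ultimately show ?thesis using sum_list_take_pos[of lam "Suc j - Suc k"] Cons.prems(1) j by simp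
  qed
  have k: "sum_list (take (Suc k - k) (a # lam)) = a" by simp
  have E_eq: "E = (if k \<in> J then {a - 1} else {}) \<union> (\<lambda>x. x + a) ` E'"
  proof -
    have "E = (if k \<in> J then {a - 1} else {}) \<union> {sum_list (take (Suc j - k) (a # lam)) - 1 |j. j \<in> J - {k}}"
    proof -
      let ?F = "\<lambda>j. sum_list (take (Suc j - k) (a # lam)) - 1"
      have "?F ` J = ?F ` ((if k \<in> J then {k} else {}) \<union> (J - {k}))" by (rule arg_cong[of _ _ "image ?F"]) auto
      also have "\<dots> = (if k \<in> J then {?F k} else {}) \<union> ?F ` (J - {k})"
        unfolding image_Un by (cases "k \<in> J") (simp_all only: if_True if_False image_insert image_empty)
      also have "?F k = a - 1" by (simp only: k)
      finally show ?thesis unfolding E_def setcompr_eq_image Collect_mem_eq .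
    qed
    also have "{sum_list (take (Suc j - k) (a # lam)) - 1 |j. j \<in> J - {k}} = (\<lambda>x. x + a) ` E'"
    proof -
      have "sum_list (take (Suc j - k) (a # lam)) - 1 = (sum_list (take (Suc j - Suc k) lam) - 1) + a"
        if "j \<in> J - {k}" for j using pos[of j] that by auto
      then have "(\<lambda>j. sum_list (take (Suc j - k) (a # lam)) - 1) ` (J - {k})
          = (\<lambda>j. (sum_list (take (Suc j - Suc k) lam) - 1) + a) ` (J - {k})" by (rule image_cong[OF refl])
      then show ?thesis unfolding E'_def setcompr_eq_image image_image Collect_mem_eq .
    qed
    finally show ?thesis .
  qed
  have sh: "{j. j + a \<in> E} = E'" "{j. j + a \<in> - E} = - E'"
    using a unfolding E_eq by (auto split: if_splits)
  have c1: "{i. i < a \<and> i \<in> E} = (if k \<in> J then {a - 1} else {})"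
    using a unfolding E_eq by auto
  have c2: "{i. i < a \<and> i \<in> - E} = (if k \<in> J then {..<a - 1} else {..<a})"
    using a unfolding E_eq by auto
  have IH: "nths (block_word (Suc k) lam) E' = filter (\<lambda>j. j \<in> J - {k}) [Suc k..<Suc k + length lam]"
    "nths (block_word (Suc k) lam) (- E')
      = block_word (Suc k) (map (\<lambda>j. if j \<in> J - {k} then lam ! (j - Suc k) - 1 else lam ! (j - Suc k)) [Suc k..<Suc k + length lam])"
  proof -
    have "J - {k} \<subseteq> {Suc k..<Suc k + length lam}"
    proof
      fix j assume j: "j \<in> J - {k}"
      then have "j \<in> {k..<k + length (a # lam)}" using Cons.prems(2) by blast
      then show "j \<in> {Suc k..<Suc k + length lam}" using j by auto
    qed
    from Cons.IH[OF _ this] Cons.prems(1)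
    show "nths (block_word (Suc k) lam) E' = filter (\<lambda>j. j \<in> J - {k}) [Suc k..<Suc k + length lam]"
      "nths (block_word (Suc k) lam) (- E')
      = block_word (Suc k) (map (\<lambda>j. if j \<in> J - {k} then lam ! (j - Suc k) - 1 else lam ! (j - Suc k)) [Suc k..<Suc k + length lam])"
      unfolding E'_def by (meson list.set_intros(2))+
  qed
  have up: "[k..<k + length (a # lam)] = k # [Suc k..<Suc k + length lam]" by (simp add: upt_conv_Cons del: upt_Suc)
  have f1: "filter (\<lambda>j. j \<in> J - {k}) [Suc k..<Suc k + length lam] = filter (\<lambda>j. j \<in> J) [Suc k..<Suc k + length lam]"
    by (intro filter_cong refl) auto
  have f2: "map (\<lambda>j. if j \<in> J - {k} then lam ! (j - Suc k) - 1 else lam ! (j - Suc k)) [Suc k..<Suc k + length lam]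
      = map (\<lambda>j. if j \<in> J then (a # lam) ! (j - k) - 1 else (a # lam) ! (j - k)) [Suc k..<Suc k + length lam]"
    by (intro map_cong refl) (auto simp: nth_Cons' One_nat_def)
  show ?case
    unfolding E_def[symmetric] up
    by (cases "k \<in> J") (simp_all add: nths_append sh[unfolded Compl_iff] nths_replicate c1 c2[unfolded Compl_iff]
        IH(1)[unfolded f1] IH(2)[unfolded f2] del: upt_Suc)
qed simp

lemma move_right_basis_tensor:
  "move_right E (basis_tensor v) = basis_tensor (nths v (- E) @ nths v E)"
proof
  fix w :: "nat list"
  obtain \<sigma> where "{x. nths x (- E) @ nths x E = w} = {permute_list \<sigma> w}"
    using move_right_eval[of "length w" E] by blast
  then have "finite {x. nths x (- E) @ nths x E = w}" by simp
  then show "move_right E (basis_tensor v) w = basis_tensor (nths v (- E) @ nths v E) w"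
    by (auto simp: move_right_def basis_tensor_def sum.delta)
qed

text \<open>A hook tableau of content \<open>M\<close> as a tensor: the basis tensor of the column
  \<open>v\<close>, preceded by the orbit sum of the letters that remain for the row. It is 0 if
  \<open>v\<close> does not fit into \<open>M\<close>.\<close>

definition tab_tensor :: "nat multiset \<Rightarrow> nat \<Rightarrow> nat list \<Rightarrow> 'k::field tensor" where
  "tab_tensor M a v w = (if mset w = M \<and> drop a w = v then 1 else 0)"

lemma B_setD:
  "J \<in> B_set lam b \<Longrightarrow> length J = b"
  "J \<in> B_set lam b \<Longrightarrow> sorted_wrt (<) J"
  "J \<in> B_set lam b \<Longrightarrow> distinct J"
  "J \<in> B_set lam b \<Longrightarrow> j \<in> set J \<Longrightarrow> 2 \<le> j \<and> j \<le> length lam"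
  by (auto simp: B_set_def strict_sorted_iff)

lemma place_op_phi_lift:
  assumes J: "J \<in> B_set lam b"
  shows "place_op (sum_list lam) (phi_lift lam J)"
    (is "place_op ?N _")
proof -
  define \<alpha> where "\<alpha> = map (\<lambda>j. if j \<in> set J then part lam j - 1 else part lam j) [1..<length lam + 1]"
  have "sum_list \<alpha> \<le> sum_list (map (part lam) [1..<length lam + 1])"
    unfolding \<alpha>_def by (rule sum_list_mono) auto
  also have "map (part lam) [1..<length lam + 1] = lam"
    by (rule nth_equalityI) (auto simp: part_def)
  finally have "0 + sum_list \<alpha> \<le> ?N" by simp
  from place_op_compose[OF place_op_on_places[OF place_op_D_mult_list this] place_op_move_right]
  show ?thesis unfolding phi_lift_def[abs_def] Let_def \<alpha>_def .
qed

text \<open>One letter j is split off from block j for each j in \<open>J\<close> and moved to the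
  right end; the product of the shortened blocks is the orbit sum of the remaining letters. The
  result is the tableau with column \<open>J\<close>.\<close>

lemma phi_lift_gen:
  assumes J: "J \<in> B_set lam b" and pos: "\<And>x. x \<in> set lam \<Longrightarrow> 0 < x"
  shows "phi_lift lam J (gen_tensor lam) = (tab_tensor (mset (block_word 1 lam)) (sum_list lam - b) J :: 'k::field tensor)"
proof
  fix w
  let ?m = "length lam"
  define \<alpha> where "\<alpha> = map (\<lambda>j. if j \<in> set J then part lam j - 1 else part lam j) [1..<?m + 1]"
  define E where "E = {sum_list (take j lam) - 1 |j. j \<in> set J}"
  have Jm: "set J \<subseteq> {1..<1 + ?m}" using B_setD(4)[OF J] by fastforce
  have E': "E = {sum_list (take (Suc j - 1) lam) - 1 |j. j \<in> set J}" by (simp add: E_def)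
  have al: "\<alpha> = map (\<lambda>j. if j \<in> set J then lam ! (j - 1) - 1 else lam ! (j - 1)) [1..<1 + ?m]"
    unfolding \<alpha>_def by (rule map_cong) (auto simp: part_def add.commute)
  have "sorted (filter (\<lambda>j. j \<in> set J) [1..<1 + ?m])" by (intro sorted_wrt_filter) simp
  then have Jf: "filter (\<lambda>j. j \<in> set J) [1..<1 + ?m] = J"
    using B_setD(2,3)[OF J] Jm by (intro sorted_distinct_set_unique) (auto simp: strict_sorted_iff)
  have nth: "nths (block_word 1 lam) E = J" "nths (block_word 1 lam) (- E) = block_word 1 \<alpha>"
    using nths_block_word[OF pos Jm] unfolding E' al Jf by simp_all
  have ms: "mset (block_word 1 lam) = mset (block_word 1 \<alpha>) + mset J"
    using mset_nths_append[of "block_word 1 lam" "- E"] by (simp add: nth)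
  let ?s = "sum_list \<alpha>"
  have s: "sum_list lam = ?s + b" using arg_cong[OF ms, of size] B_setD(1)[OF J] by simp
  let ?V = "block_word 1 \<alpha> @ J"
  have "phi_lift lam J (gen_tensor lam :: 'k tensor) w
      = D_mult_list \<alpha> (\<lambda>u. basis_tensor ?V (u @ drop ?s w)) (take ?s w)"
    by (simp add: phi_lift_def Let_def \<alpha>_def[symmetric] E_def[symmetric] move_right_basis_tensor nth on_places_def)
  also have "\<dots> = (if mset (take ?s w) = mset (block_word 1 \<alpha>) \<and> drop ?s w = J then 1 else 0)"
  proof (cases "drop ?s w = J")
    case True
    then have "(\<lambda>u. basis_tensor ?V (u @ drop ?s w)) = (gen_tensor \<alpha> :: 'k tensor)"
      by (auto simp: basis_tensor_def)
    then show ?thesis using True by (simp add: D_mult_list_block_word)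
  next
    case False
    have "D_mult_list \<alpha> (\<lambda>u. basis_tensor ?V (u @ drop ?s w)) (take ?s w) = (0 :: 'k)"
    proof (rule ccontr)
      assume "\<not> ?thesis"
      then obtain u where u: "mset u = mset (take ?s w)" "u @ drop ?s w = ?V"
        using place_op_nz[OF place_op_D_mult_list] by (fastforce simp: basis_tensor_def split: if_splits)
      have "length (u @ drop ?s w) = length w" using mset_eq_length[OF u(1)] by simp
      then have "length w = ?s + length J" unfolding u(2) by simp
      then have "length u = ?s" using mset_eq_length[OF u(1)] by simp
      then show False using u(2) False by (simp add: append_eq_append_conv)
    qed
    then show ?thesis using False by simp
  qed
  also have "mset (take ?s w) = mset (block_word 1 \<alpha>) \<and> drop ?s w = J
      \<longleftrightarrow> mset w = mset (block_word 1 lam) \<and> drop ?s w = J"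
  proof -
    have "mset w = mset (take ?s w) + mset (drop ?s w)" by (metis append_take_drop_id mset_append)
    then show ?thesis unfolding ms by auto
  qed
  finally show "phi_lift lam J (gen_tensor lam) w
      = (tab_tensor (mset (block_word 1 lam)) (sum_list lam - b) J w :: 'k)"
    by (simp add: tab_tensor_def s)
qed

section \<open>Homomorphisms between Weyl modules\<close>

lemma place_op_linear:
  assumes T: "place_op N T" and f: "f \<in> tensor_space n N"
  shows "g \<in> tensor_space n N \<Longrightarrow> T (\<lambda>w. f w + g w) = (\<lambda>w. T f w + T g w)"
    and "T (\<lambda>w. c * f w) = (\<lambda>w. c * T f w)"
proof -
  obtain \<sigma>s where ev: "\<And>f w. length w = N \<Longrightarrow> T f w = (\<Sum>\<sigma>\<leftarrow>\<sigma>s. f (permute_list \<sigma> w))"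
    using T unfolding place_op_def by blast
  have z: "T e w = 0" if "e \<in> tensor_space n N" "length w \<noteq> N" for e w
    by (rule tensor_spaceD(2)[OF place_op_tensor_space[OF T that(1)] that(2)])
  show "T (\<lambda>w. f w + g w) = (\<lambda>w. T f w + T g w)" if g: "g \<in> tensor_space n N"
  proof
    fix w
    show "T (\<lambda>w. f w + g w) w = T f w + T g w"
      using z[OF lin_sub_add[OF tensor_space_lin_sub f g]] z[OF f] z[OF g]
      by (cases "length w = N") (simp_all add: ev sum_list_addf)
  qed
  show "T (\<lambda>w. c * f w) = (\<lambda>w. c * T f w)"
  proof
    fix w
    show "T (\<lambda>w. c * f w) w = c * T f w"
      using z[OF lin_sub_smult[OF tensor_space_lin_sub f]] z[OF f]
      by (cases "length w = N") (simp_all add: ev sum_list_const_mult)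
  qed
qed

lemma schur_compose:
  assumes s: "s \<in> schur_algebra n r" and t: "t \<in> schur_algebra n r"
  shows "restrict (\<lambda>f. s (t f)) (tensor_space n r) \<in> schur_algebra n r"
  by (rule schur_algebraI) (simp_all add: schurD[OF s] schurD[OF t])

text \<open>Place permutations preserve the content of a word, so the projection to a weight space
  lies in the Schur algebra. It is used to choose a weight vector as representative of the image of
  the generator.\<close>

lemma weight_proj_schur:
  "restrict (\<lambda>f w. if mset w = M then f w else 0) (tensor_space n r) \<in> schur_algebra n r"
proof (rule schur_algebraI)
  fix f :: "'a tensor" assume f: "f \<in> tensor_space n r"
  then show "(\<lambda>w. if mset w = M then f w else 0) \<in> tensor_space n r"
    by (intro tensor_spaceI) (metis tensor_spaceD(1))
  fix \<sigma> assume \<sigma>: "\<sigma> permutes {..<r}"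
  show "(\<lambda>w. if mset w = M then place_perm \<sigma> f w else 0) = place_perm \<sigma> (\<lambda>w. if mset w = M then f w else 0)"
  proof
    fix w
    show "(if mset w = M then place_perm \<sigma> f w else 0) = place_perm \<sigma> (\<lambda>w. if mset w = M then f w else 0) w"
      using \<sigma> tensor_spaceD(2)[OF f, of "permute_list \<sigma> w"]
      by (cases "length w = r") (auto simp: place_perm_def)
  qed
qed auto

lemma finite_box_index: "finite (box_index lam)"
proof (rule finite_subset)
  show "box_index lam \<subseteq> (SIGMA i:{..length lam}. {..part lam (i + 1)})" by (auto simp: box_index_def)
qed auto

section \<open>The relations of a Weyl module as a submodule\<close>

context
  fixes n :: nat and lam :: "nat list"
  assumes n: "length lam \<le> n"
begin

text \<open>\<open>g\<close> is the image of the generator of its weight under some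
  \<open>s\<close>, and \<open>s\<close> commutes with the component of box. Hence the relations are
  generated by the raised generators of weight \<lambda>.\<close>

lemma box_component_cyclic:
  fixes g :: "'k::field tensor"
  assumes it: "(i, t) \<in> box_index lam" and g: "g \<in> class_fun n (raise lam i t)"
  obtains s where "s \<in> schur_algebra n (sum_list lam)"
    "box_component lam i t g = s (raise_op i t (gen_tensor lam))"
proof -
  let ?\<alpha> = "raise lam i t"
  have i: "1 \<le> i" "i < length lam" "t \<le> part lam (i + 1)" using it by (auto simp: box_index_def)
  have r: "sum_list ?\<alpha> = sum_list lam" by (rule sum_list_raise[OF i])
  define s where "s = restrict (schur_op ?\<alpha> g) (tensor_space n (sum_list lam))"
  have s: "s \<in> schur_algebra n (sum_list lam)"
    using schur_op_schur[OF g] unfolding s_def r .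
  have gt: "(gen_tensor ?\<alpha> :: 'k tensor) \<in> tensor_space n (sum_list lam)"
    using class_fun_tensor_space[OF gen_tensor_class_fun, of ?\<alpha> n] n unfolding r by simp
  have "s (gen_tensor ?\<alpha>) = g" using gt schur_op_gen[OF g] by (simp add: s_def)
  then have "box_component lam i t g = box_component lam i t (s (gen_tensor ?\<alpha>))" by simp
  also have "\<dots> = s (box_component lam i t (gen_tensor ?\<alpha>))"
    by (rule schur_place_op[OF s place_op_box_component[OF i(1,2)] gt, symmetric])
  also have "\<dots> = s (raise_op i t (gen_tensor lam))" by (simp add: box_component_gen[OF i])
  finally show ?thesis using that s by blast
qed

lemma gen_class: "(gen_tensor lam :: 'k::field tensor) \<in> class_fun n lam"
  by (rule gen_tensor_class_fun[OF n])

lemma raise_op_gen_class: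
  assumes "1 \<le> i"
  shows "(raise_op i t (gen_tensor lam) :: 'k::field tensor) \<in> class_fun n lam"
  using schur_class_fun[OF raise_op_schur[OF assms] gen_class]
  by (simp add: class_fun_tensor_space[OF gen_class])

lemma box_component_class_fun:
  assumes it: "(i, t) \<in> box_index lam" and g: "(g :: 'k::field tensor) \<in> class_fun n (raise lam i t)"
  shows "box_component lam i t g \<in> class_fun n lam"
proof -
  obtain s where s: "s \<in> schur_algebra n (sum_list lam)"
    "box_component lam i t g = s (raise_op i t (gen_tensor lam))"
    by (rule box_component_cyclic[OF it g])
  have "1 \<le> i" using it by (auto simp: box_index_def)
  then show ?thesis unfolding s(2) by (rule schur_class_fun[OF s(1) raise_op_gen_class])
qed

lemma box_component_linear:
  fixes f g :: "'k::field tensor"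
  assumes it: "(i, t) \<in> box_index lam" and f: "f \<in> class_fun n (raise lam i t)"
  shows "g \<in> class_fun n (raise lam i t) \<Longrightarrow>
      box_component lam i t (\<lambda>w. f w + g w) = (\<lambda>w. box_component lam i t f w + box_component lam i t g w)"
    and "box_component lam i t (\<lambda>w. c * f w) = (\<lambda>w. c * box_component lam i t f w)"
proof -
  have i: "1 \<le> i" "i < length lam" "t \<le> part lam (i + 1)" using it by (auto simp: box_index_def)
  have T: "g \<in> tensor_space n (sum_list lam)" if "g \<in> class_fun n (raise lam i t)" for g :: "'k tensor"
    using class_fun_tensor_space[OF that] sum_list_raise[OF i] by simp
  show "g \<in> class_fun n (raise lam i t) \<Longrightarrow>
      box_component lam i t (\<lambda>w. f w + g w) = (\<lambda>w. box_component lam i t f w + box_component lam i t g w)"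
    by (rule place_op_linear(1)[OF place_op_box_component[OF i(1,2)] T[OF f] T])
  show "box_component lam i t (\<lambda>w. c * f w) = (\<lambda>w. c * box_component lam i t f w)"
    by (rule place_op_linear(2)[OF place_op_box_component[OF i(1,2)] T[OF f]])
qed

lemma box_image_alt:
  "(box_image n lam :: 'k::field tensor set) = {(\<lambda>w. \<Sum>(i, t)\<in>box_index lam. box_component lam i t (x i t) w) |x.
      \<forall>(i, t)\<in>box_index lam. x i t \<in> class_fun n (raise lam i t)}"
  by (simp add: box_image_def D_set_eq)

lemma box_image_class_fun: "box_image n lam \<subseteq> (class_fun n lam :: 'k::field tensor set)"
  unfolding box_image_alt
proof clarify
  fix x :: "nat \<Rightarrow> nat \<Rightarrow> 'k tensor"
  assume x: "\<forall>(i, t)\<in>box_index lam. x i t \<in> class_fun n (raise lam i t)"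
  show "(\<lambda>w. \<Sum>(i, t)\<in>box_index lam. box_component lam i t (x i t) w) \<in> class_fun n lam"
    unfolding split_def
    by (rule lin_sub_sum[OF class_fun_lin_sub]) (use x in \<open>auto intro!: box_component_class_fun\<close>)
qed

lemma box_image_lin_sub: "lin_sub (box_image n lam :: 'k::field tensor set)"
  unfolding lin_sub_def
proof (intro conjI ballI allI)
  let ?f = "\<lambda>x (w :: nat list). \<Sum>(i, t)\<in>box_index lam. box_component lam i t (x i t) w :: 'k"
  let ?C = "\<lambda>x :: nat \<Rightarrow> nat \<Rightarrow> 'k tensor. \<forall>(i, t)\<in>box_index lam. x i t \<in> class_fun n (raise lam i t)"
  have I: "?f x \<in> box_image n lam" if "?C x" for x
    unfolding box_image_alt using that by blast
  have sm: "?C (\<lambda>i t w. c * x i t w) \<and> ?f (\<lambda>i t w. c * x i t w) = (\<lambda>w. c * ?f x w)" if "?C x" for c x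
  proof
    show "?C (\<lambda>i t w. c * x i t w)" using that lin_sub_smult[OF class_fun_lin_sub] by (fastforce simp: split_def)
    show "?f (\<lambda>i t w. c * x i t w) = (\<lambda>w. c * ?f x w)"
      unfolding sum_distrib_left
    proof (intro ext sum.cong refl)
      fix w p assume "p \<in> box_index lam"
      then have p: "(fst p, snd p) \<in> box_index lam" by simp
      then have "x (fst p) (snd p) \<in> class_fun n (raise lam (fst p) (snd p))" using that by auto
      from box_component_linear(2)[OF p this, of c]
      show "(case p of (i, t) \<Rightarrow> box_component lam i t (\<lambda>w. c * x i t w) w)
          = c * (case p of (i, t) \<Rightarrow> box_component lam i t (x i t) w)"
        by (simp add: split_def)
    qed
  qed
  have ad: "?C (\<lambda>i t w. x i t w + y i t w) \<and> ?f (\<lambda>i t w. x i t w + y i t w) = (\<lambda>w. ?f x w + ?f y w)"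
    if "?C x" "?C y" for x y
  proof
    show "?C (\<lambda>i t w. x i t w + y i t w)"
      using that lin_sub_add[OF class_fun_lin_sub] by (fastforce simp: split_def)
    show "?f (\<lambda>i t w. x i t w + y i t w) = (\<lambda>w. ?f x w + ?f y w)"
      unfolding sum.distrib[symmetric]
    proof (intro ext sum.cong refl)
      fix w p assume "p \<in> box_index lam"
      then have p: "(fst p, snd p) \<in> box_index lam" by simp
      then have "x (fst p) (snd p) \<in> class_fun n (raise lam (fst p) (snd p))"
        "y (fst p) (snd p) \<in> class_fun n (raise lam (fst p) (snd p))" using that by auto
      from box_component_linear(1)[OF p this]
      show "(case p of (i, t) \<Rightarrow> box_component lam i t (\<lambda>w. x i t w + y i t w) w)
          = (case p of (i, t) \<Rightarrow> box_component lam i t (x i t) w) + (case p of (i, t) \<Rightarrow> box_component lam i t (y i t) w)"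
        by (simp add: split_def)
    qed
  qed
  have z: "?C (\<lambda>i t w. 0)" using lin_sub_zero[OF class_fun_lin_sub] by (auto simp: split_def)
  show "(\<lambda>w. 0) \<in> (box_image n lam :: 'k tensor set)"
    using I[OF conjunct1[OF sm[OF z, of 0]]] unfolding conjunct2[OF sm[OF z, of 0]] by simp
  fix f g :: "'k tensor" and c assume f: "f \<in> box_image n lam"
  obtain x where x: "f = ?f x" "?C x" using f unfolding box_image_alt by blast
  show "(\<lambda>w. c * f w) \<in> box_image n lam"
    using I[OF conjunct1[OF sm[OF x(2), of c]]] unfolding conjunct2[OF sm[OF x(2), of c]] x(1) .
  assume g: "g \<in> box_image n lam"
  obtain y where y: "g = ?f y" "?C y" using g unfolding box_image_alt by blast
  show "(\<lambda>w. f w + g w) \<in> box_image n lam"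
    using I[OF conjunct1[OF ad[OF x(2) y(2)]]] unfolding conjunct2[OF ad[OF x(2) y(2)]] x(1) y(1) .
qed

lemma box_component_box_image:
  assumes it: "(i, t) \<in> box_index lam" and g: "(g :: 'k::field tensor) \<in> class_fun n (raise lam i t)"
  shows "box_component lam i t g \<in> box_image n lam"
proof -
  let ?x = "\<lambda>j u. if j = i \<and> u = t then g else (\<lambda>w. 0)"
  have z: "box_component lam j u (\<lambda>w. 0) w = (0 :: 'k)" if "(j, u) \<in> box_index lam" for j u w
    using that by (intro place_op_zero[OF place_op_box_component]) (auto simp: box_index_def)
  have "(\<Sum>(j, u)\<in>box_index lam. box_component lam j u (?x j u) w) = box_component lam i t g w" for w
  proof -
    have "(\<Sum>(j, u)\<in>box_index lam. box_component lam j u (?x j u) w)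
        = (\<Sum>p\<in>box_index lam. if p = (i, t) then box_component lam i t g w else 0)"
    proof (intro sum.cong refl)
      fix p assume p: "p \<in> box_index lam"
      show "(case p of (j, u) \<Rightarrow> box_component lam j u (?x j u) w) = (if p = (i, t) then box_component lam i t g w else 0)"
      proof (cases "p = (i, t)")
        case False
        then have "?x (fst p) (snd p) = (\<lambda>w. 0)" by (auto simp: prod_eq_iff)
        then show ?thesis using False z[of "fst p" "snd p" w] p by (simp add: split_def)
      qed simp
    qed
    then show ?thesis using it by (simp add: sum.delta[OF finite_box_index])
  qed
  then have "box_component lam i t g = (\<lambda>w. \<Sum>(j, u)\<in>box_index lam. box_component lam j u (?x j u) w)"
    by auto
  moreover have "\<forall>(j, u)\<in>box_index lam. ?x j u \<in> class_fun n (raise lam j u)"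
    using g lin_sub_zero[OF class_fun_lin_sub] by auto
  ultimately show ?thesis unfolding box_image_alt by (intro CollectI exI[of _ ?x] conjI)
qed

lemma box_image_schur:
  assumes s: "s \<in> schur_algebra n (sum_list lam)" and z: "z \<in> (box_image n lam :: 'k::field tensor set)"
  shows "s z \<in> box_image n lam"
proof -
  obtain x where x: "z = (\<lambda>w. \<Sum>(i, t)\<in>box_index lam. box_component lam i t (x i t) w)"
    "\<forall>(i, t)\<in>box_index lam. x i t \<in> class_fun n (raise lam i t)"
    using z unfolding box_image_alt by blast
  have *: "s (box_component lam i t (x i t)) \<in> box_image n lam
      \<and> box_component lam i t (x i t) \<in> tensor_space n (sum_list lam)" if it: "(i, t) \<in> box_index lam" for i t
  proof -
    have i: "1 \<le> i" "i < length lam" "t \<le> part lam (i + 1)" using it by (auto simp: box_index_def)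
    have g: "x i t \<in> class_fun n (raise lam i t)" using x(2) it by auto
    have gt: "x i t \<in> tensor_space n (sum_list lam)"
      using class_fun_tensor_space[OF g] sum_list_raise[OF i] by simp
    have "s (box_component lam i t (x i t)) = box_component lam i t (s (x i t))"
      by (rule schur_place_op[OF s place_op_box_component[OF i(1,2)] gt])
    moreover have "s (x i t) \<in> class_fun n (raise lam i t)"
      by (rule schur_class_fun[OF _ g]) (simp add: s sum_list_raise[OF i])
    ultimately show ?thesis
      using box_component_box_image[OF it] place_op_tensor_space[OF place_op_box_component[OF i(1,2)] gt] by simp
  qed
  have "s z = (\<lambda>w. \<Sum>p\<in>box_index lam. s (box_component lam (fst p) (snd p) (x (fst p) (snd p))) w)"
    unfolding x(1) split_def by (rule schur_sum[OF s]) (use * in \<open>simp add: split_paired_all\<close>)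
  also have "\<dots> \<in> box_image n lam"
    by (rule lin_sub_sum[OF box_image_lin_sub]) (use * in \<open>simp add: split_paired_all\<close>)
  finally show ?thesis .
qed

lemma weyl_quotient: "tensor_quotient (class_fun n lam :: 'k::field tensor set) (box_image n lam)"
  by unfold_locales (rule class_fun_lin_sub box_image_lin_sub box_image_class_fun)+
end

lemma (in tensor_quotient) finsum_Q:
  assumes "\<And>i. i \<in> I \<Longrightarrow> f i \<in> U"
  shows "(\<Oplus>\<^bsub>Q\<^esub>i\<in>I. coset W (f i)) = coset W (\<lambda>w. \<Sum>i\<in>I. f i w)"
proof -
  interpret M: Module.module class_ring Q by (rule module_Q)
  show ?thesis
    using assms
  proof (induction I rule: infinite_finite_induct)
    case (insert i I)
    have c: "(\<lambda>i. coset W (f i)) \<in> I \<rightarrow> carrier Q" "coset W (f i) \<in> carrier Q"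
      using insert.prems by (auto simp: carrier_Q)
    show ?case
      using M.finsum_insert[OF insert.hyps c] insert by (simp add: add_Q)
  qed (simp_all add: zero_Q)
qed


lemma schur_op_smult_right: "schur_op \<alpha> x (\<lambda>w. c * f w) = (\<lambda>w. c * schur_op \<alpha> x f w)"
  by (rule ext) (simp add: schur_op_def sum_distrib_left mult.assoc)

lemma schur_op_sum_right: "schur_op \<alpha> x (\<lambda>w. \<Sum>i\<in>I. f i w) = (\<lambda>w. \<Sum>i\<in>I. schur_op \<alpha> x (f i) w)"
  by (rule ext) (simp add: schur_op_def sum_distrib_right sum.swap[of _ I])

lemma weyl_module_eq:
  "weyl_module n lam = quotient_smodule (tensor_module (class_fun n lam)) (box_image n lam)"
  by (simp add: weyl_module_def D_module_def D_set_eq)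

lemma weyl_proj_eq: "weyl_proj n lam x = coset (box_image n lam) x"
  by (simp add: weyl_proj_def D_module_def)

context
  fixes n :: nat and lam :: "nat list"
  assumes n: "length lam \<le> n"
begin

interpretation weyl: tensor_quotient "class_fun n lam" "box_image n lam :: 'k::field tensor set"
  by (rule weyl_quotient[OF n])

lemma weyl_action:
  fixes x :: "'k::field tensor"
  assumes s: "s \<in> schur_algebra n (sum_list lam)" and x: "x \<in> class_fun n lam"
  shows "action (weyl_module n lam) s (coset (box_image n lam) x) = coset (box_image n lam) (s x)"
  unfolding weyl_module_eq
proof (rule weyl.action_Q)
  fix z assume "z \<in> coset (box_image n lam) x"
  then have zx: "(\<lambda>w. z w - x w) \<in> box_image n lam" by (simp add: coset_def)
  have xt: "x \<in> tensor_space n (sum_list lam)" by (rule class_fun_tensor_space[OF x])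
  have "(\<lambda>w. z w - x w) \<in> tensor_space n (sum_list lam)"
    by (rule class_fun_tensor_space[OF subsetD[OF box_image_class_fun[OF n] zx]])
  then have "s (\<lambda>w. (z w - x w) + x w) = (\<lambda>w. s (\<lambda>w. z w - x w) w + s x w)"
    by (rule schurD(2)[OF s _ xt])
  then have "(\<lambda>w. s z w - s x w) = s (\<lambda>w. z w - x w)" by simp
  then show "(\<lambda>w. s z w - s x w) \<in> box_image n lam" using box_image_schur[OF n s zx] by simp
qed

lemma carrier_weyl: "carrier (weyl_module n lam) = coset (box_image n lam) ` (class_fun n lam :: 'k::field tensor set)"
  unfolding weyl_module_eq by (rule weyl.carrier_Q)

lemma weyl_ops:
  fixes x y :: "'k::field tensor"
  shows "\<zero>\<^bsub>weyl_module n lam\<^esub> = coset (box_image n lam) (\<lambda>w. 0 :: 'k)"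
    "coset (box_image n lam) x \<oplus>\<^bsub>weyl_module n lam\<^esub> coset (box_image n lam) y = coset (box_image n lam) (\<lambda>w. x w + y w)"
    "c \<odot>\<^bsub>weyl_module n lam\<^esub> coset (box_image n lam) x = coset (box_image n lam) (\<lambda>w. c * x w)"
  unfolding weyl_module_eq by (rule weyl.zero_Q weyl.add_Q weyl.smult_Q)+

lemma weyl_zero_iff:
  "coset (box_image n lam) x = \<zero>\<^bsub>weyl_module n lam\<^esub> \<longleftrightarrow> (x :: 'k::field tensor) \<in> box_image n lam"
  unfolding weyl_ops(1) using coset_eq_iff[OF box_image_lin_sub[OF n], of x "\<lambda>w. 0"] by simp

lemma is_smodule_weyl:
  "is_smodule (schur_algebra n (sum_list lam)) (weyl_module n lam :: ('k::field, 'k tensor set, 'k tensor \<Rightarrow> 'k tensor) smodule)"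
  unfolding is_smodule_def
proof (intro conjI ballI allI)
  show "Module.module class_ring (weyl_module n lam :: ('k, 'k tensor set, 'k tensor \<Rightarrow> 'k tensor) smodule)"
    unfolding weyl_module_eq by (rule weyl.module_Q)
  fix s :: "'k tensor \<Rightarrow> 'k tensor" and X Y :: "'k tensor set" and c :: 'k
  assume s: "s \<in> schur_algebra n (sum_list lam)" and X: "X \<in> carrier (weyl_module n lam)"
  obtain x where x: "X = coset (box_image n lam) x" "x \<in> class_fun n lam" using X unfolding carrier_weyl by blast
  have sx: "s x \<in> class_fun n lam" by (rule schur_class_fun[OF s x(2)])
  note T = class_fun_tensor_space
  show "action (weyl_module n lam) s X \<in> carrier (weyl_module n lam)"
    unfolding x(1) weyl_action[OF s x(2)] carrier_weyl using sx by blast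
  show "action (weyl_module n lam) s (c \<odot>\<^bsub>weyl_module n lam\<^esub> X) = c \<odot>\<^bsub>weyl_module n lam\<^esub> action (weyl_module n lam) s X"
    unfolding x(1) weyl_action[OF s x(2)] weyl_ops
      weyl_action[OF s lin_sub_smult[OF class_fun_lin_sub x(2)]] schurD(3)[OF s T[OF x(2)]] ..
  assume "Y \<in> carrier (weyl_module n lam)"
  then obtain y where y: "Y = coset (box_image n lam) y" "y \<in> class_fun n lam" unfolding carrier_weyl by blast
  show "action (weyl_module n lam) s (X \<oplus>\<^bsub>weyl_module n lam\<^esub> Y)
      = action (weyl_module n lam) s X \<oplus>\<^bsub>weyl_module n lam\<^esub> action (weyl_module n lam) s Y"
    unfolding x(1) y(1) weyl_action[OF s x(2)] weyl_action[OF s y(2)] weyl_ops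
      weyl_action[OF s lin_sub_add[OF class_fun_lin_sub x(2) y(2)]] schurD(2)[OF s T[OF x(2)] T[OF y(2)]] ..
qed

end

section \<open>Homomorphisms and weight vectors killed by raising operators\<close>

context
  fixes n :: nat and lam h :: "nat list"
  assumes nl: "length lam \<le> n" and nh: "length h \<le> n" and r: "sum_list h = sum_list lam"
begin

lemma schur_op_eq_schur:
  fixes x y :: "'k::field tensor"
  assumes x: "x \<in> class_fun n lam" and y: "y \<in> class_fun n h"
  shows "restrict (schur_op lam x) (tensor_space n (sum_list lam)) y = schur_op lam x y"
  using class_fun_tensor_space[OF y] r by simp

lemma schur_op_class_fun:
  fixes x y :: "'k::field tensor"
  assumes x: "x \<in> class_fun n lam" and y: "y \<in> class_fun n h"
  shows "schur_op lam x y \<in> class_fun n h"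
proof -
  have "restrict (schur_op lam x) (tensor_space n (sum_list lam)) y \<in> class_fun n h"
    by (rule schur_class_fun[OF _ y]) (unfold r, rule schur_op_schur[OF x])
  then show ?thesis unfolding schur_op_eq_schur[OF x y] .
qed

text \<open>Elements of the Schur algebra are determined on tensors of weight \<open>\<lambda>\<close> by their value at the
  generator.\<close>

lemma schur_op_unique:
  fixes x y :: "'k::field tensor"
  assumes s: "s \<in> schur_algebra n (sum_list lam)" and x: "x \<in> class_fun n lam"
    and e: "s (gen_tensor lam) = x" and y: "y \<in> class_fun n h" "has_weight lam y"
  shows "s y = schur_op lam x y"
proof -
  have "s y = restrict (schur_op lam x) (tensor_space n (sum_list lam)) y"
  proof (rule schur_eq_on_weight[OF s schur_op_schur[OF x] nl _ y(2)])
    show "s (gen_tensor lam) = restrict (schur_op lam x) (tensor_space n (sum_list lam)) (gen_tensor lam)"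
      using class_fun_tensor_space[OF gen_class[OF nl], where 'a='k] schur_op_gen[OF x] e by simp
  qed
  then show ?thesis unfolding schur_op_eq_schur[OF x y(1)] .
qed

text \<open>This is what makes the map attached to \<open>y\<close> independent of representatives.
  A relation is a sum of terms \<open>s (raise_op i t (gen_tensor lam))\<close>; replacing the
  generator by \<open>y\<close> gives terms \<open>s (raise_op i t y)\<close>, which lie in the
  submodule of relations of \<open>h\<close>.\<close>

lemma schur_op_box_image:
  fixes z y :: "'k::field tensor"
  assumes y: "y \<in> class_fun n h" "has_weight lam y"
    and kill: "\<And>i t. (i, t) \<in> box_index lam \<Longrightarrow> raise_op i t y \<in> box_image n h"
    and z: "z \<in> box_image n lam"
  shows "schur_op lam z y \<in> box_image n h"
proof -
  obtain x where x: "z = (\<lambda>w. \<Sum>(i, t)\<in>box_index lam. box_component lam i t (x i t) w)"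
    "\<forall>(i, t)\<in>box_index lam. x i t \<in> class_fun n (raise lam i t)"
    using z unfolding box_image_alt[OF nl] by blast
  have *: "schur_op lam (box_component lam i t (x i t)) y \<in> box_image n h" if it: "(i, t) \<in> box_index lam" for i t
  proof -
    have g: "x i t \<in> class_fun n (raise lam i t)" using x(2) it by auto
    obtain s where s: "s \<in> schur_algebra n (sum_list lam)"
      "box_component lam i t (x i t) = s (raise_op i t (gen_tensor lam))"
      by (rule box_component_cyclic[OF nl it g])
    have i: "1 \<le> i" using it by (auto simp: box_index_def)
    let ?ts = "tensor_space n (sum_list lam) :: 'k tensor set"
    \<comment> \<open>The composite of \<open>s\<close> and the raising operator sends the generator
      to the given component, hence agrees with \<open>schur_op\<close> at every vector of weight
      \<lambda>.\<close>
    let ?u = "restrict (\<lambda>f. s (restrict (raise_op i t) ?ts f)) ?ts"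
    have u: "?u \<in> schur_algebra n (sum_list lam)"
      by (rule schur_compose[OF s(1) raise_op_schur[OF i]])
    have yt: "y \<in> ?ts" using class_fun_tensor_space[OF y(1)] r by simp
    have gt: "gen_tensor lam \<in> ?ts" by (rule class_fun_tensor_space[OF gen_class[OF nl]])
    have "?u y = schur_op lam (box_component lam i t (x i t)) y"
      by (rule schur_op_unique[OF u box_component_class_fun[OF nl it g] _ y]) (simp add: gt s(2))
    then have "schur_op lam (box_component lam i t (x i t)) y = s (raise_op i t y)" using yt by simp
    also have "\<dots> \<in> box_image n h"
      by (rule box_image_schur[OF nh _ kill[OF it]]) (simp add: r s(1))
    finally show ?thesis .
  qed
  have "schur_op lam z y = (\<lambda>w. \<Sum>p\<in>box_index lam. schur_op lam (box_component lam (fst p) (snd p) (x (fst p) (snd p))) y w)"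
    unfolding x(1) split_def schur_op_sum_left ..
  also have "\<dots> \<in> box_image n h"
    by (rule lin_sub_sum[OF box_image_lin_sub[OF nh]]) (use * in \<open>simp add: split_paired_all\<close>)
  finally show ?thesis .
qed

text \<open>\<open>y\<close> represents the image of the generator, whose values under the Schur
  algebra determine \<open>F\<close>. The raised generators are relations, so \<open>F\<close> sends
  them to 0, and this says that \<open>raise_op i t y\<close> is a relation of
  \<open>h\<close>.\<close>

lemma weyl_hom_form:
  fixes F :: "'k::field tensor set \<Rightarrow> 'k tensor set"
  assumes F: "F \<in> shom_set (schur_algebra n (sum_list lam)) (weyl_module n lam) (weyl_module n h)"
  obtains y where "y \<in> class_fun n h" "has_weight lam y"
    "\<And>x. x \<in> class_fun n lam \<Longrightarrow> F (coset (box_image n lam) x) = coset (box_image n h) (schur_op lam x y)"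
    "\<And>i t. (i, t) \<in> box_index lam \<Longrightarrow> raise_op i t y \<in> box_image n h"
proof -
  let ?M = "weyl_module n lam :: ('k, 'k tensor set, 'k tensor \<Rightarrow> 'k tensor) smodule"
  let ?N = "weyl_module n h :: ('k, 'k tensor set, 'k tensor \<Rightarrow> 'k tensor) smodule"
  let ?cl = "coset (box_image n lam) :: 'k tensor \<Rightarrow> 'k tensor set"
  let ?ch = "coset (box_image n h) :: 'k tensor \<Rightarrow> 'k tensor set"
  let ?ts = "tensor_space n (sum_list lam) :: 'k tensor set"
  let ?e = "gen_tensor lam :: 'k tensor"
  have e: "?e \<in> class_fun n lam" by (rule gen_class[OF nl])
  have Fc: "F X \<in> carrier ?N" if "X \<in> carrier ?M" for X
    using F that by (auto simp: shom_set_def LinearCombinations.module_hom_def)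
  have Fs: "F (action ?M s X) = action ?N s (F X)" if "X \<in> carrier ?M" "s \<in> schur_algebra n (sum_list lam)" for s X
    using F that by (auto simp: shom_set_def)
  have ec: "?cl ?e \<in> carrier ?M" unfolding carrier_weyl[OF nl] using e by blast
  obtain y0 where y0: "F (?cl ?e) = ?ch y0" "y0 \<in> class_fun n h"
    using Fc[OF ec] unfolding carrier_weyl[OF nh] by blast
  \<comment> \<open>The weight projection fixes the generator, so applying it to a representative of
    the image does not change the class and yields a vector of weight \<lambda>.\<close>
  let ?\<pi> = "restrict (\<lambda>f w. if mset w = mset (block_word 1 lam) then f w else 0) ?ts"
  have \<pi>: "?\<pi> \<in> schur_algebra n (sum_list lam)" by (rule weight_proj_schur)
  have \<pi>e: "?\<pi> ?e = ?e" using class_fun_tensor_space[OF e] by (auto simp: basis_tensor_def)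
  define y where "y = ?\<pi> y0"
  have act_h: "action ?N s (?ch x) = ?ch (s x)" if "s \<in> schur_algebra n (sum_list lam)" "x \<in> class_fun n h" for s x
    using weyl_action[OF nh, of s x] that r by simp
  have yc: "y \<in> class_fun n h" unfolding y_def by (rule schur_class_fun[OF _ y0(2)]) (unfold r, rule \<pi>)
  have Fe: "F (?cl ?e) = ?ch y"
    using Fs[OF ec \<pi>] weyl_action[OF nl \<pi> e] y0 act_h[OF \<pi> y0(2)] unfolding \<pi>e y_def by simp
  have yw: "has_weight lam y"
    using class_fun_tensor_space[OF y0(2)] r by (auto simp: has_weight_def y_def)
  have F_s: "F (?cl (s ?e)) = ?ch (s y)" if s: "s \<in> schur_algebra n (sum_list lam)" for s
    using Fs[OF ec s] weyl_action[OF nl s e] Fe act_h[OF s yc] by simp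
  have "F (?cl x) = ?ch (schur_op lam x y)" if x: "x \<in> class_fun n lam" for x
  proof -
    have "restrict (schur_op lam x) ?ts ?e = x"
      using class_fun_tensor_space[OF e] schur_op_gen[OF x] by simp
    then show ?thesis using F_s[OF schur_op_schur[OF x]] schur_op_eq_schur[OF x yc] by simp
  qed
  moreover have "raise_op i t y \<in> box_image n h" if it: "(i, t) \<in> box_index lam" for i t
  proof -
    have i: "1 \<le> i" "i < length lam" "t \<le> part lam (i + 1)" using it by (auto simp: box_index_def)
    have "raise_op i t ?e = box_component lam i t (gen_tensor (raise lam i t))"
      by (rule box_component_gen[OF i, symmetric])
    also have "\<dots> \<in> box_image n lam"
      by (intro box_component_box_image[OF nl it] gen_tensor_class_fun) (simp add: nl)
    finally have "?cl (raise_op i t ?e) = \<zero>\<^bsub>?M\<^esub>" using weyl_zero_iff[OF nl] by blast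
    moreover have "F \<zero>\<^bsub>?M\<^esub> = \<zero>\<^bsub>?N\<^esub>"
    proof -
      interpret mod_hom class_ring ?M ?N F
        using is_smodule_weyl[OF nl, where 'k='k] is_smodule_weyl[OF nh, where 'k='k] F
        by (auto simp: mod_hom_def mod_hom_axioms_def is_smodule_def shom_set_def)
      show ?thesis by (rule f0_is_0)
    qed
    moreover have "?ch (raise_op i t y) = F (?cl (raise_op i t ?e))"
      using F_s[OF raise_op_schur[OF i(1), of t]] class_fun_tensor_space[OF e] class_fun_tensor_space[OF yc] r by simp
    ultimately show ?thesis using weyl_zero_iff[OF nh, of "raise_op i t y"] by simp
  qed
  ultimately show ?thesis using that yc yw by blast
qed

text \<open>The map sends the class of \<open>x\<close> to the class of
  \<open>schur_op lam x y\<close>. It does not depend on the chosen representative because relations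
  go to relations.\<close>

lemma weyl_hom_exists:
  fixes y :: "'k::field tensor"
  assumes y: "y \<in> class_fun n h" "has_weight lam y"
    and kill: "\<And>i t. (i, t) \<in> box_index lam \<Longrightarrow> raise_op i t y \<in> box_image n h"
  obtains F where "F \<in> shom_set (schur_algebra n (sum_list lam)) (weyl_module n lam) (weyl_module n h)"
    "\<And>x. x \<in> class_fun n lam \<Longrightarrow> F (coset (box_image n lam) x) = coset (box_image n h) (schur_op lam x y)"
proof -
  let ?M = "weyl_module n lam :: ('k, 'k tensor set, 'k tensor \<Rightarrow> 'k tensor) smodule"
  let ?N = "weyl_module n h :: ('k, 'k tensor set, 'k tensor \<Rightarrow> 'k tensor) smodule"
  let ?cl = "coset (box_image n lam) :: 'k tensor \<Rightarrow> 'k tensor set"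
  let ?ch = "coset (box_image n h) :: 'k tensor \<Rightarrow> 'k tensor set"
  let ?ts = "tensor_space n (sum_list lam) :: 'k tensor set"
  define rep where "rep X = (SOME x. x \<in> class_fun n lam \<and> ?cl x = X)" for X
  define F where "F = (\<lambda>X\<in>carrier ?M. ?ch (schur_op lam (rep X) y))"
  have rep: "rep X \<in> class_fun n lam \<and> ?cl (rep X) = X" if "X \<in> carrier ?M" for X
  proof -
    have "\<exists>x. x \<in> class_fun n lam \<and> ?cl x = X" using that unfolding carrier_weyl[OF nl] by blast
    then show ?thesis unfolding rep_def by (rule someI_ex)
  qed
  have FX: "F (?cl x) = ?ch (schur_op lam x y)" if x: "x \<in> class_fun n lam" for x
  proof -
    have c: "?cl x \<in> carrier ?M" unfolding carrier_weyl[OF nl] using x by blast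
    have "(\<lambda>w. rep (?cl x) w - x w) \<in> box_image n lam"
      using rep[OF c] coset_eq_iff[OF box_image_lin_sub[OF nl]] by blast
    then have "(\<lambda>w. schur_op lam (rep (?cl x)) y w - schur_op lam x y w) \<in> box_image n h"
      using schur_op_box_image[OF y kill, of "\<lambda>w. rep (?cl x) w - x w"] by (simp add: schur_op_diff_left)
    from coset_eq_iff[OF box_image_lin_sub[OF nh], THEN iffD2, OF this]
    show ?thesis using c by (simp add: F_def)
  qed
  have "F \<in> LinearCombinations.module_hom class_ring ?M ?N"
    unfolding LinearCombinations.module_hom_def
  proof (intro CollectI conjI allI impI)
    show "F \<in> carrier ?M \<rightarrow> carrier ?N"
      unfolding carrier_weyl[OF nl] carrier_weyl[OF nh] using FX schur_op_class_fun[OF _ y(1)] by auto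
    fix X Y assume "X \<in> carrier ?M \<and> Y \<in> carrier ?M"
    then obtain x z where xz: "X = ?cl x" "x \<in> class_fun n lam" "Y = ?cl z" "z \<in> class_fun n lam"
      unfolding carrier_weyl[OF nl] by blast
    show "F (X \<oplus>\<^bsub>?M\<^esub> Y) = F X \<oplus>\<^bsub>?N\<^esub> F Y"
      unfolding xz(1,3) weyl_ops[OF nl] FX[OF xz(2)] FX[OF xz(4)] weyl_ops[OF nh]
        FX[OF lin_sub_add[OF class_fun_lin_sub xz(2,4)]] schur_op_add_left ..
  next
    fix c :: 'k and X assume "c \<in> carrier class_ring \<and> X \<in> carrier ?M"
    then obtain x where x: "X = ?cl x" "x \<in> class_fun n lam"
      unfolding carrier_weyl[OF nl] by blast
    show "F (c \<odot>\<^bsub>?M\<^esub> X) = c \<odot>\<^bsub>?N\<^esub> F X"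
      unfolding x(1) weyl_ops[OF nl] FX[OF x(2)] weyl_ops[OF nh]
        FX[OF lin_sub_smult[OF class_fun_lin_sub x(2)]] schur_op_smult_left ..
  qed
  moreover have "F (action ?M s X) = action ?N s (F X)"
    if s: "s \<in> schur_algebra n (sum_list lam)" and X: "X \<in> carrier ?M" for s X
  proof -
    obtain x where x: "X = ?cl x" "x \<in> class_fun n lam" using X unfolding carrier_weyl[OF nl] by blast
    have sx: "s x \<in> class_fun n lam" by (rule schur_class_fun[OF s x(2)])
    \<comment> \<open>\<open>s\<close> after \<open>schur_op lam x\<close> and
      \<open>schur_op lam (s x)\<close> agree at the generator, hence at \<open>y\<close>; this is
      the compatibility with the action.\<close>
    let ?u = "restrict (\<lambda>f. s (restrict (schur_op lam x) ?ts f)) ?ts"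
    have u: "?u \<in> schur_algebra n (sum_list lam)"
      by (rule schur_compose[OF s schur_op_schur[OF x(2)]])
    have gt: "gen_tensor lam \<in> ?ts" by (rule class_fun_tensor_space[OF gen_class[OF nl]])
    have yt: "y \<in> ?ts" using class_fun_tensor_space[OF y(1)] r by simp
    have "?u y = schur_op lam (s x) y"
      by (rule schur_op_unique[OF u sx _ y]) (simp add: gt schur_op_gen[OF x(2)])
    then have su: "schur_op lam (s x) y = s (schur_op lam x y)" using yt by simp
    have "action ?N s (?ch (schur_op lam x y)) = ?ch (s (schur_op lam x y))"
      by (rule weyl_action[OF nh _ schur_op_class_fun[OF x(2) y(1)]]) (simp add: r s)
    then show ?thesis
      unfolding x(1) weyl_action[OF nl s x(2)] FX[OF sx] FX[OF x(2)] su by simp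
  qed
  ultimately have "F \<in> shom_set (schur_algebra n (sum_list lam)) ?M ?N"
    unfolding shom_set_def by (intro CollectI conjI IntI ballI) (simp_all add: F_def)
  then show ?thesis using that FX by blast
qed

text \<open>Write \<open>x\<close> as the image of the generator under an element of the Schur
  algebra. The lift of each \<phi>_J commutes with this element, so only its value at the generator,
  the tableau with column \<open>J\<close>, enters.\<close>

lemma psi_eq:
  fixes x :: "'k::field tensor"
  assumes x: "x \<in> class_fun n lam" and pos: "\<And>a. a \<in> set lam \<Longrightarrow> 0 < a"
    and tab: "\<And>J. J \<in> B_set lam b \<Longrightarrow> (tab_tensor (mset (block_word 1 lam)) (sum_list lam - b) J :: 'k tensor) \<in> class_fun n h"
  shows "psi n lam h b x = coset (box_image n h) (schur_op lam x
    (\<lambda>w. \<Sum>J\<in>B_set lam b. of_int (d_coeff lam J) * tab_tensor (mset (block_word 1 lam)) (sum_list lam - b) J w))"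
proof -
  let ?ts = "tensor_space n (sum_list lam) :: 'k tensor set"
  let ?s = "restrict (schur_op lam x) ?ts"
  let ?tab = "\<lambda>J. tab_tensor (mset (block_word 1 lam)) (sum_list lam - b) J :: 'k tensor"
  have s: "?s \<in> schur_algebra n (sum_list lam)" by (rule schur_op_schur[OF x])
  have gt: "gen_tensor lam \<in> ?ts" by (rule class_fun_tensor_space[OF gen_class[OF nl]])
  have lift: "phi_lift lam J x = schur_op lam x (?tab J)" if J: "J \<in> B_set lam b" for J
  proof -
    have "phi_lift lam J x = phi_lift lam J (?s (gen_tensor lam))" using gt schur_op_gen[OF x] by simp
    also have "\<dots> = ?s (phi_lift lam J (gen_tensor lam))"
      by (rule schur_place_op[OF s place_op_phi_lift[OF J] gt, symmetric])
    also have "\<dots> = schur_op lam x (?tab J)"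
      using phi_lift_gen[OF J pos, where 'k='k] schur_op_eq_schur[OF x tab[OF J]] by simp
    finally show ?thesis .
  qed
  interpret weyl: tensor_quotient "class_fun n h" "box_image n h :: 'k tensor set"
    by (rule weyl_quotient[OF nh])
  let ?f = "\<lambda>J w. of_int (d_coeff lam J) * schur_op lam x (?tab J) w"
  have "of_int (d_coeff lam J) \<odot>\<^bsub>weyl_module n h\<^esub> phi n lam h J x = coset (box_image n h) (?f J)"
    if J: "J \<in> B_set lam b" for J
    by (simp add: phi_def weyl_proj_eq lift[OF J] weyl_ops[OF nh])
  then have "psi n lam h b x = (\<Oplus>\<^bsub>weyl_module n h\<^esub>J\<in>B_set lam b. coset (box_image n h) (?f J))"
    unfolding psi_def weyl_module_eq
  proof (intro abelian_monoid.finsum_cong')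
    interpret M: Module.module class_ring weyl.Q by (rule weyl.module_Q)
    show "abelian_monoid weyl.Q" ..
    have "?f J \<in> class_fun n h" if "J \<in> B_set lam b" for J
      by (intro lin_sub_smult class_fun_lin_sub schur_op_class_fun x tab that)
    then show "(\<lambda>J. coset (box_image n h) (?f J)) \<in> B_set lam b \<rightarrow> carrier weyl.Q"
      unfolding weyl.carrier_Q by blast
  qed auto
  also have "\<dots> = coset (box_image n h) (\<lambda>w. \<Sum>J\<in>B_set lam b. ?f J w)"
    unfolding weyl_module_eq
    by (rule weyl.finsum_Q) (intro lin_sub_smult class_fun_lin_sub schur_op_class_fun x tab)
  also have "(\<lambda>w. \<Sum>J\<in>B_set lam b. ?f J w) = schur_op lam x (\<lambda>w. \<Sum>J\<in>B_set lam b. of_int (d_coeff lam J) * ?tab J w)"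
    unfolding schur_op_sum_right schur_op_smult_right ..
  finally show ?thesis .
qed

end

section \<open>Relations in the Weyl module of a hook\<close>

lemma content_replicate_1: "length v = b \<Longrightarrow> content (replicate b 1) v = map (\<lambda>x. {#x#}) v"
  by (induction v arbitrary: b) (auto simp: One_nat_def)

lemma content_replicate_1_eq:
  "length v = b \<Longrightarrow> length v' = b \<Longrightarrow> content (replicate b 1) v = content (replicate b 1) v' \<longleftrightarrow> v = v'"
  by (simp add: content_replicate_1 inj_map_eq_map inj_def)

lemma mset_take_drop: "mset w = mset (take k w) + mset (drop k w)"
  by (metis append_take_drop_id mset_append)

text \<open>Once the column is fixed, the content of the row and the content of the whole word
  determine each other.\<close>

lemma class_fun_hook:
  "f \<in> class_fun n (a # replicate b 1) \<longleftrightarrow> f \<in> tensor_space n (a + b) \<and>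
    (\<forall>w w'. length w = a + b \<longrightarrow> mset w = mset w' \<longrightarrow> drop a w = drop a w' \<longrightarrow> f w = f w')"
    (is "_ \<longleftrightarrow> _ \<and> ?inv")
proof (intro iffI conjI allI impI)
  assume f: "f \<in> class_fun n (a # replicate b 1)"
  show "f \<in> tensor_space n (a + b)" using class_fun_tensor_space[OF f] by (simp add: sum_list_replicate)
  fix w w' :: "nat list"
  assume w: "length w = a + b" "mset w = mset w'" "drop a w = drop a w'"
  have "mset (take a w) = mset (take a w')" using w(2,3) by (simp add: mset_take_drop[of w a] mset_take_drop[of w' a])
  then show "f w = f w'" using w mset_eq_length[OF w(2)] by (intro class_funD[OF f]) simp_all
next
  assume f: "f \<in> tensor_space n (a + b) \<and> ?inv"
  show "f \<in> class_fun n (a # replicate b 1)"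
  proof (rule class_funI)
    show "f \<in> tensor_space n (sum_list (a # replicate b 1))" using f by (simp add: sum_list_replicate)
    fix w w' :: "nat list"
    assume w: "length w = sum_list (a # replicate b 1)" "length w' = sum_list (a # replicate b 1)"
      "content (a # replicate b 1) w = content (a # replicate b 1) w'"
    have d: "drop a w = drop a w'"
      using w content_replicate_1_eq[of "drop a w" b "drop a w'"] by (simp add: sum_list_replicate)
    have "mset (take a w) = mset (take a w')" using w(3) by simp
    then have "mset w = mset w'" using d by (simp add: mset_take_drop[of w a] mset_take_drop[of w' a])
    then show "f w = f w'" using f d w(1) by (simp add: sum_list_replicate)
  qed
qed

lemma tab_tensor_class_fun:
  assumes "size M = a + b" "set_mset M \<subseteq> {1..n}"
  shows "tab_tensor M a v \<in> class_fun n (a # replicate b 1)"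
  unfolding class_fun_hook
proof
  show "tab_tensor M a v \<in> tensor_space n (a + b)"
    using assms by (intro tensor_spaceI) (auto simp: tab_tensor_def split: if_splits)
qed (simp add: tab_tensor_def)

text \<open>For \<open>i = 1\<close> the arm absorbs the first column box; otherwise two
  neighbouring column boxes merge into a part 2. A zero part stays behind and contributes an empty
  block.\<close>

lemma raise_hook:
  assumes "1 \<le> i" "i \<le> b"
  shows "raise (a # replicate b 1) i 1 = (if i = 1 then (a + 1) # 0 # replicate (b - 1) 1
    else a # replicate (i - 2) 1 @ 2 # 0 # replicate (b - i) 1)"
proof (cases "i = 1")
  case True
  then obtain b' where "b = Suc b'" using assms by (cases b) auto
  then show ?thesis using True by (simp add: raise_def part_def One_nat_def)
next
  case False
  define j where "j = i - 2"
  have i: "i = Suc (Suc j)" using False assms(1) by (simp add: j_def One_nat_def)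
  obtain k where b: "b = Suc (Suc j) + k" using assms(2) i by (metis le_Suc_ex)
  have "replicate b (1::nat) = replicate j 1 @ 1 # 1 # replicate k 1"
  proof -
    have "b = j + (2 + k)" using b by simp
    then have "replicate b (1::nat) = replicate j 1 @ replicate 2 1 @ replicate k 1" by (simp only: replicate_add)
    then show ?thesis by (simp add: numeral_2_eq_2)
  qed
  then have h: "a # replicate b (1::nat) = (a # replicate j 1) @ 1 # 1 # replicate k 1" by simp
  have p: "part (a # replicate b 1) i = 1" "part (a # replicate b 1) (i + 1) = 1"
    using assms i by (auto simp: part_def)
  define A where "A = a # replicate j (1::nat)"
  have iA: "i - 1 = length A" "i = Suc (length A)" using i by (simp_all add: A_def)
  have u: "(A @ 1 # 1 # B)[length A := x, Suc (length A) := y] = A @ x # y # B" for x y B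
    by (simp add: list_update_append)
  have "raise (a # replicate b 1) i 1 = (A @ 1 # 1 # replicate k 1)[length A := 1 + 1, Suc (length A) := 1 - 1]"
    unfolding raise_def p by (simp only: h A_def[symmetric] iA(1) iA(2)[symmetric])
  then have "raise (a # replicate b 1) i 1 = (a # replicate j 1) @ 2 # 0 # replicate k 1"
    unfolding u unfolding A_def by (simp only: one_add_one diff_self_eq_0)
  moreover have "i - 2 = j" "b - i = k" using i b by auto
  ultimately show ?thesis using False by simp
qed

lemma box_index_hook: "box_index (a # replicate b 1) = (\<lambda>i. (i, 1)) ` {1..b}"
proof -
  have "part (a # replicate b 1) (i + 1) = 1" if "1 \<le> i" "i < Suc b" for i
    using that by (cases i) (auto simp: part_def)
  then show ?thesis unfolding box_index_def by (force simp: image_def)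
qed

text \<open>Multiplying a factor of degree 1 by one of degree 0 changes nothing. For a hook the map
  box is therefore the inclusion of tensors with more symmetry.\<close>

lemma box_component_hook:
  assumes i: "1 \<le> i" "i \<le> b" and g: "g \<in> tensor_space n (a + b)"
  shows "box_component (a # replicate b 1) i 1 g = g"
proof
  fix w
  let ?h = "a # replicate b 1"
  have T: "place_op (a + b) (box_component ?h i 1 :: 'a tensor \<Rightarrow> _)"
    using place_op_box_component[of i ?h 1] i by (simp add: sum_list_replicate)
  show "box_component ?h i 1 g w = g w"
  proof (cases "length w = a + b")
    case True
    obtain j where j: "i = Suc j" using i(1) by (cases i) auto
    define p where "p = sum_list (take i ?h)"
    have p: "p < length w" using i True j by (simp add: p_def sum_list_replicate min_def)
    have pt: "part ?h (i + 1) = 1" using i j by (auto simp: part_def)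
    define x where "x = w ! p"
    have w: "take p w @ [x] @ drop (p + 1) w = w" using p id_take_nth_drop[of p w] by (simp add: x_def One_nat_def)
    have tk: "take 1 (drop p w) = [x]" using p by (simp add: x_def One_nat_def take_Suc hd_drop_conv_nth)
    have D: "D_mult 1 f [x] = f [x]" for f :: "'a tensor"
    proof -
      have "{A. A \<subseteq> {..<length [x]} \<and> card A = 1} = {{0}}"
        by (auto simp: One_nat_def card_Suc_eq)
      then show ?thesis by (simp add: D_mult_def nths_Cons)
    qed
    show ?thesis using w by (simp add: box_component_def on_places_def pt p_def[symmetric] tk D)
  next
    case False
    then show ?thesis using tensor_spaceD(2)[OF g] tensor_spaceD(2)[OF place_op_tensor_space[OF T g]] by simp
  qed
qed

lemma content_swap:
  assumes "sum_list A \<le> length u" "length u + 2 \<le> sum_list A + c"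
  shows "content (A @ c # B) (u @ x # y # v) = content (A @ c # B) (u @ y # x # v)"
proof -
  define U e where "U = drop (sum_list A) u" and "e = sum_list A + c - length u - 2"
  have c: "c = length U + Suc (Suc e)" using assms by (simp add: U_def e_def)
  have t: "take (sum_list A) (u @ z) = take (sum_list A) u" and d: "drop (sum_list A) (u @ z) = U @ z" for z
    using assms(1) by (simp_all add: U_def)
  have "take c (U @ p # q # v) = U @ p # q # take e v" "drop c (U @ p # q # v) = drop e v" for p q
    unfolding c by simp_all
  then show ?thesis by (simp add: blocks_append t d del: take_append drop_append)
qed

locale hook_contextqed

locale hook_context =
  fixes n a b :: nat
  assumes a: "1 \<le> a" and bn: "b + 1 \<le> n"
begin

abbreviation hk :: "nat list" where "hk \<equiv> a # replicate b 1"

lemma hk_facts: "length hk \<le> n" "sum_list hk = a + b"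
  using bn by (simp_all add: sum_list_replicate)

text \<open>The relations say that a tensor vanishes in the Weyl module if it is symmetric in the first
  \<open>a + 1\<close> places or in two consecutive places of the column.\<close>

lemma box_image_hook_row:
  assumes b: "1 \<le> b" and f: "f \<in> tensor_space n (a + b)"
    and inv: "\<And>w w'. length w = a + b \<Longrightarrow> mset w = mset w' \<Longrightarrow> drop (a + 1) w = drop (a + 1) w' \<Longrightarrow> f w = f w'"
  shows "(f :: 'k::field tensor) \<in> box_image n hk"
proof -
  have rh: "raise hk 1 1 = (a + 1) # 0 # replicate (b - 1) 1" using raise_hook[of 1 b a] b by simp
  have "f \<in> class_fun n (raise hk 1 1)"
    unfolding rh
  proof (rule class_funI)
    show "f \<in> tensor_space n (sum_list ((a + 1) # 0 # replicate (b - 1) 1))"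
      using f b by (simp add: sum_list_replicate)
    fix w w' :: "nat list"
    assume w: "length w = sum_list ((a + 1) # 0 # replicate (b - 1) 1)" "length w' = sum_list ((a + 1) # 0 # replicate (b - 1) 1)"
      "content ((a + 1) # 0 # replicate (b - 1) 1) w = content ((a + 1) # 0 # replicate (b - 1) 1) w'"
    have l: "length w = a + b" "length w' = a + b" using w b by (auto simp: sum_list_replicate)
    have d: "drop (a + 1) w = drop (a + 1) w'"
      using w(3) l b content_replicate_1_eq[of "drop (a + 1) w" "b - 1" "drop (a + 1) w'"] by simp
    have "mset (take (a + 1) w) = mset (take (a + 1) w')" using w(3) by simp
    then have "mset w = mset w'" using d by (simp add: mset_take_drop[of w "a + 1"] mset_take_drop[of w' "a + 1"])
    then show "f w = f w'" by (rule inv[OF l(1) _ d])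
  qed
  moreover have "(1, 1) \<in> box_index hk" using b by (auto simp: box_index_hook)
  ultimately have "box_component hk 1 1 f \<in> box_image n hk"
    using box_component_box_image[OF hk_facts(1)] by blast
  then show ?thesis using box_component_hook[of 1 b f n a] b f by simp
qed

lemma box_image_hook_column:
  assumes f: "f \<in> class_fun n hk" and s: "j + 2 \<le> b"
    and inv: "\<And>u x y v. length u = a + j \<Longrightarrow> length u + 2 + length v = a + b \<Longrightarrow> f (u @ x # y # v) = f (u @ y # x # v)"
  shows "(f :: 'k::field tensor) \<in> box_image n hk"
proof -
  define i where "i = j + 2"
  have i: "1 \<le> i" "i \<le> b" "i \<noteq> 1" using s by (auto simp: i_def)
  let ?R = "replicate (b - i) (1::nat)"
  have rh: "raise hk i 1 = (a # replicate j 1) @ 2 # 0 # ?R"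
    using raise_hook[OF i(1,2), of a] i(3) by (simp add: i_def)
  have ft: "f \<in> tensor_space n (a + b)" using class_fun_tensor_space[OF f] by (simp add: sum_list_replicate)
  have sb: "sum_list (raise hk i 1) = a + b" unfolding rh using i by (simp add: sum_list_replicate i_def)
  have sA: "sum_list (a # replicate j (1::nat)) = a + j" by (simp add: sum_list_replicate)
  have "f \<in> class_fun n (raise hk i 1)"
  proof (rule class_funI)
    show "f \<in> tensor_space n (sum_list (raise hk i 1))" unfolding sb by (rule ft)
    fix w w' :: "nat list"
    assume w: "length w = sum_list (raise hk i 1)" "length w' = sum_list (raise hk i 1)"
      "content (raise hk i 1) w = content (raise hk i 1) w'"
    have l: "length w = a + b" "length w' = a + b" using w sb by auto
    have ex: "\<exists>u1 u2 x y v. z = u1 @ u2 @ x # y # v \<and> length u1 = a \<and> length u2 = j \<and> length v = b - i"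
      if "length z = a + b" for z :: "nat list"
    proof -
      have "length (drop (a + j) z) = Suc (Suc (b - i))" using that s by (simp add: i_def)
      then obtain x y v where xy: "drop (a + j) z = x # y # v" "length v = b - i"
        unfolding length_Suc_conv by blast
      have "take j (drop a z) @ drop (a + j) z = drop a z"
        by (metis append_take_drop_id drop_drop add.commute)
      then have "z = take a z @ take j (drop a z) @ drop (a + j) z" by simp
      then show ?thesis unfolding xy(1)
        by (intro exI conjI) (assumption, use that s xy(2) in auto)
    qed
    obtain u1 u2 x y v where z: "w = u1 @ u2 @ x # y # v" "length u1 = a" "length u2 = j" "length v = b - i"
      using ex[OF l(1)] by blast
    obtain u1' u2' x' y' v' where z': "w' = u1' @ u2' @ x' # y' # v'" "length u1' = a" "length u2' = j" "length v' = b - i"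
      using ex[OF l(2)] by blast
    have cont: "content (raise hk i 1) (p @ q @ c # d # e)
        = mset p # content (replicate j 1) q @ {#c, d#} # {#} # content ?R e"
      if "length p = a" "length q = j" for p q e :: "nat list" and c d
      unfolding rh using that by (simp add: blocks_append sum_list_replicate numeral_2_eq_2)
    have e: "mset u1 = mset u1'" "content (replicate j 1) u2 = content (replicate j 1) u2'"
      "{#x, y#} = {#x', y'#}" "content ?R v = content ?R v'"
      using w(3) unfolding z(1) z'(1) cont[OF z(2,3)] cont[OF z'(2,3)]
      by (auto simp: append_eq_append_conv content_replicate_1[OF z(3)] content_replicate_1[OF z'(3)] z(3) z'(3))
    have e2: "u2 = u2'" "v = v'"
      using e(2,4) content_replicate_1_eq[OF z(3) z'(3)] content_replicate_1_eq[OF z(4) z'(4)] by auto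
    have fc: "f (u1 @ t) = f (u1' @ t)" if "length t = b" for t
      using f e(1) z(2) z'(2) that unfolding class_fun_hook by auto
    have lt: "length (u2 @ p # q # v) = b" for p q using z s by (simp add: i_def)
    have "(x = x' \<and> y = y') \<or> (x = y' \<and> y = x')"
      using e(3) by (auto simp: add_eq_conv_ex)
    then show "f w = f w'"
    proof
      assume "x = x' \<and> y = y'"
      then show ?thesis using fc[OF lt] e2 by (simp add: z(1) z'(1))
    next
      assume xy: "x = y' \<and> y = x'"
      have "f ((u1 @ u2) @ x # y # v) = f ((u1 @ u2) @ y # x # v)"
        using z s by (intro inv) (auto simp: i_def)
      then show ?thesis using fc[OF lt, of y x] e2 xy by (simp add: z(1) z'(1))
    qed
  qed
  moreover have "(i, 1) \<in> box_index hk" using i by (auto simp: box_index_hook)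
  ultimately have "box_component hk i 1 f \<in> box_image n hk"
    using box_component_box_image[OF hk_facts(1)] by blast
  then show ?thesis using box_component_hook[OF i(1,2) ft] by simp
qed

text \<open>Of the i-th summand only the symmetry in the places a+i-1 and a+i, counted from 1, is
  kept. This is all that antisymmetrisation needs in order to vanish on it.\<close>

lemma box_image_hook_elim:
  assumes z: "z \<in> (box_image n hk :: 'k::field tensor set)"
  obtains g where "z = (\<lambda>w. \<Sum>i\<in>{1..b}. g i w)"
    "\<And>i u x y v. i \<in> {1..b} \<Longrightarrow> length u + 2 = a + i \<Longrightarrow> g i (u @ x # y # v) = g i (u @ y # x # v)"
proof -
  obtain x where x: "z = (\<lambda>w. \<Sum>(i, t)\<in>box_index hk. box_component hk i t (x i t) w)"
    "\<forall>(i, t)\<in>box_index hk. x i t \<in> class_fun n (raise hk i t)"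
    using z unfolding box_image_alt[OF hk_facts(1)] by blast
  have c: "x i 1 \<in> class_fun n (raise hk i 1)" if "i \<in> {1..b}" for i
    using x(2) that unfolding box_index_hook by auto
  have bc: "box_component hk i 1 (x i 1) = x i 1" if i: "i \<in> {1..b}" for i
  proof -
    have "sum_list (raise hk i 1) = a + b"
      using i sum_list_raise[of i hk 1] by (auto simp: sum_list_replicate part_def)
    then have "x i 1 \<in> tensor_space n (a + b)" using class_fun_tensor_space[OF c[OF i]] by simp
    then show ?thesis using i by (intro box_component_hook) auto
  qed
  have "z = (\<lambda>w. \<Sum>i\<in>{1..b}. x i 1 w)"
    unfolding x(1) box_index_hook
    by (subst sum.reindex) (auto simp: inj_on_def bc intro!: ext sum.cong)
  moreover have "x i 1 (u @ p # q # v) = x i 1 (u @ q # p # v)"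
    if i: "i \<in> {1..b}" and u: "length u + 2 = a + i" for i u p q v
  proof (rule class_funD[OF c[OF i]])
    show "content (raise hk i 1) (u @ p # q # v) = content (raise hk i 1) (u @ q # p # v)"
    proof (cases "i = 1")
      case True
      have "content ([] @ (a + 1) # 0 # replicate (b - 1) 1) (u @ p # q # v)
          = content ([] @ (a + 1) # 0 # replicate (b - 1) 1) (u @ q # p # v)"
        using u True by (intro content_swap) auto
      then show ?thesis using raise_hook[of i b a] i True by simp
    next
      case False
      have "content ((a # replicate (i - 2) 1) @ 2 # 0 # replicate (b - i) 1) (u @ p # q # v)
          = content ((a # replicate (i - 2) 1) @ 2 # 0 # replicate (b - i) 1) (u @ q # p # v)"
        using u False i by (intro content_swap) (auto simp: sum_list_replicate)
      then show ?thesis using raise_hook[of i b a] i False by simp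
    qed
  qed simp
  ultimately show ?thesis using that[of "\<lambda>i. x i 1"] by blast
qed

end

section \<open>Straightening\<close>

text \<open>Earlier letters have larger weight, so turning a descent into an ascent lowers the
  value; it is the termination measure of straightening.\<close>

fun straight_measure :: "nat list \<Rightarrow> nat" where
  "straight_measure [] = 0"
| "straight_measure (x # xs) = Suc (length xs) * x + straight_measure xs"

lemma straight_measure_swap:
  "q < p \<Longrightarrow> straight_measure (s @ q # p # t) < straight_measure (s @ p # q # t)"
  by (induction s) (auto simp: algebra_simps)

lemma not_sorted_adjacent:
  "\<not> sorted_wrt (<) (v :: nat list) \<Longrightarrow> \<exists>s p q t. v = s @ p # q # t \<and> q \<le> p"
proof (induction v)
  case (Cons x v)
  show ?case
  proof (cases "sorted_wrt (<) v")
    case False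
    then obtain s p q t where "v = s @ p # q # t" "q \<le> p" using Cons.IH by blast
    then show ?thesis by (intro exI[of _ "x # s"] exI) auto
  next
    case True
    then obtain y t where v: "v = y # t" using Cons.prems by (cases v) auto
    have "\<not> x < y"
    proof
      assume "x < y"
      then have "sorted_wrt (<) (x # v)" using True unfolding v by auto
      then show False using Cons.prems by simp
    qed
    then show ?thesis unfolding v by (intro exI[of _ "[]"] exI) auto
  qed
qed simp

lemma tab_tensor_swap:
  assumes "length u = a + length s"
  shows "tab_tensor M a (s @ p # q # t) (u @ x # y # v) = tab_tensor M a (s @ q # p # t) (u @ y # x # v)"
proof -
  have m: "mset (u @ x # y # v) = mset (u @ y # x # v)" by (simp add: add_mset_commute)
  have d: "drop a (u @ x # y # v) = s @ p # q # t \<longleftrightarrow> drop a (u @ y # x # v) = s @ q # p # t"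
    using assms by auto
  show ?thesis unfolding tab_tensor_def m d ..
qed

context hook_context
begin

text \<open>The sum of the two tableaux is symmetric in the two places, and so is a single tableau
  with equal entries there. In characteristic 2 the second relation does not follow from the
  first.\<close>

lemma column_relation:
  assumes M: "size M = a + b" "set_mset M \<subseteq> {1..n}" and l: "length (s @ p # q # t) = b"
  shows "(\<lambda>w. tab_tensor M a (s @ p # q # t) w + tab_tensor M a (s @ q # p # t) w) \<in> (box_image n hk :: 'k::field tensor set)"
    and "p = q \<Longrightarrow> (tab_tensor M a (s @ p # q # t) :: 'k tensor) \<in> box_image n hk"
proof -
  have T: "(tab_tensor M a v :: 'k tensor) \<in> class_fun n hk" for v by (rule tab_tensor_class_fun[OF M])
  show "(\<lambda>w. tab_tensor M a (s @ p # q # t) w + tab_tensor M a (s @ q # p # t) w) \<in> (box_image n hk :: 'k tensor set)"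
  proof (rule box_image_hook_column[OF lin_sub_add[OF class_fun_lin_sub T T]])
    show "length s + 2 \<le> b" using l by simp
    fix u x y v assume "length (u :: nat list) = a + length s"
    then show "tab_tensor M a (s @ p # q # t) (u @ x # y # v) + tab_tensor M a (s @ q # p # t) (u @ x # y # v)
        = tab_tensor M a (s @ p # q # t) (u @ y # x # v) + (tab_tensor M a (s @ q # p # t) (u @ y # x # v) :: 'k)"
      using tab_tensor_swap[of u a s M p q t x y v, where 'a='k] tab_tensor_swap[of u a s M q p t x y v, where 'a='k]
      by (simp add: add.commute)
  qed
  show "(tab_tensor M a (s @ p # q # t) :: 'k tensor) \<in> box_image n hk" if "p = q"
  proof (rule box_image_hook_column[OF T])
    show "length s + 2 \<le> b" using l by simp
    fix u x y v assume "length (u :: nat list) = a + length s"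
    then show "tab_tensor M a (s @ p # q # t) (u @ x # y # v) = (tab_tensor M a (s @ p # q # t) (u @ y # x # v) :: 'k)"
      using tab_tensor_swap[of u a s M p q t x y v, where 'a='k] that by simp
  qed
qed

text \<open>Summing over the top entry of the column forgets which letter stands in place
  \<open>a + 1\<close>, so the sum is symmetric in the first \<open>a + 1\<close> places.\<close>

lemma row_relation:
  assumes M: "size M = a + b" "set_mset M \<subseteq> {1..n}" and l: "Suc (length v) = b"
  shows "(\<lambda>w. \<Sum>c\<in>set_mset M. tab_tensor M a (c # v) w) \<in> (box_image n hk :: 'k::field tensor set)"
proof (rule box_image_hook_row)
  show "1 \<le> b" using l by simp
  have "(\<lambda>w. \<Sum>c\<in>set_mset M. tab_tensor M a (c # v) w) \<in> (class_fun n hk :: 'k tensor set)"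
    by (intro lin_sub_sum class_fun_lin_sub tab_tensor_class_fun M)
  from class_fun_tensor_space[OF this]
  show "(\<lambda>w. \<Sum>c\<in>set_mset M. tab_tensor M a (c # v) w) \<in> (tensor_space n (a + b) :: 'k tensor set)"
    by (simp add: sum_list_replicate)
  have ev: "(\<Sum>c\<in>set_mset M. tab_tensor M a (c # v) w) = (if mset w = M \<and> drop (a + 1) w = v then 1 else (0 :: 'k))"
    if w: "length w = a + b" for w
  proof -
    have d: "drop a w = w ! a # drop (a + 1) w" using w l Cons_nth_drop_Suc[of a w] by (simp add: One_nat_def)
    have "(\<Sum>c\<in>set_mset M. tab_tensor M a (c # v) w)
        = (\<Sum>c\<in>set_mset M. if c = w ! a then if mset w = M \<and> drop (a + 1) w = v then 1 else 0 else 0)"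
      by (intro sum.cong) (auto simp: tab_tensor_def d)
    also have "\<dots> = (if w ! a \<in> set_mset M then if mset w = M \<and> drop (a + 1) w = v then 1 else 0 else 0)"
      by (rule sum.delta) simp
    also have "\<dots> = (if mset w = M \<and> drop (a + 1) w = v then 1 else 0)"
      using w l by auto
    finally show ?thesis .
  qed
  fix w w' :: "nat list"
  assume w: "length w = a + b" "mset w = mset w'" "drop (a + 1) w = drop (a + 1) w'"
  have "length w' = a + b" using w(1) mset_eq_length[OF w(2)] by simp
  then show "(\<Sum>c\<in>set_mset M. tab_tensor M a (c # v) w) = (\<Sum>c\<in>set_mset M. tab_tensor M a (c # v) w' :: 'k)"
    using ev[OF w(1)] ev[of w'] w by simp
qed

text \<open>Column relations sort the column. If it then begins with 1, the row relation expresses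
  the tableau by tableaux with another letter on top; these have no 1 in the column, since 1
  occurred only once.\<close>

lemma straighten:
  fixes U :: "'k::field tensor set"
  assumes M: "size M = a + b" "set_mset M \<subseteq> {1..n}" and U: "lin_sub U" and box: "box_image n hk \<subseteq> U"
    and std: "\<And>v. length v = b \<Longrightarrow> sorted_wrt (<) v \<Longrightarrow> 1 \<notin> set v \<Longrightarrow> set v \<subseteq> set_mset M \<Longrightarrow> tab_tensor M a v \<in> U"
    and v: "length v = b" "set v \<subseteq> set_mset M"
  shows "tab_tensor M a v \<in> U"
proof -
  have swap: "tab_tensor M a (s @ p # q # t) \<in> U"
    if l: "length (s @ p # q # t) = b" and qp: "q \<le> p" and IH: "q < p \<Longrightarrow> tab_tensor M a (s @ q # p # t) \<in> U" for s p q t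
  proof (cases "p = q")
    case True
    then show ?thesis using column_relation(2)[OF M l] box by blast
  next
    case False
    have "(\<lambda>w. (tab_tensor M a (s @ p # q # t) w + tab_tensor M a (s @ q # p # t) w) - tab_tensor M a (s @ q # p # t) w) \<in> U"
      by (rule lin_sub_diff[OF U subsetD[OF box column_relation(1)[OF M l]] IH]) (use False qp in simp)
    then show ?thesis by simp
  qed
  \<comment> \<open>Columns without 1 are treated separately because replacing a top entry 1 by a
    larger letter raises the measure.\<close>
  have no1: "tab_tensor M a v \<in> U" if "length v = b" "set v \<subseteq> set_mset M" "1 \<notin> set v" for v
    using that
  proof (induction "straight_measure v" arbitrary: v rule: less_induct)
    case less
    show ?case
    proof (cases "sorted_wrt (<) v")
      case True
      then show ?thesis using std less.prems by blast
    next
      case False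
      then obtain s p q t where v: "v = s @ p # q # t" "q \<le> p" using not_sorted_adjacent by blast
      show ?thesis unfolding v(1)
      proof (rule swap)
        assume "q < p"
        then show "tab_tensor M a (s @ q # p # t) \<in> U"
          using less.prems straight_measure_swap[of q p s t] v(1) by (intro less.hyps) auto
      qed (use less.prems v in auto)
    qed
  qed
  show ?thesis
    using v
  proof (induction "straight_measure v" arbitrary: v rule: less_induct)
    case less
    show ?case
    proof (cases "sorted_wrt (<) v")
      case False
      then obtain s p q t where v: "v = s @ p # q # t" "q \<le> p" using not_sorted_adjacent by blast
      show ?thesis unfolding v(1)
      proof (rule swap)
        assume "q < p"
        then show "tab_tensor M a (s @ q # p # t) \<in> U"
          using less.prems straight_measure_swap[of q p s t] v(1) by (intro less.hyps) auto
      qed (use less.prems v in auto)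
    next
      case True
      show ?thesis
      proof (cases "1 \<in> set v")
        case False
        then show ?thesis using no1 less.prems by blast
      next
        case 1: True
        then obtain x v' where xv: "v = x # v'" by (cases v) auto
        have gt: "x < y" if "y \<in> set v'" for y using True that unfolding xv by simp
        have "1 \<le> x" using less.prems(2) M(2) unfolding xv by auto
        then have x: "x = 1" "1 \<notin> set v'" using 1 gt unfolding xv by force+
        have l: "Suc (length v') = b" using less.prems(1) xv by simp
        have 1: "1 \<in> set_mset M" using less.prems(2) xv x by auto
        have "(\<lambda>w. (\<Sum>c\<in>set_mset M. tab_tensor M a (c # v') w) - (\<Sum>c\<in>set_mset M - {1}. tab_tensor M a (c # v') w)) \<in> U"
          by (intro lin_sub_diff U subsetD[OF box row_relation[OF M l]] lin_sub_sum no1)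
            (use l less.prems(2) xv x in auto)
        moreover have "(\<Sum>c\<in>set_mset M. tab_tensor M a (c # v') w) - (\<Sum>c\<in>set_mset M - {1}. tab_tensor M a (c # v') w)
            = (tab_tensor M a v w :: 'k)" for w
          using sum.remove[OF finite_set_mset 1, of "\<lambda>c. tab_tensor M a (c # v') w :: 'k"] xv x by simp
        ultimately show ?thesis by simp
      qed
    qed
  qed
qed

text \<open>In a fixed weight an element of the hook module depends only on the column part of the
  word, so it is the combination of tableaux with these values as coefficients.\<close>

lemma tab_tensor_span:
  fixes U :: "'k::field tensor set"
  assumes M: "size M = a + b" "set_mset M \<subseteq> {1..n}" and U: "lin_sub U"
    and tab: "\<And>v. length v = b \<Longrightarrow> set v \<subseteq> set_mset M \<Longrightarrow> tab_tensor M a v \<in> U"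
    and y: "y \<in> class_fun n hk" "\<And>w. y w \<noteq> 0 \<Longrightarrow> mset w = M"
  shows "y \<in> U"
proof -
  define W where "W = {w. mset w = M}"
  define rep where "rep v = (SOME w. w \<in> W \<and> drop a w = v)" for v
  have rep: "rep v \<in> W \<and> drop a (rep v) = v" if v: "v \<in> drop a ` W" for v
  proof -
    have "\<exists>w. w \<in> W \<and> drop a w = v" using v by auto
    then show ?thesis unfolding rep_def by (rule someI_ex)
  qed
  have fin: "finite (drop a ` W)" using finite_mset_words[of M] by (simp add: W_def)
  have len: "length w = a + b" if "w \<in> W" for w using that M(1) by (auto simp: W_def)
  have "y w = (\<Sum>v\<in>drop a ` W. y (rep v) * tab_tensor M a v w)" for w
  proof -
    have "(\<Sum>v\<in>drop a ` W. y (rep v) * tab_tensor M a v w)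
        = (\<Sum>v\<in>drop a ` W. if v = drop a w then (if mset w = M then y (rep (drop a w)) else 0) else 0)"
      by (intro sum.cong) (auto simp: tab_tensor_def)
    also have "\<dots> = (if drop a w \<in> drop a ` W then (if mset w = M then y (rep (drop a w)) else 0) else 0)"
      by (rule sum.delta[OF fin])
    also have "\<dots> = y w"
    proof (cases "mset w = M")
      case True
      then have w: "w \<in> W" by (simp add: W_def)
      then have dw: "drop a w \<in> drop a ` W" by blast
      have "y (rep (drop a w)) = y w"
      proof -
        have r: "rep (drop a w) \<in> W" "drop a (rep (drop a w)) = drop a w" using rep[OF dw] by auto
        have "mset (rep (drop a w)) = mset w" using r(1) unfolding W_def True by (rule CollectD)
        from conjunct2[OF y(1)[unfolded class_fun_hook], rule_format, OF len[OF r(1)] this r(2)]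
        show ?thesis .
      qed
      then show ?thesis using dw True by simp
    qed (use y(2) in auto)
    finally show ?thesis by simp
  qed
  then have "y = (\<lambda>w. \<Sum>v\<in>drop a ` W. y (rep v) * tab_tensor M a v w)" by (rule ext)
  also have "\<dots> \<in> U"
  proof (intro lin_sub_sum lin_sub_smult U tab)
    fix v assume "v \<in> drop a ` W"
    then obtain w where w: "w \<in> W" "v = drop a w" by auto
    show "length v = b" using w len by simp
    show "set v \<subseteq> set_mset M" using w set_drop_subset[of a w] by (auto simp: W_def)
  qed
  finally show ?thesis .
qed

end

section \<open>Coordinates of the Weyl module of a hook\<close>

fun inversions :: "nat list \<Rightarrow> nat" where
  "inversions [] = 0"
| "inversions (x # xs) = length (filter (\<lambda>y. y < x) xs) + inversions xs"

lemma inversions_swap: "p < q \<Longrightarrow> inversions (s @ q # p # t) = Suc (inversions (s @ p # q # t))"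
  by (induction s) auto

lemma inversions_sorted: "sorted_wrt (<) v \<Longrightarrow> inversions v = 0"
  by (induction v) (auto simp: filter_empty_conv)

text \<open>The functional which reads off a coefficient after antisymmetrising the last \<open>b + 1\<close> places,
  i.e. after the Koszul map \<open>D\<^sub>a \<otimes> \<Lambda>\<^sup>b \<rightarrow> D\<^bsub>a-1\<^esub> \<otimes> \<Lambda>\<^bsup>b+1\<^esup>\<close>, whose image is the Weyl module of the hook.\<close>

definition koszul_coeff :: "nat list \<Rightarrow> nat list \<Rightarrow> 'k::field tensor \<Rightarrow> 'k" where
  "koszul_coeff u z0 y = (\<Sum>z | mset z = mset z0. (-1) ^ inversions z * y (u @ z))"

lemma koszul_coeff_sum: "koszul_coeff u z0 (\<lambda>w. \<Sum>i\<in>I. f i w) = (\<Sum>i\<in>I. koszul_coeff u z0 (f i))"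
  by (simp add: koszul_coeff_def sum_distrib_left sum.swap[of _ I])

lemma koszul_coeff_smult: "koszul_coeff u z0 (\<lambda>w. c * f w) = c * koszul_coeff u z0 f"
  by (simp add: koszul_coeff_def sum_distrib_left mult.left_commute)

lemma koszul_coeff_diff: "koszul_coeff u z0 (\<lambda>w. f w - g w) = koszul_coeff u z0 f - koszul_coeff u z0 g"
  by (simp add: koszul_coeff_def sum_subtractf algebra_simps)

lemma koszul_coeff_add: "koszul_coeff u z0 (\<lambda>w. f w + g w) = koszul_coeff u z0 f + koszul_coeff u z0 g"
  by (simp add: koszul_coeff_def sum.distrib algebra_simps)

text \<open>\<open>P\<close> splits the index set into two halves exchanged by \<open>sw\<close>,
  and terms cancel in pairs. The splitting is needed in characteristic 2, where a sum equal to its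
  negative need not vanish.\<close>

lemma sum_sign_involution:
  assumes Z: "finite Z" and sw: "\<And>z. z \<in> Z \<Longrightarrow> sw z \<in> Z \<and> sw (sw z) = z \<and> (P (sw z) \<longleftrightarrow> \<not> P z) \<and> G (sw z) = - (G z :: 'k::field)"
  shows "sum G Z = 0"
proof -
  have "sum G {z\<in>Z. \<not> P z} = sum (\<lambda>z. - G z) {z\<in>Z. P z}"
    by (rule sum.reindex_bij_witness[of _ sw sw]) (use sw in auto)
  moreover have "sum G Z = sum G {z\<in>Z. P z} + sum G {z\<in>Z. \<not> P z}"
    using sum.union_disjoint[of "{z\<in>Z. P z}" "{z\<in>Z. \<not> P z}" G] Z
    by (simp add: Un_def conj_disj_distribL[symmetric] disjoint_iff)
  ultimately show ?thesis by (simp add: sum_negf)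
qed

text \<open>Exchanging the letters at positions \<open>i\<close> and \<open>i + 1\<close> of
  \<open>z\<close> changes the parity of the inversions, as the letters are distinct, and leaves the
  value of \<open>g\<close> unchanged.\<close>

lemma koszul_coeff_symmetric:
  assumes d: "distinct z0" and i: "i + 2 \<le> length z0"
    and g: "\<And>s x y t. length s = i \<Longrightarrow> g (u @ s @ x # y # t) = g (u @ s @ y # x # t)"
  shows "koszul_coeff u z0 g = 0"
proof -
  define sw where "sw z = take i z @ z ! Suc i # z ! i # drop (Suc (Suc i)) z" for z :: "nat list"
  have sw_eq: "sw (s @ x # y # t) = s @ y # x # t" if "length s = i" for s x y t
    using that by (simp add: sw_def nth_append)
  have ex: "\<exists>s x y t. z = s @ x # y # t \<and> length s = i \<and> x \<noteq> y" if z: "mset z = mset z0" for z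
  proof -
    have l: "length z = length z0" by (rule mset_eq_length[OF z])
    have dz: "distinct z" using d mset_eq_imp_distinct_iff[OF z] by simp
    have "drop i z = z ! i # z ! Suc i # drop (Suc (Suc i)) z"
      using l i Cons_nth_drop_Suc[of i z] Cons_nth_drop_Suc[of "Suc i" z] by simp
    then have e: "z = take i z @ z ! i # z ! Suc i # drop (Suc (Suc i)) z" by (metis append_take_drop_id)
    have "z ! i \<noteq> z ! Suc i" using dz l i by (simp add: nth_eq_iff_index_eq)
    moreover have "length (take i z) = i" using l i by simp
    ultimately show ?thesis using e by blast
  qed
  show ?thesis
    unfolding koszul_coeff_def
  proof (rule sum_sign_involution[where sw = sw and P = "\<lambda>z. z ! i < z ! Suc i"])
    show "finite {z. mset z = mset z0}" by (rule finite_mset_words)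
    fix z assume "z \<in> {z. mset z = mset z0}"
    then have z: "mset z = mset z0" by simp
    obtain s x y t where zz: "z = s @ x # y # t" "length s = i" "x \<noteq> y" using ex[OF z] by blast
    have "inversions (s @ y # x # t) = Suc (inversions (s @ x # y # t)) \<or> inversions (s @ x # y # t) = Suc (inversions (s @ y # x # t))"
      using inversions_swap[of x y s t] inversions_swap[of y x s t] zz(3) by (cases "x < y") auto
    then have "(-1) ^ inversions (s @ y # x # t) = - ((-1) ^ inversions (s @ x # y # t) :: 'a)" by auto
    then show "sw z \<in> {z. mset z = mset z0} \<and> sw (sw z) = z \<and> (sw z ! i < sw z ! Suc i \<longleftrightarrow> \<not> z ! i < z ! Suc i)
        \<and> (-1) ^ inversions (sw z) * g (u @ sw z) = - ((-1) ^ inversions z * g (u @ z))"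
      using z zz g[OF zz(2)] unfolding zz(1) sw_eq[OF zz(2)] by (auto simp: nth_append add_mset_commute)
  qed
qed

text \<open>\<open>u\<close> has \<open>a - 1\<close> letters, so the first letter of
  \<open>z\<close> falls into the last place of the row and only the tail of \<open>z\<close> is
  compared with the column.\<close>

lemma koszul_coeff_tab_tensor:
  assumes u: "Suc (length u) = a" and M: "mset u + mset z0 = M" and z0: "z0 \<noteq> []"
  shows "koszul_coeff u z0 (tab_tensor M a x) = (\<Sum>z | mset z = mset z0 \<and> tl z = x. (-1) ^ inversions z)"
proof -
  have "(-1) ^ inversions z * tab_tensor M a x (u @ z) = (if tl z = x then (-1) ^ inversions z else 0 :: 'a)"
    if z: "mset z = mset z0" for z
  proof -
    have "drop a (u @ z) = tl z" using u by (simp add: drop_Suc flip: u)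
    then show ?thesis using z M by (simp add: tab_tensor_def)
  qed
  then have "koszul_coeff u z0 (tab_tensor M a x) = (\<Sum>z | mset z = mset z0. if tl z = x then (-1) ^ inversions z else 0 :: 'a)"
    unfolding koszul_coeff_def by (intro sum.cong) auto
  also have "\<dots> = (\<Sum>z\<in>{z\<in>{z. mset z = mset z0}. tl z = x}. (-1) ^ inversions z)"
    by (rule sum.inter_filter[OF finite_mset_words, symmetric])
  finally show ?thesis by simp
qed

lemma strict_sorted_mset_eq:
  "sorted_wrt (<) (x :: nat list) \<Longrightarrow> sorted_wrt (<) v \<Longrightarrow> mset x = mset v \<Longrightarrow> x = v"
  by (metis properties_for_sort strict_sorted_imp_sorted sorted_sort_id)

context
  fixes u v :: "nat list" and a :: nat and M :: "nat multiset"
  assumes u: "Suc (length u) = a" and M: "mset u + mset (1 # v) = M"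
    and v: "sorted_wrt (<) v" "\<And>x. x \<in> set v \<Longrightarrow> 1 < x"
begin

text \<open>A column without 1 forces the letter 1 to the head of \<open>z\<close>, which leaves
  \<open>x = v\<close> as the only possibility. The functionals are thus dual to the standard
  tableaux.\<close>

lemma koszul_coeff_standard:
  assumes x: "sorted_wrt (<) x" "1 \<notin> set x"
  shows "koszul_coeff u (1 # v) (tab_tensor M a x) = (if x = v then 1 else (0 :: 'k::field))"
proof -
  have "{z. mset z = mset (1 # v) \<and> tl z = x} = (if x = v then {1 # v} else {})"
  proof -
    have "z = 1 # v \<and> x = v" if z: "mset z = mset (1 # v)" "tl z = x" for z
    proof -
      obtain c where c: "z = c # x" using z by (cases z) auto
      have "1 \<in> set z" using mset_eq_setD[OF z(1)] by simp
      then have "c = 1" using c x(2) by auto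
      then have "mset x = mset v" using z(1) c by simp
      then show ?thesis using strict_sorted_mset_eq[OF x(1) v(1)] c \<open>c = 1\<close> by simp
    qed
    then show ?thesis by auto
  qed
  moreover have "inversions (1 # v) = 0" using v by (intro inversions_sorted) auto
  moreover have "koszul_coeff u (1 # v) (tab_tensor M a x)
      = (\<Sum>z | mset z = mset (1 # v) \<and> tl z = x. (-1) ^ inversions z :: 'k)"
    by (rule koszul_coeff_tab_tensor[OF u M]) simp
  ultimately show ?thesis by (cases "x = v") (simp_all only: if_True if_False sum.empty, simp)
qed

lemma koszul_coeff_not_distinct:
  assumes "\<not> distinct x"
  shows "koszul_coeff u (1 # v) (tab_tensor M a x) = (0 :: 'k::field)"
proof -
  have "distinct (1 # v)" using v by (auto simp: strict_sorted_iff)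
  then have "distinct z" if "mset z = mset (1 # v)" for z using mset_eq_imp_distinct_iff[OF that] by simp
  then have e: "{z. mset z = mset (1 # v) \<and> tl z = x} = {}" using assms distinct_tl by blast
  have "koszul_coeff u (1 # v) (tab_tensor M a x)
      = (\<Sum>z | mset z = mset (1 # v) \<and> tl z = x. (-1) ^ inversions z :: 'k)"
    by (rule koszul_coeff_tab_tensor[OF u M]) simp
  then show ?thesis unfolding e by simp
qed

text \<open>The head of \<open>z\<close> is the one letter of \<open>v\<close> missing from
  \<open>K\<close>. If it stands at position s of \<open>v\<close>, it precedes the letter 1 and the
  s smaller letters of \<open>K\<close>, hence the sign (-1)^(s+1). At most one summand is nonzero;
  the form as a sum over s allows an exchange with the sum over columns.\<close>

lemma koszul_coeff_one:
  assumes K: "sorted_wrt (<) K" "\<And>x. x \<in> set K \<Longrightarrow> 1 < x"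
  shows "koszul_coeff u (1 # v) (tab_tensor M a (1 # K))
    = - (\<Sum>s<length v. if K = take s v @ drop (Suc s) v then (-1) ^ s else (0 :: 'k::field))"
proof -
  define del where "del s = take s v @ drop (Suc s) v" for s
  have del_mset: "mset (v ! s # del s) = mset v" if "s < length v" for s
  proof -
    have "v = take s v @ v ! s # drop (Suc s) v" by (rule id_take_nth_drop[OF that])
    then have "mset v = mset (take s v @ v ! s # drop (Suc s) v)" by simp
    then show ?thesis by (simp add: del_def)
  qed
  have dv: "distinct v" using v by (simp add: strict_sorted_iff)
  have kc: "koszul_coeff u (1 # v) (tab_tensor M a (1 # K))
      = (\<Sum>z | mset z = mset (1 # v) \<and> tl z = 1 # K. (-1) ^ inversions z :: 'k)"
    by (rule koszul_coeff_tab_tensor[OF u M]) simp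
  have zne: "z \<noteq> []" if "mset z = mset (1 # v)" for z :: "nat list" using that by auto
  show ?thesis
  proof (cases "\<exists>c. mset (c # K) = mset v")
    case False
    have "{z. mset z = mset (1 # v) \<and> tl z = 1 # K} = {}"
    proof -
      have False if z: "mset z = mset (1 # v)" "tl z = 1 # K" for z
      proof -
        obtain c where "z = c # 1 # K" using z(2) zne[OF z(1)] by (cases z) simp_all
        then have "mset (c # K) = mset v" using z(1) by (simp add: add_mset_commute)
        then show False using False by blast
      qed
      then show ?thesis by blast
    qed
    moreover have "K \<noteq> del s" if "s < length v" for s using del_mset[OF that] False by blast
    ultimately show ?thesis unfolding kc del_def[symmetric] by (simp only: sum.empty) simp
  next
    case True
    then obtain c where c: "mset (c # K) = mset v" by blast
    have "c \<in> set v" using mset_eq_setD[OF c] by auto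
    then obtain s where s: "s < length v" "v ! s = c" by (auto simp: in_set_conv_nth)
    have sd: "sorted_wrt (<) (del s)"
    proof -
      have "sorted_wrt (<) (take s v @ v ! s # drop (Suc s) v)" using v(1) id_take_nth_drop[OF s(1)] by simp
      then show ?thesis unfolding del_def by (auto simp: sorted_wrt_append)
    qed
    have "mset (c # K) = mset (c # del s)"
      using c del_mset[OF s(1)] unfolding s(2) by (rule trans[OF _ sym])
    then have "mset K = mset (del s)" by simp
    then have Ks: "K = del s" by (rule strict_sorted_mset_eq[OF K(1) sd])
    have uniq: "s' = s" if s': "s' < length v" "K = del s'" for s'
    proof -
      have "mset (v ! s' # K) = mset (c # K)" using del_mset[OF s'(1)] s'(2) c by simp
      then have "v ! s' = c" by simp
      then show ?thesis using nth_eq_iff_index_eq[OF dv s'(1) s(1)] s(2) by simp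
    qed
    have "{z. mset z = mset (1 # v) \<and> tl z = 1 # K} = {c # 1 # K}"
    proof -
      have "z = c # 1 # K" if z: "mset z = mset (1 # v)" "tl z = 1 # K" for z
      proof -
        obtain c' where c': "z = c' # 1 # K" using z(2) zne[OF z(1)] by (cases z) simp_all
        then have "mset (c' # K) = mset (c # K)" using z(1) c by (simp add: add_mset_commute)
        then show ?thesis using c' by simp
      qed
      moreover have "mset (c # 1 # K) = mset (1 # v)" using c by (simp add: add_mset_commute)
      ultimately show ?thesis by auto
    qed
    moreover have "inversions (c # 1 # K) = Suc s"
    proof -
      have "1 < c" using v(2) \<open>c \<in> set v\<close> by blast
      have i0: "inversions (1 # K) = 0" using K by (intro inversions_sorted) auto
      have srt: "sorted_wrt (<) (take s v @ c # drop (Suc s) v)" using v(1) id_take_nth_drop[OF s(1)] s(2) by simp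
      have "filter (\<lambda>y. y < c) (take s v) = take s v" "filter (\<lambda>y. y < c) (drop (Suc s) v) = []"
        using srt by (auto simp: sorted_wrt_append filter_id_conv filter_empty_conv)
      then have "filter (\<lambda>y. y < c) K = take s v" by (simp add: Ks del_def)
      then show ?thesis using i0 \<open>1 < c\<close> s(1) by simp
    qed
    ultimately have "koszul_coeff u (1 # v) (tab_tensor M a (1 # K)) = - ((-1) ^ s :: 'k)"
      unfolding kc by simp
    moreover have "(\<Sum>s'<length v. if K = del s' then (-1) ^ s' else (0 :: 'k)) = (\<Sum>s'<length v. if s' = s then (-1) ^ s else 0)"
      using uniq Ks by (intro sum.cong) auto
    moreover have "\<dots> = (-1) ^ s" using s(1) by (simp add: sum.delta)
    ultimately show ?thesis by (simp add: del_def[symmetric])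
  qed
qed

end

context hook_context
begin

text \<open>Each summand of a relation is symmetric in two neighbouring places among the last
  \<open>b + 1\<close>, and these are the places that the functional antisymmetrises.\<close>

lemma koszul_coeff_box_image:
  assumes z: "z \<in> (box_image n hk :: 'k::field tensor set)"
    and u: "Suc (length u) = a" and z0: "distinct z0" "length z0 = Suc b"
  shows "koszul_coeff u z0 z = 0"
proof -
  obtain g where g: "z = (\<lambda>w. \<Sum>i\<in>{1..b}. g i w)"
    "\<And>i u x y v. i \<in> {1..b} \<Longrightarrow> length u + 2 = a + i \<Longrightarrow> g i (u @ x # y # v) = g i (u @ y # x # v)"
    by (rule box_image_hook_elim[OF z]) (rule that, assumption, blast)
  have "koszul_coeff u z0 (g i) = 0" if i: "i \<in> {1..b}" for i
  proof (rule koszul_coeff_symmetric[OF z0(1)])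
    show "(i - 1) + 2 \<le> length z0" using i z0(2) by auto
    fix s x y t assume "length (s :: nat list) = i - 1"
    then have "length (u @ s) + 2 = a + i" using u i by auto
    from g(2)[OF i this] show "g i (u @ s @ x # y # t) = g i (u @ s @ y # x # t)" by simp
  qed
  then show ?thesis unfolding g(1) koszul_coeff_sum by simp
qed

end

section \<open>Raising operators on the Weyl module of a hook\<close>

lemma raised_mset:
  "raised i w v \<Longrightarrow> \<exists>k. count (mset w) i = count (mset v) i + k
    \<and> mset w + replicate_mset k (Suc i) = mset v + replicate_mset k i"
proof (induction rule: list_all2_induct)
  case (Cons c w d v)
  then obtain k where k: "count (mset w) i = count (mset v) i + k"
    "mset w + replicate_mset k (Suc i) = mset v + replicate_mset k i" by blast
  show ?case
  proof (cases "d = c")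
    case True
    then show ?thesis using k by (intro exI[of _ k]) simp
  next
    case False
    then have "c = i" "d = Suc i" using Cons by auto
    then show ?thesis using k by (intro exI[of _ "Suc k"]) (simp add: add_mset_commute)
  qed
qed (intro exI[of _ 0], simp)

text \<open>Such a word amounts to a choice of \<open>s\<close> of the letters \<open>i\<close> of
  \<open>u\<close>; the induction is Pascal's rule.\<close>

lemma card_raised:
  "card {v. raised i u v \<and> count (mset v) i + s = count (mset u) i} = count (mset u) i choose s"
proof (induction u arbitrary: s)
  case Nil
  have "{v. raised i [] v \<and> count (mset v) i + s = count (mset []) i} = (if s = 0 then {[]} else {})" by auto
  then show ?case by (cases s) auto
next
  case (Cons c u)
  let ?S = "\<lambda>s. {v. raised i u v \<and> count (mset v) i + s = count (mset u) i}"
  let ?T = "{v. raised i (c # u) v \<and> count (mset v) i + s = count (mset (c # u)) i}"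
  have ci: "card ((#) d ` ?S s) = count (mset u) i choose s" for d s
    using Cons[of s] by (simp add: card_image)
  show ?case
  proof (cases "c = i")
    case False
    have "?T = (#) c ` ?S s" using False by (auto simp: list_all2_Cons1)
    then show ?thesis using ci False by simp
  next
    case True
    show ?thesis
    proof (cases s)
      case 0
      have "?T = (#) i ` ?S s"
        using True 0 raised_mset[of i u] by (fastforce simp: list_all2_Cons1)
      then show ?thesis using ci[of i s] 0 by simp
    next
      case (Suc s')
      have "?T = (#) i ` ?S s \<union> (#) (Suc i) ` ?S s'"
        using True Suc by (auto simp: list_all2_Cons1)
      moreover have "finite (?S s)" "finite (?S s')" using finite_raised[of i u] by auto
      moreover have "(#) i ` ?S s \<inter> (#) (Suc i) ` ?S s' = {}" by auto
      ultimately have "card ?T = card ((#) i ` ?S s) + card ((#) (Suc i) ` ?S s')"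
        by (simp only: card_Un_disjoint finite_imageI)
      then show ?thesis unfolding ci using True Suc by simp
    qed
  qed
qed

definition lower_letter :: "nat \<Rightarrow> nat list \<Rightarrow> nat list" where
  "lower_letter i J = map (\<lambda>j. if j = Suc i then i else j) J"

text \<open>A word with distinct letters contains \<open>i + 1\<close> at most once, so at most one
  letter can have changed.\<close>

lemma raised_distinct:
  assumes "distinct J"
  shows "raised i x J \<longleftrightarrow> x = J \<or> Suc i \<in> set J \<and> x = lower_letter i J"
proof
  assume "raised i x J"
  then show "x = J \<or> Suc i \<in> set J \<and> x = lower_letter i J"
    using assms
  proof (induction rule: list_all2_induct)
    case (Cons c x d J)
    have id: "lower_letter i J = J" if "Suc i \<notin> set J"
      using that by (auto simp: lower_letter_def intro: map_idI)
    show ?case using Cons id by (auto simp: lower_letter_def)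
  qed simp
next
  have "raised i (lower_letter i J) J"
    by (auto simp: lower_letter_def list_all2_conv_all_nth)
  then show "x = J \<or> Suc i \<in> set J \<and> x = lower_letter i J \<Longrightarrow> raised i x J"
    using raised_refl by blast
qed

lemma count_lower_letter:
  "distinct J \<Longrightarrow> Suc i \<in> set J \<Longrightarrow> count (mset (lower_letter i J)) i = Suc (count (mset J) i)"
proof (induction J)
  case (Cons d J)
  show ?case
  proof (cases "d = Suc i")
    case True
    then have "lower_letter i J = J" using Cons.prems by (auto simp: lower_letter_def intro: map_idI)
    then show ?thesis using True by (simp add: lower_letter_def)
  next
    case False
    then show ?thesis using Cons by (auto simp: lower_letter_def)
  qed
qed simp

text \<open>Row and column change independently; the letters that change in the column are deducted
  from the number that must change in the row.\<close>

lemma card_raised_drop: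
  assumes l: "length u = a" "length x = length J"
  shows "card {v. raised i (u @ x) v \<and> count (mset v) i + t = count (mset (u @ x)) i \<and> drop a v = J}
    = (if raised i x J then card {v. raised i u v \<and> count (mset v) i + (count (mset J) i + t) = count (mset u) i + count (mset x) i} else 0)"
proof -
  let ?S = "{v. raised i u v \<and> count (mset v) i + (count (mset J) i + t) = count (mset u) i + count (mset x) i}"
  have "{v. raised i (u @ x) v \<and> count (mset v) i + t = count (mset (u @ x)) i \<and> drop a v = J}
      = (if raised i x J then (\<lambda>v. v @ J) ` ?S else {})" (is "?L = ?R")
  proof
    show "?L \<subseteq> ?R"
    proof
      fix v assume "v \<in> ?L"
      then have v: "raised i (u @ x) v" "count (mset v) i + t = count (mset (u @ x)) i" "drop a v = J" by auto
      have lv: "length v = length u + length x" using list_all2_lengthD[OF v(1)] by simp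
      have vv: "v = take a v @ J" using v(3) append_take_drop_id[of a v] by simp
      have "raised i (u @ x) (take a v @ J)" using v(1) vv by simp
      then have r: "raised i u (take a v)" "raised i x J"
        using l lv by (auto simp: list_all2_append)
      have "count (mset v) i = count (mset (take a v)) i + count (mset J) i"
        using arg_cong[OF vv, of "\<lambda>v. count (mset v) i"] by simp
      then have "take a v \<in> ?S" using v(2) r(1) by simp
      then show "v \<in> ?R" using r(2) vv by auto
    qed
    show "?R \<subseteq> ?L"
    proof
      fix v assume "v \<in> ?R"
      then obtain u' where u': "raised i x J" "u' \<in> ?S" "v = u' @ J" by (auto split: if_splits)
      moreover have "length u' = a" using u'(2) l(1) list_all2_lengthD[of _ u u'] by auto
      ultimately show "v \<in> ?L" using l by (auto simp: list_all2_appendI)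
    qed
  qed
  moreover have "card ((\<lambda>v. v @ J) ` ?S) = card ?S" by (intro card_image inj_onI) auto
  ultimately show ?thesis by simp
qed

text \<open>Either all \<open>t\<close> changed letters lie in the row, or one of them lies in the
  column and \<open>t - 1\<close> in the row. The binomials count which letters \<open>i\<close> in
  the row of the resulting tableau, of content \<open>N\<close>, were changed; in the second case
  one letter \<open>i\<close> of \<open>N\<close> more is in the column.\<close>

lemma raise_op_tab_tensor:
  assumes J: "distinct J" and t: "1 \<le> t" and N: "size N = a + length J"
    and MN: "N + replicate_mset t (Suc i) = M + replicate_mset t i"
  shows "raise_op i t (tab_tensor M a J) = (\<lambda>w.
    of_nat ((count N i - count (mset J) i) choose t) * tab_tensor N a J w
    + (if Suc i \<in> set J then of_nat ((count N i - count (mset J) i - 1) choose (t - 1)) * tab_tensor N a (lower_letter i J) w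
       else (0 :: 'k::field)))"
proof
  fix w
  let ?V = "{v. raised i w v \<and> count (mset v) i + t = count (mset w) i}"
  have mM: "mset v = M \<longleftrightarrow> mset w = N" if v: "v \<in> ?V" for v
  proof -
    obtain k where k: "count (mset w) i = count (mset v) i + k"
      "mset w + replicate_mset k (Suc i) = mset v + replicate_mset k i"
      using raised_mset[of i w v] v by auto
    have "k = t" using k(1) v by simp
    then have *: "mset w + replicate_mset t (Suc i) = mset v + replicate_mset t i" using k(2) by simp
    show ?thesis
    proof
      assume "mset v = M"
      then have "mset w + replicate_mset t (Suc i) = N + replicate_mset t (Suc i)" using * MN by simp
      then show "mset w = N" by simp
    next
      assume "mset w = N"
      then have "mset v + replicate_mset t i = M + replicate_mset t i" using * MN by simp
      then show "mset v = M" by simp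
    qed
  qed
  have "raise_op i t (tab_tensor M a J) w = (\<Sum>v\<in>?V. if mset v = M \<and> drop a v = J then 1 else (0 :: 'k))"
    by (simp add: raise_op_def tab_tensor_def)
  also have "\<dots> = (\<Sum>v\<in>?V. if mset w = N \<and> drop a v = J then 1 else 0)"
    using mM by (intro sum.cong refl) auto
  also have "\<dots> = (if mset w = N then of_nat (card {v. raised i w v \<and> count (mset v) i + t = count (mset w) i \<and> drop a v = J}) else 0)"
  proof (cases "mset w = N")
    case True
    have "{v. raised i w v \<and> count (mset v) i + t = count (mset w) i \<and> drop a v = J} = {v\<in>?V. drop a v = J}" by auto
    then show ?thesis using True sum.inter_filter[OF finite_raised, of "\<lambda>_. 1 :: 'k", symmetric] by simp
  qed simp
  also have "\<dots> = of_nat ((count N i - count (mset J) i) choose t) * tab_tensor N a J w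
    + (if Suc i \<in> set J then of_nat ((count N i - count (mset J) i - 1) choose (t - 1)) * tab_tensor N a (lower_letter i J) w else 0)"
  proof (cases "mset w = N")
    case True
    define u x where "u = take a w" and "x = drop a w"
    have lw: "length w = a + length J" using True N by (metis size_mset)
    have w: "w = u @ x" "length u = a" "length x = length J" using lw by (auto simp: u_def x_def)
    have cu: "count N i = count (mset u) i + count (mset x) i" using True w(1) by auto
    have neq: "lower_letter i J \<noteq> J" if "Suc i \<in> set J"
      using count_lower_letter[OF J that] by auto
    have tt: "tab_tensor N a y w = (if x = y then 1 else 0 :: 'k)" for y
      using True by (simp add: tab_tensor_def x_def)
    note cd = card_raised_drop[OF w(2,3), of i t, folded w(1)]
    consider (same) "x = J" | (low) "Suc i \<in> set J" "x = lower_letter i J" | (none) "\<not> raised i x J"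
      using raised_distinct[OF J] by blast
    then show ?thesis
    proof cases
      case same
      have r: "raised i x J" using same raised_refl by simp
      have "{v. raised i u v \<and> count (mset v) i + (count (mset J) i + t) = count (mset u) i + count (mset x) i}
          = {v. raised i u v \<and> count (mset v) i + t = count (mset u) i}" using same by auto
      then have "card {v. raised i w v \<and> count (mset v) i + t = count (mset w) i \<and> drop a v = J} = count (mset u) i choose t"
        using cd r card_raised by simp
      then show ?thesis using True same cu neq by (auto simp: tt)
    next
      case low
      have r: "raised i x J" using low raised_distinct[OF J] by blast
      have cx: "count (mset x) i = Suc (count (mset J) i)" using count_lower_letter[OF J low(1)] low(2) by simp
      have "{v. raised i u v \<and> count (mset v) i + (count (mset J) i + t) = count (mset u) i + count (mset x) i}
          = {v. raised i u v \<and> count (mset v) i + (t - 1) = count (mset u) i}" using cx t by auto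
      then have "card {v. raised i w v \<and> count (mset v) i + t = count (mset w) i \<and> drop a v = J} = count (mset u) i choose (t - 1)"
        using cd r card_raised by simp
      moreover have "count N i - count (mset J) i - 1 = count (mset u) i" using cu cx by simp
      ultimately show ?thesis using True low neq[OF low(1)] by (simp add: tt)
    next
      case none
      then have "card {v. raised i w v \<and> count (mset v) i + t = count (mset w) i \<and> drop a v = J} = 0"
        using cd by simp
      then show ?thesis using none raised_distinct[OF J, of i x] by (auto simp: tt)
    qed
  qed (simp add: tab_tensor_def)
  finally show "raise_op i t (tab_tensor M a J) w = of_nat ((count N i - count (mset J) i) choose t) * tab_tensor N a J w
    + (if Suc i \<in> set J then of_nat ((count N i - count (mset J) i - 1) choose (t - 1)) * tab_tensor N a (lower_letter i J) w
       else (0 :: 'k))" .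
qed

lemma finite_strict_lists: "finite {v. length v = b \<and> set v \<subseteq> A \<and> P v}" if "finite A"
  by (rule finite_subset[OF _ finite_lists_length_eq[OF that, of b]]) auto

lemma mset_complement_ex:
  assumes d: "distinct xs" and s: "set xs \<subseteq> set_mset M"
  obtains u where "mset u + mset xs = M"
proof -
  have "mset xs \<subseteq># M"
  proof (rule mset_subset_eqI)
    fix x
    have "count (mset xs) x = (if x \<in> set xs then 1 else 0)"
      using distinct_count_atmost_1[THEN iffD1, OF d] by (rule spec)
    moreover have "1 \<le> count M x" if "x \<in> set xs"
      using s that by (auto simp: Suc_le_eq One_nat_def)
    ultimately show "count (mset xs) x \<le> count M x" by auto
  qed
  then have "M - mset xs + mset xs = M" by (rule subset_mset.diff_add)
  moreover obtain u where "mset u = M - mset xs" using ex_mset by blast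
  ultimately have "mset u + mset xs = M" by metis
  then show ?thesis by (rule that)
qed

section \<open>Standard tableaux of a given content and their dual functionals\<close>

context hook_context
begin

text \<open>The columns of the semistandard hook tableaux of content \<open>M\<close> when
  \<open>M\<close> contains 1: the 1 occupies the corner, and the row is determined by the
  column.\<close>

definition standard_columns :: "nat multiset \<Rightarrow> nat list set" where
  "standard_columns M = {v. length v = b \<and> set v \<subseteq> set_mset M \<and> sorted_wrt (<) v \<and> 1 \<notin> set v}"

definition standard_comb :: "nat multiset \<Rightarrow> (nat list \<Rightarrow> 'k::field) \<Rightarrow> 'k tensor" where
  "standard_comb M c = (\<lambda>w. \<Sum>v\<in>standard_columns M. c v * tab_tensor M a v w)"

lemma finite_standard_columns: "finite (standard_columns M)"
  unfolding standard_columns_def by (rule finite_strict_lists) simp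

text \<open>The tensors congruent to a standard combination form a subspace that contains the
  relations and the standard tableaux, so straightening applies with this subspace as
  target.\<close>

lemma standard_expansion:
  fixes z :: "'k::field tensor"
  assumes M: "size M = a + b" "set_mset M \<subseteq> {1..n}"
    and z: "z \<in> class_fun n hk" "\<And>w. z w \<noteq> 0 \<Longrightarrow> mset w = M"
  obtains c where "(\<lambda>w. z w - standard_comb M c w) \<in> box_image n hk"
proof -
  define U where "U = {y :: 'k tensor. \<exists>c. (\<lambda>w. y w - standard_comb M c w) \<in> box_image n hk}"
  note box = box_image_lin_sub[OF hk_facts(1), where 'k='k]
  have zero: "standard_comb M (\<lambda>_. 0) = (\<lambda>w. 0 :: 'k)" by (simp add: standard_comb_def)
  have U: "lin_sub U"
    unfolding lin_sub_def
  proof (intro conjI ballI allI)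
    show "(\<lambda>w. 0) \<in> U" using lin_sub_zero[OF box] zero unfolding U_def by (auto intro!: exI[of _ "\<lambda>_. 0"])
    fix f g k assume "f \<in> U"
    then obtain c where c: "(\<lambda>w. f w - standard_comb M c w) \<in> box_image n hk" unfolding U_def by blast
    have "(\<lambda>w. k * f w - standard_comb M (\<lambda>v. k * c v) w) = (\<lambda>w. k * (f w - standard_comb M c w))"
      by (simp add: standard_comb_def sum_distrib_left right_diff_distrib mult.assoc)
    then show "(\<lambda>w. k * f w) \<in> U" using lin_sub_smult[OF box c, of k] unfolding U_def
      by (intro CollectI exI[of _ "\<lambda>v. k * c v"]) simp
    assume "g \<in> U"
    then obtain d where d: "(\<lambda>w. g w - standard_comb M d w) \<in> box_image n hk" unfolding U_def by blast
    have "(\<lambda>w. (f w + g w) - standard_comb M (\<lambda>v. c v + d v) w)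
        = (\<lambda>w. (f w - standard_comb M c w) + (g w - standard_comb M d w))"
      by (simp add: standard_comb_def sum.distrib algebra_simps)
    then show "(\<lambda>w. f w + g w) \<in> U" using lin_sub_add[OF box c d] unfolding U_def
      by (intro CollectI exI[of _ "\<lambda>v. c v + d v"]) simp
  qed
  have boxU: "box_image n hk \<subseteq> U"
  proof
    fix y assume y: "y \<in> (box_image n hk :: 'k tensor set)"
    have "(\<lambda>w. y w - standard_comb M (\<lambda>_. 0) w) = y" by (simp add: zero)
    then show "y \<in> U" using y unfolding U_def by (intro CollectI exI[of _ "\<lambda>_. 0"]) simp
  qed
  have std: "tab_tensor M a v \<in> U" if v: "v \<in> standard_columns M" for v
  proof -
    let ?c = "\<lambda>x. if x = v then 1 else (0 :: 'k)"
    have "standard_comb M ?c w = tab_tensor M a v w" for w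
    proof -
      have "standard_comb M ?c w = (\<Sum>x\<in>standard_columns M. if x = v then tab_tensor M a v w else 0)"
        unfolding standard_comb_def by (intro sum.cong) auto
      then show ?thesis using finite_standard_columns v by (simp add: sum.delta)
    qed
    then have "(\<lambda>w. tab_tensor M a v w - standard_comb M ?c w) = (\<lambda>w. 0)" by simp
    then show ?thesis using lin_sub_zero[OF box] unfolding U_def by (intro CollectI exI[of _ ?c]) simp
  qed
  have "z \<in> U"
  proof (rule tab_tensor_span[OF M U _ z])
    fix v assume v: "length v = b" "set v \<subseteq> set_mset M"
    show "tab_tensor M a v \<in> U"
    proof (rule straighten[OF M U boxU _ v])
      fix x assume "length x = b" "sorted_wrt (<) x" "1 \<notin> set x" "set x \<subseteq> set_mset M"
      then show "tab_tensor M a x \<in> U" by (intro std) (simp add: standard_columns_def)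
    qed
  qed
  then show ?thesis using that unfolding U_def by blast
qed

text \<open>The functional at \<open>v\<close> reads off the coefficient of \<open>v\<close> and
  vanishes on the relations, which gives the linear independence of the standard tableaux in the
  Weyl module.\<close>

lemma koszul_coeff_standard_comb:
  fixes c :: "nat list \<Rightarrow> 'k::field"
  assumes M: "size M = a + b" "set_mset M \<subseteq> {1..n}"
    and v: "v \<in> standard_columns M" and u: "mset u + mset (1 # v) = M"
  shows "koszul_coeff u (1 # v) (standard_comb M c) = c v"
    and "y \<in> box_image n hk \<Longrightarrow> koszul_coeff u (1 # v) (y :: 'k tensor) = 0"
proof -
  have ul: "Suc (length u) = a"
    using arg_cong[OF u, of size] v M(1) by (simp add: standard_columns_def)
  have sv: "sorted_wrt (<) v" using v by (simp add: standard_columns_def)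
  have gt: "1 < x" if "x \<in> set v" for x
  proof -
    have "x \<in> {1..n}" "x \<noteq> 1" using that v M(2) by (auto simp: standard_columns_def)
    then show ?thesis by auto
  qed
  have "koszul_coeff u (1 # v) (standard_comb M c)
      = (\<Sum>x\<in>standard_columns M. c x * koszul_coeff u (1 # v) (tab_tensor M a x))"
    unfolding standard_comb_def koszul_coeff_sum koszul_coeff_smult ..
  also have "\<dots> = (\<Sum>x\<in>standard_columns M. if x = v then c v else 0)"
  proof (intro sum.cong refl)
    fix x assume "x \<in> standard_columns M"
    then have x: "sorted_wrt (<) x" "1 \<notin> set x" by (auto simp: standard_columns_def)
    have "koszul_coeff u (1 # v) (tab_tensor M a x) = (if x = v then 1 else (0 :: 'k))"
      by (rule koszul_coeff_standard[OF ul u sv _ x]) (rule gt)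
    then show "c x * koszul_coeff u (1 # v) (tab_tensor M a x) = (if x = v then c v else 0)" by simp
  qed
  also have "\<dots> = c v" using finite_standard_columns v by (simp add: sum.delta)
  finally show "koszul_coeff u (1 # v) (standard_comb M c) = c v" .
  assume y: "y \<in> box_image n hk"
  have "distinct (1 # v)" "length v = b" using v by (auto simp: standard_columns_def strict_sorted_iff)
  then show "koszul_coeff u (1 # v) y = 0" using koszul_coeff_box_image[OF y ul] by simp
qed

lemma standard_complement:
  assumes "1 \<in># M" "v \<in> standard_columns M"
  obtains u where "mset u + mset (1 # v) = M"
proof -
  have "distinct (1 # v)" "set (1 # v) \<subseteq> set_mset M"
    using assms by (auto simp: standard_columns_def strict_sorted_iff)
  then show ?thesis using mset_complement_ex that by blast
qed

text \<open>Modulo relations \<open>z\<close> is a standard combination, and the functionals return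
  exactly its coefficients.\<close>

lemma box_image_iff_koszul:
  fixes z :: "'k::field tensor"
  assumes M: "size M = a + b" "set_mset M \<subseteq> {1..n}" "1 \<in># M"
    and z: "z \<in> class_fun n hk" "\<And>w. z w \<noteq> 0 \<Longrightarrow> mset w = M"
  shows "z \<in> box_image n hk \<longleftrightarrow>
    (\<forall>v\<in>standard_columns M. \<forall>u. mset u + mset (1 # v) = M \<longrightarrow> koszul_coeff u (1 # v) z = 0)"
proof
  assume "z \<in> box_image n hk"
  then show "\<forall>v\<in>standard_columns M. \<forall>u. mset u + mset (1 # v) = M \<longrightarrow> koszul_coeff u (1 # v) z = 0"
    using koszul_coeff_standard_comb(2)[OF M(1,2)] by blast
next
  assume zero: "\<forall>v\<in>standard_columns M. \<forall>u. mset u + mset (1 # v) = M \<longrightarrow> koszul_coeff u (1 # v) z = 0"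
  obtain c where c: "(\<lambda>w. z w - standard_comb M c w) \<in> box_image n hk"
    by (rule standard_expansion[OF M(1,2) z])
  have "c v = 0" if v: "v \<in> standard_columns M" for v
  proof -
    obtain u where u: "mset u + mset (1 # v) = M" using standard_complement[OF M(3) v] .
    note k = koszul_coeff_standard_comb[OF M(1,2) v u]
    have "koszul_coeff u (1 # v) z - koszul_coeff u (1 # v) (standard_comb M c) = 0"
      using k(2)[OF c] by (simp add: koszul_coeff_diff)
    then show ?thesis using zero v u k(1)[of c] by simp
  qed
  then have "standard_comb M c = (\<lambda>w. 0)" by (simp add: standard_comb_def)
  then show "z \<in> box_image n hk" using c by simp
qed

end

section \<open>The raising relations as linear equations in the coefficients\<close>

definition drop_at :: "nat \<Rightarrow> 'a list \<Rightarrow> 'a list" where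
  "drop_at s v = take s v @ drop (Suc s) v"

definition raise_letter :: "nat \<Rightarrow> nat list \<Rightarrow> nat list" where
  "raise_letter i v = map (\<lambda>j. if j = i then Suc i else j) v"

text \<open>The coordinate at column \<open>v\<close> of the combination with coefficients
  \<open>c\<close> after the \<open>t\<close>-th divided power of the i-th root vector. The
  binomials count letters \<open>i\<close> of the raised tableau, less one if the column holds one.
  For \<open>i = 1\<close> a letter 2 of the column can become 1, and the Koszul functional turns
  this column into the alternating sum; a term with 2 in the shortened column would have 2 twice and
  is left out.\<close>

definition kill_coeff :: "nat list \<Rightarrow> (nat list \<Rightarrow> 'k::field) \<Rightarrow> nat \<Rightarrow> nat \<Rightarrow> nat list \<Rightarrow> 'k" where
  "kill_coeff lam c i t v =
    (if i = 1 then of_nat ((part lam 1 + t) choose t) * c v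
       - of_nat ((part lam 1 + t - 1) choose (t - 1))
         * (\<Sum>s<length v. if 2 \<in> set (drop_at s v) then 0 else (-1) ^ s * c (2 # drop_at s v))
     else of_nat ((part lam i + t - (if i \<in> set v then 1 else 0)) choose t) * c v
       + (if i \<in> set v \<and> Suc i \<notin> set v
          then of_nat ((part lam i + t - 1) choose (t - 1)) * c (raise_letter i v) else 0))"

definition tab_comb :: "nat list \<Rightarrow> nat \<Rightarrow> (nat list \<Rightarrow> 'k::field) \<Rightarrow> 'k tensor" where
  "tab_comb lam b c w =
    (\<Sum>J\<in>B_set lam b. c J * tab_tensor (mset (block_word 1 lam)) (sum_list lam - b) J w)"

lemma count_block_word_1: "count (mset (block_word 1 \<alpha>)) x = part \<alpha> x"
  by (simp add: count_block_word part_def less_Suc_eq_le)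

lemma part_raise:
  assumes "1 \<le> i" "i < length lam"
  shows "part (raise lam i t) x
    = (if x = i then part lam i + t else if x = Suc i then part lam (Suc i) - t else part lam x)"
  using assms by (auto simp: part_def raise_def nth_list_update One_nat_def)

lemma finite_B_set: "finite (B_set lam b)"
proof (rule finite_subset)
  show "B_set lam b \<subseteq> {v. length v = b \<and> set v \<subseteq> {2..length lam} \<and> True}" by (auto simp: B_set_def)
qed (rule finite_strict_lists, simp)

lemma strict_sorted_map:
  assumes "sorted_wrt (<) v" "\<And>x y. x \<in> set v \<Longrightarrow> y \<in> set v \<Longrightarrow> x < y \<Longrightarrow> f x < f y"
  shows "sorted_wrt (<) (map f v)"
  using assms unfolding sorted_wrt_map by (auto intro: sorted_wrt_mono_rel)

lemma raise_letter_B_set: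
  assumes v: "v \<in> B_set lam b" and i: "Suc i \<notin> set v" "Suc i \<le> length lam" "1 \<le> i"
  shows "raise_letter i v \<in> B_set lam b"
proof -
  have "sorted_wrt (<) (raise_letter i v)"
    unfolding raise_letter_def
  proof (rule strict_sorted_map[OF B_setD(2)[OF v]])
    fix x y assume "x \<in> set v" "y \<in> set v" "x < y"
    then show "(if x = i then Suc i else x) < (if y = i then Suc i else y)"
      using i(1) by (auto simp: Suc_lessI) (metis Suc_lessI)
  qed
  then show ?thesis
    using B_setD(1,4)[OF v] i by (auto simp: B_set_def raise_letter_def)
qed

lemma drop_at_props:
  assumes "sorted_wrt (<) (v :: nat list)" "s < length v"
  shows "sorted_wrt (<) (drop_at s v)" "set (drop_at s v) \<subseteq> set v" "Suc (length (drop_at s v)) = length v"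
proof -
  have "sorted_wrt (<) (take s v @ v ! s # drop (Suc s) v)" using assms id_take_nth_drop[of s v] by simp
  then show "sorted_wrt (<) (drop_at s v)" by (auto simp: drop_at_def sorted_wrt_append)
  show "set (drop_at s v) \<subseteq> set v"
    using set_take_subset[of s v] set_drop_subset[of "Suc s" v] by (auto simp: drop_at_def)
  show "Suc (length (drop_at s v)) = length v" using assms by (simp add: drop_at_def)
qed

lemma raise_op_linear_comb:
  "raise_op i t (\<lambda>w. \<Sum>J\<in>I. c J * f J w) = (\<lambda>w. \<Sum>J\<in>I. c J * raise_op i t (f J) w)"
  by (rule ext) (simp add: raise_op_def sum_distrib_left sum.swap[of _ I])

locale hook_pair = hook_context +
  fixes lam :: "nat list"
  assumes lam_n: "length lam \<le> n" and pos: "\<And>x. x \<in> set lam \<Longrightarrow> 0 < x"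
    and size: "a + b = sum_list lam"
begin

lemma part_pos: "1 \<le> x \<Longrightarrow> x \<le> length lam \<Longrightarrow> 0 < part lam x"
  by (auto simp: part_def intro!: pos)

lemma tab_tensor_lam: "tab_tensor (mset (block_word 1 lam)) (sum_list lam - b) J \<in> class_fun n hk"
proof -
  have "sum_list lam - b = a" using size by simp
  moreover have "set (block_word 1 lam) \<subseteq> {1..n}" using set_block_word[of 1 lam] lam_n by auto
  ultimately show ?thesis using tab_tensor_class_fun[of "mset (block_word 1 lam)" a b n J] size by simp
qed

lemma tab_comb_class_fun: "tab_comb lam b c \<in> class_fun n hk"
proof -
  have "tab_comb lam b c = (\<lambda>w. \<Sum>J\<in>B_set lam b. c J * tab_tensor (mset (block_word 1 lam)) (sum_list lam - b) J w)"
    by (simp add: tab_comb_def[abs_def])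
  also have "\<dots> \<in> class_fun n hk"
    by (intro lin_sub_sum lin_sub_smult class_fun_lin_sub tab_tensor_lam)
  finally show ?thesis .
qed

lemma tab_comb_weight: "has_weight lam (tab_comb lam b c)"
  unfolding has_weight_def
proof (intro allI impI)
  fix w assume nz: "tab_comb lam b c w \<noteq> 0"
  show "mset w = mset (block_word 1 lam)"
  proof (rule ccontr)
    assume "\<not> ?thesis"
    then have "tab_comb lam b c w = 0" by (simp add: tab_comb_def tab_tensor_def)
    then show False using nz by simp
  qed
qed

text \<open>\<open>v\<close> runs through the standard columns of the raised weight. If
  \<open>t = part lam (Suc i)\<close>, no letter \<open>i + 1\<close> is left, so columns containing
  it do not occur; this is the origin of the side condition.\<close>

lemma kill_iff:
  fixes c :: "nat list \<Rightarrow> 'k::field"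
  assumes it: "(i, t) \<in> box_index lam"
  shows "raise_op i t (tab_comb lam b c) \<in> box_image n hk \<longleftrightarrow>
    (\<forall>v\<in>B_set lam b. (Suc i \<in> set v \<longrightarrow> t < part lam (Suc i)) \<longrightarrow> kill_coeff lam c i t v = 0)"
proof -
  have i: "1 \<le> i" "i < length lam" and t: "1 \<le> t" "t \<le> part lam (Suc i)"
    using it by (auto simp: box_index_def Suc_eq_plus1)
  have t': "t \<le> part lam (i + 1)" using t(2) by (simp add: Suc_eq_plus1)
  define M where "M = mset (block_word 1 lam)"
  define N where "N = mset (block_word 1 (raise lam i t))"
  define z where "z = raise_op i t (tab_comb lam b c)"
  have aa: "sum_list lam - b = a" using size by simp
  have cM: "count M x = part lam x" for x unfolding M_def by (rule count_block_word_1)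
  have cN: "count N x = (if x = i then part lam i + t else if x = Suc i then part lam (Suc i) - t else part lam x)" for x
    unfolding N_def count_block_word_1 by (rule part_raise[OF i])
  have sN: "size N = a + b" using sum_list_raise[OF i t'] by (simp add: N_def size)
  have MN: "N + replicate_mset t (Suc i) = M + replicate_mset t i"
    using t by (intro multiset_eqI) (auto simp: cN cM)
  have Nn: "set_mset N \<subseteq> {1..n}" using set_block_word[of 1 "raise lam i t"] lam_n by (auto simp: N_def)
  have memN: "x \<in># N \<longleftrightarrow> 1 \<le> x \<and> x \<le> length lam \<and> (x = Suc i \<longrightarrow> t < part lam (Suc i))" for x
  proof -
    have "x \<in># N \<longleftrightarrow> 0 < count N x" by simp
    also have "\<dots> \<longleftrightarrow> 1 \<le> x \<and> x \<le> length lam \<and> (x = Suc i \<longrightarrow> t < part lam (Suc i))"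
    proof (cases "1 \<le> x \<and> x \<le> length lam")
      case True
      then show ?thesis using part_pos[of x] t by (auto simp: cN)
    next
      case False
      then have "part lam x = 0" "x \<noteq> i" "x \<noteq> Suc i" using i by (auto simp: part_def)
      then show ?thesis using False by (simp add: cN)
    qed
    finally show ?thesis .
  qed
  have N1: "1 \<in># N" using i by (simp add: memN)
  have zc: "z \<in> class_fun n hk"
  proof -
    have "restrict (raise_op i t) (tensor_space n (sum_list hk)) (tab_comb lam b c) \<in> class_fun n hk"
      by (rule schur_class_fun[OF raise_op_schur[OF i(1)] tab_comb_class_fun])
    then show ?thesis unfolding z_def using class_fun_tensor_space[OF tab_comb_class_fun[of c]] by simp
  qed
  have zw: "mset w = N" if nz: "z w \<noteq> 0" for w
  proof -
    obtain v where v: "raised i w v" "count (mset v) i + t = count (mset w) i" "tab_comb lam b c v \<noteq> 0"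
      using raise_op_nz[of i t "tab_comb lam b c" w] nz unfolding z_def by blast
    have "mset v = M" using tab_comb_weight v(3) unfolding has_weight_def M_def by blast
    moreover obtain k where "count (mset w) i = count (mset v) i + k"
      "mset w + replicate_mset k (Suc i) = mset v + replicate_mset k i"
      using raised_mset[OF v(1)] by blast
    ultimately have "mset w + replicate_mset t (Suc i) = N + replicate_mset t (Suc i)" using v(2) MN by simp
    then show ?thesis by simp
  qed
  have valid: "v \<in> standard_columns N \<longleftrightarrow> v \<in> B_set lam b \<and> (Suc i \<in> set v \<longrightarrow> t < part lam (Suc i))" for v
  proof
    assume "v \<in> standard_columns N"
    then have v: "length v = b \<and> sorted_wrt (<) v \<and> 1 \<notin> set v \<and> set v \<subseteq> set_mset N" by (simp add: standard_columns_def)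
    have "2 \<le> x \<and> x \<le> length lam" if "x \<in> set v" for x
    proof -
      have "x \<in># N" "x \<noteq> 1" using v that by auto
      then show ?thesis unfolding memN by simp
    qed
    moreover have "t < part lam (Suc i)" if "Suc i \<in> set v"
    proof -
      have "Suc i \<in># N" using v that by blast
      then show ?thesis unfolding memN by simp
    qed
    ultimately show "v \<in> B_set lam b \<and> (Suc i \<in> set v \<longrightarrow> t < part lam (Suc i))"
      using v by (auto simp: B_set_def)
  next
    assume v: "v \<in> B_set lam b \<and> (Suc i \<in> set v \<longrightarrow> t < part lam (Suc i))"
    then show "v \<in> standard_columns N"
      unfolding standard_columns_def using B_setD[of v lam b] by (fastforce simp: memN)
  qed
  have zsum: "z = (\<lambda>w. \<Sum>J\<in>B_set lam b. c J * raise_op i t (tab_tensor M a J) w)"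
    unfolding z_def tab_comb_def[abs_def] raise_op_linear_comb M_def aa ..
  have val: "koszul_coeff u (1 # v) z = kill_coeff lam c i t v"
    if v: "v \<in> B_set lam b" and u: "mset u + mset (1 # v) = N" for u v
  proof -
    have ul: "Suc (length u) = a" using arg_cong[OF u, of size] sN B_setD(1)[OF v] by simp
    have vs: "sorted_wrt (<) v" by (rule B_setD(2)[OF v])
    have v1: "1 < x" if "x \<in> set v" for x using B_setD(4)[OF v that] by simp
    let ?k = "\<lambda>x. koszul_coeff u (1 # v) (tab_tensor N a x) :: 'k"
    let ?C = "\<lambda>J. of_nat ((count N i - count (mset J) i) choose t) :: 'k"
    let ?D = "\<lambda>J. of_nat ((count N i - count (mset J) i - 1) choose (t - 1)) :: 'k"
    have cJ: "count (mset J) i = (if i \<in> set J then 1 else 0)" if "J \<in> B_set lam b" for J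
      using distinct_count_atmost_1[THEN iffD1, OF B_setD(3)[OF that]] by (rule spec)
    have ks: "?k x = (if x = v then 1 else 0)" if "sorted_wrt (<) x" "1 \<notin> set x" for x
      by (rule koszul_coeff_standard[OF ul u vs _ that]) (rule v1)
    have kJ: "?k J = (if J = v then 1 else 0)" if J: "J \<in> B_set lam b" for J
      using B_setD(4)[OF J, of 1] by (intro ks B_setD(2)[OF J]) auto
    have rt: "raise_op i t (tab_tensor M a J) = (\<lambda>w. ?C J * tab_tensor N a J w
        + (if Suc i \<in> set J then ?D J * tab_tensor N a (lower_letter i J) w else (0 :: 'k)))"
      if J: "J \<in> B_set lam b" for J
      by (rule raise_op_tab_tensor[OF B_setD(3)[OF J] t(1) _ MN]) (simp add: sN B_setD(1)[OF J])
    have kr: "koszul_coeff u (1 # v) (raise_op i t (tab_tensor M a J))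
        = ?C J * ?k J + (if Suc i \<in> set J then ?D J * ?k (lower_letter i J) else 0)"
      if J: "J \<in> B_set lam b" for J
      unfolding rt[OF J] koszul_coeff_add koszul_coeff_smult
      by (cases "Suc i \<in> set J") (simp_all add: koszul_coeff_smult, simp add: koszul_coeff_def)
    have kz: "koszul_coeff u (1 # v) z = (\<Sum>J\<in>B_set lam b. c J * (?C J * ?k J))
        + (\<Sum>J\<in>B_set lam b. if Suc i \<in> set J then c J * (?D J * ?k (lower_letter i J)) else 0)"
      unfolding zsum koszul_coeff_sum koszul_coeff_smult sum.distrib[symmetric]
      by (intro sum.cong refl) (simp add: kr distrib_left)
    have first: "(\<Sum>J\<in>B_set lam b. c J * (?C J * ?k J)) = ?C v * c v"
    proof -
      have "(\<Sum>J\<in>B_set lam b. c J * (?C J * ?k J)) = (\<Sum>J\<in>B_set lam b. if J = v then ?C v * c v else 0)"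
        by (intro sum.cong refl) (simp add: kJ)
      then show ?thesis using finite_B_set v by (simp add: sum.delta)
    qed
    show ?thesis
    proof (cases "i = 1")
      case True
      have c0: "count (mset J) i = 0" if "J \<in> B_set lam b" for J
        using cJ[OF that] B_setD(4)[OF that, of 1] True by auto
      let ?e = "\<lambda>J. if Suc i \<in> set J then c J * (?D J * ?k (lower_letter i J)) else 0"
      let ?DD = "of_nat ((part lam 1 + t - 1) choose (t - 1)) :: 'k"
      have two: "Suc i = 2" using True by simp
      \<comment> \<open>A column of \<open>B_set\<close> with an entry 2 has it on top. Lowering it
        puts 1 on top, and \<open>koszul_coeff_one\<close> gives the alternating sum over the
        dropped entry of \<open>v\<close>.\<close>
      have e: "?e J = - (\<Sum>s<length v. if J = 2 # drop_at s v then ?DD * ((-1) ^ s * c J) else 0)"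
        if J: "J \<in> B_set lam b" for J
      proof (cases "2 \<in> set J")
        case t2: True
        obtain x K where xK: "J = x # K" using t2 by (cases J) auto
        have gt: "x < y" if "y \<in> set K" for y using B_setD(2)[OF J] that unfolding xK by simp
        have "2 \<le> x" using B_setD(4)[OF J, of x] unfolding xK by simp
        then have x: "x = 2" using t2 gt unfolding xK by force
        have K: "sorted_wrt (<) K" "\<And>y. y \<in> set K \<Longrightarrow> 2 < y" using B_setD(2)[OF J] gt unfolding xK x by auto
        have low: "lower_letter i J = 1 # K"
          unfolding lower_letter_def xK x two True by (auto dest: K(2) intro!: map_idI)
        have "?k (1 # K) = - (\<Sum>s<length v. if K = take s v @ drop (Suc s) v then (-1) ^ s else (0 :: 'k))"
          by (rule koszul_coeff_one[OF ul u vs _ K(1)]) (use v1 K(2) in force)+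
        then have k: "?k (lower_letter i J) = - (\<Sum>s<length v. if K = drop_at s v then (-1) ^ s else 0)"
          unfolding low drop_at_def .
        have D: "?D J = ?DD" unfolding c0[OF J] unfolding cN True by simp
        have "?e J = - (c J * (?DD * (\<Sum>s<length v. if K = drop_at s v then (-1) ^ s else 0)))"
          unfolding k D two using t2 by simp
        also have "\<dots> = - (\<Sum>s<length v. if J = 2 # drop_at s v then ?DD * ((-1) ^ s * c J) else 0)"
          unfolding sum_distrib_left xK x by (intro arg_cong[of _ _ uminus] sum.cong) auto
        finally show ?thesis .
      next
        case False
        then have "J \<noteq> 2 # drop_at s v" for s by auto
        then show ?thesis using False two by simp
      qed
      have "(\<Sum>J\<in>B_set lam b. ?e J)
          = - (\<Sum>s<length v. \<Sum>J\<in>B_set lam b. if J = 2 # drop_at s v then ?DD * ((-1) ^ s * c J) else 0)"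
        by (simp add: e sum_negf sum.swap[of _ "B_set lam b"])
      also have "(\<Sum>s<length v. \<Sum>J\<in>B_set lam b. if J = 2 # drop_at s v then ?DD * ((-1) ^ s * c J) else 0)
          = (\<Sum>s<length v. ?DD * (if 2 \<in> set (drop_at s v) then 0 else (-1) ^ s * c (2 # drop_at s v)))"
      proof (intro sum.cong refl)
        fix s assume "s \<in> {..<length v}"
        then have s: "s < length v" by simp
        note d = drop_at_props[OF vs s]
        have dB: "2 # drop_at s v \<in> B_set lam b \<longleftrightarrow> 2 \<notin> set (drop_at s v)"
        proof
          assume "2 # drop_at s v \<in> B_set lam b"
          then show "2 \<notin> set (drop_at s v)" using B_setD(3) by fastforce
        next
          assume 2: "2 \<notin> set (drop_at s v)"
          have "2 < y \<and> y \<le> length lam" if "y \<in> set (drop_at s v)" for y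
          proof -
            have "y \<noteq> 2" using that 2 by auto
            moreover have "2 \<le> y \<and> y \<le> length lam" using B_setD(4)[OF v subsetD[OF d(2) that]] .
            ultimately show ?thesis by simp
          qed
          then show "2 # drop_at s v \<in> B_set lam b"
            using d(1,3) B_setD(1)[OF v] i by (force simp: B_set_def True)
        qed
        have "(\<Sum>J\<in>B_set lam b. if J = 2 # drop_at s v then ?DD * ((-1) ^ s * c J) else 0)
            = (\<Sum>J\<in>B_set lam b. if J = 2 # drop_at s v then ?DD * ((-1) ^ s * c (2 # drop_at s v)) else 0)"
          by (intro sum.cong) auto
        then show "(\<Sum>J\<in>B_set lam b. if J = 2 # drop_at s v then ?DD * ((-1) ^ s * c J) else 0)
            = ?DD * (if 2 \<in> set (drop_at s v) then 0 else (-1) ^ s * c (2 # drop_at s v))"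
          using dB by (simp add: sum.delta[OF finite_B_set])
      qed
      finally have "(\<Sum>J\<in>B_set lam b. ?e J)
          = - (?DD * (\<Sum>s<length v. if 2 \<in> set (drop_at s v) then 0 else (-1) ^ s * c (2 # drop_at s v)))"
        by (simp only: sum_distrib_left)
      moreover have "?C v = of_nat ((part lam 1 + t) choose t)" unfolding c0[OF v] unfolding cN True by simp
      ultimately show ?thesis unfolding kz first kill_coeff_def using True by simp
    next
      case False
      let ?w = "raise_letter i v"
      let ?DD = "of_nat ((part lam i + t - 1) choose (t - 1)) :: 'k"
      \<comment> \<open>Only \<open>raise_letter i v\<close> can be lowered to \<open>v\<close>. If
        \<open>J\<close> contains both \<open>i\<close> and \<open>i + 1\<close>, lowering produces
        a repeated letter and the functional vanishes.\<close>
      have e: "(if Suc i \<in> set J then c J * (?D J * ?k (lower_letter i J)) else 0)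
          = (if J = ?w then if i \<in> set v \<and> Suc i \<notin> set v then ?DD * c ?w else 0 else 0)"
        if J: "J \<in> B_set lam b" for J
      proof (cases "Suc i \<in> set J \<and> i \<notin> set J")
        case True
        have "sorted_wrt (<) (lower_letter i J)"
          unfolding lower_letter_def
        proof (rule strict_sorted_map[OF B_setD(2)[OF J]])
          fix x y assume "x \<in> set J" "y \<in> set J" "x < y"
          moreover from this have "x \<noteq> i" "y \<noteq> i" using True by auto
          ultimately show "(if x = Suc i then i else x) < (if y = Suc i then i else y)"
            by (auto simp: less_Suc_eq)
        qed
        moreover have "1 \<notin> set (lower_letter i J)"
          using B_setD(4)[OF J, of 1] False by (auto simp: lower_letter_def)
        ultimately have "?k (lower_letter i J) = (if lower_letter i J = v then 1 else 0)" by (rule ks)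
        moreover have "lower_letter i J = v \<longleftrightarrow> J = ?w \<and> i \<in> set v \<and> Suc i \<notin> set v"
        proof
          assume "lower_letter i J = v"
          then have lv: "v = lower_letter i J" by simp
          have "raise_letter i (lower_letter i J) = J"
            unfolding raise_letter_def lower_letter_def map_map using True by (intro map_idI) auto
          then show "J = ?w \<and> i \<in> set v \<and> Suc i \<notin> set v"
            using True unfolding lv by (auto simp: lower_letter_def)
        next
          assume w: "J = ?w \<and> i \<in> set v \<and> Suc i \<notin> set v"
          then show "lower_letter i J = v"
            unfolding raise_letter_def lower_letter_def by (auto simp: map_map intro!: map_idI)
        qed
        moreover have "count N i - count (mset J) i - 1 = part lam i + t - 1"
          unfolding cJ[OF J] cN using True by simp
        ultimately show ?thesis using True by auto
      next
        case nt: False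
        have "i \<notin> set ?w" if "Suc i \<notin> set v" using that by (auto simp: raise_letter_def)
        moreover have "Suc i \<in> set ?w" if "i \<in> set v" using that by (auto simp: raise_letter_def)
        ultimately have r0: "(if J = ?w then if i \<in> set v \<and> Suc i \<notin> set v then ?DD * c ?w else 0 else 0) = 0"
          using nt by auto
        have "?k (lower_letter i J) = 0" if "Suc i \<in> set J"
        proof (rule koszul_coeff_not_distinct[OF ul u vs])
          have "i \<in> set J" using nt that by blast
          have "\<not> inj_on (\<lambda>j. if j = Suc i then i else j) (set J)"
          proof
            assume "inj_on (\<lambda>j. if j = Suc i then i else j) (set J)"
            from inj_onD[OF this _ that \<open>i \<in> set J\<close>] show False by simp
          qed
          then show "\<not> distinct (lower_letter i J)" unfolding lower_letter_def distinct_map by blast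
        qed (rule v1)
        then show ?thesis unfolding r0 by simp
      qed
      have "(\<Sum>J\<in>B_set lam b. if Suc i \<in> set J then c J * (?D J * ?k (lower_letter i J)) else 0)
          = (\<Sum>J\<in>B_set lam b. if J = ?w then if i \<in> set v \<and> Suc i \<notin> set v then ?DD * c ?w else 0 else 0)"
        by (intro sum.cong refl e)
      also have "\<dots> = (if i \<in> set v \<and> Suc i \<notin> set v then ?DD * c ?w else 0)"
        using raise_letter_B_set[OF v, of i] i by (auto simp: sum.delta[OF finite_B_set])
      finally have "(\<Sum>J\<in>B_set lam b. if Suc i \<in> set J then c J * (?D J * ?k (lower_letter i J)) else 0)
          = (if i \<in> set v \<and> Suc i \<notin> set v then ?DD * c ?w else 0)" .
      moreover have "?C v = of_nat ((part lam i + t - (if i \<in> set v then 1 else 0)) choose t)"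
        unfolding cJ[OF v] unfolding cN by simp
      ultimately show ?thesis unfolding kz first kill_coeff_def using False by simp
    qed
  qed
  have "z \<in> box_image n hk \<longleftrightarrow>
    (\<forall>v\<in>standard_columns N. \<forall>u. mset u + mset (1 # v) = N \<longrightarrow> koszul_coeff u (1 # v) z = 0)"
    by (rule box_image_iff_koszul[OF sN Nn N1 zc]) (rule zw)
  also have "\<dots> \<longleftrightarrow> (\<forall>v\<in>standard_columns N. kill_coeff lam c i t v = 0)"
  proof (intro ball_cong refl)
    fix v assume v: "v \<in> standard_columns N"
    obtain u where "mset u + mset (1 # v) = N" using standard_complement[OF N1 v] .
    then show "(\<forall>u. mset u + mset (1 # v) = N \<longrightarrow> koszul_coeff u (1 # v) z = 0) \<longleftrightarrow> kill_coeff lam c i t v = 0"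
      using val v valid by metis
  qed
  also have "\<dots> \<longleftrightarrow> (\<forall>v\<in>B_set lam b. (Suc i \<in> set v \<longrightarrow> t < part lam (Suc i)) \<longrightarrow> kill_coeff lam c i t v = 0)"
    using valid by blast
  finally show ?thesis unfolding z_def .
qed

lemma standard_columns_lam: "standard_columns (mset (block_word 1 lam)) = B_set lam b"
proof -
  have mem: "x \<in># mset (block_word 1 lam) \<longleftrightarrow> 1 \<le> x \<and> x \<le> length lam" for x
  proof -
    have "x \<in># mset (block_word 1 lam) \<longleftrightarrow> 0 < part lam x"
      unfolding count_block_word_1[symmetric] by simp
    then show ?thesis using part_pos[of x] by (auto simp: part_def)
  qed
  have "2 \<le> x \<longleftrightarrow> 1 \<le> x \<and> x \<noteq> 1" for x :: nat by auto
  then have "set v \<subseteq> set_mset (mset (block_word 1 lam)) \<and> 1 \<notin> set v \<longleftrightarrow> set v \<subseteq> {2..length lam}" for v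
    using mem unfolding subset_iff atLeastAtMost_iff by metis
  then show ?thesis unfolding standard_columns_def B_set_def by blast
qed

lemma tab_comb_eq: "tab_comb lam b c = standard_comb (mset (block_word 1 lam)) c"
proof -
  have "sum_list lam - b = a" using size by simp
  then show ?thesis by (simp add: tab_comb_def[abs_def] standard_comb_def standard_columns_lam)
qed

lemma weight_facts:
  "size (mset (block_word 1 lam)) = a + b" "set_mset (mset (block_word 1 lam)) \<subseteq> {1..n}"
  using set_block_word[of 1 lam] lam_n size by auto

lemma tab_comb_expansion:
  fixes y :: "'k::field tensor"
  assumes y: "y \<in> class_fun n hk" "has_weight lam y"
  obtains c where "(\<lambda>w. y w - tab_comb lam b c w) \<in> box_image n hk"
  using standard_expansion[OF weight_facts y(1)] y(2) unfolding tab_comb_eq has_weight_def by blast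

text \<open>The functional at \<open>v\<close> vanishes on relations and returns \<open>c v\<close>;
  this is the independence of the tableaux with columns in \<open>B_set\<close>.\<close>

lemma tab_comb_zero:
  fixes c :: "nat list \<Rightarrow> 'k::field"
  assumes z: "tab_comb lam b c \<in> box_image n hk" and v: "v \<in> B_set lam b" and ne: "lam \<noteq> []"
  shows "c v = 0"
proof -
  have "0 < part lam 1" using ne by (intro part_pos) (auto simp: Suc_le_eq One_nat_def)
  then have one: "1 \<in># mset (block_word 1 lam)" unfolding count_block_word_1[symmetric] by simp
  have v': "v \<in> standard_columns (mset (block_word 1 lam))" using v standard_columns_lam by simp
  obtain u where u: "mset u + mset (1 # v) = mset (block_word 1 lam)" using standard_complement[OF one v'] .
  show ?thesis using koszul_coeff_standard_comb[OF weight_facts v' u] z unfolding tab_comb_eq by metis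
qed

end

declare upt_Suc [simp del]

section \<open>Coefficients of the homomorphism\<close>

lemma B_set_nth:
  assumes "v \<in> B_set lam b" "k < b"
  shows "k + 2 \<le> v ! k"
  using assms(2)
proof (induction k)
  case 0
  then have "v ! 0 \<in> set v" using B_setD(1)[OF assms(1)] by (intro nth_mem) simp
  then have "2 \<le> v ! 0" using B_setD(4)[OF assms(1)] by blast
  then show ?case by simp
next
  case (Suc k)
  then have "v ! k < v ! Suc k"
    using B_setD(1,2)[OF assms(1)] by (intro sorted_wrt_nth_less[of "(<)"]) simp_all
  then show ?case using Suc by simp
qed

lemma B_set_part:
  assumes "v \<in> B_set lam b" "1 \<le> u" "u \<le> b"
  shows "u + 1 \<le> part v u" "part v u \<in> set v"
  using B_set_nth[OF assms(1), of "u - 1"] assms B_setD(1)[OF assms(1)] by (auto simp: part_def One_nat_def)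

lemma part_raise_letter:
  "1 \<le> u \<Longrightarrow> u \<le> length v \<Longrightarrow> part (raise_letter i v) u = (if part v u = i then Suc i else part v u)"
  by (simp add: part_def raise_letter_def One_nat_def)

lemma length_raise_letter [simp]: "length (raise_letter i v) = length v"
  by (simp add: raise_letter_def)

text \<open>If \<open>i\<close> is the entry in row u0, raising it extends only the inner product of
  this row, by the index \<open>i - 1\<close>, whose factor is -\<lambda>_i.\<close>

lemma d_coeff_raise_letter:
  assumes v: "v \<in> B_set lam b" and i: "i \<in> set v"
  shows "d_coeff lam (raise_letter i v) = - int (part lam i) * d_coeff lam v"
proof -
  have len: "length v = b" by (rule B_setD(1)[OF v])
  let ?g = "\<lambda>u j. \<Prod>x=u..j - 2. - int (part lam (x + 1))"
  obtain k where k: "k < length v" "v ! k = i" using i by (auto simp: in_set_conv_nth)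
  define u0 where "u0 = Suc k"
  have u0: "u0 \<in> {1..b}" "part v u0 = i" using k len by (auto simp: u0_def part_def One_nat_def)
  have uniq: "u = u0" if "u \<in> {1..b}" "part v u = i" for u
  proof -
    have "v ! (u - 1) = v ! k" "u - 1 < length v" "1 \<le> u"
      using that len k(2) by (auto simp: part_def)
    then have "u - 1 = k" using nth_eq_iff_index_eq[OF B_setD(3)[OF v] _ k(1)] by blast
    then show ?thesis using \<open>1 \<le> u\<close> by (simp add: u0_def One_nat_def)
  qed
  have ui: "u0 + 1 \<le> i" using B_set_part(1)[OF v, of u0] u0 by simp
  have g: "?g u0 (Suc i) = - int (part lam i) * ?g u0 i"
  proof -
    have "{u0..Suc i - 2} = insert (i - 1) {u0..i - 2}" using ui by (auto simp: One_nat_def)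
    moreover have "i - 1 \<notin> {u0..i - 2}" "i - 1 + 1 = i" using ui u0 by auto
    ultimately show ?thesis by simp
  qed
  have "d_coeff lam (raise_letter i v) = (\<Prod>u\<in>{1..b}. ?g u (part (raise_letter i v) u))"
    by (simp add: d_coeff_def len)
  also have "\<dots> = ?g u0 (part (raise_letter i v) u0) * (\<Prod>u\<in>{1..b} - {u0}. ?g u (part (raise_letter i v) u))"
    by (rule prod.remove) (use u0 in auto)
  also have "part (raise_letter i v) u0 = Suc i" using part_raise_letter[of u0 v i] u0 len by simp
  also have "(\<Prod>u\<in>{1..b} - {u0}. ?g u (part (raise_letter i v) u)) = (\<Prod>u\<in>{1..b} - {u0}. ?g u (part v u))"
  proof (rule prod.cong[OF refl])
    fix u assume u: "u \<in> {1..b} - {u0}"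
    then have "part v u \<noteq> i" using uniq by blast
    then show "?g u (part (raise_letter i v) u) = ?g u (part v u)"
      using part_raise_letter[of u v i] u len by simp
  qed
  also have "?g u0 (Suc i) * (\<Prod>u\<in>{1..b} - {u0}. ?g u (part v u))
      = - int (part lam i) * (?g u0 (part v u0) * (\<Prod>u\<in>{1..b} - {u0}. ?g u (part v u)))"
    using g u0(2) by simp
  also have "?g u0 (part v u0) * (\<Prod>u\<in>{1..b} - {u0}. ?g u (part v u)) = (\<Prod>u\<in>{1..b}. ?g u (part v u))"
    by (rule prod.remove[symmetric]) (use u0 in auto)
  finally show ?thesis by (simp add: d_coeff_def len)
qed

lemma d_coeff_initial: "d_coeff lam [2..<b + 2] = 1"
proof -
  have "(\<Prod>x=u..part [2..<b + 2] u - 2. - int (part lam (x + 1))) = 1" if "u \<in> {1..b}" for u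
  proof -
    have "part [2..<b + 2] u = u + 1" using that by (auto simp: part_def)
    then have "{u..part [2..<b + 2] u - 2} = {}" using that by auto
    then show ?thesis by simp
  qed
  then show ?thesis unfolding d_coeff_def by (intro prod.neutral) simp
qed

lemma sorted_list_eqI:
  "sorted_wrt (<) (v :: nat list) \<Longrightarrow> sorted_wrt (<) w \<Longrightarrow> set v = set w \<Longrightarrow> v = w"
  by (rule sorted_distinct_set_unique) (auto simp: strict_sorted_iff)

text \<open>If no entry could be lowered, the entries would be closed downwards to \<open>k\<close>
  and hence be the interval of length \<open>b\<close> starting at \<open>k\<close>.\<close>

lemma exists_lower:
  assumes v: "sorted_wrt (<) (v :: nat list)" "length v = b" "\<And>x. x \<in> set v \<Longrightarrow> k \<le> x"
    and ne: "v \<noteq> [k..<k + b]"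
  obtains i where "k \<le> i" "Suc i \<in> set v" "i \<notin> set v"
proof -
  have "\<exists>i. k \<le> i \<and> Suc i \<in> set v \<and> i \<notin> set v"
  proof (rule ccontr)
    assume no: "\<not> ?thesis"
    have down: "y \<in> set v" if "x \<in> set v" "k \<le> y" "y \<le> x" for x y
      using that(3,2,1)
    proof (induction rule: inc_induct)
      case (step n)
      then show ?case using no by auto
    qed simp
    have "set v = {k..<k + b}"
    proof (cases "v = []")
      case False
      define M where "M = Max (set v)"
      have M: "M \<in> set v" "\<And>x. x \<in> set v \<Longrightarrow> x \<le> M" using False by (auto simp: M_def)
      have "set v = {k..M}"
      proof
        show "set v \<subseteq> {k..M}" using M(2) v(3) by fastforce
        show "{k..M} \<subseteq> set v" using down[OF M(1)] by fastforce
      qed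
      moreover have "card (set v) = b" using v(1,2) by (simp add: distinct_card strict_sorted_iff)
      ultimately have Mb: "Suc M - k = b" by simp
      have "k \<le> M" using M(1) v(3) by blast
      then have "{k..M} = {k..<k + b}" using Mb by auto
      then show ?thesis using \<open>set v = {k..M}\<close> by simp
    qed (use v in simp)
    then have "v = [k..<k + b]" by (intro sorted_list_eqI[OF v(1)]) auto
    then show False using ne by simp
  qed
  then show ?thesis using that by blast
qed

lemma lower_letter_B_set:
  assumes v: "v \<in> B_set lam b" and i: "2 \<le> i" "Suc i \<in> set v" "i \<notin> set v"
  shows "lower_letter i v \<in> B_set lam b" "raise_letter i (lower_letter i v) = v"
    "i \<in> set (lower_letter i v)" "Suc i \<notin> set (lower_letter i v)"
    "sum_list (lower_letter i v) < sum_list v"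
proof -
  have "sorted_wrt (<) (lower_letter i v)"
    unfolding lower_letter_def
  proof (rule strict_sorted_map[OF B_setD(2)[OF v]])
    fix x y assume "x \<in> set v" "y \<in> set v" "x < y"
    moreover from this have "x \<noteq> i" "y \<noteq> i" using i by auto
    ultimately show "(if x = Suc i then i else x) < (if y = Suc i then i else y)"
      by (auto simp: less_Suc_eq)
  qed
  then show "lower_letter i v \<in> B_set lam b"
    using B_setD(1,4)[OF v] i by (fastforce simp: B_set_def lower_letter_def)
  show "raise_letter i (lower_letter i v) = v"
    unfolding raise_letter_def lower_letter_def map_map using i by (intro map_idI) auto
  show "i \<in> set (lower_letter i v)" "Suc i \<notin> set (lower_letter i v)" using i by (auto simp: lower_letter_def)
  have "sum_list (map (\<lambda>j. if j = Suc i then i else j) v) < sum_list (map (\<lambda>j. j) v)"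
    using i(2)
  proof (induction v)
    case (Cons x v)
    have "sum_list (map (\<lambda>j. if j = Suc i then i else j) v) \<le> sum_list (map (\<lambda>j. j) v)"
      by (rule sum_list_mono) auto
    then show ?case using Cons by (cases "Suc i \<in> set v") auto
  qed simp
  then show "sum_list (lower_letter i v) < sum_list v" by (simp add: lower_letter_def)
qed

text \<open>Separates the arithmetic from the modules: \<open>l\<close> and \<open>d\<close> are the
  images in the field of the parts and of the integers \<open>d_coeff\<close>.\<close>

locale hook_coeffs =
  fixes lam :: "nat list" and b :: nat and l :: "nat \<Rightarrow> 'k::field" and d :: "nat list \<Rightarrow> 'k"
  assumes pos: "\<And>x. x \<in> set lam \<Longrightarrow> 0 < x"
    and mono: "\<And>i j. 1 \<le> i \<Longrightarrow> i \<le> j \<Longrightarrow> part lam j \<le> part lam i"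
    and bm: "b + 2 \<le> length lam"
    and l: "\<And>i. l i = of_nat (part lam i)"
    and d: "\<And>J. d J = of_int (d_coeff lam J)"
begin

lemma part_pos: "1 \<le> x \<Longrightarrow> x \<le> length lam \<Longrightarrow> 1 \<le> part lam x"
  by (auto simp: part_def Suc_le_eq One_nat_def intro!: pos)

lemma d_raise: "v \<in> B_set lam b \<Longrightarrow> i \<in> set v \<Longrightarrow> d (raise_letter i v) = - l i * d v"
proof -
  assume "v \<in> B_set lam b" "i \<in> set v"
  from d_coeff_raise_letter[OF this] show ?thesis unfolding d l by simp
qed

lemma d_initial: "d [2..<b + 2] = 1"
  unfolding d d_coeff_initial by simp

lemma initial_B_set: "[2..<b + 2] \<in> B_set lam b"
  using bm by (auto simp: B_set_def)

text \<open>Every column other than (2, ..., b+1) arises from one with smaller sum by raising an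
  entry, and both \<open>c\<close> and \<open>d\<close> change by the same factor.\<close>

lemma coeffs_unique:
  assumes c: "\<And>v i. v \<in> B_set lam b \<Longrightarrow> i \<in> set v \<Longrightarrow> Suc i \<notin> set v \<Longrightarrow> Suc i \<le> length lam
      \<Longrightarrow> c (raise_letter i v) = - l i * (c v :: 'k)"
    and v: "v \<in> B_set lam b"
  shows "c v = c [2..<b + 2] * d v"
  using v
proof (induction "sum_list v" arbitrary: v rule: less_induct)
  case less
  show ?case
  proof (cases "v = [2..<b + 2]")
    case True
    then show ?thesis using d_initial by simp
  next
    case False
    obtain i where i: "2 \<le> i" "Suc i \<in> set v" "i \<notin> set v"
      by (rule exists_lower[of v b 2])
        (use B_setD[OF less.prems] False in \<open>auto simp: add.commute\<close>)
    note w = lower_letter_B_set[OF less.prems i]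
    have "Suc i \<le> length lam" using B_setD(4)[OF less.prems i(2)] by simp
    then show ?thesis
      using c[OF w(1,3,4)] d_raise[OF w(1,3)] less.hyps[OF w(5,1)] w(2) by simp
  qed
qed

text \<open>The entry in row \<open>u\<close> has passed over \<open>w\<close>, so the product for
  this row contains the factor -\<lambda>_w.\<close>

lemma d_zero:
  assumes v: "v \<in> B_set lam b" and u: "1 \<le> u" "u \<le> b" and w: "u + 1 \<le> w" "w < part v u" and z: "l w = 0"
  shows "d v = 0"
proof -
  have "d v = (\<Prod>u=1..b. \<Prod>x=u..part v u - 2. - l (x + 1))"
    by (simp add: d d_coeff_def l B_setD(1)[OF v])
  moreover have "(\<Prod>x=u..part v u - 2. - l (x + 1)) = 0"
  proof (rule prod_zero)
    show "\<exists>x\<in>{u..part v u - 2}. - l (x + 1) = 0"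
      using w z by (intro bexI[of _ "w - 1"]) auto
  qed simp
  ultimately show ?thesis using u by (simp only:, intro prod_zero) auto
qed

text \<open>The coefficient of the column (2, ..., k, k+2, ..., b+2), whose entries from row
  \<open>k\<close> on are one larger than in (2, ..., b+1).\<close>

definition tail_prod :: "nat \<Rightarrow> 'k" where
  "tail_prod k = (\<Prod>u=k..b. - l (u + 1))"

lemma tail_prod_simps: "tail_prod (b + 1) = 1" "k \<le> b \<Longrightarrow> tail_prod k = - l (k + 1) * tail_prod (Suc k)"
  by (simp_all add: tail_prod_def prod.atLeast_Suc_atMost)

lemma tail_prod_zero: "k \<le> u \<Longrightarrow> u \<le> b \<Longrightarrow> l (u + 1) = 0 \<Longrightarrow> tail_prod k = 0"
  unfolding tail_prod_def by (rule prod_zero) (auto intro!: bexI[of _ u])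

lemma d_shifted: "d [3..<b + 3] = tail_prod 1"
proof -
  have "part [3..<b + 3] u = u + 2" if "u \<in> {1..b}" for u using that by (auto simp: part_def)
  then show ?thesis by (simp add: d d_coeff_def tail_prod_def l)
qed

lemma d_shifted_drop:
  assumes "s < b"
  shows "d (2 # drop_at s [3..<b + 3]) = tail_prod (s + 2)"
proof -
  let ?I = "2 # drop_at s [3..<b + 3]"
  have len: "length ?I = b" using assms by (simp add: drop_at_def)
  have p: "part ?I u = (if u \<le> s + 1 then u + 1 else u + 2)" if u: "u \<in> {1..b}" for u
  proof (cases "u = 1")
    case True
    then show ?thesis using u len by (simp add: part_def)
  next
    case False
    then obtain j where j: "u = Suc (Suc j)" using u by (metis One_nat_def atLeastAtMost_iff not0_implies_Suc not_one_le_zero)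
    have "part ?I u = drop_at s [3..<b + 3] ! j" using u len unfolding part_def j by (simp add: One_nat_def)
    also have "\<dots> = (if j < s then 3 + j else 4 + j)"
      using u j assms unfolding drop_at_def by (auto simp: nth_append nth_drop)
    finally show ?thesis using j by (auto simp: numeral_eq_Suc)
  qed
  have "d ?I = (\<Prod>u=1..b. \<Prod>x=u..part ?I u - 2. - l (x + 1))"
    unfolding d d_coeff_def len by (simp add: l)
  also have "\<dots> = (\<Prod>u=1..b. if u \<le> s + 1 then 1 else - l (u + 1))"
  proof (intro prod.cong refl)
    fix u assume "u \<in> {1..b}"
    then show "(\<Prod>x=u..part ?I u - 2. - l (x + 1)) = (if u \<le> s + 1 then 1 else - l (u + 1))"
      using p[of u] by auto
  qed
  also have "\<dots> = (\<Prod>u\<in>{s + 2..b}. - l (u + 1))"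
    by (rule prod.mono_neutral_cong_right) auto
  finally show ?thesis by (simp add: tail_prod_def)
qed

end

section \<open>The divisibility conditions\<close>

context hook_coeffs
begin

text \<open>The multiset coefficient, in the form in which it occurs in \<open>R_gcd\<close>; the
  raising relations use it with x = \<lambda>_i or x = \<lambda>_i + 1.\<close>

definition C :: "nat \<Rightarrow> nat \<Rightarrow> 'k" where
  "C x t = of_nat ((x + t - 1) choose t)"

text \<open>The divisibility of R(x, y) by the characteristic, expressed in the field.\<close>

definition RZ :: "nat \<Rightarrow> nat \<Rightarrow> bool" where
  "RZ x y \<longleftrightarrow> (\<forall>j. 1 \<le> j \<longrightarrow> j \<le> y \<longrightarrow> C x j = 0)"

abbreviation L :: "nat \<Rightarrow> nat" where "L \<equiv> part lam"

definition first_sum :: "nat list \<Rightarrow> 'k" where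
  "first_sum v = (\<Sum>s<length v. if 2 \<in> set (drop_at s v) then 0 else (-1) ^ s * d (2 # drop_at s v))"

definition killed :: bool where
  "killed \<longleftrightarrow> (\<forall>i t. (i, t) \<in> box_index lam \<longrightarrow>
    (\<forall>v\<in>B_set lam b. (Suc i \<in> set v \<longrightarrow> t < L (Suc i)) \<longrightarrow> kill_coeff lam d i t v = 0))"

lemma RZ_D: "RZ x y \<Longrightarrow> 1 \<le> j \<Longrightarrow> j \<le> y \<Longrightarrow> C x j = 0"
  by (simp add: RZ_def)

lemma C_0 [simp]: "C x 0 = 1" and C_1: "C x 1 = of_nat x"
  by (simp_all add: C_def choose_one)

lemma C_L_1: "C (L i) 1 = l i" "C (L i + 1) 1 = l i + 1"
  by (simp_all add: C_1 l)

text \<open>Both sides equal (x+t-1) times the binomial of x+t-2 over t-1, by the two absorption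
  identities.\<close>

lemma C_absorb: "1 \<le> t \<Longrightarrow> of_nat t * C x t = of_nat x * C (x + 1) (t - 1)"
proof -
  assume "1 \<le> t"
  then obtain s where t: "t = Suc s" by (cases t) auto
  have "Suc s * ((x + s) choose Suc s) = (x + s) * ((x + s - 1) choose s)" by (rule binomial_absorption)
  also have "\<dots> = x * ((x + s) choose s)" using binomial_absorb_comp[of "x + s" s] by simp
  finally have "of_nat (Suc s * ((x + s) choose Suc s)) = (of_nat (x * ((x + s) choose s)) :: 'k)" by simp
  then show ?thesis unfolding t C_def of_nat_mult by (simp add: add.commute)
qed

lemma C_pascal: "1 \<le> t \<Longrightarrow> C (x + 1) t = C (x + 1) (t - 1) + C x t"
proof -
  assume "1 \<le> t"
  then obtain s where t: "t = Suc s" by (cases t) auto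
  have "x + 1 + Suc s - 1 = Suc (x + s)" "x + 1 + (Suc s - 1) - 1 = x + s" "x + Suc s - 1 = x + s" by auto
  then show ?thesis unfolding t C_def by (simp only: binomial_Suc_Suc of_nat_add diff_Suc_1)
qed

lemma box_index_iff: "(i, t) \<in> box_index lam \<longleftrightarrow> 1 \<le> i \<and> i < length lam \<and> 1 \<le> t \<and> t \<le> L (Suc i)"
  by (simp add: box_index_def Suc_eq_plus1)

text \<open>If \<open>i\<close> but not \<open>i + 1\<close> is in \<open>v\<close>, the raised
  column has coefficient -\<lambda>_i times that of \<open>v\<close>; absorption turns its
  contribution into -t C(\<lambda>_i, t), which explains the factor 1 - t. In particular the
  relation with \<open>t = 1\<close> holds automatically.\<close>

lemma kill_coeff_eq:
  assumes i: "2 \<le> i" and t: "1 \<le> t" and v: "v \<in> B_set lam b"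
  shows "kill_coeff lam d i t v = (if i \<in> set v then
      if Suc i \<in> set v then C (L i) t * d v else (1 - of_nat t) * C (L i) t * d v
    else C (L i + 1) t * d v)"
proof -
  have n: "L i + t - 0 = L i + 1 + t - 1" "L i + t - 1 = L i + 1 + (t - 1) - 1" using t by auto
  have "kill_coeff lam d i t v = (if i \<in> set v then C (L i) t else C (L i + 1) t) * d v
      + (if i \<in> set v \<and> Suc i \<notin> set v then C (L i + 1) (t - 1) * (- l i * d v) else 0)"
    using i n d_raise[OF v] by (auto simp: kill_coeff_def C_def)
  also have "\<dots> = (if i \<in> set v then
      if Suc i \<in> set v then C (L i) t * d v else (1 - of_nat t) * C (L i) t * d v
    else C (L i + 1) t * d v)"
    using C_absorb[OF t, of "L i"] by (auto simp: l algebra_simps)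
  finally show ?thesis .
qed

lemma kill_coeff_eq_1:
  assumes t: "1 \<le> t"
  shows "kill_coeff lam d 1 t v = C (L 1 + 1) t * d v - C (L 1 + 1) (t - 1) * first_sum v"
  using t by (simp add: kill_coeff_def C_def first_sum_def)

text \<open>The entry 2 is on top, and only dropping it leaves a column without 2; putting 2 back
  gives \<open>v\<close> itself.\<close>

lemma first_sum_2:
  assumes v: "v \<in> B_set lam b" and 2: "2 \<in> set v"
  shows "first_sum v = d v"
proof -
  obtain x K where xK: "v = x # K" using 2 by (cases v) auto
  have gt: "x < y" if "y \<in> set K" for y using B_setD(2)[OF v] that unfolding xK by simp
  have "2 \<le> x" using B_setD(4)[OF v, of x] unfolding xK by simp
  then have x: "x = 2" "2 \<notin> set K" using 2 gt unfolding xK by force+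
  have s: "2 \<in> set (drop_at s v)" if "0 < s" for s
    using that x unfolding xK drop_at_def by (cases s) auto
  have "first_sum v = (\<Sum>s<length v. if s = 0 then d v else 0)"
    unfolding first_sum_def
  proof (intro sum.cong refl)
    fix s
    show "(if 2 \<in> set (drop_at s v) then 0 else (-1) ^ s * d (2 # drop_at s v)) = (if s = 0 then d v else 0)"
      using s[of s] x by (cases "s = 0") (auto simp: xK drop_at_def)
  qed
  then show ?thesis by (simp add: sum.delta xK)
qed

lemma kill_coeff_eq_1_2:
  assumes t: "1 \<le> t" and v: "v \<in> B_set lam b" and 2: "2 \<in> set v"
  shows "kill_coeff lam d 1 t v = C (L 1) t * d v"
  unfolding kill_coeff_eq_1[OF t] first_sum_2[OF v 2] C_pascal[OF t] by (simp add: algebra_simps)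

lemma shifted_B_set: "[3..<b + 3] \<in> B_set lam b"
  using bm by (auto simp: B_set_def)

lemma first_sum_shifted: "first_sum [3..<b + 3] = (\<Sum>s<b. (-1) ^ s * tail_prod (s + 2))"
  unfolding first_sum_def
proof (rule sum.cong)
  fix s assume s: "s \<in> {..<b}"
  then have "2 \<notin> set (drop_at s [3..<b + 3])"
    by (auto simp: drop_at_def dest!: in_set_takeD in_set_dropD)
  then show "(if 2 \<in> set (drop_at s [3..<b + 3]) then 0 else (-1) ^ s * d (2 # drop_at s [3..<b + 3]))
      = (-1) ^ s * tail_prod (s + 2)" using d_shifted_drop[of s] s by (simp only: lessThan_iff if_False)
qed simp

text \<open>Moving an entry from \<open>i\<close> to \<open>i + 1\<close> multiplies all terms but one of the relation for \<open>i = 1\<close>,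
  \<open>t = 1\<close> by \<open>-\<lambda>\<^sub>i\<close>; the remaining one changes by a term which the relation for \<open>(i, 1)\<close> kills.\<close>

lemma first_sum_general:
  assumes A: "\<And>i v. 2 \<le> i \<Longrightarrow> i < length lam \<Longrightarrow> v \<in> B_set lam b \<Longrightarrow> i \<notin> set v \<Longrightarrow> Suc i \<notin> set v \<Longrightarrow> (l i + 1) * d v = 0"
    and base: "first_sum [3..<b + 3] = (l 1 + 1) * d [3..<b + 3]"
    and v: "v \<in> B_set lam b" "2 \<notin> set v"
  shows "first_sum v = (l 1 + 1) * d v"
  using v
proof (induction "sum_list v" arbitrary: v rule: less_induct)
  case less
  note v = less.prems
  show ?case
  proof (cases "v = [3..<b + 3]")
    case True
    then show ?thesis using base by simp
  next
    case False
    have ge3: "3 \<le> x" if "x \<in> set v" for x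
    proof -
      have "2 \<le> x" "x \<noteq> 2" using B_setD(4)[OF v(1) that] v(2) that by auto
      then show ?thesis by simp
    qed
    obtain i where i: "3 \<le> i" "Suc i \<in> set v" "i \<notin> set v"
      by (rule exists_lower[of v b 3]) (use B_setD[OF v(1)] ge3 False in \<open>auto simp: add.commute\<close>)
    define w where "w = lower_letter i v"
    have w: "w \<in> B_set lam b" "raise_letter i w = v" "i \<in> set w" "Suc i \<notin> set w" "sum_list w < sum_list v"
      unfolding w_def using lower_letter_B_set[OF v(1) _ i(2,3)] i(1) by auto
    have im: "i < length lam" using B_setD(4)[OF v(1) i(2)] by simp
    have lv: "length v = b" and lw: "length w = b" using B_setD(1)[OF v(1)] B_setD(1)[OF w(1)] by auto
    have w2: "2 \<notin> set w" using v(2) i(1) by (auto simp: w_def lower_letter_def)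
    obtain k where k: "k < b" "w ! k = i" using w(3) lw by (auto simp: in_set_conv_nth)
    have dn: "2 \<notin> set (drop_at s v)" "2 \<notin> set (drop_at s w)" for s
      using v(2) w2 by (auto simp: drop_at_def dest: in_set_takeD in_set_dropD)
    have da: "drop_at s v = raise_letter i (drop_at s w)" for s
      by (simp add: drop_at_def raise_letter_def take_map drop_map flip: w(2))
    have wn: "w ! s \<noteq> i" if "s < b" "s \<noteq> k" for s
      using nth_eq_iff_index_eq[OF B_setD(3)[OF w(1)], of s k] that k lw by simp
    have B2: "2 # drop_at s w \<in> B_set lam b" if "s < b" for s
    proof -
      note dp = drop_at_props[OF B_setD(2)[OF w(1)], of s]
      have "2 < y \<and> y \<le> length lam" if "y \<in> set (drop_at s w)" for y
      proof -
        have "y \<in> set w" using dp(2) that \<open>s < b\<close> lw by auto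
        then have "2 \<le> y" "y \<le> length lam" "y \<noteq> 2" using B_setD(4)[OF w(1)] w2 by auto
        then show ?thesis by simp
      qed
      then show ?thesis using dp(1,3) that lw bm by (force simp: B_set_def)
    qed
    have split: "w = take s w @ w ! s # drop (Suc s) w" if "s < b" for s
      using id_take_nth_drop[of s w] that lw by simp
    have i_in: "i \<in> set (drop_at s w)" if "s < b" "s \<noteq> k" for s
    proof -
      have "i \<in> set (take s w @ w ! s # drop (Suc s) w)" using split[OF that(1)] w(3) by simp
      then show ?thesis using wn[OF that] by (auto simp: drop_at_def)
    qed
    have i_notin: "i \<notin> set (drop_at k w)" "Suc i \<notin> set (drop_at k w)"
    proof -
      have "distinct (take k w @ w ! k # drop (Suc k) w)" using split[OF k(1)] B_setD(3)[OF w(1)] by simp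
      then show "i \<notin> set (drop_at k w)" using k(2) by (auto simp: drop_at_def)
      show "Suc i \<notin> set (drop_at k w)" using w(4) by (auto simp: drop_at_def dest: in_set_takeD in_set_dropD)
    qed
    have summand: "(-1) ^ s * d (2 # drop_at s v) = - l i * ((-1) ^ s * d (2 # drop_at s w))
        + (if s = k then (-1) ^ k * ((l i + 1) * d (2 # drop_at k w)) else 0)" if s: "s < b" for s
    proof (cases "s = k")
      case True
      have "raise_letter i (drop_at k w) = drop_at k w"
        unfolding raise_letter_def using i_notin by (intro map_idI) auto
      then show ?thesis using True by (simp add: da algebra_simps)
    next
      case False
      have "2 # drop_at s v = raise_letter i (2 # drop_at s w)" using i(1) by (simp add: da raise_letter_def)
      then have "d (2 # drop_at s v) = - l i * d (2 # drop_at s w)"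
        using d_raise[OF B2[OF s], of i] i_in[OF s False] by (metis list.set_intros(2))
      then show ?thesis using False by simp
    qed
    have zero: "(l i + 1) * d (2 # drop_at k w) = 0"
      by (rule A[OF _ im B2[OF k(1)]]) (use i i_notin in auto)
    have "first_sum v = (\<Sum>s<b. (-1) ^ s * d (2 # drop_at s v))"
      by (simp add: first_sum_def dn lv)
    also have "\<dots> = (\<Sum>s<b. - l i * ((-1) ^ s * d (2 # drop_at s w)))"
      using zero by (intro sum.cong refl) (simp add: summand)
    also have "\<dots> = - l i * first_sum w"
      by (simp add: first_sum_def dn lw sum_distrib_left)
    also have "first_sum w = (l 1 + 1) * d w" by (rule less.hyps[OF w(5,1) w2])
    also have "- l i * ((l 1 + 1) * d w) = (l 1 + 1) * d v"
      using d_raise[OF w(1,3)] w(2) by simp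
    finally show ?thesis .
  qed
qed

text \<open>The hypotheses sort the relations by whether \<open>i\<close> and \<open>i + 1\<close>
  lie in the column. The case with \<open>i + 1\<close> but not \<open>i\<close> reduces to the
  lowered column with \<open>t + 1\<close>, and for \<open>i = 1\<close> all columns without 2
  reduce to (3, ..., b+2).\<close>

lemma killedI:
  assumes A: "\<And>i t v. 2 \<le> i \<Longrightarrow> i < length lam \<Longrightarrow> v \<in> B_set lam b \<Longrightarrow> i \<notin> set v \<Longrightarrow> Suc i \<notin> set v
      \<Longrightarrow> 1 \<le> t \<Longrightarrow> t \<le> L (Suc i) \<Longrightarrow> C (L i + 1) t * d v = 0"
    and B: "\<And>i t v. 2 \<le> i \<Longrightarrow> i < length lam \<Longrightarrow> v \<in> B_set lam b \<Longrightarrow> i \<in> set v \<Longrightarrow> Suc i \<in> set v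
      \<Longrightarrow> 1 \<le> t \<Longrightarrow> t < L (Suc i) \<Longrightarrow> C (L i) t * d v = 0"
    and Cc: "\<And>i t v. 2 \<le> i \<Longrightarrow> i < length lam \<Longrightarrow> v \<in> B_set lam b \<Longrightarrow> i \<in> set v \<Longrightarrow> Suc i \<notin> set v
      \<Longrightarrow> 2 \<le> t \<Longrightarrow> t \<le> L (Suc i) \<Longrightarrow> C (L i) t * d v = 0"
    and One: "\<And>t v. v \<in> B_set lam b \<Longrightarrow> 2 \<in> set v \<Longrightarrow> 1 \<le> t \<Longrightarrow> t < L 2 \<Longrightarrow> C (L 1) t * d v = 0"
    and Two: "\<And>t v. v \<in> B_set lam b \<Longrightarrow> 2 \<notin> set v \<Longrightarrow> 2 \<le> t \<Longrightarrow> t \<le> L 2 \<Longrightarrow> C (L 1) t * d v = 0"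
    and base: "first_sum [3..<b + 3] = (l 1 + 1) * d [3..<b + 3]"
  shows killed
  unfolding killed_def
proof (intro allI impI ballI)
  fix i t v
  assume it: "(i, t) \<in> box_index lam" and v: "v \<in> B_set lam b" and valid: "Suc i \<in> set v \<longrightarrow> t < L (Suc i)"
  have i: "1 \<le> i" "i < length lam" and t: "1 \<le> t" "t \<le> L (Suc i)" using it by (auto simp: box_index_iff)
  show "kill_coeff lam d i t v = 0"
  proof (cases "i = 1")
    case True
    have two: "Suc i = 2" using True by simp
    show ?thesis
    proof (cases "2 \<in> set v")
      case t2: True
      then show ?thesis
        using kill_coeff_eq_1_2[OF t(1) v t2] One[OF v t2 t(1)] valid True two by simp
    next
      case n2: False
      have fs: "first_sum v = (l 1 + 1) * d v"
      proof (rule first_sum_general[OF _ base v n2])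
        fix i v assume *: "2 \<le> i" "i < length lam" "v \<in> B_set lam b" "i \<notin> set v" "Suc i \<notin> set v"
        have "1 \<le> L (Suc i)" using part_pos[of "Suc i"] *(2) by simp
        then show "(l i + 1) * d v = 0" using A[OF *, of 1] unfolding C_L_1 by simp
      qed
      \<comment> \<open>With x = \<lambda>_1, Pascal's rule turns C(x+1, t) - C(x+1, t-1) into C(x,
        t), and absorption turns x C(x+1, t-1) into t C(x, t).\<close>
      have "C (L 1 + 1) t - C (L 1 + 1) (t - 1) * (l 1 + 1) = (1 - of_nat t) * C (L 1) t"
        using C_absorb[OF t(1), of "L 1"] C_pascal[OF t(1), of "L 1"] by (simp add: l algebra_simps)
      then have "kill_coeff lam d i t v = (1 - of_nat t) * C (L 1) t * d v"
        unfolding True kill_coeff_eq_1[OF t(1)] fs by (metis left_diff_distrib mult.assoc)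
      also have "\<dots> = 0"
      proof (cases "t = 1")
        case False
        then show ?thesis using Two[OF v n2, of t] t two by (simp add: mult.assoc)
      qed simp
      finally show ?thesis .
    qed
  next
    case False
    then have i2: "2 \<le> i" using i by simp
    note ke = kill_coeff_eq[OF i2 t(1) v]
    consider (a) "i \<notin> set v" "Suc i \<notin> set v" | (b) "i \<in> set v" "Suc i \<in> set v"
      | (c) "i \<in> set v" "Suc i \<notin> set v" | (d) "i \<notin> set v" "Suc i \<in> set v" by blast
    then show ?thesis
    proof cases
      case a
      then show ?thesis using ke A[OF i2 i(2) v a t] by simp
    next
      case b
      then show ?thesis using ke B[OF i2 i(2) v b t(1)] valid by simp
    next
      case c
      then show ?thesis using ke Cc[OF i2 i(2) v c _ t(2)] t by (cases "t = 1") (simp_all add: mult.assoc)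
    next
      case d
      note w = lower_letter_B_set[OF v i2 d(2,1)]
      \<comment> \<open>The factor -\<lambda>_i of the lowered column is absorbed: -\<lambda>_i
        C(\<lambda>_i + 1, t) = -(t+1) C(\<lambda>_i, t+1). The index t+1 is admissible because t <
        \<lambda>_{i+1}.\<close>
      have "d v = - l i * d (lower_letter i v)" using d_raise[OF w(1,3)] w(2) by simp
      then have "C (L i + 1) t * d v = - ((of_nat (L i) * C (L i + 1) (Suc t - 1)) * d (lower_letter i v))"
        by (simp add: l algebra_simps)
      also have "of_nat (L i) * C (L i + 1) (Suc t - 1) = of_nat (Suc t) * C (L i) (Suc t)"
        by (rule C_absorb[symmetric]) simp
      also have "- (of_nat (Suc t) * C (L i) (Suc t) * d (lower_letter i v)) = 0"
        using Cc[OF i2 i(2) w(1,3,4), of "Suc t"] t valid d by (simp add: mult.assoc)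
      finally show ?thesis using ke d by simp
    qed
  qed
qed

lemma killedD:
  "killed \<Longrightarrow> 1 \<le> i \<Longrightarrow> i < length lam \<Longrightarrow> 1 \<le> t \<Longrightarrow> t \<le> L (Suc i) \<Longrightarrow> v \<in> B_set lam b
    \<Longrightarrow> (Suc i \<in> set v \<Longrightarrow> t < L (Suc i)) \<Longrightarrow> kill_coeff lam d i t v = 0"
  unfolding killed_def box_index_iff by blast

text \<open>Three test columns suffice. The column (2, ..., b+1), with coefficient 1, gives the
  first four statements; raising its last entry gives the fifth; the column (3, ..., b+2) with
  \<open>i = 1\<close> and \<open>t = 1\<close> gives the last.\<close>

lemma killed_necessary:
  assumes k: killed
  shows "\<And>i. 1 \<le> i \<Longrightarrow> i \<le> b \<Longrightarrow> RZ (L i) (L (Suc i) - 1)"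
    and "\<And>i. b + 2 \<le> i \<Longrightarrow> i < length lam \<Longrightarrow> RZ (L i + 1) (L (Suc i))"
    and "b = 0 \<Longrightarrow> RZ (L 1 + 1) (L 2)"
    and "\<And>t. 1 \<le> b \<Longrightarrow> 1 \<le> t \<Longrightarrow> t \<le> L (b + 2) \<Longrightarrow> (1 - of_nat t) * C (L (b + 1)) t = 0"
    and "\<And>t. 1 \<le> b \<Longrightarrow> 1 \<le> t \<Longrightarrow> t < L (b + 2) \<Longrightarrow> C (L (b + 1) + 1) t * l (b + 1) = 0"
    and "(\<Sum>s<b. (-1) ^ s * tail_prod (s + 2)) = (l 1 + 1) * tail_prod 1"
proof -
  let ?v = "[2..<b + 2]"
  note vB = initial_B_set
  have d1: "d ?v = 1" by (rule d_initial)
  have mem: "x \<in> set ?v \<longleftrightarrow> 2 \<le> x \<and> x \<le> b + 1" for x by auto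
  show "RZ (L i) (L (Suc i) - 1)" if i: "1 \<le> i" "i \<le> b" for i
    unfolding RZ_def
  proof (intro allI impI)
    fix t assume t: "1 \<le> t" "t \<le> L (Suc i) - 1"
    have kz: "kill_coeff lam d i t ?v = 0"
      by (rule killedD[OF k i(1) _ t(1) _ vB]) (use i t bm in auto)
    show "C (L i) t = 0"
    proof (cases "i = 1")
      case True
      then show ?thesis using kz kill_coeff_eq_1_2[OF t(1) vB] i d1 mem[of 2] by simp
    next
      case False
      then show ?thesis using kz kill_coeff_eq[OF _ t(1) vB, of i] i d1 mem[of i] mem[of "Suc i"] by simp
    qed
  qed
  show "RZ (L i + 1) (L (Suc i))" if i: "b + 2 \<le> i" "i < length lam" for i
    unfolding RZ_def
  proof (intro allI impI)
    fix t assume t: "1 \<le> t" "t \<le> L (Suc i)"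
    have n: "i \<notin> set ?v" "Suc i \<notin> set ?v" using i unfolding mem by auto
    have "kill_coeff lam d i t ?v = 0"
      by (rule killedD[OF k _ i(2) t vB]) (use i n in auto)
    then show "C (L i + 1) t = 0" using kill_coeff_eq[OF _ t(1) vB, of i] i n d1 by simp
  qed
  show "RZ (L 1 + 1) (L 2)" if b0: "b = 0"
    unfolding RZ_def
  proof (intro allI impI)
    fix t assume t: "1 \<le> t" "t \<le> L 2"
    have v0: "?v = []" using b0 by simp
    have "kill_coeff lam d 1 t ?v = 0"
      by (rule killedD[OF k _ _ t(1) _ vB]) (use t bm v0 in \<open>auto simp: numeral_2_eq_2 One_nat_def\<close>)
    then show "C (L 1 + 1) t = 0" using kill_coeff_eq_1[OF t(1), of ?v] d1 unfolding v0 by (simp add: first_sum_def)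
  qed
  have im: "b + 1 < length lam" using bm by simp
  have Sb: "Suc (b + 1) = b + 2" by simp
  show "(1 - of_nat t) * C (L (b + 1)) t = 0" if b1: "1 \<le> b" and t: "1 \<le> t" "t \<le> L (b + 2)" for t
  proof -
    have "kill_coeff lam d (b + 1) t ?v = 0"
      by (rule killedD[OF k _ im t(1) _ vB]) (use t in \<open>unfold Sb, auto\<close>)
    moreover have "b + 1 \<in> set ?v" "Suc (b + 1) \<notin> set ?v" using b1 unfolding mem by auto
    ultimately show ?thesis using kill_coeff_eq[OF _ t(1) vB, of "b + 1"] b1 d1 by simp
  qed
  show "C (L (b + 1) + 1) t * l (b + 1) = 0" if b1: "1 \<le> b" and t: "1 \<le> t" "t < L (b + 2)" for t
  proof -
    \<comment> \<open>The column (2, ..., b, b+2) contains b+2 but not b+1, and its coefficient is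
      -\<lambda>_{b+1}.\<close>
    let ?w = "raise_letter (b + 1) ?v"
    have m: "b + 1 \<in> set ?v" "Suc (b + 1) \<notin> set ?v" using b1 unfolding mem by auto
    have wB: "?w \<in> B_set lam b" by (rule raise_letter_B_set[OF vB m(2)]) (use bm in auto)
    have wn: "b + 1 \<notin> set ?w" using m(2) by (auto simp: raise_letter_def)
    have "kill_coeff lam d (b + 1) t ?w = 0"
      by (rule killedD[OF k _ im t(1) _ wB]) (use t in \<open>unfold Sb, auto\<close>)
    then have "C (L (b + 1) + 1) t * d ?w = 0" using kill_coeff_eq[OF _ t(1) wB, of "b + 1"] b1 wn by simp
    then show ?thesis using d_raise[OF vB m(1)] d1 by simp
  qed
  let ?J = "[3..<b + 3]"
  have "kill_coeff lam d 1 1 ?J = 0"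
    by (rule killedD[OF k _ _ _ _ shifted_B_set]) (use bm part_pos[of "Suc 1"] in auto)
  then show "(\<Sum>s<b. (-1) ^ s * tail_prod (s + 2)) = (l 1 + 1) * tail_prod 1"
    using kill_coeff_eq_1[of 1 ?J] by (simp add: C_L_1 d_shifted first_sum_shifted)
qed

end

declare One_nat_def [simp]

section \<open>Evaluation of the relation for the column (3, ..., b+2) and the two criteria\<close>

context hook_coeffs
begin

text \<open>The entry in row \<open>w - 1\<close> is at least \<open>w\<close>; as \<open>w\<close>
  is missing, it has passed over \<open>w\<close> and contributes the factor -\<lambda>_w.\<close>

lemma skip_zero:
  assumes v: "v \<in> B_set lam b" and w: "2 \<le> w" "w \<le> b + 1" "w \<notin> set v" and z: "l w = 0"
  shows "d v = 0"
proof -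
  have u: "1 \<le> w - 1" "w - 1 \<le> b" using w by auto
  have "w - 1 + 1 = w" using w by simp
  then have "w \<le> part v (w - 1)" "part v (w - 1) \<noteq> w" using B_set_part[OF v u] w(3) by auto
  then show ?thesis using d_zero[OF v u, of w] w(1) z by simp
qed

lemma tail_prod_ones:
  assumes "\<And>i. q < i \<Longrightarrow> i \<le> b + 1 \<Longrightarrow> l i = 1" "q \<le> k" "k \<le> b + 1"
  shows "tail_prod k = (-1) ^ (b + 1 - k)"
proof -
  have "tail_prod k = (\<Prod>u=k..b. - 1)"
    unfolding tail_prod_def using assms by (intro prod.cong) auto
  also have "\<dots> = (-1) ^ (b + 1 - k)" by (simp add: prod_constant)
  finally show ?thesis .
qed

text \<open>Up to the common sign (-1)^(b+1) the summand for s is 1 if s \<ge> q - 2, \<lambda>_q if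
  s = q - 3, and 0 for smaller s, where the product contains \<lambda>_{q-1} = 0. Counting the ones
  gives b + 2 - q for q \<ge> 2. The use with \<open>q = b + 1\<close> serves the long case.\<close>

lemma base_iff:
  assumes q: "q \<le> b + 1"
    and Z: "\<And>i. 1 \<le> i \<Longrightarrow> i < q \<Longrightarrow> l i = 0"
    and O: "\<And>i. q < i \<Longrightarrow> i \<le> b + 1 \<Longrightarrow> l i = 1"
  shows "(\<Sum>s<b. (-1) ^ s * tail_prod (s + 2)) = (l 1 + 1) * tail_prod 1 \<longleftrightarrow> l q + of_nat (b + 2 - q) = 0"
proof -
  let ?e = "(-1) ^ (b + 1) :: 'k"
  \<comment> \<open>\<open>part\<close> is 0 at index 0, which matches the convention \<lambda>_q =
    0 for q = 0.\<close>
  have l0: "l 0 = 0" by (simp add: l part_def)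
  have ones: "tail_prod k = (-1) ^ (b + 1 - k)" if "q \<le> k" "k \<le> b + 1" for k
    by (rule tail_prod_ones[OF O that])
  have e: "(-1) ^ i * (-1) ^ j = ?e" if "even (i + j + b + 1)" for i j :: nat
    using that by (auto simp flip: power_add simp: minus_one_power_iff)
  have below: "tail_prod (q - 1) = - l q * (-1) ^ (b + 1 - q)" if "1 \<le> q"
    using tail_prod_simps(2)[of "q - 1"] ones[of q] q that by simp
  have zero: "tail_prod k = 0" if "k + 2 \<le> q" for k
  proof (rule tail_prod_zero)
    show "k \<le> q - 2" "q - 2 \<le> b" using that q by auto
    have "q - 2 + 1 = q - 1" using that by simp
    then show "l (q - 2 + 1) = 0" using Z[of "q - 1"] that by simp
  qed
  have summand: "(-1) ^ s * tail_prod (s + 2) = ?e * ((if s + 3 = q then l q else 0) + (if q \<le> s + 2 then 1 else 0))"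
    if s: "s < b" for s
  proof -
    consider "q \<le> s + 2" | "s + 3 = q" | "s + 4 \<le> q" by linarith
    then show ?thesis
    proof cases
      case 1
      have "(-1) ^ s * tail_prod (s + 2) = (-1) ^ s * (-1) ^ (b + 1 - (s + 2))" using ones[OF 1] s by simp
      also have "\<dots> = ?e" by (rule e) (use s in auto)
      finally show ?thesis using 1 by simp
    next
      case 2
      have "(-1) ^ s * tail_prod (s + 2) = - l q * ((-1) ^ s * (-1) ^ (b + 1 - q))"
        using below 2 by auto
      also have "(-1) ^ s * (-1) ^ (b + 1 - q) = - ?e"
      proof -
        have "b + 1 = s + (b + 1 - q) + 3" using 2 q by simp
        then have "?e = (-1) ^ (s + (b + 1 - q) + 3)" by (rule arg_cong)
        then show ?thesis by (simp add: power_add numeral_3_eq_3)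
      qed
      finally show ?thesis using 2 by simp
    next
      case 3
      then show ?thesis using zero[of "s + 2"] by simp
    qed
  qed
  \<comment> \<open>The truncated \<open>q - 2\<close> also covers q < 2, where all b summands are
    counted.\<close>
  have cnt: "(\<Sum>s<b. if q \<le> s + 2 then 1 else (0 :: 'k)) = of_nat (b - (q - 2))"
  proof -
    have "(\<Sum>s<b. if q \<le> s + 2 then 1 else (0 :: 'k)) = (\<Sum>s\<in>{q - 2..<b}. 1)"
      by (rule sum.mono_neutral_cong_right) auto
    then show ?thesis by simp
  qed
  have lhs: "(\<Sum>s<b. (-1) ^ s * tail_prod (s + 2)) = ?e * ((if 3 \<le> q then l q else 0) + of_nat (b - (q - 2)))"
  proof -
    have "(\<Sum>s<b. if s + 3 = q then l q else 0) = (if 3 \<le> q then l q else 0)"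
    proof (cases "3 \<le> q")
      case True
      then have "(s + 3 = q) = (s = q - 3)" for s by auto
      then show ?thesis using True q by (simp add: sum.delta)
    qed (auto intro!: sum.neutral)
    moreover have "(\<Sum>s<b. (-1) ^ s * tail_prod (s + 2))
        = (\<Sum>s<b. ?e * ((if s + 3 = q then l q else 0) + (if q \<le> s + 2 then 1 else 0)))"
      by (intro sum.cong refl summand) simp
    ultimately show ?thesis unfolding sum_distrib_left[symmetric] sum.distrib cnt by simp
  qed
  have key: "x = y \<longleftrightarrow> E = 0" if "x - y = ?e * E" for x y E :: 'k
  proof -
    have "x = y \<longleftrightarrow> x - y = 0" by simp
    then show ?thesis unfolding that by simp
  qed
  \<comment> \<open>For q \<le> 2 the right-hand side supplies what the sum lacks: its factor
    \<open>l 1 + 1\<close> is 2 for q = 0, \<lambda>_1 + 1 for q = 1 and 1 for q = 2, where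
    \<open>tail_prod 1\<close> carries -\<lambda>_2. For q \<ge> 3 it vanishes.\<close>
  consider "q = 0" | "q = 1" | "q = 2" | "3 \<le> q" by linarith
  then show ?thesis
  proof cases
    case 1
    have "tail_prod 1 = - ?e" using ones[of 1] 1 by simp
    moreover have "l 1 = 1" using O[of 1] 1 by simp
    ultimately have "(\<Sum>s<b. (-1) ^ s * tail_prod (s + 2)) - (l 1 + 1) * tail_prod 1 = ?e * (l q + of_nat (b + 2 - q))"
      unfolding lhs using 1 l0 by (simp add: algebra_simps)
    then show ?thesis by (rule key)
  next
    case 2
    have "tail_prod 1 = - ?e" using ones[of 1] 2 by simp
    then have "(\<Sum>s<b. (-1) ^ s * tail_prod (s + 2)) - (l 1 + 1) * tail_prod 1 = ?e * (l q + of_nat (b + 2 - q))"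
      unfolding lhs using 2 by (simp add: algebra_simps)
    then show ?thesis by (rule key)
  next
    case 3
    have "1 * (-1) ^ (b + 1 - 2) = (-1) ^ 0 * ((-1) ^ (b + 1 - 2) :: 'k)" by simp
    also have "\<dots> = ?e" by (rule e) (use 3 q in auto)
    finally have "tail_prod 1 = - l 2 * ?e" using below 3 by simp
    then have "(\<Sum>s<b. (-1) ^ s * tail_prod (s + 2)) - (l 1 + 1) * tail_prod 1 = ?e * (l q + of_nat (b + 2 - q))"
      unfolding lhs using 3 Z[of 1] by (simp add: algebra_simps)
    then show ?thesis by (rule key)
  next
    case 4
    then have "b - (q - 2) = b + 2 - q" by simp
    then have "(\<Sum>s<b. (-1) ^ s * tail_prod (s + 2)) - (l 1 + 1) * tail_prod 1 = ?e * (l q + of_nat (b + 2 - q))"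
      unfolding lhs using 4 zero[of 1] by simp
    then show ?thesis by (rule key)
  qed
qed

text \<open>In the absorption identity with t = \<lambda>_j the right-hand side is 0, and
  \<lambda>_j is invertible in the field.\<close>

lemma C_L_zero_of_first:
  assumes z: "l i = 0" "l j \<noteq> 0" and j: "1 \<le> L j"
  shows "C (L i) (L j) = 0"
  using C_absorb[OF j, of "L i"] z by (simp add: l)

lemma RZ_first: "RZ (L i) y \<Longrightarrow> 1 \<le> y \<Longrightarrow> l i = 0" "RZ (L i + 1) y \<Longrightarrow> 1 \<le> y \<Longrightarrow> l i = -1"
  using RZ_D[of "L i" y 1] RZ_D[of "L i + 1" y 1] unfolding C_L_1 by (simp_all add: eq_neg_iff_add_eq_0)

text \<open>All rows up to b+1 have length at least 2, so the conditions on R have index at least 1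
  and give \<lambda>_i = 0 for i \<le> b, while the relation for (3, ..., b+2) amounts to
  \<lambda>_{b+1} = -1. Columns skipping some w \<le> b then have coefficient 0.\<close>

lemma killed_iff_long:
  assumes big: "2 \<le> L (b + 1)"
  shows "killed \<longleftrightarrow> (\<forall>i. 1 \<le> i \<longrightarrow> i < b \<longrightarrow> RZ (L i) (L (Suc i) - 1))
    \<and> (1 \<le> b \<longrightarrow> RZ (L b) (L (Suc b)))
    \<and> (\<forall>i. b + 1 \<le> i \<longrightarrow> i < length lam \<longrightarrow> RZ (L i + 1) (L (Suc i)))" (is "_ \<longleftrightarrow> ?R1 \<and> ?R2 \<and> ?R3")
proof -
  have two: "2 \<le> L i" if "1 \<le> i" "i \<le> b + 1" for i using mono[OF that] big by simp
  show ?thesis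
  proof
    assume k: killed
    note N = killed_necessary[OF k]
    have Z: "l i = 0" if "1 \<le> i" "i \<le> b" for i
      using RZ_first(1)[OF N(1)[OF that]] two[of "Suc i"] that by simp
    have m1: "l (b + 1) = -1"
    proof -
      have "l (b + 1) + of_nat (b + 2 - (b + 1)) = 0"
        by (rule base_iff[THEN iffD1, OF _ _ _ N(6)]) (use Z in auto)
      then show ?thesis by (simp add: eq_neg_iff_add_eq_0)
    qed
    have R1: ?R1 using N(1) by simp
    have R2: ?R2
    proof
      assume b1: "1 \<le> b"
      show "RZ (L b) (L (Suc b))"
        unfolding RZ_def
      proof (intro allI impI)
        fix j assume j: "1 \<le> j" "j \<le> L (Suc b)"
        \<comment> \<open>The test column gives all indices below \<lambda>_{b+1}. At the top index
          absorption applies, since \<lambda>_{b+1} = -1 is invertible.\<close>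
        show "C (L b) j = 0"
        proof (cases "j = L (Suc b)")
          case True
          then show ?thesis using C_L_zero_of_first[of b "Suc b"] Z[of b] m1 b1 j by simp
        next
          case False
          then show ?thesis using RZ_D[OF N(1)[of b], of j] b1 j by simp
        qed
      qed
    qed
    have R3: "RZ (L i + 1) (L (Suc i))" if i: "b + 1 \<le> i" "i < length lam" for i
    proof (cases "i = b + 1")
      case False
      then show ?thesis using N(2)[of i] i by simp
    next
      case True
      have Sb: "Suc i = b + 2" using True by simp
      show ?thesis
      proof (cases "b = 0")
        case True
        then show ?thesis using N(3) Sb \<open>i = b + 1\<close> by (simp add: numeral_2_eq_2)
      next
        case False
        then have b1: "1 \<le> b" by simp
        let ?x = "L (b + 1)"
        have less: "C (?x + 1) j = 0" if "1 \<le> j" "j < L (b + 2)" for j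
          using N(5)[OF b1 that] m1 by simp
        show ?thesis
          unfolding RZ_def unfolding Sb unfolding True
        proof (intro allI impI)
          fix j assume j: "1 \<le> j" "j \<le> L (b + 2)"
          show "C (?x + 1) j = 0"
          proof (cases "j = 1")
            case True
            then show ?thesis using C_L_1(2)[of "b + 1"] m1 by simp
          next
            case False
            have z: "C (?x + 1) (j - 1) = 0" using less[of "j - 1"] j False by simp
            \<comment> \<open>Absorption gives j C(x, j) = 0 and the relation gives (1 - j) C(x, j)
              = 0; adding them removes the factor j.\<close>
            have "of_nat j * C ?x j = 0" using C_absorb[OF j(1), of ?x] z by simp
            then have "C ?x j = 0" using N(4)[OF b1 j] unfolding left_diff_distrib by auto
            then show ?thesis using C_pascal[OF j(1), of ?x] z by simp
          qed
        qed
      qed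
    qed
    show "?R1 \<and> ?R2 \<and> ?R3" using R1 R2 R3 by blast
  next
    assume R: "?R1 \<and> ?R2 \<and> ?R3"
    have R1: "\<And>i. 1 \<le> i \<Longrightarrow> i < b \<Longrightarrow> RZ (L i) (L (Suc i) - 1)" and R2: "1 \<le> b \<Longrightarrow> RZ (L b) (L (Suc b))"
      and R3: "\<And>i. b + 1 \<le> i \<Longrightarrow> i < length lam \<Longrightarrow> RZ (L i + 1) (L (Suc i))" using R by auto
    have Z: "l i = 0" if i: "1 \<le> i" "i \<le> b" for i
    proof (cases "i = b")
      case True
      then show ?thesis using RZ_first(1)[OF R2] two[of "Suc b"] i by simp
    next
      case False
      then show ?thesis using RZ_first(1)[OF R1[of i]] two[of "Suc i"] i by simp
    qed
    have m1: "l (b + 1) = -1"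
      using RZ_first(2)[OF R3[of "b + 1"]] part_pos[of "Suc (b + 1)"] bm by simp
    \<comment> \<open>By Pascal's rule C(x, t) is the difference of C(x+1, t) and C(x+1, t-1). The
      bound t \<ge> 2 keeps the second index positive, since C(x+1, 0) = 1.\<close>
    have diff: "C (L i) t = 0" if "b + 1 \<le> i" "i < length lam" "2 \<le> t" "t \<le> L (Suc i)" for i t
      using C_pascal[of t "L i"] RZ_D[OF R3[OF that(1,2)], of t] RZ_D[OF R3[OF that(1,2)], of "t - 1"] that(3,4) by simp
    show killed
    proof (rule killedI)
      fix i t v
      assume i: "2 \<le> i" "i < length lam" and v: "v \<in> B_set lam b"
      {
        assume "i \<notin> set v" "1 \<le> t" "t \<le> L (Suc i)"
        then show "C (L i + 1) t * d v = 0"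
          using RZ_D[OF R3[of i], of t] skip_zero[OF v i(1)] Z[of i] i by (cases "i \<le> b") auto
      next
        assume m: "i \<in> set v" "Suc i \<in> set v" and t: "1 \<le> t" "t < L (Suc i)"
        consider "i < b" | "i = b" | "b < i" by linarith
        then show "C (L i) t * d v = 0"
        proof cases
          case 1
          then show ?thesis using RZ_D[OF R1[of i], of t] i t by simp
        next
          case 2
          then show ?thesis using RZ_D[OF R2, of t] i t by simp
        next
          case 3
          \<comment> \<open>A column with \<open>i\<close> and \<open>i + 1\<close> beyond b has
            only b - 2 other entries, too few for the b - 1 numbers 2, ..., b.\<close>
          have "\<not> {2..b} \<subseteq> set v"
          proof
            assume "{2..b} \<subseteq> set v"
            then have "insert i (insert (Suc i) {2..b}) \<subseteq> set v" using m by simp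
            then have "card (insert i (insert (Suc i) {2..b})) \<le> card (set v)" by (intro card_mono) simp_all
            then show False using 3 i(1) B_setD(1,3)[OF v] by (simp add: distinct_card)
          qed
          then obtain w where "2 \<le> w" "w \<le> b" "w \<notin> set v" by (meson atLeastAtMost_iff subsetI)
          then show ?thesis using skip_zero[OF v, of w] Z[of w] by simp
        qed
      next
        assume m: "i \<in> set v" "Suc i \<notin> set v" and t: "2 \<le> t" "t \<le> L (Suc i)"
        consider "i < b" | "i = b" | "b < i" by linarith
        then show "C (L i) t * d v = 0"
        proof cases
          case 1
          then show ?thesis using skip_zero[OF v, of "Suc i"] Z[of "Suc i"] i m by simp
        next
          case 2
          then show ?thesis using RZ_D[OF R2, of t] i t by simp
        next
          case 3
          then show ?thesis using diff[of i t] i t by simp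
        qed
      }
    next
      fix t v
      assume v: "v \<in> B_set lam b"
      {
        assume m: "2 \<in> set v" and t: "1 \<le> t" "t < L 2"
        have "b \<noteq> 0" using m B_setD(1)[OF v] by auto
        then consider "b = 1" | "1 < b" by linarith
        then show "C (L 1) t * d v = 0"
          using RZ_D[OF R2, of t] RZ_D[OF R1[of 1], of t] t by cases (auto simp: numeral_2_eq_2)
      next
        assume m: "2 \<notin> set v" and t: "2 \<le> t" "t \<le> L 2"
        have S: "Suc 1 = 2" by simp
        consider "b = 0" | "b = 1" | "1 < b" by linarith
        then show "C (L 1) t * d v = 0"
        proof cases
          case 1
          then show ?thesis using diff[of 1 t] t bm unfolding S by simp
        next
          case 2
          then show ?thesis using RZ_D[OF R2, of t] t 2 by (simp add: numeral_2_eq_2)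
        next
          case 3
          then show ?thesis using skip_zero[OF v, of 2] Z[of 2] m by simp
        qed
      }
    next
      show "first_sum [3..<b + 3] = (l 1 + 1) * d [3..<b + 3]"
        unfolding first_sum_shifted d_shifted
        by (rule base_iff[THEN iffD2, of "b + 1"]) (use Z m1 in auto)
    qed
  qed
qed

text \<open>An index t \<ge> 2 occurs only for i < q, where \<lambda>_i = 0 in the field. Below
  \<lambda>_{i+1} the binomial is covered by R; at t = \<lambda>_{i+1} either \<lambda>_{i+1} is
  invertible and absorption applies, or it is 0 and a column without \<open>i + 1\<close> has
  coefficient 0.\<close>

lemma killed_iff_short:
  assumes q: "q \<le> b"
    and two: "\<And>i. 1 \<le> i \<Longrightarrow> i \<le> q \<Longrightarrow> 2 \<le> L i" and ones: "\<And>i. q < i \<Longrightarrow> i \<le> length lam \<Longrightarrow> L i = 1"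
  shows "killed \<longleftrightarrow> (\<forall>i. 1 \<le> i \<longrightarrow> i < q \<longrightarrow> RZ (L i) (L (Suc i) - 1))
    \<and> l q + of_nat (b + 2 - q) = 0 \<and> (b + 3 \<le> length lam \<longrightarrow> (2 :: 'k) = 0)" (is "_ \<longleftrightarrow> ?R1 \<and> ?E \<and> ?T")
proof -
  have l1: "l i = 1" if "q < i" "i \<le> length lam" for i using ones[OF that] by (simp add: l)
  have Z: "l i = 0" if ?R1 "1 \<le> i" "i < q" for i
    using RZ_first(1)[of i "L (Suc i) - 1"] two[of "Suc i"] that by simp
  have base: "(\<Sum>s<b. (-1) ^ s * tail_prod (s + 2)) = (l 1 + 1) * tail_prod 1 \<longleftrightarrow> ?E" if R1: ?R1
    by (rule base_iff) (use q bm Z[OF R1] l1 in auto)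
  show ?thesis
  proof
    assume k: killed
    note N = killed_necessary[OF k]
    have R1: ?R1 using N(1) q by simp
    have T: "(2 :: 'k) = 0" if "b + 3 \<le> length lam"
    proof -
      \<comment> \<open>Row b+2 lies after q and has length 1, while the relation makes this length
        -1 in the field.\<close>
      have "l (b + 2) = -1"
        using RZ_first(2)[OF N(2)[of "b + 2"]] part_pos[of "Suc (b + 2)"] that by simp
      moreover have "l (b + 2) = 1" using l1[of "b + 2"] q bm by simp
      ultimately have "(1 :: 'k) + 1 = 0" by (metis add.right_inverse)
      then show ?thesis by simp
    qed
    show "?R1 \<and> ?E \<and> ?T" using R1 base[OF R1] N(6) T by blast
  next
    assume R: "?R1 \<and> ?E \<and> ?T"
    then have R1: "\<And>i. 1 \<le> i \<Longrightarrow> i < q \<Longrightarrow> RZ (L i) (L (Suc i) - 1)" and E: ?E and T: ?T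
      and Z: "\<And>i. 1 \<le> i \<Longrightarrow> i < q \<Longrightarrow> l i = 0" using Z by auto
    have last: "C (L i) t * d v = 0"
      if v: "v \<in> B_set lam b" and i: "1 \<le> i" "i < length lam" "Suc i \<notin> set v" and t: "2 \<le> t" "t \<le> L (Suc i)" for i t v
    proof -
      have iq: "i < q"
      proof (rule ccontr)
        assume "\<not> i < q"
        then have "L (Suc i) = 1" using ones[of "Suc i"] i by simp
        then show False using t by simp
      qed
      consider "t < L (Suc i)" | "t = L (Suc i)" "l (Suc i) = 0" | "t = L (Suc i)" "l (Suc i) \<noteq> 0" using t by linarith
      then show ?thesis
      proof cases
        case 1
        then show ?thesis using RZ_D[OF R1[OF i(1) iq], of t] t by simp
      next
        case 2
        then show ?thesis using skip_zero[OF v, of "Suc i"] i iq q by simp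
      next
        case 3
        then show ?thesis using C_L_zero_of_first[OF Z[OF i(1) iq] 3(2)] t by simp
      qed
    qed
    show killed
    proof (rule killedI)
      fix i t v
      assume i: "2 \<le> i" "i < length lam" and v: "v \<in> B_set lam b"
      {
        assume m: "i \<notin> set v" "Suc i \<notin> set v" and t: "1 \<le> t" "t \<le> L (Suc i)"
        show "C (L i + 1) t * d v = 0"
        proof (cases "i < q")
          case True
          then show ?thesis using skip_zero[OF v i(1)] Z[of i] i m q by simp
        next
          case False
          have t1: "t = 1" using ones[of "Suc i"] False i t by simp
          \<comment> \<open>A column of b entries avoiding both \<open>i\<close> and
            \<open>i + 1\<close> needs b + 2 numbers among 2, ..., m, hence m \<ge> b + 3 and the
            characteristic is 2.\<close>
          have "insert i (insert (Suc i) (set v)) \<subseteq> {2..length lam}" using B_setD(4)[OF v] i by auto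
          then have "card (insert i (insert (Suc i) (set v))) \<le> card {2..length lam}" by (intro card_mono) simp_all
          then have "b + 3 \<le> length lam" using m B_setD(1,3)[OF v] by (simp add: distinct_card)
          then have char2: "(2 :: 'k) = 0" using T by blast
          show ?thesis
          proof (cases "l i = 0")
            case True
            have "i \<le> b + 1"
            proof (rule ccontr)
              assume "\<not> i \<le> b + 1"
              then show False using l1[of i] i q True by simp
            qed
            then show ?thesis using skip_zero[OF v i(1) _ m(1) True] by simp
          next
            case nz: False
            \<comment> \<open>In characteristic 2 a part that is nonzero in the field equals 1
              there, so \<open>l i + 1 = 0\<close>.\<close>
            have "l i = of_nat (L i mod 2)"
            proof -
              have "l i = of_nat (2 * (L i div 2) + L i mod 2)" by (simp add: l)
              also have "\<dots> = 2 * of_nat (L i div 2) + of_nat (L i mod 2)" by (simp only: of_nat_add of_nat_mult of_nat_numeral)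
              finally show ?thesis using char2 by simp
            qed
            then have "l i = 1" using nz by (cases "even (L i)") (auto simp: odd_iff_mod_2_eq_one)
            then have "l i + 1 = 0" using char2 by simp
            then show ?thesis using C_L_1(2)[of i] t1 by simp
          qed
        qed
      next
        assume m: "i \<in> set v" "Suc i \<in> set v" and t: "1 \<le> t" "t < L (Suc i)"
        have iq: "i < q"
        proof (rule ccontr)
          assume "\<not> i < q"
          then have "L (Suc i) = 1" using ones[of "Suc i"] i by simp
          then show False using t by simp
        qed
        then show "C (L i) t * d v = 0" using RZ_D[OF R1[of i], of t] t i by simp
      next
        assume m: "i \<in> set v" "Suc i \<notin> set v" and t: "2 \<le> t" "t \<le> L (Suc i)"
        show "C (L i) t * d v = 0" by (rule last[OF v _ i(2) m(2) t]) (use i in simp)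
      }
    next
      fix t v
      assume v: "v \<in> B_set lam b"
      have S: "Suc 1 = 2" by simp
      {
        assume t: "1 \<le> t" "t < L 2"
        have "1 < q" using ones[of 2] t bm by (cases "1 < q") auto
        then show "C (L 1) t * d v = 0" using RZ_D[OF R1[of 1], of t] t by (simp add: numeral_2_eq_2)
      next
        assume m: "2 \<notin> set v" and t: "2 \<le> t" "t \<le> L 2"
        show "C (L 1) t * d v = 0" using last[OF v, of 1 t] m t bm unfolding S by simp
      }
    next
      show "first_sum [3..<b + 3] = (l 1 + 1) * d [3..<b + 3]"
        unfolding first_sum_shifted d_shifted using base R by blast
    qed
  qed
qed

lemma RZ_iff_dvd:
  assumes p: "CHAR('k) = p"
  shows "p dvd R_gcd x y \<longleftrightarrow> RZ x y"
proof -
  have "p dvd R_gcd x y \<longleftrightarrow> (\<forall>z\<in>{(x + j - 1) choose j |j. 1 \<le> j \<and> j \<le> y}. p dvd z)"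
    unfolding R_gcd_def by (rule dvd_Gcd_iff)
  also have "\<dots> \<longleftrightarrow> RZ x y"
    by (auto simp: RZ_def C_def of_nat_eq_0_iff_char_dvd p)
  finally show ?thesis .
qed

end

declare One_nat_def [simp del]

section \<open>The space of homomorphisms\<close>

locale hook_hom = hook_pair n a b lam + hook_coeffs lam b l d
  for n a b lam and l :: "nat \<Rightarrow> 'k::field" and d
begin

definition H :: "('k, 'k tensor set \<Rightarrow> 'k tensor set) module" where
  "H = shom (schur_algebra n (sum_list lam)) (weyl_module n lam) (weyl_module n hk)"

lemma hk_n: "length hk \<le> n" and hk_size: "sum_list hk = sum_list lam"
  using hk_facts size by auto

lemma carrier_H: "carrier H = shom_set (schur_algebra n (sum_list lam)) (weyl_module n lam) (weyl_module n hk)"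
  by (simp add: H_def shom_def)

lemma vectorspace_H: "vectorspace class_ring H"
  unfolding H_def
  using vectorspace_shom[OF is_smodule_weyl[OF lam_n] is_smodule_weyl[OF hk_n, unfolded hk_size]] .

lemma zero_H: "\<zero>\<^bsub>H\<^esub> = (\<lambda>X\<in>carrier (weyl_module n lam). \<zero>\<^bsub>weyl_module n hk\<^esub>)"
  by (simp add: H_def shom_def)

lemma H_eqI:
  assumes F: "F \<in> carrier H" "G \<in> extensional (carrier (weyl_module n lam))"
    and eq: "\<And>x. x \<in> class_fun n lam \<Longrightarrow> F (coset (box_image n lam) x) = G (coset (box_image n lam) x)"
  shows "F = G"
proof (rule extensionalityI[OF _ F(2)])
  show "F \<in> extensional (carrier (weyl_module n lam))" using F(1) by (simp add: carrier_H shom_set_def)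
  fix X assume "X \<in> carrier (weyl_module n lam :: ('k, 'k tensor set, 'k tensor \<Rightarrow> 'k tensor) smodule)"
  then show "F X = G X" using eq unfolding carrier_weyl[OF lam_n] by blast
qed

lemma schur_algebra_box_image:
  assumes "s \<in> schur_algebra n (sum_list lam)" "z \<in> box_image n hk"
  shows "s z \<in> (box_image n hk :: 'k tensor set)"
  by (rule box_image_schur[OF hk_n _ assms(2)]) (use assms(1) hk_size in simp)

lemma box_image_hk_tensor_space: "z \<in> box_image n hk \<Longrightarrow> (z :: 'k tensor) \<in> tensor_space n (sum_list lam)"
  using box_image_class_fun[OF hk_n] class_fun_tensor_space hk_size by (metis subsetD)

lemma raise_op_box_image: "1 \<le> i \<Longrightarrow> i < n \<Longrightarrow> z \<in> box_image n hk \<Longrightarrow> raise_op i t (z :: 'k tensor) \<in> box_image n hk"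
  using schur_algebra_box_image[OF raise_op_schur, of i z t] box_image_hk_tensor_space[of z] by simp

lemma schur_op_hk_box_image:
  "x \<in> class_fun n lam \<Longrightarrow> z \<in> box_image n hk \<Longrightarrow> schur_op lam x (z :: 'k tensor) \<in> box_image n hk"
  using schur_algebra_box_image[OF schur_op_schur, of x z] box_image_hk_tensor_space[of z] by simp

text \<open>The identity lies in the Schur algebra and fixes the generator, so it agrees with this
  operator on vectors of weight \<lambda>.\<close>

lemma schur_op_gen_left:
  assumes "y \<in> class_fun n hk" "has_weight lam y"
  shows "schur_op lam (gen_tensor lam) y = (y :: 'k tensor)"
proof -
  have "restrict (\<lambda>f. f) (tensor_space n (sum_list lam)) \<in> (schur_algebra n (sum_list lam) :: ('k tensor \<Rightarrow> 'k tensor) set)"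
    by (rule schur_algebraI) auto
  from schur_op_unique[OF lam_n hk_n hk_size this gen_class[OF lam_n] _ assms]
  show ?thesis using class_fun_tensor_space[OF gen_class[OF lam_n], where 'a='k]
      class_fun_tensor_space[OF assms(1)] hk_size by simp
qed

definition psi_rep :: "'k tensor \<Rightarrow> 'k tensor" where
  "psi_rep x = schur_op lam x (tab_comb lam b d)"

lemma psi_rep_eq:
  assumes "x \<in> class_fun n lam"
  shows "psi n lam hk b x = coset (box_image n hk) (psi_rep x)"
  using psi_eq[OF lam_n hk_n hk_size assms pos tab_tensor_lam]
  by (simp add: psi_rep_def tab_comb_def[abs_def] d)

lemma killed_iff: "killed \<longleftrightarrow> (\<forall>i t. (i, t) \<in> box_index lam \<longrightarrow> raise_op i t (tab_comb lam b d) \<in> box_image n hk)"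
  unfolding killed_def using kill_iff by blast

text \<open>The relations with i \<ge> 2 and t = 1 make the coefficients of the weight vector a
  multiple of \<open>d\<close>; the factor is the coefficient of (2, ..., b+1). If it is nonzero,
  dividing by it shows that \<open>d\<close> itself satisfies all relations.\<close>

lemma hom_form:
  assumes F: "F \<in> carrier H"
  obtains c where "\<And>x. x \<in> class_fun n lam \<Longrightarrow> F (coset (box_image n lam) x) = coset (box_image n hk) (\<lambda>w. c * psi_rep x w)"
    "c \<noteq> 0 \<Longrightarrow> killed"
proof -
  note box = box_image_lin_sub[OF hk_n, where 'k='k]
  obtain y where y: "y \<in> class_fun n hk" "has_weight lam y"
    and Fy: "\<And>x. x \<in> class_fun n lam \<Longrightarrow> F (coset (box_image n lam) x) = coset (box_image n hk) (schur_op lam x y)"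
    and ky: "\<And>i t. (i, t) \<in> box_index lam \<Longrightarrow> raise_op i t y \<in> box_image n hk"
    using weyl_hom_form[OF lam_n hk_n hk_size F[unfolded carrier_H]] by blast
  obtain c where c: "(\<lambda>w. y w - tab_comb lam b c w) \<in> box_image n hk" by (rule tab_comb_expansion[OF y])
  have kc: "raise_op i t (tab_comb lam b c) \<in> box_image n hk" if it: "(i, t) \<in> box_index lam" for i t
  proof -
    have i: "1 \<le> i" "i < n" using it lam_n by (auto simp: box_index_def)
    have "raise_op i t (\<lambda>w. y w - tab_comb lam b c w) = (\<lambda>w. raise_op i t y w - raise_op i t (tab_comb lam b c) w)"
      by (rule ext) (simp add: raise_op_def sum_subtractf)
    then show ?thesis
      using lin_sub_diff[OF box ky[OF it] raise_op_box_image[OF i c, of t]] by simp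
  qed
  have rel: "c (raise_letter i v) = - l i * c v"
    if v: "v \<in> B_set lam b" "i \<in> set v" "Suc i \<notin> set v" "Suc i \<le> length lam" for v i
  proof -
    have i: "2 \<le> i" using B_setD(4)[OF v(1,2)] by simp
    have "(i, 1) \<in> box_index lam" using i v(4) part_pos[of "Suc i"] by (simp add: box_index_iff)
    then have "kill_coeff lam c i 1 v = 0" using kc kill_iff v(1,3) by blast
    then have "l i * c v + c (raise_letter i v) = 0" using i v(2,3) by (simp add: kill_coeff_def l choose_one)
    then show ?thesis by (simp add: eq_neg_iff_add_eq_0 add.commute)
  qed
  let ?c = "c [2..<b + 2]"
  have cd: "c v = ?c * d v" if "v \<in> B_set lam b" for v by (rule coeffs_unique[OF rel that])
  have comb: "tab_comb lam b c = (\<lambda>w. ?c * tab_comb lam b d w)"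
    by (rule ext) (simp add: tab_comb_def cd sum_distrib_left mult.assoc)
  show ?thesis
  proof (rule that)
    fix x :: "'k tensor" assume x: "x \<in> class_fun n lam"
    have "schur_op lam x (\<lambda>w. y w - tab_comb lam b c w) = (\<lambda>w. schur_op lam x y w - schur_op lam x (tab_comb lam b c) w)"
      by (rule ext) (simp add: schur_op_def sum_subtractf left_diff_distrib)
    then have "(\<lambda>w. schur_op lam x y w - schur_op lam x (tab_comb lam b c) w) \<in> box_image n hk"
      using schur_op_hk_box_image[OF x c] by simp
    then have "coset (box_image n hk) (schur_op lam x y) = coset (box_image n hk) (schur_op lam x (tab_comb lam b c))"
      by (simp add: coset_eq_iff[OF box])
    then show "F (coset (box_image n lam) x) = coset (box_image n hk) (\<lambda>w. ?c * psi_rep x w)"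
      unfolding Fy[OF x] psi_rep_def comb schur_op_smult_right .
  next
    assume ne: "?c \<noteq> 0"
    show killed
      unfolding killed_iff
    proof (intro allI impI)
      fix i t assume it: "(i, t) \<in> box_index lam"
      have "raise_op i t (tab_comb lam b c) = (\<lambda>w. ?c * raise_op i t (tab_comb lam b d) w)"
        unfolding comb by (rule ext) (simp add: raise_op_def sum_distrib_left)
      then have "(\<lambda>w. inverse ?c * (?c * raise_op i t (tab_comb lam b d) w)) \<in> box_image n hk"
        using lin_sub_smult[OF box kc[OF it], of "inverse ?c"] by simp
      then show "raise_op i t (tab_comb lam b d) \<in> box_image n hk"
        using ne by (simp flip: mult.assoc)
    qed
  qed
qed

text \<open>The homomorphism is nonzero because the image of the generator has coefficient 1 at the
  standard column (2, ..., b+1).\<close>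

lemma killed_hom:
  assumes killed
  obtains F where "F \<in> carrier H" "F \<noteq> \<zero>\<^bsub>H\<^esub>"
    "\<And>x. x \<in> class_fun n lam \<Longrightarrow> F (coset (box_image n lam) x) = coset (box_image n hk) (psi_rep x)"
proof -
  obtain F where F: "F \<in> carrier H"
    "\<And>x. x \<in> class_fun n lam \<Longrightarrow> F (coset (box_image n lam) x) = coset (box_image n hk) (psi_rep x)"
    unfolding carrier_H psi_rep_def
    using weyl_hom_exists[OF lam_n hk_n hk_size tab_comb_class_fun tab_comb_weight, of d] assms
    unfolding killed_iff by blast
  let ?g = "gen_tensor lam :: 'k tensor"
  have g: "?g \<in> class_fun n lam" by (rule gen_class[OF lam_n])
  have "F \<noteq> \<zero>\<^bsub>H\<^esub>"
  proof
    assume "F = \<zero>\<^bsub>H\<^esub>"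
    then have "F (coset (box_image n lam) ?g) = \<zero>\<^bsub>weyl_module n hk\<^esub>"
      using g by (simp add: zero_H carrier_weyl[OF lam_n])
    then have "coset (box_image n hk) (tab_comb lam b d) = \<zero>\<^bsub>weyl_module n hk\<^esub>"
      using F(2)[OF g] by (simp add: psi_rep_def schur_op_gen_left[OF tab_comb_class_fun tab_comb_weight])
    then have "tab_comb lam b d \<in> box_image n hk" unfolding weyl_zero_iff[OF hk_n] .
    then have "d [2..<b + 2] = 0" by (rule tab_comb_zero[OF _ initial_B_set]) (use bm in auto)
    then show False using d_initial by simp
  qed
  then show ?thesis using F that by blast
qed

text \<open>Every homomorphism is a scalar times \<psi> on representatives, and a nonzero scalar
  forces \<open>killed\<close>. So either only 0 exists, or all homomorphisms are multiples of the
  one induced by \<psi>.\<close>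

lemma H_result:
  shows "vectorspace.fin_dim class_ring H \<and> vectorspace.dim class_ring H \<le> 1"
    and "carrier H \<noteq> {\<zero>\<^bsub>H\<^esub>} \<longleftrightarrow> killed"
    and "killed \<Longrightarrow> \<exists>F\<in>carrier H. F \<noteq> \<zero>\<^bsub>H\<^esub> \<and> (\<forall>x\<in>carrier (D_module n lam). F (weyl_proj n lam x) = psi n lam hk b x)"
proof -
  interpret V: vectorspace class_ring H by (rule vectorspace_H)
  have zero: "\<zero>\<^bsub>H\<^esub> \<in> carrier H" by (rule V.zero_closed)
  have triv: "G = \<zero>\<^bsub>H\<^esub>" if nk: "\<not> killed" and G: "G \<in> carrier H" for G
  proof -
    obtain c where c: "\<And>x. x \<in> class_fun n lam \<Longrightarrow> G (coset (box_image n lam) x) = coset (box_image n hk) (\<lambda>w. c * psi_rep x w)"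
      "c \<noteq> 0 \<Longrightarrow> killed" by (rule hom_form[OF G]) blast
    have "c = 0" using c(2) nk by blast
    then show ?thesis
      by (intro H_eqI[OF G]) (auto simp: zero_H c(1) carrier_weyl[OF lam_n] weyl_ops(1)[OF hk_n])
  qed
  have smult: "c \<odot>\<^bsub>H\<^esub> F = (\<lambda>X\<in>carrier (weyl_module n lam). c \<odot>\<^bsub>weyl_module n hk\<^esub> F X)" for c F
    by (simp add: H_def shom_def)
  have multiple: "\<exists>c. G = c \<odot>\<^bsub>H\<^esub> F" if G: "G \<in> carrier H"
    and F: "\<And>x. x \<in> class_fun n lam \<Longrightarrow> F (coset (box_image n lam) x) = coset (box_image n hk) (psi_rep x)" for F G
  proof -
    obtain c where c: "\<And>x. x \<in> class_fun n lam \<Longrightarrow> G (coset (box_image n lam) x) = coset (box_image n hk) (\<lambda>w. c * psi_rep x w)"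
      by (rule hom_form[OF G]) blast
    have "G = c \<odot>\<^bsub>H\<^esub> F"
      by (intro H_eqI[OF G]) (auto simp: smult c F carrier_weyl[OF lam_n] weyl_ops(3)[OF hk_n])
    then show ?thesis ..
  qed
  show "vectorspace.fin_dim class_ring H \<and> vectorspace.dim class_ring H \<le> 1"
  proof (cases killed)
    case True
    obtain F where F: "F \<in> carrier H"
      "\<And>x. x \<in> class_fun n lam \<Longrightarrow> F (coset (box_image n lam) x) = coset (box_image n hk) (psi_rep x)"
      by (rule killed_hom[OF True]) blast
    show ?thesis by (rule dim_le_1[OF vectorspace_H F(1)]) (rule multiple[OF _ F(2)])
  next
    case False
    show ?thesis
    proof (rule dim_le_1[OF vectorspace_H zero])
      fix G assume G: "G \<in> carrier H"
      have "\<zero>\<^bsub>H\<^esub> = \<one>\<^bsub>class_ring\<^esub> \<odot>\<^bsub>H\<^esub> \<zero>\<^bsub>H\<^esub>" using V.smult_one[OF zero] by simp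
      then show "\<exists>c. G = c \<odot>\<^bsub>H\<^esub> \<zero>\<^bsub>H\<^esub>" using triv[OF False G] by blast
    qed
  qed
  show "carrier H \<noteq> {\<zero>\<^bsub>H\<^esub>} \<longleftrightarrow> killed"
  proof
    assume "carrier H \<noteq> {\<zero>\<^bsub>H\<^esub>}"
    then show killed using triv zero by blast
  next
    assume killed
    then show "carrier H \<noteq> {\<zero>\<^bsub>H\<^esub>}" by (rule killed_hom) blast
  qed
  assume killed
  then obtain F where F: "F \<in> carrier H" "F \<noteq> \<zero>\<^bsub>H\<^esub>"
    "\<And>x. x \<in> class_fun n lam \<Longrightarrow> F (coset (box_image n lam) x) = coset (box_image n hk) (psi_rep x)"
    by (rule killed_hom) blast
  have "F (weyl_proj n lam x) = psi n lam hk b x" if "x \<in> carrier (D_module n lam)" for x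
  proof -
    have "x \<in> class_fun n lam" using that by (simp add: D_module_def tensor_module_def D_set_eq)
    then show ?thesis by (simp add: weyl_proj_eq F(3) psi_rep_eq)
  qed
  then show "\<exists>F\<in>carrier H. F \<noteq> \<zero>\<^bsub>H\<^esub> \<and> (\<forall>x\<in>carrier (D_module n lam). F (weyl_proj n lam x) = psi n lam hk b x)"
    using F by blast
qed

end

theorem theorem3p1:
  fixes n r m a b p q :: nat and lam h :: "nat list"
  assumes "infinite (UNIV :: 'k::field set)"
    and "CHAR('k) = p" and "p > 0"
    and "lam \<in> partitions n r" and "length lam = m" and "part lam m \<noteq> 0"
    and "h \<in> partitions n r" and "h = a # replicate b 1"
    and "m \<ge> b + 2"
    and "q = (if lam = replicate m 1 then 0 else Max {i. 1 \<le> i \<and> i \<le> m \<and> part lam i \<ge> 2})"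
  defines "H \<equiv> shom (schur_algebra n r) (weyl_module n lam)
    (weyl_module n h :: ('k, 'k tensor set, 'k tensor \<Rightarrow> 'k tensor) smodule)"
  shows "(vectorspace.fin_dim class_ring H \<and> vectorspace.dim class_ring H \<le> 1)
    \<and> (q \<ge> b + 1 \<longrightarrow>
        (carrier H \<noteq> {\<zero>\<^bsub>H\<^esub>} \<longleftrightarrow>
          (\<forall>i. 1 \<le> i \<and> i \<le> b - 1 \<longrightarrow> p dvd R_gcd (part lam i) (part lam (i + 1) - 1))
          \<and> (b \<noteq> 0 \<longrightarrow> p dvd R_gcd (part lam b) (part lam (b + 1)))
          \<and> (\<forall>i. b + 1 \<le> i \<and> i \<le> m - 1 \<longrightarrow> p dvd R_gcd (part lam i + 1) (part lam (i + 1)))))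
    \<and> (q \<le> b \<longrightarrow>
        (carrier H \<noteq> {\<zero>\<^bsub>H\<^esub>} \<longleftrightarrow>
          (\<forall>i. 1 \<le> i \<and> i \<le> q - 1 \<longrightarrow> p dvd R_gcd (part lam i) (part lam (i + 1) - 1))
          \<and> p dvd part lam q + b + 2 - q
          \<and> (m - b \<ge> 3 \<longrightarrow> p dvd 2)))
    \<and> ((q \<ge> b + 1 \<or> q \<le> b) \<and> carrier H \<noteq> {\<zero>\<^bsub>H\<^esub>} \<longrightarrow>
        (\<exists>F\<in>carrier H. F \<noteq> \<zero>\<^bsub>H\<^esub> \<and>
          (\<forall>x\<in>carrier (D_module n lam). F (weyl_proj n lam x) = psi n lam h b x)))"
proof -
  have lam: "length lam \<le> n" "sorted_wrt (\<ge>) lam" "sum_list lam = r" and h: "length h \<le> n" "sum_list h = r"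
    using assms(4,7) by (auto simp: partitions_def)
  have m: "length lam = m" "part lam m \<noteq> 0" "b + 2 \<le> m" using assms(5,6,9) by auto
  have mono: "part lam j \<le> part lam i" if "1 \<le> i" "i \<le> j" for i j
    using that sorted_wrt_nth_less[OF lam(2), of "i - 1" "j - 1"] by (cases "i = j") (auto simp: part_def)
  have pos: "0 < x" if "x \<in> set lam" for x
  proof -
    obtain k where k: "k < m" "x = lam ! k" using \<open>x \<in> set lam\<close> m(1) by (auto simp: in_set_conv_nth)
    have "part lam m \<le> part lam (Suc k)" by (rule mono) (use k in auto)
    then show ?thesis using k m by (simp add: part_def)
  qed
  have ab: "a + b = sum_list lam" using h(2) lam(3) unfolding assms(8) by (simp add: sum_list_replicate)
  \<comment> \<open>All m parts are positive, so a + b = r \<ge> m \<ge> b + 2 and the arm of the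
    hook is not empty.\<close>
  have "m \<le> sum_list lam" using sum_list_mono[of lam "\<lambda>_. 1" "\<lambda>x. x"] pos m(1)
    by (simp add: sum_list_triv Suc_le_eq One_nat_def)
  then have a1: "1 \<le> a" using ab m(3) by simp
  let ?l = "\<lambda>i. of_nat (part lam i) :: 'k" and ?d = "\<lambda>J. of_int (d_coeff lam J) :: 'k"
  interpret hh: hook_hom n a b lam ?l ?d
    by unfold_locales (use a1 lam(1) h(1) m pos mono ab assms(8) in auto)
  have H: "H = hh.H" unfolding H_def hh.H_def lam(3)[symmetric] assms(8) ..
  have dvd: "p dvd x \<longleftrightarrow> (of_nat x :: 'k) = 0" for x
    unfolding of_nat_eq_0_iff_char_dvd assms(2) ..
  note RZ = hh.RZ_iff_dvd[OF assms(2)]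
  let ?Q = "{i. 1 \<le> i \<and> i \<le> m \<and> part lam i \<ge> 2}"
  have finQ: "finite ?Q" by (rule finite_subset[of _ "{..m}"]) auto
  \<comment> \<open>If no part is at least 2, all parts are 1; this is the case where q is set to 0,
    and no maximum of an empty set is taken.\<close>
  have q0: "q = 0" if "?Q = {}"
  proof -
    have "lam = replicate m 1"
    proof (rule nth_equalityI)
      fix k assume k: "k < length lam"
      have "Suc k \<notin> ?Q" unfolding that by simp
      then have "part lam (Suc k) < 2" using k m(1) by auto
      then show "lam ! k = replicate m 1 ! k" using k m(1) pos[of "lam ! k"] by (simp add: part_def)
    qed (simp add: m(1))
    then show ?thesis using assms(10) by simp
  qed
  have qQ: "q \<in> ?Q" "\<And>i. i \<in> ?Q \<Longrightarrow> i \<le> q" if ne: "?Q \<noteq> {}"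
  proof -
    have "lam \<noteq> replicate m 1"
    proof
      assume e: "lam = replicate m 1"
      have "part (replicate m 1) i \<le> 1" for i
      proof (cases "1 \<le> i \<and> i \<le> m")
        case True
        then have "i - 1 < m" by auto
        then show ?thesis using True by (simp add: part_def)
      next
        case False
        then show ?thesis unfolding part_def length_replicate by (simp only: if_False)
      qed
      then have "part lam i \<le> 1" for i unfolding e .
      then show False using ne by (metis (mono_tags, lifting) One_nat_def Suc_1 empty_Collect_eq not_less_eq_eq)
    qed
    then have "q = Max ?Q" using assms(10) by simp
    then show "q \<in> ?Q" "\<And>i. i \<in> ?Q \<Longrightarrow> i \<le> q" using Max_in[OF finQ ne] Max_ge[OF finQ] by simp_all
  qed
  have two: "2 \<le> part lam i" if "1 \<le> i" "i \<le> q" for i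
    using mono[OF that] qQ q0 that by (cases "?Q = {}") auto
  have ones: "part lam i = 1" if "q < i" "i \<le> length lam" for i
  proof -
    have "i \<notin> ?Q" using qQ(2)[of i] that by (cases "?Q = {}") auto
    then show ?thesis using hh.part_pos[of i] that m(1) by auto
  qed
  have long: "hh.killed \<longleftrightarrow>
      (\<forall>i. 1 \<le> i \<and> i \<le> b - 1 \<longrightarrow> p dvd R_gcd (part lam i) (part lam (i + 1) - 1))
      \<and> (b \<noteq> 0 \<longrightarrow> p dvd R_gcd (part lam b) (part lam (b + 1)))
      \<and> (\<forall>i. b + 1 \<le> i \<and> i \<le> m - 1 \<longrightarrow> p dvd R_gcd (part lam i + 1) (part lam (i + 1)))"
    if "q \<ge> b + 1"
  proof -
    have "1 \<le> i \<and> i \<le> b - 1 \<longleftrightarrow> 1 \<le> i \<and> i < b" "b + 1 \<le> i \<and> i \<le> m - 1 \<longleftrightarrow> b + 1 \<le> i \<and> i < m"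
      "b \<noteq> 0 \<longleftrightarrow> 1 \<le> b" for i using m(3) by auto
    then show ?thesis using hh.killed_iff_long[OF two] that unfolding RZ m(1) Suc_eq_plus1 by auto
  qed
  have short: "hh.killed \<longleftrightarrow>
      (\<forall>i. 1 \<le> i \<and> i \<le> q - 1 \<longrightarrow> p dvd R_gcd (part lam i) (part lam (i + 1) - 1))
      \<and> p dvd part lam q + b + 2 - q \<and> (m - b \<ge> 3 \<longrightarrow> p dvd 2)" if q: "q \<le> b"
  proof -
    have r: "1 \<le> i \<and> i \<le> q - 1 \<longleftrightarrow> 1 \<le> i \<and> i < q" "m - b \<ge> 3 \<longleftrightarrow> b + 3 \<le> m" for i by auto
    \<comment> \<open>With q \<le> b the truncated subtraction is exact and can be moved into the
      bracket.\<close>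
    have s: "part lam q + b + 2 - q = part lam q + (b + 2 - q)" using q by simp
    have e: "p dvd part lam q + (b + 2 - q) \<longleftrightarrow> (of_nat (part lam q) + of_nat (b + 2 - q) :: 'k) = 0"
      "p dvd 2 \<longleftrightarrow> (2 :: 'k) = 0" using dvd[of "part lam q + (b + 2 - q)"] dvd[of 2] by simp_all
    show ?thesis using hh.killed_iff_short[OF q two ones] unfolding RZ m(1) Suc_eq_plus1 r s e by blast
  qed
  show ?thesis
    unfolding H using hh.H_result long short unfolding assms(8)[symmetric] by blast
qed

end
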